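(* Assume $H$ is twice continuously differentiable in a neighborhood of $\beta^*$, with $\mathcal H=\nabla^2H(\beta^* )$, and assume there are no degenerate buyers: $\beta_i^*=1$ implies $\delta_i^*>0$ (i.e. $I_{==}=\emptyset$). Let $\delta_t,\epsilon_t>0$ be sequences with $\delta_t=o(1)$, $\epsilon_t=o(1)$, $\sqrt t\,\epsilon_t\to\infty$ and $\sqrt t\,\delta_t\to c\in(0,\infty]$. Let $\hat I_{=}=\{i:\beta_i^\gamma>1-\delta_t\}$, $\hat B=\{\beta\in[0,1]^n:\beta_i=1\text{ for }i\in\hat I_{=}\}$ and $$\beta^{\mathrm{boot}}=\operatorname*{argmin}_{\beta\in\hat B}\ \epsilon_t\,(G^{\mathrm{boot}})^{\top}(\beta-\beta^\gamma)+\tfrac12\|\beta^\gamma-\beta\|_{\widehat{\mathcal H}}^2 .$$ If $\widehat{\mathcal H}\to\mathcal H$ in probability, then the conditional distribution of $\epsilon_t^{-1}(\beta^{\mathrm{boot}}-\beta^\gamma)$ consistently estimates $\mathcal J_{\mathrm{FPPE}}$.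
   Context: Setting. There are $n$ buyers with budgets $b_i>0$, a measurable item space $\Theta$ with integrating measure $d\theta$, nonnegative integrable valuations $v_i:\Theta\to[0,\infty)$ with $\max_i\sup_\theta v_i(\theta)<\infty$, and a bounded supply function $s\ge 0$ with $\int_\Theta s\,d\theta=1$. Write $\mathbb E[g]=\int g\,s\,d\theta$. Let $\theta^1,\theta^2,\dots$ be i.i.d. draws from the density $s$ and $P_tf=\frac1t\sum_{\tau=1}^tf(\theta^\tau)$. For $\beta\in(0,\infty)^n$ put $$F(\theta,\beta)=\max_{i}\beta_iv_i(\theta)-\sum_{i=1}^nb_i\log\beta_i,\quad H(\beta)=\mathbb E[F(\cdot,\beta)],\quad H_t(\beta)=P_tF(\cdot,\beta).$$ The limit FPPE (first-price pacing equilibrium) pacing multiplier is $\beta^*=\operatorname{argmin}_{(0,1]^n}H$ and the finite (observed) one is $\beta^\gamma=\operatorname{argmin}_{(0,1]^n}H_t$. Leftover budgets: $\delta^*=-\nabla H(\beta^* )$ (equivalently $\delta_i^*$ is $b_i$ minus buyer $i$'s equilibrium payment; $\delta_i^*\ge0$). $I_{==}=\{i:\beta_i^*=1,\delta_i^*=0\}$. $\mathcal J_{\mathrm{FPPE}}$ denotes the limit distribution of $\sqrt t(\beta^\gamma-\beta^* )$; when $I_{==}=\emptyset$ it equals $$\mathcal N\big(0,\ (P\mathcal HP)^{\dagger}\operatorname{Cov}[\nabla F(\cdot,\beta^* )](P\mathcal HP)^{\dagger}\big),\qquad P=\operatorname{Diag}\big(\mathbf 1\{\beta_i^*<1\}\big),$$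 with $\dagger$ the Moore–Penrose inverse. $\mathcal H$ is positive definite and $\nabla F(\theta,\beta^* )$ exists for almost every $\theta$. Notation $\|a\|_A^2=a^{\top}Aa$. Bootstrap objects. $W=(W_1,\dots,W_t)$ is multinomial with $t$ trials and probabilities $(1/t,\dots,1/t)$, independent of the data; $P_t^{\mathrm{boot}}f=\frac1t\sum_\tau W_\tau f(\theta^\tau)$. $D_F(\theta,\beta)$ is a deterministic selection from the subdifferential $\partial_\beta F(\theta,\beta)$, and $G^{\mathrm{boot}}=\sqrt t\,(P_t^{\mathrm{boot}}-P_t)D_F(\cdot,\beta^\gamma)$. $\widehat{\mathcal H}$ is the numerical-difference Hessian estimate with entries $\widehat{\mathcal H}_{k\ell}=(\widehat\nabla^2_{k\ell,\eta_t}H_t)(\beta^\gamma)$ for a stepsize $\eta_t>0$, where $(\widehat\nabla^2_{k\ell,\eta}g)(\beta)=[g(\beta+\eta e_k+\eta e_\ell)-g(\beta-\eta e_k+\eta e_\ell)-g(\beta+\eta e_k-\eta e_\ell)+g(\beta-\eta e_k-\eta e_\ell)]/(4\eta^2)$ and $e_k$ are the unit vectors. Consistency: for random vectors $X_t\in\mathbb R^n$ that are functions of $(\theta^\tau)_{\tau\le t}$ and $W$, the conditional distribution of $X_t$ consistently estimates a law $L$ if $$\sup_{f\in\mathrm{BL}_1}\big|\mathbb E[f(X_t)\mid\theta^1,\dots,\theta^t]-\mathbb E_{X\sim L}[f(X)]\big|\to0\text{ in probability},$$ where $\mathrm{BL}_1$ is the set of $f:\mathbb R^n\to\mathbb R$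 with $\sup|f|\le1$ and $|f(x)-f(y)|\le\|x-y\|_2$. *)

theory Defs
  imports "HOL-Probability.Probability"
begin

section \<open>Linear algebra and calculus\<close>

definition gradient :: "('v::real_inner \<Rightarrow> real) \<Rightarrow> 'v \<Rightarrow> 'v" where
  "gradient f x = (THE D. GDERIV f x :> D)"

definition hessian :: "(real^'n \<Rightarrow> real) \<Rightarrow> real^'n \<Rightarrow> real^'n^'n" where
  "hessian f x = matrix (frechet_derivative (gradient f) (at x))"

definition C2_near :: "(real^'n \<Rightarrow> real) \<Rightarrow> real^'n \<Rightarrow> bool" where
  "C2_near f x \<longleftrightarrow> (\<exists>U. open U \<and> x \<in> U \<and> f differentiable_on U \<and>
     gradient f differentiable_on U \<and> continuous_on U (hessian f))"

definition subdifferential :: "'v::real_inner set \<Rightarrow> ('v \<Rightarrow> real) \<Rightarrow> 'v \<Rightarrow> 'v set" where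
  "subdifferential S f x = {g. \<forall>y\<in>S. f x + g \<bullet> (y - x) \<le> f y}"

definition moore_penrose :: "real^'n^'m \<Rightarrow> real^'m^'n" where
  "moore_penrose A = (THE X. A ** X ** A = A \<and> X ** A ** X = X \<and>
     transpose (A ** X) = A ** X \<and> transpose (X ** A) = X ** A)"

definition num_hessian :: "real \<Rightarrow> (real^'n \<Rightarrow> real) \<Rightarrow> real^'n \<Rightarrow> real^'n^'n" where
  "num_hessian \<eta> g \<beta> = (\<chi> k l.
     (g (\<beta> + \<eta> *\<^sub>R axis k 1 + \<eta> *\<^sub>R axis l 1) - g (\<beta> - \<eta> *\<^sub>R axis k 1 + \<eta> *\<^sub>R axis l 1)
      - g (\<beta> + \<eta> *\<^sub>R axis k 1 - \<eta> *\<^sub>R axis l 1) + g (\<beta> - \<eta> *\<^sub>R axis k 1 - \<eta> *\<^sub>R axis l 1))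
     / (4 * \<eta>\<^sup>2))"

section \<open>Probability\<close>

definition std_mvnormal :: "(real^'n) measure" where
  "std_mvnormal = density lborel (\<lambda>z. ennreal (\<Prod>i\<in>UNIV. std_normal_density (z $ i)))"

text \<open>
  The law of \<open>\<mu> + A Z\<close> with \<open>Z\<close> standard normal and \<open>A A\<^sup>T = \<Sigma>\<close>; it does not depend on
  the choice of the factor \<open>A\<close>, and \<open>\<Sigma>\<close> may be singular. Only meaningful for symmetric positive
  semidefinite \<open>\<Sigma>\<close>.
\<close>
definition mvnormal :: "real^'n \<Rightarrow> real^'n^'n \<Rightarrow> (real^'n) measure" where
  "mvnormal \<mu> \<Sigma> =
     (let A = (SOME A :: real^'n^'n. A ** transpose A = \<Sigma>)
      in distr std_mvnormal borel (\<lambda>z. \<mu> + A *v z))"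

text \<open>
  Counts of the categories \<open>0, \<dots>, k - 1\<close> in \<open>m\<close> independent trials with law \<open>p\<close>, as a list
  of length \<open>k\<close>.
\<close>
definition multinomial_pmf :: "nat \<Rightarrow> nat \<Rightarrow> nat pmf \<Rightarrow> nat list pmf" where
  "multinomial_pmf m k p = map_pmf (\<lambda>xs. map (count_list xs) [0..<k]) (replicate_pmf m p)"

text \<open>
  Convergence in probability to a constant. The outer measure agrees with the probability
  whenever the event is measurable, and avoids the value \<open>0\<close> that \<^const>\<open>measure\<close> assigns
  to non-measurable sets.
\<close>
definition tendsto_in_prob :: "'w measure \<Rightarrow> (nat \<Rightarrow> 'w \<Rightarrow> 'b::metric_space) \<Rightarrow> 'b \<Rightarrow> bool" where
  "tendsto_in_prob P Y c \<longleftrightarrow>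
     (\<forall>\<epsilon>>0. (\<lambda>t. outer_measure_of P {\<omega> \<in> space P. \<epsilon> < dist (Y t \<omega>) c}) \<longlonglongrightarrow> 0)"

text \<open>\<open>K\<close> is a regular conditional distribution of \<open>X\<close> given the sub-sigma-algebra \<open>G\<close>.\<close>
definition cond_distribution ::
  "'w measure \<Rightarrow> 'w measure \<Rightarrow> ('w \<Rightarrow> 'b::euclidean_space) \<Rightarrow> ('w \<Rightarrow> 'b measure) \<Rightarrow> bool" where
  "cond_distribution P G X K \<longleftrightarrow>
     X \<in> borel_measurable P \<and> K \<in> measurable G (prob_algebra borel) \<and>
     (\<forall>B\<in>sets borel. AE \<omega> in P.
        measure (K \<omega>) B = real_cond_exp P G (\<lambda>\<omega>. indicator B (X \<omega>)) \<omega>)"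

definition BL1 :: "('b::metric_space \<Rightarrow> real) set" where
  "BL1 = {f. (\<forall>x. \<bar>f x\<bar> \<le> 1) \<and> lipschitz_on 1 UNIV f}"

text \<open>
  A supremum of conditional expectations over the uncountable class \<^const>\<open>BL1\<close> only makes sense
  for simultaneous versions, i.e. as expectations under a regular conditional distribution \<open>K t\<close>.
  Such \<open>K t\<close> are unique up to null sets, so the choice of \<open>K\<close> is immaterial.
\<close>
definition consistently_estimates ::
  "'w measure \<Rightarrow> (nat \<Rightarrow> 'w measure) \<Rightarrow> (nat \<Rightarrow> 'w \<Rightarrow> 'b::euclidean_space) \<Rightarrow> 'b measure \<Rightarrow> bool"
where
  "consistently_estimates P G X L \<longleftrightarrow>
     (\<exists>K. (\<forall>t>0. cond_distribution P (G t) (X t) (K t)) \<and>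
        tendsto_in_prob P
          (\<lambda>t \<omega>. SUP f\<in>BL1. \<bar>(LINT x|K t \<omega>. f x) - (LINT x|L. f x)\<bar>) 0)"

section \<open>First-price pacing equilibria\<close>

definition supply_mean :: "'a measure \<Rightarrow> ('a \<Rightarrow> real) \<Rightarrow> ('a \<Rightarrow> real) \<Rightarrow> real" where
  "supply_mean M s g = (LINT \<theta>|M. g \<theta> * s \<theta>)"

definition supply_cov :: "'a measure \<Rightarrow> ('a \<Rightarrow> real) \<Rightarrow> ('a \<Rightarrow> real^'n) \<Rightarrow> real^'n^'n" where
  "supply_cov M s g = (\<chi> k l. supply_mean M s
     (\<lambda>\<theta>. (g \<theta> $ k - supply_mean M s (\<lambda>\<theta>. g \<theta> $ k)) * (g \<theta> $ l - supply_mean M s (\<lambda>\<theta>. g \<theta> $ l))))"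

text \<open>
  The intended domain of \<open>F\<close> is the open positive orthant; elsewhere \<^const>\<open>ln\<close> takes its
  conventional total values. Below only \<^const>\<open>num_hessian\<close> can leave the domain, and only for a
  large stepsize.
\<close>
definition F :: "real^'n \<Rightarrow> ('n \<Rightarrow> 'a \<Rightarrow> real) \<Rightarrow> 'a \<Rightarrow> real^'n \<Rightarrow> real" where
  "F b v \<theta> \<beta> = (MAX i. \<beta> $ i * v i \<theta>) - (\<Sum>i\<in>UNIV. b $ i * ln (\<beta> $ i))"

definition pos_orthant :: "(real^'n) set" where
  "pos_orthant = {\<beta>. \<forall>i. 0 < \<beta> $ i}"

definition pacing_box :: "(real^'n) set" where
  "pacing_box = {\<beta>. \<forall>i. 0 < \<beta> $ i \<and> \<beta> $ i \<le> 1}"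

definition H :: "real^'n \<Rightarrow> ('n \<Rightarrow> 'a \<Rightarrow> real) \<Rightarrow> 'a measure \<Rightarrow> ('a \<Rightarrow> real) \<Rightarrow> real^'n \<Rightarrow> real" where
  "H b v M s \<beta> = supply_mean M s (\<lambda>\<theta>. F b v \<theta> \<beta>)"

definition beta_star :: "real^'n \<Rightarrow> ('n \<Rightarrow> 'a \<Rightarrow> real) \<Rightarrow> 'a measure \<Rightarrow> ('a \<Rightarrow> real) \<Rightarrow> real^'n" where
  "beta_star b v M s = arg_min_on (H b v M s) pacing_box"

definition leftover :: "real^'n \<Rightarrow> ('n \<Rightarrow> 'a \<Rightarrow> real) \<Rightarrow> 'a measure \<Rightarrow> ('a \<Rightarrow> real) \<Rightarrow> real^'n" where
  "leftover b v M s = - gradient (H b v M s) (beta_star b v M s)"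

definition limit_hessian ::
  "real^'n \<Rightarrow> ('n \<Rightarrow> 'a \<Rightarrow> real) \<Rightarrow> 'a measure \<Rightarrow> ('a \<Rightarrow> real) \<Rightarrow> real^'n^'n" where
  "limit_hessian b v M s = hessian (H b v M s) (beta_star b v M s)"

definition unpaced_proj ::
  "real^'n \<Rightarrow> ('n \<Rightarrow> 'a \<Rightarrow> real) \<Rightarrow> 'a measure \<Rightarrow> ('a \<Rightarrow> real) \<Rightarrow> real^'n^'n" where
  "unpaced_proj b v M s = (\<chi> i j. if i = j \<and> beta_star b v M s $ i < 1 then 1 else 0)"

text \<open>
  The limit distribution of \<open>\<surd>t (\<beta>\<^sup>\<gamma> - \<beta>\<^sup>*)\<close> in its explicit form, which is valid when no
  buyer has both \<open>\<beta>\<^sup>*\<^sub>i = 1\<close> and leftover budget \<open>0\<close>.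
\<close>
definition J_FPPE ::
  "real^'n \<Rightarrow> ('n \<Rightarrow> 'a \<Rightarrow> real) \<Rightarrow> 'a measure \<Rightarrow> ('a \<Rightarrow> real) \<Rightarrow> (real^'n) measure" where
  "J_FPPE b v M s =
     (let P = unpaced_proj b v M s;
          Q = moore_penrose (P ** limit_hessian b v M s ** P)
      in mvnormal 0 (Q ** supply_cov M s (\<lambda>\<theta>. gradient (F b v \<theta>) (beta_star b v M s)) ** Q))"

section \<open>Observed market and bootstrap\<close>

text \<open>
  A sample of size \<open>t\<close> is a function \<open>d\<close> on \<open>{..<t}\<close>, and the weights are a list \<open>w\<close> of length
  \<open>t\<close>; both are indexed from \<open>0\<close>.
\<close>

definition emp_mean :: "nat \<Rightarrow> (nat \<Rightarrow> 'a) \<Rightarrow> ('a \<Rightarrow> 'b::real_vector) \<Rightarrow> 'b" where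
  "emp_mean t d f = (1 / real t) *\<^sub>R (\<Sum>\<tau><t. f (d \<tau>))"

definition boot_mean :: "nat \<Rightarrow> (nat \<Rightarrow> 'a) \<Rightarrow> nat list \<Rightarrow> ('a \<Rightarrow> 'b::real_vector) \<Rightarrow> 'b" where
  "boot_mean t d w f = (1 / real t) *\<^sub>R (\<Sum>\<tau><t. real (w ! \<tau>) *\<^sub>R f (d \<tau>))"

definition H_emp :: "real^'n \<Rightarrow> ('n \<Rightarrow> 'a \<Rightarrow> real) \<Rightarrow> nat \<Rightarrow> (nat \<Rightarrow> 'a) \<Rightarrow> real^'n \<Rightarrow> real" where
  "H_emp b v t d \<beta> = emp_mean t d (\<lambda>\<theta>. F b v \<theta> \<beta>)"

definition beta_obs :: "real^'n \<Rightarrow> ('n \<Rightarrow> 'a \<Rightarrow> real) \<Rightarrow> nat \<Rightarrow> (nat \<Rightarrow> 'a) \<Rightarrow> real^'n" where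
  "beta_obs b v t d = arg_min_on (H_emp b v t d) pacing_box"

definition G_boot ::
  "real^'n \<Rightarrow> ('n \<Rightarrow> 'a \<Rightarrow> real) \<Rightarrow> ('a \<Rightarrow> real^'n \<Rightarrow> real^'n) \<Rightarrow> nat \<Rightarrow> (nat \<Rightarrow> 'a) \<Rightarrow> nat list \<Rightarrow> real^'n"
where
  "G_boot b v D t d w = sqrt (real t) *\<^sub>R
     (boot_mean t d w (\<lambda>\<theta>. D \<theta> (beta_obs b v t d)) - emp_mean t d (\<lambda>\<theta>. D \<theta> (beta_obs b v t d)))"

definition H_hat ::
  "real^'n \<Rightarrow> ('n \<Rightarrow> 'a \<Rightarrow> real) \<Rightarrow> real \<Rightarrow> nat \<Rightarrow> (nat \<Rightarrow> 'a) \<Rightarrow> real^'n^'n" where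
  "H_hat b v \<eta> t d = num_hessian \<eta> (H_emp b v t d) (beta_obs b v t d)"

definition I_hat :: "real^'n \<Rightarrow> ('n \<Rightarrow> 'a \<Rightarrow> real) \<Rightarrow> real \<Rightarrow> nat \<Rightarrow> (nat \<Rightarrow> 'a) \<Rightarrow> 'n set" where
  "I_hat b v \<delta> t d = {i. 1 - \<delta> < beta_obs b v t d $ i}"

definition B_hat :: "real^'n \<Rightarrow> ('n \<Rightarrow> 'a \<Rightarrow> real) \<Rightarrow> real \<Rightarrow> nat \<Rightarrow> (nat \<Rightarrow> 'a) \<Rightarrow> (real^'n) set" where
  "B_hat b v \<delta> t d =
     {\<beta>. (\<forall>i. 0 \<le> \<beta> $ i \<and> \<beta> $ i \<le> 1) \<and> (\<forall>i\<in>I_hat b v \<delta> t d. \<beta> $ i = 1)}"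

definition boot_objective ::
  "real^'n \<Rightarrow> ('n \<Rightarrow> 'a \<Rightarrow> real) \<Rightarrow> ('a \<Rightarrow> real^'n \<Rightarrow> real^'n) \<Rightarrow> real \<Rightarrow> real \<Rightarrow>
   nat \<Rightarrow> (nat \<Rightarrow> 'a) \<Rightarrow> nat list \<Rightarrow> real^'n \<Rightarrow> real" where
  "boot_objective b v D \<epsilon> \<eta> t d w \<beta> =
     \<epsilon> * (G_boot b v D t d w \<bullet> (\<beta> - beta_obs b v t d)) +
     1/2 * ((beta_obs b v t d - \<beta>) \<bullet> (H_hat b v \<eta> t d *v (beta_obs b v t d - \<beta>)))"

definition sample :: "(nat \<Rightarrow> 'w \<Rightarrow> 'a) \<Rightarrow> nat \<Rightarrow> 'w \<Rightarrow> nat \<Rightarrow> 'a" where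
  "sample \<theta> t \<omega> = (\<lambda>\<tau>\<in>{..<t}. \<theta> \<tau> \<omega>)"

definition sample_sigma :: "'w measure \<Rightarrow> 'a measure \<Rightarrow> (nat \<Rightarrow> 'w \<Rightarrow> 'a) \<Rightarrow> nat \<Rightarrow> 'w measure" where
  "sample_sigma P M \<theta> t = vimage_algebra (space P) (sample \<theta> t) (PiM {..<t} (\<lambda>_. M))"

end

theory Submission
  imports Defs
begin

text \<open>
  In the rescaled variable \<open>u = (\<beta> - \<beta>\<^sup>\<gamma>) / \<epsilon>\<close> the bootstrap programme minimises
  \<open>G \<bullet> u + u \<bullet> (A u) / 2\<close>, with \<open>G\<close> the resampled gradient fluctuation and \<open>A\<close> the estimated Hessian,
  over a box in the coordinates outside the estimated active set. If that set is the true one and the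
  box is not binding, the solution is close to \<open>- Q G\<close>, where \<open>Q\<close> is the Moore--Penrose inverse of the
  Hessian compressed to the paced buyers, and \<open>Q\<close> times a normal vector with the covariance of the
  gradient is the limit law. Three facts make this rigorous.

  \<^item> \<^emph>\<open>Active set.\<close> A buyer with \<open>\<beta>\<^sup>*\<^sub>i = 1\<close> has positive leftover budget, so \<open>H\<close> strictly decreases in
    its multiplier near \<open>\<beta>\<^sup>*\<close>. A uniform law of large numbers and convexity push the observed multiplier
    to exactly \<open>1\<close> with probability tending to one (\<open>beta_obs_active\<close>). All other multipliers stay
    away from \<open>0\<close> and \<open>1\<close> by consistency (\<open>beta_obs_consistent\<close>), so for small \<open>\<epsilon>\<close> the box is slack and
    comparing objective values gives the approximate solution (\<open>boot_error_near_solution\<close>).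

  \<^item> \<^emph>\<open>Freezing the point of linearisation.\<close> The subgradients in \<open>G\<close> are taken at the random point
    \<open>\<beta>\<^sup>\<gamma>\<close>. Given the data, the weights are independent draws, so replacing \<open>\<beta>\<^sup>\<gamma>\<close> by \<open>\<beta>\<^sup>*\<close> costs at most
    the empirical second moment of the change of the subgradient. That change is zero except for
    items that are nearly tied at \<open>\<beta>\<^sup>*\<close>, which are rare (\<open>gap_fluctuation_vanishes\<close>).
    At ties the selection \<open>D_F\<close> is an arbitrary, possibly non-measurable, subgradient. But a tie is a kink of the objective, so ties are null at every point
    of differentiability of \<open>H\<close> (\<open>AE_not_tie\<close>). Two observations tied between the same two buyers at one
    multiplier vector share a ratio of valuations, and where ties are null this has
    probability zero; so, almost surely, at most one observation per pair of buyers is tied at \<open>\<beta>\<^sup>\<gamma>\<close> (\<open>AE_few_ties\<close>), which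
    contributes only \<open>O(t\<^bsup>-1/2\<^esup>)\<close> (\<open>tie_mass_vanishes\<close>).

  \<^item> \<^emph>\<open>Conditional central limit theorem.\<close> Given the data, what is left is a normalised sum of
    independent uniform draws from the observed values of the influence function. Replacing one summand
    at a time by a Gaussian, against test functions smoothed by a small Gaussian, gives an error bound
    that holds for all bounded Lipschitz functions at once and depends on the data only through the
    covariance (\<open>triangular_array_clt_BL1\<close>, \<open>bootstrap_clt_BL1\<close>). The law of large numbers
    identifies that covariance (\<open>linear_part_conditional_clt\<close>).

  The first two facts hold jointly in the data and the weights
  (\<open>boot_error_asymptotically_linear\<close>). Averaging over the weights turns them into a
  statement about the conditional law (\<open>conditional_error_vanishes\<close>), where the third applies.
\<close>

section \<open>Events of vanishing outer probability\<close>

text \<open>Some events below quantify over all multiplier vectors or over all test functions, so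
  they need not be measurable and their probabilities are outer ones.\<close>

definition vanishing :: "'w measure \<Rightarrow> (nat \<Rightarrow> 'w set) \<Rightarrow> bool" where
  "vanishing P A \<longleftrightarrow> (\<lambda>t. outer_measure_of P (A t)) \<longlonglongrightarrow> 0"

lemma outer_measure_of_Un_le:
  "outer_measure_of P (A \<union> B) \<le> outer_measure_of P A + outer_measure_of P B"
proof (cases "A \<subseteq> space P \<and> B \<subseteq> space P")
  case True
  then obtain E E' where E: "E \<in> sets P" "A \<subseteq> E" "outer_measure_of P A = emeasure P E"
    and E': "E' \<in> sets P" "B \<subseteq> E'" "outer_measure_of P B = emeasure P E'"
    using outer_measure_of_attain[of A P] outer_measure_of_attain[of B P] by auto
  have "outer_measure_of P (A \<union> B) \<le> outer_measure_of P (E \<union> E')"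
    using E E' by (intro outer_measure_of_mono) auto
  also have "\<dots> \<le> emeasure P E + emeasure P E'"
    using E E' by (simp add: emeasure_subadditive)
  finally show ?thesis using E E' by simp
next
  case False
  \<comment> \<open>The outer measure of a set outside the space is the infimum of the empty set.\<close>
  have *: "outer_measure_of P X = \<infinity>" if "\<not> X \<subseteq> space P" for X
  proof -
    have "{B\<in>sets P. X \<subseteq> B} = {}"
      using that sets.sets_into_space by blast
    then show ?thesis unfolding outer_measure_of_def by (simp only:) simp
  qed
  from False have "outer_measure_of P A = \<infinity> \<or> outer_measure_of P B = \<infinity>"
    using * by blast
  then show ?thesis by auto
qed

lemma vanishing_iff:
  "vanishing P A \<longleftrightarrow> (\<forall>e>0. \<forall>\<^sub>F t in sequentially. outer_measure_of P (A t) \<le> ennreal e)"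
proof
  assume "vanishing P A"
  then show "\<forall>e>0. \<forall>\<^sub>F t in sequentially. outer_measure_of P (A t) \<le> ennreal e"
    unfolding vanishing_def
    by (auto dest!: order_tendstoD(2)[where a="ennreal _"] elim!: eventually_mono intro: less_imp_le)
next
  assume *: "\<forall>e>0. \<forall>\<^sub>F t in sequentially. outer_measure_of P (A t) \<le> ennreal e"
  show "vanishing P A" unfolding vanishing_def
  proof (rule order_tendstoI)
    fix a :: ennreal assume "0 < a"
    then obtain e where e: "0 < e" "e < a" using dense by blast
    then have "e < top" using less_top_ennreal by (metis less_trans top.not_eq_extremum)
    then obtain r where r: "e = ennreal r" "0 \<le> r" by (cases e) auto
    with e have "0 < r" by (metis ennreal_0 less_irrefl order_le_imp_less_or_eq)
    with * have "\<forall>\<^sub>F t in sequentially. outer_measure_of P (A t) \<le> ennreal r" by blast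
    then show "\<forall>\<^sub>F t in sequentially. outer_measure_of P (A t) < a"
      by (rule eventually_mono) (use e r in auto)
  qed auto
qed

text \<open>The exceptional sets \<open>C\<close> need only have small, not vanishing, outer probability: this is what
  boundedness in probability provides.\<close>

lemma vanishing_approx:
  assumes "\<And>e. e > 0 \<Longrightarrow> \<exists>B C. (\<forall>\<^sub>F t in sequentially. A t \<subseteq> B t \<union> C t) \<and> vanishing P B
     \<and> (\<forall>\<^sub>F t in sequentially. outer_measure_of P (C t) \<le> ennreal e)"
  shows "vanishing P A"
  unfolding vanishing_iff
proof (intro allI impI)
  fix e :: real assume "e > 0"
  then obtain B C where BC: "\<forall>\<^sub>F t in sequentially. A t \<subseteq> B t \<union> C t" "vanishing P B"
     "\<forall>\<^sub>F t in sequentially. outer_measure_of P (C t) \<le> ennreal (e/2)"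
    using assms[of "e/2"] by auto
  have "\<forall>\<^sub>F t in sequentially. outer_measure_of P (B t) \<le> ennreal (e/2)"
    using BC(2) \<open>e > 0\<close> by (auto simp: vanishing_iff)
  with BC(1,3) show "\<forall>\<^sub>F t in sequentially. outer_measure_of P (A t) \<le> ennreal e"
  proof eventually_elim
    case (elim t)
    have "outer_measure_of P (A t) \<le> outer_measure_of P (B t \<union> C t)"
      using elim by (intro outer_measure_of_mono)
    also have "\<dots> \<le> outer_measure_of P (B t) + outer_measure_of P (C t)"
      by (rule outer_measure_of_Un_le)
    also have "\<dots> \<le> ennreal (e/2) + ennreal (e/2)"
      using elim by (intro add_mono)
    also have "\<dots> = ennreal e" using \<open>e > 0\<close> by (simp flip: ennreal_plus)
    finally show ?case .
  qed
qed

lemma vanishing_Un: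
  assumes "vanishing P A" "vanishing P B"
  shows "vanishing P (\<lambda>t. A t \<union> B t)"
proof (rule vanishing_approx, intro exI conjI)
  show "\<forall>\<^sub>F t in sequentially. A t \<union> B t \<subseteq> A t \<union> B t" by simp
  show "\<forall>\<^sub>F t in sequentially. outer_measure_of P (B t) \<le> ennreal e" if "e > 0" for e
    using assms(2) that by (auto simp: vanishing_iff)
qed (rule assms(1))

lemma vanishing_eventually_empty:
  assumes "\<forall>\<^sub>F t in sequentially. A t = {}"
  shows "vanishing P A"
  unfolding vanishing_iff using assms by (auto elim!: eventually_mono)

lemma vanishing_subset:
  assumes "vanishing P B" "\<forall>\<^sub>F t in sequentially. A t \<subseteq> B t"
  shows "vanishing P A"
proof (rule vanishing_approx, intro exI conjI)
  show "\<forall>\<^sub>F t in sequentially. A t \<subseteq> B t \<union> {}" using assms(2) by simp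
  show "\<forall>\<^sub>F t in sequentially. outer_measure_of P {} \<le> ennreal e" for e by simp
qed (rule assms(1))

lemma vanishing_finite_UN:
  assumes "finite I" "\<And>i. i \<in> I \<Longrightarrow> vanishing P (A i)"
  shows "vanishing P (\<lambda>t. \<Union>i\<in>I. A i t)"
  using assms
proof (induction I rule: finite_induct)
  case empty
  then show ?case by (auto intro: vanishing_eventually_empty)
next
  case (insert i I)
  have "vanishing P (\<lambda>t. A i t \<union> (\<Union>i\<in>I. A i t))"
    using insert by (intro vanishing_Un) auto
  then show ?case by simp
qed

lemma markov_bound:
  assumes [measurable]: "f \<in> borel_measurable P" and c: "0 < c"
    and b: "(\<integral>\<^sup>+\<omega>. ennreal (f \<omega>) \<partial>P) \<le> ennreal B"
  shows "outer_measure_of P {\<omega>\<in>space P. c \<le> f \<omega>} \<le> ennreal (B / c)"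
proof -
  have "outer_measure_of P {\<omega>\<in>space P. c \<le> f \<omega>} = emeasure P {\<omega>\<in>space P. c \<le> f \<omega>}"
    by (rule outer_measure_of_eq) measurable
  also have "\<dots> \<le> emeasure P {\<omega>\<in>space P. 1 \<le> ennreal (1 / c) * ennreal (f \<omega>)}"
  proof (rule emeasure_mono)
    have "1 \<le> ennreal (1/c) * ennreal (f \<omega>)" if "c \<le> f \<omega>" for \<omega>
      using that c by (simp flip: ennreal_mult'' add: field_simps)
    then show "{\<omega>\<in>space P. c \<le> f \<omega>} \<subseteq> {\<omega>\<in>space P. 1 \<le> ennreal (1 / c) * ennreal (f \<omega>)}" by auto
  qed measurable
  also have "\<dots> \<le> ennreal (1/c) * (\<integral>\<^sup>+\<omega>. ennreal (f \<omega>) * indicator (space P) \<omega> \<partial>P)"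
    by (intro order_trans[OF _ nn_integral_Markov_inequality] eq_refl arg_cong[where f="emeasure P"]) auto
  also have "(\<integral>\<^sup>+\<omega>. ennreal (f \<omega>) * indicator (space P) \<omega> \<partial>P) = (\<integral>\<^sup>+\<omega>. ennreal (f \<omega>) \<partial>P)"
    by (rule nn_integral_cong) auto
  also have "ennreal (1/c) * \<dots> \<le> ennreal (1/c) * ennreal B"
    using b by (rule mult_left_mono) auto
  also have "\<dots> = ennreal (B / c)" using c by (simp flip: ennreal_mult')
  finally show ?thesis .
qed

lemma vanishing_le:
  assumes "\<forall>\<^sub>F t in sequentially. outer_measure_of P (A t) \<le> ennreal (B t)" and B: "B \<longlonglongrightarrow> 0"
  shows "vanishing P A"
  unfolding vanishing_iff
proof (intro allI impI)
  fix e :: real assume "e > 0"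
  then have "\<forall>\<^sub>F t in sequentially. B t < e" using B by (intro order_tendstoD(2)) auto
  with assms(1) show "\<forall>\<^sub>F t in sequentially. outer_measure_of P (A t) \<le> ennreal e"
    by eventually_elim (meson ennreal_leI less_imp_le order_trans)
qed

lemma vanishing_markov:
  assumes "\<forall>\<^sub>F t in sequentially. f t \<in> borel_measurable P"
    and "\<forall>\<^sub>F t in sequentially. (\<integral>\<^sup>+\<omega>. ennreal (f t \<omega>) \<partial>P) \<le> ennreal (B t)"
    and B: "B \<longlonglongrightarrow> 0" and c: "0 < c"
  shows "vanishing P (\<lambda>t. {\<omega>\<in>space P. c \<le> f t \<omega>})"
proof (rule vanishing_le)
  show "\<forall>\<^sub>F t in sequentially. outer_measure_of P {\<omega>\<in>space P. c \<le> f t \<omega>} \<le> ennreal (B t / c)"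
    using assms(1,2) by eventually_elim (intro markov_bound c)
  show "(\<lambda>t. B t / c) \<longlonglongrightarrow> 0" using tendsto_divide[OF B tendsto_const[of c]] c by simp
qed

section \<open>Linear algebra\<close>

lemma norm_matrix_vector_mult_le:
  fixes A :: "real^'n^'m"
  shows "norm (A *v x) \<le> norm A * norm x"
proof -
  have "norm (A *v x) \<le> L2_set (\<lambda>i. norm (A $ i) * norm x) UNIV"
    unfolding norm_vec_def[of "A *v x"]
    by (intro L2_set_mono) (auto simp: matrix_vector_mul_component Cauchy_Schwarz_ineq2)
  also have "\<dots> = norm A * norm x"
    by (simp add: L2_set_left_distrib norm_vec_def[of A])
  finally show ?thesis .
qed

text \<open>Cholesky's elimination, one index of the support at a time: subtracting \<open>w w\<^sup>T\<close>, with \<open>w\<close>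
  the column of \<open>a\<close> divided by the root of the diagonal entry, clears row and column \<open>a\<close>, and the
  remainder is a Schur complement, hence again positive semidefinite.\<close>

lemma psd_entries_factor:
  fixes S :: "'n::finite \<Rightarrow> 'n \<Rightarrow> real"
  assumes "finite I" and sym: "\<And>i j. S i j = S j i"
    and psd: "\<And>x. 0 \<le> (\<Sum>i\<in>UNIV. \<Sum>j\<in>UNIV. x i * S i j * x j)"
    and supp: "\<And>i j. i \<notin> I \<Longrightarrow> S i j = 0"
  shows "\<exists>A. (\<forall>k l. S k l = (\<Sum>j\<in>UNIV. A k j * A l j)) \<and> (\<forall>k. \<forall>j. j \<notin> I \<longrightarrow> A k j = 0)"
  using assms
proof (induction I arbitrary: S rule: finite_induct)
  case empty
  then show ?case by (intro exI[of _ "\<lambda>_ _. 0"]) auto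
next
  case (insert a I)
  \<comment> \<open>If the diagonal entry is zero, then \<open>w = 0\<close> by the convention for division by zero, and
    row \<open>a\<close> is zero already.\<close>
  define w where "w k = S k a / sqrt (S a a)" for k
  define S' where "S' k l = S k l - w k * w l" for k l
  have diag_expand: "(\<Sum>i\<in>UNIV. \<Sum>j\<in>UNIV. (x i - (if i = a then s else 0)) * S i j * (x j - (if j = a then s else 0)))
     = (\<Sum>i\<in>UNIV. \<Sum>j\<in>UNIV. x i * S i j * x j) - 2 * s * (\<Sum>i\<in>UNIV. x i * S i a) + s^2 * S a a" for x s
  proof -
    have "(\<Sum>i\<in>UNIV. \<Sum>j\<in>UNIV. (x i - (if i = a then s else 0)) * S i j * (x j - (if j = a then s else 0)))
      = (\<Sum>i\<in>UNIV. \<Sum>j\<in>UNIV. x i * S i j * x j - (if j = a then s * (x i * S i j) else 0)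
          - (if i = a then s * S i j * x j else 0) + (if i = a then if j = a then s^2 * S i j else 0 else 0))"
      by (intro sum.cong refl) (auto simp: algebra_simps power2_eq_square)
    also have "\<dots> = (\<Sum>i\<in>UNIV. \<Sum>j\<in>UNIV. x i * S i j * x j) - s * (\<Sum>i\<in>UNIV. x i * S i a)
       - s * (\<Sum>j\<in>UNIV. S a j * x j) + s^2 * S a a"
    proof -
      have 1: "(\<Sum>i\<in>UNIV. \<Sum>j\<in>UNIV. if i = a then s * S i j * x j else 0) = (\<Sum>j\<in>UNIV. s * S a j * x j)"
        by (subst sum.swap) simp
      have 2: "(\<Sum>i\<in>UNIV. \<Sum>j\<in>UNIV. if i = a then if j = a then s\<^sup>2 * S i j else 0 else 0) = s^2 * S a a"
        by (subst sum.swap) simp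
      show ?thesis
        by (simp add: sum.distrib sum_subtractf 1 2) (simp add: sum_distrib_left mult.assoc)
    qed
    also have "(\<Sum>j\<in>UNIV. S a j * x j) = (\<Sum>i\<in>UNIV. x i * S i a)"
      using insert.prems(1) by (intro sum.cong) (auto simp: mult.commute)
    finally show ?thesis by (simp add: algebra_simps)
  qed
  have nn: "0 \<le> (\<Sum>i\<in>UNIV. \<Sum>j\<in>UNIV. x i * S i j * x j) - 2 * s * (\<Sum>i\<in>UNIV. x i * S i a) + s^2 * S a a" for x s
    using insert.prems(2)[of "\<lambda>i. x i - (if i = a then s else 0)"] unfolding diag_expand .
  have Saa: "0 \<le> S a a" using nn[of "\<lambda>_. 0" 1] by simp
  have row0: "S k a = 0" if "S a a = 0" for k
  proof -
    let ?e = "\<lambda>i. if i = k then 1 else (0::real)"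
    have "(\<Sum>i\<in>UNIV. \<Sum>j\<in>UNIV. ?e i * S i j * ?e j) = S k k"
    proof -
      have "(\<Sum>i\<in>UNIV. \<Sum>j\<in>UNIV. ?e i * S i j * ?e j)
        = (\<Sum>i\<in>UNIV. if i = k then \<Sum>j\<in>UNIV. if j = k then S k k else 0 else 0)"
        by (intro sum.cong refl) (auto intro!: sum.cong simp del: mult_1_left mult_1_right sum.delta sum.delta')
      then show ?thesis by simp
    qed
    moreover have "(\<Sum>i\<in>UNIV. ?e i * S i a) = S k a" by (simp add: if_distrib[of "\<lambda>x. x * _"] cong: if_cong)
    ultimately have "0 \<le> S k k - 2 * s * S k a" for s using nn[of ?e s] that by simp
    from this[of "(S k k + 1) / (2 * S k a)"] show ?thesis
      by (cases "S k a = 0") (auto simp: field_simps)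
  qed
  have psd': "0 \<le> (\<Sum>i\<in>UNIV. \<Sum>j\<in>UNIV. x i * S' i j * x j)" for x
  proof -
    have "(\<Sum>i\<in>UNIV. \<Sum>j\<in>UNIV. x i * S' i j * x j)
       = (\<Sum>i\<in>UNIV. \<Sum>j\<in>UNIV. x i * S i j * x j) - (\<Sum>i\<in>UNIV. x i * w i) ^ 2"
      by (simp add: S'_def algebra_simps power2_eq_square sum_subtractf sum_product)
    also have "(\<Sum>i\<in>UNIV. x i * w i) = (\<Sum>i\<in>UNIV. x i * S i a) / sqrt (S a a)"
      by (simp add: w_def sum_divide_distrib)
    also have "0 \<le> (\<Sum>i\<in>UNIV. \<Sum>j\<in>UNIV. x i * S i j * x j) - \<dots>\<^sup>2"
    proof (cases "S a a = 0")
      case True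
      then show ?thesis using insert.prems(2)[of x] by simp
    next
      case False
      then show ?thesis
        using nn[of x "(\<Sum>i\<in>UNIV. x i * S i a) / S a a"] Saa
        by (simp add: power2_eq_square divide_simps)
    qed
    finally show ?thesis .
  qed
  have supp': "S' i j = 0" if "i \<notin> I" for i j
  proof (cases "i = a")
    case True
    then show ?thesis using Saa row0 insert.prems(1)[of a j]
      by (cases "S a a = 0") (auto simp: S'_def w_def)
  next
    case False
    then show ?thesis using that insert.prems(3) by (auto simp: S'_def w_def)
  qed
  have "S' i j = S' j i" for i j using insert.prems(1) by (simp add: S'_def)
  from insert.IH[OF this psd' supp'] obtain A where
    A: "\<And>k l. S' k l = (\<Sum>j\<in>UNIV. A k j * A l j)" "\<And>k j. j \<notin> I \<Longrightarrow> A k j = 0" by blast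
  define A' where "A' k j = A k j + (if j = a then w k else 0)" for k j
  have "(\<Sum>j\<in>UNIV. A' k j * A' l j) = (\<Sum>j\<in>UNIV. A k j * A l j + (if j = a then w k * w l else 0))" for k l
    using A(2)[OF \<open>a \<notin> I\<close>] by (intro sum.cong) (auto simp: A'_def)
  then have "(\<Sum>j\<in>UNIV. A' k j * A' l j) = S k l" for k l
    by (simp add: sum.distrib flip: A(1)) (simp add: S'_def)
  moreover have "A' k j = 0" if "j \<notin> insert a I" for k j using A(2) that by (auto simp: A'_def)
  ultimately show ?case by (intro exI[of _ A']) auto
qed

lemma psd_factor:
  fixes S :: "real^'n^'n"
  assumes sym: "transpose S = S" and psd: "\<And>x. 0 \<le> x \<bullet> (S *v x)"
  shows "\<exists>A :: real^'n^'n. A ** transpose A = S"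
proof -
  have sym': "S $ i $ j = S $ j $ i" for i j
    using sym by (metis transpose_def vec_lambda_beta)
  have psd': "0 \<le> (\<Sum>i\<in>UNIV. \<Sum>j\<in>UNIV. x i * S $ i $ j * x j)" for x
  proof -
    have "(\<chi> i. x i) \<bullet> (S *v (\<chi> i. x i)) = (\<Sum>i\<in>UNIV. \<Sum>j\<in>UNIV. x i * S $ i $ j * x j)"
      by (simp add: inner_vec_def matrix_vector_mult_def sum_distrib_left mult_ac)
    then show ?thesis using psd[of "\<chi> i. x i"] by simp
  qed
  have "\<exists>A :: 'n \<Rightarrow> 'n \<Rightarrow> real. \<forall>k l. S $ k $ l = (\<Sum>j\<in>UNIV. A k j * A l j)"
    using psd_entries_factor[of UNIV "\<lambda>i j. S $ i $ j", OF finite sym' psd'] by simp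
  then obtain A :: "'n \<Rightarrow> 'n \<Rightarrow> real" where A: "\<And>k l. S $ k $ l = (\<Sum>j\<in>UNIV. A k j * A l j)" by metis
  have "(\<chi> k j. A k j) ** transpose (\<chi> k j. A k j) = S"
    by (simp add: vec_eq_iff matrix_matrix_mult_def transpose_def A)
  then show ?thesis by blast
qed

lemma moore_penrose_eqI:
  fixes A :: "real^'n^'m"
  assumes "A ** X ** A = A" "X ** A ** X = X"
     "transpose (A ** X) = A ** X" "transpose (X ** A) = X ** A"
  shows "moore_penrose A = X"
  unfolding moore_penrose_def
proof (rule the_equality)
  fix Y assume Y: "A ** Y ** A = A \<and> Y ** A ** Y = Y \<and>
     transpose (A ** Y) = A ** Y \<and> transpose (Y ** A) = Y ** A"
  have AXY: "A ** X = A ** Y"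
  proof -
    have "A ** X = (A ** Y) ** (A ** X)" using Y by (simp add: matrix_mul_assoc)
    also have "\<dots> = transpose (A ** Y) ** transpose (A ** X)" using Y assms by simp
    also have "\<dots> = transpose ((A ** X) ** (A ** Y))" by (simp only: matrix_transpose_mul)
    also have "\<dots> = transpose (A ** Y)" using assms by (simp add: matrix_mul_assoc)
    finally show ?thesis using Y by simp
  qed
  have XAY: "X ** A = Y ** A"
  proof -
    have "X ** A = (X ** A) ** (Y ** A)" using Y by (metis matrix_mul_assoc)
    also have "\<dots> = transpose (X ** A) ** transpose (Y ** A)" using Y assms by simp
    also have "\<dots> = transpose ((Y ** A) ** (X ** A))" by (simp only: matrix_transpose_mul)
    also have "\<dots> = transpose (Y ** A)" using assms by (metis matrix_mul_assoc)
    finally show ?thesis using Y by simp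
  qed
  have "Y = Y ** (A ** Y)" using Y by (simp add: matrix_mul_assoc)
  also have "\<dots> = X ** A ** X" using AXY XAY by (metis matrix_mul_assoc)
  finally show "Y = X" using assms by simp
qed (use assms in auto)

definition diag_proj :: "'n set \<Rightarrow> real^'n^'n" where
  "diag_proj J = (\<chi> i j. if i = j \<and> i \<in> J then 1 else 0)"

lemma diag_proj_mult_vec: "(diag_proj J *v x) $ i = (if i \<in> J then x $ i else 0)"
  by (simp add: diag_proj_def matrix_vector_mult_def if_distrib[of "\<lambda>x. x * _"] cong: if_cong)

text \<open>The matrix \<open>N = P H P + (1 - P)\<close> is positive definite and commutes with \<open>P\<close>. On the range of
  \<open>P\<close> it agrees with the compression and on the kernel with the identity, so \<open>P N\<^sup>-\<^sup>1\<close> is the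
  pseudo-inverse.\<close>

lemma moore_penrose_compression:
  fixes H :: "real^'n^'n" and J :: "'n set"
  assumes sym: "transpose H = H" and pd: "\<And>x. x \<noteq> 0 \<Longrightarrow> 0 < x \<bullet> (H *v x)"
  defines "P \<equiv> diag_proj J"
  defines "Q \<equiv> moore_penrose (P ** H ** P)"
  shows "transpose Q = Q" "P ** Q = Q" "P ** H ** Q = P"
proof -
  have Pv: "P *v x = (\<chi> i. if i \<in> J then x $ i else 0)" for x
    by (simp add: vec_eq_iff diag_proj_mult_vec P_def)
  have PP: "P ** P = P"
    unfolding matrix_eq by (simp add: vec_eq_iff P_def diag_proj_mult_vec flip: matrix_vector_mul_assoc)
  have Pt: "transpose P = P" by (auto simp: P_def diag_proj_def transpose_def vec_eq_iff)
  define N where "N = P ** H ** P + (mat 1 - P)"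
  have Nt: "transpose N = N"
  proof -
    have "transpose N = transpose (P ** H ** P) + (mat 1 - transpose P)"
      by (simp add: N_def transpose_def vec_eq_iff mat_def)
    then show ?thesis by (simp add: N_def matrix_transpose_mul Pt sym matrix_mul_assoc)
  qed
  have "x = 0" if "N *v x = 0" for x
  proof -
    have "x \<bullet> (P *v y) = (P *v x) \<bullet> y" for y using Pt by (metis dot_lmul_matrix vector_transpose_matrix)
    then have "x \<bullet> (N *v x) = (P *v x) \<bullet> (H *v (P *v x)) + x \<bullet> (x - P *v x)"
      by (simp add: N_def matrix_vector_mult_add_rdistrib matrix_vector_mult_diff_rdistrib inner_add_right
          flip: matrix_vector_mul_assoc)
    moreover have "x \<bullet> (x - P *v x) = norm (x - P *v x) ^ 2"
      by (auto simp: power2_norm_eq_inner inner_vec_def Pv intro!: sum.cong)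
    ultimately have *: "(P *v x) \<bullet> (H *v (P *v x)) + norm (x - P *v x) ^ 2 = 0" using that by simp
    have "P *v x = 0"
    proof (rule ccontr)
      assume "P *v x \<noteq> 0"
      from pd[OF this] show False using * by (smt (verit) zero_le_power2)
    qed
    then show ?thesis using * by simp
  qed
  then have "invertible N" by (simp add: invertible_left_inverse matrix_left_invertible_ker)
  then obtain R where R: "N ** R = mat 1" "R ** N = mat 1" by (auto simp: invertible_def)
  have PPv: "P *v (P *v x) = P *v x" for x by (simp add: matrix_vector_mul_assoc PP)
  have PN: "P ** N = P ** H ** P" "N ** P = P ** H ** P"
    unfolding matrix_eq N_def
    by (simp_all add: matrix_vector_mult_add_rdistrib matrix_vector_mult_diff_rdistrib
        matrix_vector_right_distrib matrix_vector_mult_diff_distrib PPv flip: matrix_vector_mul_assoc)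
  have Rt: "transpose R = R"
  proof -
    have "transpose R ** N = mat 1" using R(1) Nt by (metis matrix_transpose_mul transpose_mat)
    then have "transpose R ** (N ** R) = R" by (simp add: matrix_mul_assoc)
    then show ?thesis by (simp add: R(1))
  qed
  have RP: "R ** P = P ** R"
  proof -
    have "R ** P = R ** P ** (N ** R)" by (simp add: R)
    also have "\<dots> = R ** (P ** N) ** R" by (simp add: matrix_mul_assoc)
    also have "\<dots> = R ** (N ** P) ** R" by (simp only: PN)
    also have "\<dots> = P ** R" by (simp add: matrix_mul_assoc R)
    finally show ?thesis .
  qed
  have a: "(P ** H ** P) ** (P ** R) = P"
  proof -
    have "(P ** H ** P) ** (P ** R) = P ** H ** (P ** P) ** R" by (simp add: matrix_mul_assoc)
    also have "\<dots> = P ** N ** R" by (simp only: PP PN)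
    also have "\<dots> = P" by (simp add: R flip: matrix_mul_assoc)
    finally show ?thesis .
  qed
  have b: "(P ** R) ** (P ** H ** P) = P"
  proof -
    have "(P ** R) ** (P ** H ** P) = P ** (R ** N) ** P" by (simp only: flip: PN(2)) (simp add: matrix_mul_assoc)
    then show ?thesis by (simp add: R PP)
  qed
  have Q: "Q = P ** R"
    unfolding Q_def
  proof (rule moore_penrose_eqI)
    show "P ** H ** P ** (P ** R) ** (P ** H ** P) = P ** H ** P"
      unfolding a by (simp add: matrix_mul_assoc PP)
    show "P ** R ** (P ** H ** P) ** (P ** R) = P ** R"
      unfolding b by (simp add: matrix_mul_assoc PP)
  qed (simp_all only: a b Pt)
  show "transpose Q = Q" by (simp add: Q matrix_transpose_mul Rt Pt RP)
  show "P ** Q = Q" by (simp add: Q matrix_mul_assoc PP)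
  show "P ** H ** Q = P" using a by (simp add: Q matrix_mul_assoc) (metis PP matrix_mul_assoc)
qed

lemma pd_lower_bound:
  fixes H :: "real^'n^'n"
  assumes pd: "\<And>x. x \<noteq> 0 \<Longrightarrow> 0 < x \<bullet> (H *v x)"
  obtains \<mu> where "0 < \<mu>" "\<And>x. \<mu> * norm x ^ 2 \<le> x \<bullet> (H *v x)"
proof -
  let ?f = "\<lambda>x. x \<bullet> (H *v x)"
  have "sphere (0::real^'n) 1 \<noteq> {}" by simp
  moreover have "continuous_on (sphere 0 1) ?f" by (intro continuous_intros matrix_vector_mult_linear_continuous_on)
  ultimately obtain y where y: "y \<in> sphere 0 1" "\<And>x. x \<in> sphere 0 1 \<Longrightarrow> ?f y \<le> ?f x"
    using continuous_attains_inf[OF compact_sphere] by blast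
  show ?thesis
  proof
    have "y \<noteq> 0" using y(1) by auto
    then show "0 < ?f y" by (rule pd)
    fix x show "?f y * norm x ^ 2 \<le> ?f x"
    proof (cases "x = 0")
      case False
      then have "?f y \<le> ?f ((1 / norm x) *\<^sub>R x)" by (intro y) auto
      also have "\<dots> = ?f x / norm x ^ 2"
        by (simp add: matrix_vector_mult_scaleR power2_eq_square)
      finally show ?thesis using False by (simp add: field_simps)
    qed simp
  qed
qed

text \<open>If \<open>q\<close> is stationary for the unperturbed quadratic in the direction of \<open>u - q\<close> and \<open>u\<close> is at
  least as good as \<open>q\<close> for the perturbed one, then strong convexity bounds \<open>u - q\<close> by the
  size of the perturbation at \<open>q\<close>.\<close>

lemma quadratic_minimiser_perturbation:
  fixes H H' :: "real^'n^'n"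
  assumes sym: "transpose H' = H'"
    and mu: "\<And>x. \<mu> * norm x ^ 2 \<le> x \<bullet> (H *v x)"
    and close: "norm (H' - H) \<le> \<rho>" "\<rho> \<le> \<mu> / 2" and \<mu>: "0 < \<mu>"
    and stat: "(H *v q + G) \<bullet> (u - q) = 0"
    and le: "G \<bullet> u + 1/2 * (u \<bullet> (H' *v u)) \<le> G \<bullet> q + 1/2 * (q \<bullet> (H' *v q))"
  shows "norm (u - q) \<le> 4 * \<rho> / \<mu> * norm q"
proof -
  define e where "e = u - q"
  define D where "D = H' - H"
  have H': "H' *v x = H *v x + D *v x" for x by (simp add: D_def matrix_vector_mult_diff_rdistrib)
  have D: "norm (D *v x) \<le> \<rho> * norm x" for x
    using norm_matrix_vector_mult_le[of D x] close(1) by (simp add: D_def) (meson mult_right_mono norm_ge_zero order_trans)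
  have symi: "x \<bullet> (H' *v y) = y \<bullet> (H' *v x)" for x y
    using sym by (metis dot_lmul_matrix inner_commute vector_transpose_matrix)
  have u: "u = q + e" by (simp add: e_def)
  have "G \<bullet> e + q \<bullet> (H' *v e) + 1/2 * (e \<bullet> (H' *v e)) \<le> 0"
    using le symi[of e q] unfolding u
    by (simp add: matrix_vector_right_distrib inner_add_left inner_add_right algebra_simps)
  moreover have "q \<bullet> (H' *v e) = e \<bullet> (H *v q) + (D *v q) \<bullet> e"
    using symi[of q e] by (simp add: H' inner_add_right inner_commute)
  moreover have "G \<bullet> e + e \<bullet> (H *v q) = 0" using stat by (simp add: e_def inner_add_left add.commute inner_commute[of "u - q" "H *v q"])
  moreover have "e \<bullet> (H' *v e) \<ge> (\<mu> - \<rho>) * norm e ^ 2"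
  proof -
    have "\<bar>e \<bullet> (D *v e)\<bar> \<le> norm e * (\<rho> * norm e)"
      using Cauchy_Schwarz_ineq2[of e "D *v e"] D[of e] by (meson mult_left_mono norm_ge_zero order_trans)
    then show ?thesis using mu[of e] by (simp add: H' inner_add_right algebra_simps power2_eq_square)
  qed
  moreover have "\<bar>(D *v q) \<bullet> e\<bar> \<le> \<rho> * norm q * norm e"
    using Cauchy_Schwarz_ineq2[of "D *v q" e] D[of q] by (meson mult_right_mono norm_ge_zero order_trans)
  ultimately have "1/2 * ((\<mu> - \<rho>) * norm e ^ 2) \<le> \<rho> * norm q * norm e" by linarith
  then have "((\<mu> - \<rho>) * norm e) * norm e \<le> (2 * \<rho> * norm q) * norm e" by (simp add: power2_eq_square algebra_simps)
  then have *: "(\<mu> - \<rho>) * norm e \<le> 2 * \<rho> * norm q"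
    using norm_ge_zero[of "H' - H"] close(1)
    by (cases "norm e = 0") (auto intro!: mult_nonneg_nonneg elim: order_trans[rotated])
  have "\<mu> / 2 * norm e \<le> (\<mu> - \<rho>) * norm e" using close(2) by (intro mult_right_mono) auto
  with * have "\<mu> / 2 * norm e \<le> 2 * \<rho> * norm q" by linarith
  then show ?thesis using \<mu> by (simp add: e_def field_simps)
qed

section \<open>The standard normal law on a Euclidean space\<close>

lemma prod_Basis_cart: "(\<Prod>b\<in>(Basis :: (real^'n) set). g b) = (\<Prod>i\<in>UNIV. g (axis i 1))"
proof -
  have B: "(Basis :: (real^'n) set) = range (\<lambda>i. axis i 1)" by (auto simp: Basis_vec_def)
  have "inj (\<lambda>i::'n. axis i (1::real))" by (auto simp: inj_on_def axis_eq_axis)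
  then show ?thesis unfolding B by (subst prod.reindex) auto
qed

lemma nn_integral_lborel_prod_cart:
  fixes f :: "'n::finite \<Rightarrow> real \<Rightarrow> ennreal"
  assumes [measurable]: "\<And>i. f i \<in> borel_measurable borel"
  shows "(\<integral>\<^sup>+x. (\<Prod>i\<in>UNIV. f i (x $ i)) \<partial>(lborel :: (real^'n) measure)) = (\<Prod>i\<in>UNIV. \<integral>\<^sup>+x. f i x \<partial>lborel)"
proof -
  define g where "g b = f (THE i. b = axis i (1::real))" for b :: "real^'n"
  have g: "g (axis i 1) = f i" for i unfolding g_def by (simp add: axis_eq_axis)
  have "(\<integral>\<^sup>+x. (\<Prod>b\<in>Basis. g b (x \<bullet> b)) \<partial>(lborel :: (real^'n) measure)) = (\<Prod>b\<in>Basis. \<integral>\<^sup>+x. g b x \<partial>lborel)"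
    by (rule nn_integral_lborel_prod) (auto simp: g_def)
  then show ?thesis by (simp add: prod_Basis_cart g inner_axis)
qed

definition gauss_density :: "real^'n \<Rightarrow> real" where
  "gauss_density z = (\<Prod>i\<in>UNIV. std_normal_density (z $ i))"

lemma gauss_density_measurable[measurable]: "gauss_density \<in> borel_measurable borel"
  unfolding gauss_density_def by measurable

lemma gauss_density_eq:
  "gauss_density (z::real^'n) = (1 / sqrt (2 * pi)) ^ CARD('n) * exp (- (norm z)\<^sup>2 / 2)"
proof -
  have "(norm z)\<^sup>2 = (\<Sum>i\<in>UNIV. (z $ i)\<^sup>2)"
    by (simp add: norm_vec_def L2_set_def sum_nonneg)
  then have "exp (- (norm z)\<^sup>2 / 2) = (\<Prod>i\<in>UNIV. exp (- (z $ i)\<^sup>2 / 2))"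
    by (simp add: exp_sum sum_divide_distrib flip: sum_negf)
  then show ?thesis
    unfolding gauss_density_def std_normal_density_def by (simp only: prod.distrib) simp
qed

lemma gauss_density_nonneg[simp]: "0 \<le> gauss_density z"
  unfolding gauss_density_def by (intro prod_nonneg) auto

lemma std_mvnormal_eq: "std_mvnormal = density lborel (\<lambda>z. ennreal (gauss_density z))"
  by (simp add: std_mvnormal_def gauss_density_def)

lemma sets_std_mvnormal[simp, measurable_cong]: "sets std_mvnormal = sets borel"
  by (simp add: std_mvnormal_def)

lemma space_std_mvnormal[simp]: "space std_mvnormal = UNIV"
  by (simp add: std_mvnormal_def)

lemma ennreal_gauss_density: "ennreal (gauss_density z) = (\<Prod>i\<in>UNIV. ennreal (std_normal_density (z $ i)))"
  unfolding gauss_density_def by (subst prod_ennreal) auto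

lemma nn_integral_std_normal: "(\<integral>\<^sup>+x. ennreal (std_normal_density x) \<partial>lborel) = 1"
  by (subst nn_integral_eq_integral) auto

lemma nn_integral_gauss_density: "(\<integral>\<^sup>+z. ennreal (gauss_density (z::real^'n)) \<partial>lborel) = 1"
  unfolding ennreal_gauss_density
  by (subst nn_integral_lborel_prod_cart) (auto simp: nn_integral_std_normal)

interpretation std_mvnormal: prob_space "std_mvnormal :: (real^'n) measure"
proof
  show "emeasure std_mvnormal (space (std_mvnormal :: (real^'n) measure)) = 1"
    using nn_integral_gauss_density by (simp add: std_mvnormal_eq emeasure_density)
qed

lemma measure_std_mvnormal_UNIV[simp]: "measure (std_mvnormal :: (real^'n) measure) UNIV = 1"
  using std_mvnormal.prob_space[where 'n='n] by simp

lemma nn_integral_std_mvnormal: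
  "u \<in> borel_measurable borel \<Longrightarrow>
    (\<integral>\<^sup>+z. u z \<partial>std_mvnormal) = (\<integral>\<^sup>+z. ennreal (gauss_density z) * u z \<partial>lborel)"
  unfolding std_mvnormal_eq by (subst nn_integral_density) auto

lemma integral_std_mvnormal:
  "(g::_\<Rightarrow>real) \<in> borel_measurable borel \<Longrightarrow>
    (LINT z|std_mvnormal. g z) = (LINT z|lborel. gauss_density z * g z)"
  unfolding std_mvnormal_eq by (subst integral_density) auto

lemma nn_integral_std_normal_exp_finite: "(\<integral>\<^sup>+x. ennreal (std_normal_density x * exp (c * \<bar>x\<bar>)) \<partial>lborel) < \<infinity>"
proof -
  have "(\<integral>\<^sup>+x. ennreal (std_normal_density x * exp (c * \<bar>x\<bar>)) \<partial>lborel)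
    \<le> (\<integral>\<^sup>+x. ennreal (2 * exp (2/3 * c\<^sup>2)) * ennreal (normal_density 0 2 x) \<partial>lborel)"
  proof (rule nn_integral_mono)
    fix x :: real
    \<comment> \<open>Completing the square bounds the integrand by a multiple of the normal density of variance \<open>4\<close>.\<close>
    have "0 \<le> (3/8) * (\<bar>x\<bar> - 4/3 * c)\<^sup>2" by simp
    also have "\<dots> = 3/8 * x\<^sup>2 - c * \<bar>x\<bar> + 2/3 * c\<^sup>2" by (simp add: power2_eq_square algebra_simps)
    finally have "- x\<^sup>2 / 2 + c * \<bar>x\<bar> \<le> 2/3 * c\<^sup>2 + - x\<^sup>2 / 8" by simp
    then have "exp (- x\<^sup>2 / 2) * exp (c * \<bar>x\<bar>) \<le> exp (2/3 * c\<^sup>2) * exp (- x\<^sup>2 / 8)"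
      by (simp only: exp_le_cancel_iff flip: exp_add)
    then have "(1 / sqrt (2*pi)) * (exp (- x\<^sup>2 / 2) * exp (c * \<bar>x\<bar>)) \<le> (1 / sqrt (2*pi)) * (exp (2/3 * c\<^sup>2) * exp (- x\<^sup>2 / 8))"
      by (intro mult_left_mono) auto
    moreover have "normal_density 0 2 x = 1 / (2 * sqrt (2 * pi)) * exp (- x\<^sup>2 / 8)"
      using real_sqrt_mult[of 4 2] by (simp add: normal_density_def real_sqrt_mult)
    ultimately have "std_normal_density x * exp (c * \<bar>x\<bar>) \<le> 2 * exp (2/3 * c\<^sup>2) * normal_density 0 2 x"
      by (simp add: std_normal_density_def mult_ac)
    then show "ennreal (std_normal_density x * exp (c * \<bar>x\<bar>)) \<le> ennreal (2 * exp (2/3 * c\<^sup>2)) * ennreal (normal_density 0 2 x)"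
      by (subst ennreal_mult[symmetric]) (auto intro: ennreal_leI)
  qed
  also have "\<dots> = ennreal (2 * exp (2/3 * c\<^sup>2))"
    by (subst nn_integral_cmult) (auto simp: nn_integral_eq_integral)
  finally show ?thesis by (simp add: le_less_trans)
qed

text \<open>Exponential moments dominate all the polynomial and exponential integrands that occur below.\<close>

lemma integrable_exp_norm: 
  assumes "0 \<le> c"
  shows "integrable std_mvnormal (\<lambda>z::real^'n. exp (c * norm z))"
proof (rule integrableI_bounded)
  show "(\<lambda>z::real^'n. exp (c * norm z)) \<in> borel_measurable std_mvnormal" by measurable
  have "(\<integral>\<^sup>+z. ennreal (norm (exp (c * norm (z::real^'n)))) \<partial>std_mvnormal)
    = (\<integral>\<^sup>+z. ennreal (gauss_density (z::real^'n) * exp (c * norm z)) \<partial>lborel)"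
    by (subst nn_integral_std_mvnormal) (auto simp: ennreal_mult)
  also have "\<dots> \<le> (\<integral>\<^sup>+z. (\<Prod>i\<in>UNIV. ennreal (std_normal_density ((z::real^'n) $ i) * exp (c * \<bar>z $ i\<bar>))) \<partial>lborel)"
  proof (rule nn_integral_mono)
    fix z :: "real^'n"
    have "c * norm z \<le> (\<Sum>i\<in>UNIV. c * \<bar>z $ i\<bar>)"
      using norm_le_l1_cart[of z] assms by (simp add: mult_left_mono flip: sum_distrib_left)
    then have "exp (c * norm z) \<le> (\<Prod>i\<in>UNIV. exp (c * \<bar>z $ i\<bar>))" by (simp flip: exp_sum)
    then have "gauss_density z * exp (c * norm z) \<le> gauss_density z * (\<Prod>i\<in>UNIV. exp (c * \<bar>z $ i\<bar>))"
      by (intro mult_left_mono) auto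
    also have "\<dots> = (\<Prod>i\<in>UNIV. std_normal_density (z $ i) * exp (c * \<bar>z $ i\<bar>))"
      by (simp add: gauss_density_def prod.distrib)
    finally show "ennreal (gauss_density z * exp (c * norm z)) \<le> (\<Prod>i\<in>UNIV. ennreal (std_normal_density (z $ i) * exp (c * \<bar>z $ i\<bar>)))"
      by (subst prod_ennreal) (auto intro: ennreal_leI)
  qed
  also have "\<dots> = (\<Prod>i\<in>(UNIV::'n set). (\<integral>\<^sup>+x. ennreal (std_normal_density x * exp (c * \<bar>x\<bar>)) \<partial>lborel))"
    by (rule nn_integral_lborel_prod_cart) measurable
  also have "\<dots> < \<infinity>" using nn_integral_std_normal_exp_finite[of c] by (simp add: power_less_top_ennreal)
  finally show "(\<integral>\<^sup>+z. ennreal (norm (exp (c * norm (z::real^'n)))) \<partial>std_mvnormal) < \<infinity>" .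
qed

lemma norm_power_le_exp: "norm z ^ k \<le> exp (real k * norm z)"
proof -
  have "norm z \<le> exp (norm z)" using exp_ge_add_one_self[of "norm z"] by linarith
  then have "norm z ^ k \<le> exp (norm z) ^ k" by (rule power_mono) simp
  then show ?thesis by (simp add: exp_of_nat_mult)
qed

lemma integrable_norm_power: "integrable std_mvnormal (\<lambda>z::real^'n. norm z ^ k)"
  by (rule Bochner_Integration.integrable_bound[OF integrable_exp_norm[of "real k"]])
     (auto intro: norm_power_le_exp)

lemma integrable_component: "integrable std_mvnormal (\<lambda>z::real^'n. z $ i)"
  by (rule Bochner_Integration.integrable_bound[OF integrable_norm_power[of 1]])
     (auto simp: component_le_norm_cart)

lemma abs_component_mult_le: "\<bar>(z::real^'n) $ i * z $ j\<bar> \<le> norm z ^ 2"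
  by (simp add: abs_mult power2_eq_square mult_mono component_le_norm_cart)

lemma integrable_component_mult: "integrable std_mvnormal (\<lambda>z::real^'n. z $ i * z $ j)"
  by (rule Bochner_Integration.integrable_bound[OF integrable_norm_power[of 2]])
     (auto simp: abs_component_mult_le)

text \<open>The reflection of one coordinate; invariance of the normal law under it kills all moments that are
  odd in that coordinate.\<close>

definition flip :: "'n::finite \<Rightarrow> real^'n \<Rightarrow> real^'n" where
  "flip i z = (\<chi> j. if j = i then - (z $ j) else z $ j)"

lemma flip_component: "flip i z $ j = (if j = i then - (z $ j) else z $ j)"
  by (simp add: flip_def)

lemma flip_measurable[measurable]: "flip i \<in> borel_measurable borel"
proof -
  have "flip i = (\<lambda>z. z - (2 * z $ i) *\<^sub>R axis i 1)"
    by (auto simp: fun_eq_iff vec_eq_iff flip_component axis_def)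
  then show ?thesis by simp
qed

lemma distr_lborel_flip: "distr lborel borel (flip (i::'n::finite)) = lborel"
proof -
  define c where "c b = (if b = axis i 1 then - 1 else 1::real)" for b :: "real^'n"
  have T: "(\<lambda>x. 0 + (\<Sum>j\<in>Basis. (c j * (x \<bullet> j)) *\<^sub>R j)) = flip i"
  proof
    fix x :: "real^'n"
    have "(\<Sum>j\<in>Basis. (c j * (x \<bullet> j)) *\<^sub>R j) = (\<Sum>k\<in>UNIV. (c (axis k 1) * x $ k) *\<^sub>R axis k 1)"
    proof -
      have B: "(Basis :: (real^'n) set) = range (\<lambda>i. axis i 1)" by (auto simp: Basis_vec_def)
      have "inj (\<lambda>i::'n. axis i (1::real))" by (auto simp: inj_on_def axis_eq_axis)
      then show ?thesis unfolding B by (subst sum.reindex) (auto simp: inner_axis)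
    qed
    then show "0 + (\<Sum>j\<in>Basis. (c j * (x \<bullet> j)) *\<^sub>R j) = flip i x"
      by (auto simp: vec_eq_iff flip_component axis_def c_def if_distrib[of "\<lambda>x. _ * x"] vec_eq_iff cong: if_cong)
  qed
  have "(lborel :: (real^'n) measure) = density (distr lborel borel (\<lambda>x. 0 + (\<Sum>j\<in>Basis. (c j * (x \<bullet> j)) *\<^sub>R j))) (\<lambda>_. (\<Prod>j\<in>Basis. \<bar>c j\<bar>))"
    by (rule lborel_affine_euclidean) (auto simp: c_def)
  also have "(\<Prod>j\<in>Basis. \<bar>c j\<bar>) = 1" by (intro prod.neutral) (auto simp: c_def)
  finally show ?thesis unfolding T by (simp add: density_1)
qed

lemma integral_std_mvnormal_flip:
  assumes [measurable]: "(g :: real^'n \<Rightarrow> real) \<in> borel_measurable borel"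
  shows "(LINT z|std_mvnormal. g (flip i z)) = (LINT z|std_mvnormal. g z)"
proof -
  have n: "gauss_density (flip i z) = gauss_density z" for z :: "real^'n"
    unfolding gauss_density_def by (intro prod.cong) (auto simp: flip_component std_normal_density_def)
  have "(LINT z|std_mvnormal. g z) = (LINT z|distr lborel borel (flip i). gauss_density z * g z)"
    by (simp add: integral_std_mvnormal distr_lborel_flip)
  also have "\<dots> = (LINT z|std_mvnormal. g (flip i z))"
    by (simp add: integral_distr integral_std_mvnormal n)
  finally show ?thesis by simp
qed

lemma std_mvnormal_mean: "(LINT z|std_mvnormal. (z::real^'n) $ i) = 0"
  using integral_std_mvnormal_flip[of "\<lambda>z. z $ i" i] by (simp add: flip_component)

lemma std_mvnormal_cov: "(LINT z|std_mvnormal. (z::real^'n) $ i * z $ j) = (if i = j then 1 else 0)"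
proof (cases "i = j")
  case False
  then show ?thesis
    using integral_std_mvnormal_flip[of "\<lambda>z. z $ i * z $ j" i] by (simp add: flip_component)
next
  case True
  have "(\<integral>\<^sup>+z. ennreal ((z::real^'n) $ i * z $ i) \<partial>std_mvnormal)
     = (\<integral>\<^sup>+z. (\<Prod>k\<in>UNIV. ennreal (std_normal_density ((z::real^'n) $ k) * (if k = i then (z $ k)\<^sup>2 else 1))) \<partial>lborel)"
  proof (subst nn_integral_std_mvnormal, measurable, rule nn_integral_cong)
    fix z :: "real^'n"
    have "(\<Prod>k\<in>UNIV. std_normal_density (z $ k) * (if k = i then (z $ k)\<^sup>2 else 1)) = gauss_density z * (z $ i)\<^sup>2"
      by (simp add: prod.distrib gauss_density_def)
    then show "ennreal (gauss_density z) * ennreal (z $ i * z $ i)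
       = (\<Prod>k\<in>UNIV. ennreal (std_normal_density (z $ k) * (if k = i then (z $ k)\<^sup>2 else 1)))"
      by (subst prod_ennreal) (auto simp: power2_eq_square simp flip: ennreal_mult')
  qed
  also have "\<dots> = (\<Prod>k\<in>UNIV. (\<integral>\<^sup>+x. ennreal (std_normal_density x * (if k = i then x\<^sup>2 else 1)) \<partial>lborel))"
    by (rule nn_integral_lborel_prod_cart) measurable
  also have "\<dots> = 1"
  proof (rule prod.neutral, intro ballI)
    fix k
    have "(\<integral>\<^sup>+x. ennreal (std_normal_density x * x\<^sup>2) \<partial>lborel) = 1"
      using std_normal_moment_even[of 1] by (subst nn_integral_eq_integral) (auto simp: has_bochner_integral_iff fact_numeral)
    then show "(\<integral>\<^sup>+x. ennreal (std_normal_density x * (if k = i then x\<^sup>2 else 1)) \<partial>lborel) = 1"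
      by (cases "k = i") (simp_all add: nn_integral_std_normal)
  qed
  finally have "(\<integral>\<^sup>+z. ennreal ((z::real^'n) $ i * z $ i) \<partial>std_mvnormal) = 1" .
  then show ?thesis using True by (subst integral_eq_nn_integral) auto
qed

lemma nn_integral_lborel_affine:
  fixes u :: "real^'n \<Rightarrow> ennreal"
  assumes [measurable]: "u \<in> borel_measurable borel" and c: "0 < c"
  shows "(\<integral>\<^sup>+x. u x \<partial>lborel) = (\<integral>\<^sup>+x. ennreal (c ^ CARD('n)) * u (t + c *\<^sub>R x) \<partial>lborel)"
proof -
  have "(\<integral>\<^sup>+x. u x \<partial>lborel) = (\<integral>\<^sup>+x. u x \<partial>(density (distr lborel borel (\<lambda>x. t + c *\<^sub>R x)) (\<lambda>_. \<bar>c\<bar>^DIM(real^'n))))"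
    using c lborel_affine[of c t] by simp
  then show ?thesis using c by (simp add: nn_integral_density nn_integral_distr)
qed

text \<open>Cameron--Martin: shifting the argument is the same as tilting the density.\<close>

lemma std_mvnormal_shift:
  assumes [measurable]: "(g :: real^'n \<Rightarrow> real) \<in> borel_measurable borel"
  shows "(LINT z|std_mvnormal. g (z + a)) = (LINT z|std_mvnormal. exp (a \<bullet> z - (norm a)\<^sup>2 / 2) * g z)"
proof -
  have L: "(lborel :: (real^'n) measure) = distr lborel borel (\<lambda>x. - a + x)"
    using lborel_affine[of 1 "- a"] by (simp add: density_1)
  have d: "gauss_density (z - a) = gauss_density z * exp (a \<bullet> z - (norm a)\<^sup>2 / 2)" for z
  proof -
    have "- (norm (z - a))\<^sup>2 / 2 = - (norm z)\<^sup>2 / 2 + (a \<bullet> z - (norm a)\<^sup>2 / 2)"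
      by (simp add: power2_norm_eq_inner inner_diff_left inner_diff_right inner_commute field_simps)
    then show ?thesis by (simp add: gauss_density_eq flip: exp_add)
  qed
  have "(LINT z|std_mvnormal. g (z + a)) = (LINT z|lborel. gauss_density z * g (z + a))"
    by (rule integral_std_mvnormal) measurable
  also have "\<dots> = (LINT z|distr lborel borel (\<lambda>x. - a + x). gauss_density z * g (z + a))"
    using L by simp
  also have "\<dots> = (LINT z|lborel. gauss_density (z - a) * g z)"
    by (subst integral_distr) auto
  also have "\<dots> = (LINT z|std_mvnormal. exp (a \<bullet> z - (norm a)\<^sup>2 / 2) * g z)"
    by (subst integral_std_mvnormal) (auto simp: d mult_ac)
  finally show ?thesis .
qed

text \<open>Two independent standard normal vectors have a rotation invariant joint density: substituting
  \<open>w = c x + s y\<close> turns the exponent \<open>|x|\<^sup>2 + |y|\<^sup>2\<close> into \<open>|w|\<^sup>2 + |(y - s w) / c|\<^sup>2\<close>, and the second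
  term integrates out.\<close>

lemma std_mvnormal_rotation_nn:
  fixes u :: "real^'n \<Rightarrow> ennreal"
  assumes [measurable]: "u \<in> borel_measurable borel" and c: "0 < c" and cs: "c\<^sup>2 + s\<^sup>2 = 1"
  shows "(\<integral>\<^sup>+y. \<integral>\<^sup>+x. u (c *\<^sub>R x + s *\<^sub>R y) \<partial>std_mvnormal \<partial>std_mvnormal) = (\<integral>\<^sup>+z. u z \<partial>std_mvnormal)"
proof -
  let ?\<phi> = "\<lambda>z::real^'n. ennreal (gauss_density z)"
  let ?C = "ennreal ((1/c) ^ CARD('n))"
  have id: "?\<phi> ((w - s *\<^sub>R y) /\<^sub>R c) * ?\<phi> y = ?\<phi> w * ?\<phi> ((y - s *\<^sub>R w) /\<^sub>R c)" for w y :: "real^'n"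
  proof -
    have "(norm ((w - s *\<^sub>R y) /\<^sub>R c))\<^sup>2 + (norm y)\<^sup>2 = (norm w)\<^sup>2 + (norm ((y - s *\<^sub>R w) /\<^sub>R c))\<^sup>2"
    proof -
      have "(norm (w - s *\<^sub>R y))\<^sup>2 + c\<^sup>2 * (norm y)\<^sup>2 = c\<^sup>2 * (norm w)\<^sup>2 + (norm (y - s *\<^sub>R w))\<^sup>2"
        unfolding power2_norm_eq_inner
        using cs by (simp add: inner_diff_left inner_diff_right inner_commute) algebra
      moreover have "(norm (v /\<^sub>R c))\<^sup>2 = (norm v)\<^sup>2 / c\<^sup>2" for v :: "real^'n"
        by (simp add: power_mult_distrib power_inverse divide_inverse)
      ultimately show ?thesis using c by (simp only:) (simp add: field_simps)
    qed
    then have "exp (- (norm ((w - s *\<^sub>R y) /\<^sub>R c))\<^sup>2 / 2) * exp (- (norm y)\<^sup>2 / 2)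
      = exp (- (norm w)\<^sup>2 / 2) * exp (- (norm ((y - s *\<^sub>R w) /\<^sub>R c))\<^sup>2 / 2)"
      unfolding exp_add[symmetric] by (intro arg_cong[where f=exp]) linarith
    then have "gauss_density ((w - s *\<^sub>R y) /\<^sub>R c) * gauss_density y
       = gauss_density w * gauss_density ((y - s *\<^sub>R w) /\<^sub>R c)"
      unfolding gauss_density_eq by (simp add: mult_ac)
    then show ?thesis by (simp flip: ennreal_mult)
  qed
  have meas[measurable]: "(\<lambda>x. u (f x)) \<in> borel_measurable N" if "f \<in> borel_measurable N" for f and N :: "'z measure"
    using that by measurable
  have inner: "(\<integral>\<^sup>+x. u (c *\<^sub>R x + s *\<^sub>R y) \<partial>std_mvnormal)
     = (\<integral>\<^sup>+w. ?C * (?\<phi> ((w - s *\<^sub>R y) /\<^sub>R c) * u w) \<partial>lborel)" for y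
  proof -
    have "(\<integral>\<^sup>+x. u (c *\<^sub>R x + s *\<^sub>R y) \<partial>std_mvnormal) = (\<integral>\<^sup>+x. ?\<phi> x * u (c *\<^sub>R x + s *\<^sub>R y) \<partial>lborel)"
      by (rule nn_integral_std_mvnormal) measurable
    also have "\<dots> = (\<integral>\<^sup>+w. ?C * (?\<phi> (- (s/c) *\<^sub>R y + (1/c) *\<^sub>R w) * u (c *\<^sub>R (- (s/c) *\<^sub>R y + (1/c) *\<^sub>R w) + s *\<^sub>R y)) \<partial>lborel)"
      using c by (intro nn_integral_lborel_affine) auto
    also have "\<dots> = (\<integral>\<^sup>+w. ?C * (?\<phi> ((w - s *\<^sub>R y) /\<^sub>R c) * u w) \<partial>lborel)"
    proof (rule nn_integral_cong)
      fix w :: "real^'n"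
      have "- (s/c) *\<^sub>R y + (1/c) *\<^sub>R w = (w - s *\<^sub>R y) /\<^sub>R c" using c by (simp add: scaleR_diff_right divide_inverse mult.commute)
      moreover have "c *\<^sub>R ((w - s *\<^sub>R y) /\<^sub>R c) + s *\<^sub>R y = w" using c by simp
      ultimately show "?C * (?\<phi> (- (s/c) *\<^sub>R y + (1/c) *\<^sub>R w) * u (c *\<^sub>R (- (s/c) *\<^sub>R y + (1/c) *\<^sub>R w) + s *\<^sub>R y))
        = ?C * (?\<phi> ((w - s *\<^sub>R y) /\<^sub>R c) * u w)" by (simp only:)
    qed
    finally show ?thesis .
  qed
  have "(\<integral>\<^sup>+y. \<integral>\<^sup>+x. u (c *\<^sub>R x + s *\<^sub>R y) \<partial>std_mvnormal \<partial>std_mvnormal)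
     = (\<integral>\<^sup>+y. ?\<phi> y * (\<integral>\<^sup>+w. ?C * (?\<phi> ((w - s *\<^sub>R y) /\<^sub>R c) * u w) \<partial>lborel) \<partial>lborel)"
    unfolding inner by (rule nn_integral_std_mvnormal) measurable
  also have "\<dots> = (\<integral>\<^sup>+y. (\<integral>\<^sup>+w. ?\<phi> y * (?C * (?\<phi> ((w - s *\<^sub>R y) /\<^sub>R c) * u w)) \<partial>lborel) \<partial>lborel)"
    by (simp add: nn_integral_cmult)
  also have "\<dots> = (\<integral>\<^sup>+w. (\<integral>\<^sup>+y. ?\<phi> y * (?C * (?\<phi> ((w - s *\<^sub>R y) /\<^sub>R c) * u w)) \<partial>lborel) \<partial>lborel)"
    by (rule lborel_pair.Fubini') measurable
  also have "\<dots> = (\<integral>\<^sup>+w. ?\<phi> w * u w \<partial>lborel)"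
  proof (rule nn_integral_cong)
    fix w :: "real^'n"
    have "(\<integral>\<^sup>+y. ?\<phi> y * (?C * (?\<phi> ((w - s *\<^sub>R y) /\<^sub>R c) * u w)) \<partial>lborel)
      = (\<integral>\<^sup>+y. (?\<phi> w * u w) * (?C * ?\<phi> ((y - s *\<^sub>R w) /\<^sub>R c)) \<partial>lborel)"
    proof (rule nn_integral_cong)
      fix y :: "real^'n"
      have "?\<phi> y * (?C * (?\<phi> ((w - s *\<^sub>R y) /\<^sub>R c) * u w)) = (?\<phi> ((w - s *\<^sub>R y) /\<^sub>R c) * ?\<phi> y) * ?C * u w"
        by (simp add: mult_ac)
      then show "?\<phi> y * (?C * (?\<phi> ((w - s *\<^sub>R y) /\<^sub>R c) * u w)) = (?\<phi> w * u w) * (?C * ?\<phi> ((y - s *\<^sub>R w) /\<^sub>R c))"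
        unfolding id by (simp add: mult_ac)
    qed
    also have "\<dots> = (?\<phi> w * u w) * (\<integral>\<^sup>+y. ?C * ?\<phi> ((y - s *\<^sub>R w) /\<^sub>R c) \<partial>lborel)"
      by (rule nn_integral_cmult) measurable
    also have "(\<integral>\<^sup>+y. ?C * ?\<phi> ((y - s *\<^sub>R w) /\<^sub>R c) \<partial>lborel) = (\<integral>\<^sup>+y. ?\<phi> y \<partial>lborel)"
      using c by (subst nn_integral_lborel_affine[of ?\<phi> "1/c" "- (s/c) *\<^sub>R w"])
        (auto intro!: nn_integral_cong simp: scaleR_diff_right divide_inverse mult.commute)
    finally show "(\<integral>\<^sup>+y. ?\<phi> y * (?C * (?\<phi> ((w - s *\<^sub>R y) /\<^sub>R c) * u w)) \<partial>lborel) = ?\<phi> w * u w"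
      by (simp add: nn_integral_gauss_density)
  qed
  also have "\<dots> = (\<integral>\<^sup>+z. u z \<partial>std_mvnormal)" by (rule nn_integral_std_mvnormal[symmetric]) measurable
  finally show ?thesis .
qed

lemma std_mvnormal_convolution:
  fixes g :: "real^'n \<Rightarrow> real"
  assumes [measurable]: "g \<in> borel_measurable borel" and K: "\<And>x. \<bar>g x\<bar> \<le> K" and a: "0 \<le> a" and b: "0 \<le> b"
  shows "(LINT y|std_mvnormal. LINT x|std_mvnormal. g (a *\<^sub>R x + b *\<^sub>R y)) = (LINT z|std_mvnormal. g (sqrt (a\<^sup>2 + b\<^sup>2) *\<^sub>R z))"
proof (cases "a = 0")
  case True
  then show ?thesis using b by simp
next
  case False
  with a have a: "0 < a" by simp
  define r where "r = sqrt (a\<^sup>2 + b\<^sup>2)"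
  have r2: "r\<^sup>2 = a\<^sup>2 + b\<^sup>2" by (simp add: r_def)
  have r: "0 < r" using a by (simp add: r_def add_pos_nonneg)
  let ?g = "std_mvnormal :: (real^'n) measure"
  interpret pair_prob_space ?g ?g by unfold_locales
  have eq: "distr (?g \<Otimes>\<^sub>M ?g) borel (\<lambda>(y, x). (a/r) *\<^sub>R x + (b/r) *\<^sub>R y) = distr ?g borel (\<lambda>z. z)"
  proof (rule measure_eqI)
    fix A assume "A \<in> sets (distr (?g \<Otimes>\<^sub>M ?g) borel (\<lambda>(y, x). (a/r) *\<^sub>R x + (b/r) *\<^sub>R y))"
    then have [measurable]: "A \<in> sets borel" by simp
    have 1: "(a/r)\<^sup>2 + (b/r)\<^sup>2 = 1" using r r2 a by (simp add: power_divide flip: add_divide_distrib)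
    have "emeasure (distr (?g \<Otimes>\<^sub>M ?g) borel (\<lambda>(y, x). (a/r) *\<^sub>R x + (b/r) *\<^sub>R y)) A
       = (\<integral>\<^sup>+w. indicator A w \<partial>(distr (?g \<Otimes>\<^sub>M ?g) borel (\<lambda>(y, x). (a/r) *\<^sub>R x + (b/r) *\<^sub>R y)))"
      by simp
    also have "\<dots> = (\<integral>\<^sup>+p. indicator A ((a/r) *\<^sub>R snd p + (b/r) *\<^sub>R fst p) \<partial>(?g \<Otimes>\<^sub>M ?g))"
      by (subst nn_integral_distr) (auto simp: case_prod_beta)
    also have "\<dots> = (\<integral>\<^sup>+y. \<integral>\<^sup>+x. indicator A ((a/r) *\<^sub>R x + (b/r) *\<^sub>R y) \<partial>?g \<partial>?g)"
      by (subst std_mvnormal.nn_integral_fst[symmetric]) auto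
    also have "\<dots> = (\<integral>\<^sup>+z. indicator A z \<partial>?g)"
      using a r 1 by (intro std_mvnormal_rotation_nn) auto
    also have "\<dots> = emeasure (distr ?g borel (\<lambda>z. z)) A"
      by (simp add: emeasure_distr)
    finally show "emeasure (distr (?g \<Otimes>\<^sub>M ?g) borel (\<lambda>(y, x). (a/r) *\<^sub>R x + (b/r) *\<^sub>R y)) A = emeasure (distr ?g borel (\<lambda>z. z)) A" .
  qed simp
  have int: "integrable (?g \<Otimes>\<^sub>M ?g) (\<lambda>p. g (r *\<^sub>R ((a/r) *\<^sub>R snd p + (b/r) *\<^sub>R fst p)))"
    by (rule P.integrable_const_bound[where B=K]) (auto simp: K)
  have "(LINT y|?g. LINT x|?g. g (a *\<^sub>R x + b *\<^sub>R y)) = (LINT y|?g. LINT x|?g. g (r *\<^sub>R ((a/r) *\<^sub>R x + (b/r) *\<^sub>R y)))"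
    using r by (simp add: scaleR_add_right)
  also have "\<dots> = (LINT p|(?g \<Otimes>\<^sub>M ?g). g (r *\<^sub>R ((a/r) *\<^sub>R snd p + (b/r) *\<^sub>R fst p)))"
    using integral_fst'[OF int] by simp
  also have "\<dots> = (LINT w|distr (?g \<Otimes>\<^sub>M ?g) borel (\<lambda>(y, x). (a/r) *\<^sub>R x + (b/r) *\<^sub>R y). g (r *\<^sub>R w))"
    by (subst integral_distr) (auto simp: case_prod_beta)
  also have "\<dots> = (LINT z|?g. g (r *\<^sub>R z))"
    unfolding eq by (subst integral_distr) auto
  finally show ?thesis by (simp add: r_def)
qed

section \<open>Gaussian averaging and a uniform central limit bound\<close>

text \<open>For linear \<open>L\<close> this is the heat flow with covariance \<open>L L\<^sup>T\<close>.\<close>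

definition heat :: "(real^'n \<Rightarrow> real^'n) \<Rightarrow> (real^'n \<Rightarrow> real) \<Rightarrow> real^'n \<Rightarrow> real" where
  "heat L f x = (LINT z|std_mvnormal. f (x + L z))"

lemma heat_measurable[measurable]:
  assumes [measurable]: "f \<in> borel_measurable borel" "L \<in> borel_measurable borel"
  shows "heat L f \<in> borel_measurable borel"
  unfolding heat_def by measurable

lemma heat_integrable:
  fixes L :: "real^'n \<Rightarrow> real^'n"
  assumes [measurable]: "f \<in> borel_measurable borel" "L \<in> borel_measurable borel" and K: "\<And>x. \<bar>f x\<bar> \<le> (K::real)"
  shows "integrable std_mvnormal (\<lambda>z. f (x + L z))"
  by (rule std_mvnormal.integrable_const_bound[where B=K]) (auto simp: K)

lemma abs_integral_le_const:
  assumes "prob_space N" "\<And>z. \<bar>h z\<bar> \<le> (K::real)" "h \<in> borel_measurable N"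
  shows "\<bar>LINT z|N. h z\<bar> \<le> K"
proof -
  interpret prob_space N by fact
  have i: "integrable N h" by (rule integrable_const_bound[where B=K]) (use assms in auto)
  have "\<bar>LINT z|N. h z\<bar> \<le> (LINT z|N. \<bar>h z\<bar>)" by (rule integral_abs_bound)
  also have "\<dots> \<le> (LINT z|N. K)" using i assms(2) by (intro integral_mono) auto
  finally show ?thesis by (simp add: prob_space)
qed

lemma heat_bounded:
  assumes [measurable]: "f \<in> borel_measurable borel" "L \<in> borel_measurable borel" and K: "\<And>x. \<bar>f x\<bar> \<le> (K::real)"
  shows "\<bar>heat L f x\<bar> \<le> K"
  unfolding heat_def by (rule abs_integral_le_const) (auto simp: K std_mvnormal.prob_space_axioms)

lemma heat_commute:
  fixes L L' :: "real^'n \<Rightarrow> real^'n"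
  assumes [measurable]: "f \<in> borel_measurable borel" "L \<in> borel_measurable borel" "L' \<in> borel_measurable borel"
    and K: "\<And>x. \<bar>f x\<bar> \<le> (K::real)"
  shows "heat L (heat L' f) = heat L' (heat L f)"
proof
  fix x :: "real^'n"
  let ?g = "std_mvnormal :: (real^'n) measure"
  interpret pair_prob_space ?g ?g by unfold_locales
  have "integrable (?g \<Otimes>\<^sub>M ?g) (case_prod (\<lambda>y z. f (x + L z + L' y)))"
    by (rule P.integrable_const_bound[where B=K]) (auto simp: K case_prod_beta)
  from Fubini_integral[OF this] show "heat L (heat L' f) x = heat L' (heat L f) x"
    unfolding heat_def by (simp add: add_ac)
qed

text \<open>This lets a single Gaussian step be split off from, or merged into, a longer Gaussian sum.\<close>

lemma heat_semigroup:
  fixes A :: "real^'n^'n"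
  assumes [measurable]: "f \<in> borel_measurable borel"
    and K: "\<And>x. \<bar>f x\<bar> \<le> (K::real)" and a: "0 \<le> a" and b: "0 \<le> b"
  shows "heat (\<lambda>z. b *\<^sub>R (A *v z)) (heat (\<lambda>z. a *\<^sub>R (A *v z)) f) = heat (\<lambda>z. sqrt (a\<^sup>2 + b\<^sup>2) *\<^sub>R (A *v z)) f"
proof
  fix x
  have [measurable]: "(\<lambda>z. A *v z) \<in> borel_measurable borel"
    by (intro borel_measurable_continuous_onI matrix_vector_mult_linear_continuous_on)
  have "(LINT y|std_mvnormal. LINT z|std_mvnormal. f (x + A *v (a *\<^sub>R z + b *\<^sub>R y)))
    = (LINT z|std_mvnormal. f (x + A *v (sqrt (a\<^sup>2 + b\<^sup>2) *\<^sub>R z)))"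
    by (rule std_mvnormal_convolution[where K=K]) (auto simp: K a b)
  then show "heat (\<lambda>z. b *\<^sub>R (A *v z)) (heat (\<lambda>z. a *\<^sub>R (A *v z)) f) x = heat (\<lambda>z. sqrt (a\<^sup>2 + b\<^sup>2) *\<^sub>R (A *v z)) f x"
    by (simp add: heat_def matrix_vector_right_distrib matrix_vector_mult_scaleR add_ac)
qed

text \<open>The error of the second-order expansion in \<open>a\<close> of the Cameron--Martin density of a shift by \<open>a\<close>;
  the terms subtracted are the Hermite polynomials of degree at most two.\<close>

definition tilt_remainder :: "real^'n \<Rightarrow> real^'n \<Rightarrow> real" where
  "tilt_remainder a z = exp (a \<bullet> z - (norm a)\<^sup>2 / 2) - 1 - a \<bullet> z - 1/2 * ((a \<bullet> z)\<^sup>2 - (norm a)\<^sup>2)"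

lemma tilt_remainder_le:
  fixes a z :: "real^'n"
  assumes "norm a \<le> 1"
  shows "\<bar>tilt_remainder a z\<bar> \<le> norm a ^ 3 * (2 * exp (4 * (norm z + 1)))"
proof -
  define y where "y = a \<bullet> z - (norm a)\<^sup>2 / 2"
  define r where "r = norm a"
  have r: "0 \<le> r" "r \<le> 1" using assms by (auto simp: r_def)
  have az: "\<bar>a \<bullet> z\<bar> \<le> r * norm z" unfolding r_def by (rule Cauchy_Schwarz_ineq2)
  have r2: "r\<^sup>2 \<le> r" using r by (simp add: power2_eq_square mult_left_le)
  have y: "\<bar>y\<bar> \<le> r * (norm z + 1)"
    using az r2 zero_le_power2[of r] unfolding y_def r_def[symmetric] distrib_left abs_le_iff
    by (intro conjI) linarith+
  have y': "\<bar>y\<bar> \<le> norm z + 1"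
    by (rule order_trans[OF y]) (use r in \<open>simp add: mult_left_le_one_le\<close>)
  have pw: "(norm z + 1) ^ 3 \<le> exp (3 * (norm z + 1))"
  proof -
    have "norm z + 1 \<le> exp (norm z + 1)" using exp_ge_add_one_self[of "norm z + 1"] by linarith
    then have "(norm z + 1) ^ 3 \<le> exp (norm z + 1) ^ 3" by (rule power_mono) simp
    then show ?thesis by (simp flip: exp_of_nat_mult)
  qed
  obtain t where t: "\<bar>t\<bar> \<le> \<bar>y\<bar>" "exp y = (\<Sum>m<3. y ^ m / fact m) + exp t / fact 3 * y ^ 3"
    using Maclaurin_exp_le[of y 3] by auto
  have "exp y - 1 - y - y\<^sup>2 / 2 = exp t / 6 * y ^ 3"
    using t(2) by (simp add: eval_nat_numeral)
  then have "\<bar>exp y - 1 - y - y\<^sup>2 / 2\<bar> = exp t / 6 * \<bar>y\<bar> ^ 3"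
    by (simp only: abs_mult power_abs) simp
  also have "\<dots> \<le> exp (norm z + 1) * (r * (norm z + 1)) ^ 3"
  proof (intro mult_mono power_mono y)
    have "exp t \<le> exp (norm z + 1)" using t(1) y' by simp
    then show "exp t / 6 \<le> exp (norm z + 1)" using exp_gt_zero[of t] by linarith
  qed (use r in auto)
  also have "\<dots> = r ^ 3 * (exp (norm z + 1) * (norm z + 1) ^ 3)" by (simp add: power_mult_distrib)
  also have "\<dots> \<le> r ^ 3 * (exp (norm z + 1) * exp (3 * (norm z + 1)))"
    using pw r by (intro mult_left_mono) auto
  also have "\<dots> = r ^ 3 * exp (4 * (norm z + 1))" by (simp flip: exp_add)
  finally have 1: "\<bar>exp y - 1 - y - y\<^sup>2 / 2\<bar> \<le> r ^ 3 * exp (4 * (norm z + 1))" .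
  have "tilt_remainder a z - (exp y - 1 - y - y\<^sup>2 / 2) = r ^ 4 / 8 - (a \<bullet> z) * r\<^sup>2 / 2"
    unfolding tilt_remainder_def y_def r_def[symmetric] by (simp add: power2_eq_square power4_eq_xxxx field_simps)
  also have "\<bar>\<dots>\<bar> \<le> r ^ 3 * (norm z + 1)"
  proof -
    have "r ^ 4 \<le> r ^ 3" using r by (intro power_decreasing) auto
    moreover have "\<bar>(a \<bullet> z) * r\<^sup>2\<bar> \<le> r ^ 3 * norm z"
    proof -
      have "\<bar>(a \<bullet> z) * r\<^sup>2\<bar> \<le> (r * norm z) * r\<^sup>2" unfolding abs_mult using az by (intro mult_mono) auto
      then show ?thesis by (simp add: power2_eq_square power3_eq_cube mult_ac)
    qed
    moreover have "0 \<le> r ^ 4" "0 \<le> r ^ 3 * norm z" using r by auto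
    ultimately show ?thesis unfolding distrib_left mult_1_right by linarith
  qed
  also have "\<dots> \<le> r ^ 3 * exp (4 * (norm z + 1))"
  proof (rule mult_left_mono)
    have "norm z + 1 \<le> 4 * (norm z + 1)" by simp
    also have "\<dots> \<le> exp (4 * (norm z + 1))" using exp_ge_add_one_self[of "4 * (norm z + 1)"] by linarith
    finally show "norm z + 1 \<le> exp (4 * (norm z + 1))" .
  qed (use r in auto)
  finally have 2: "\<bar>tilt_remainder a z - (exp y - 1 - y - y\<^sup>2 / 2)\<bar> \<le> r ^ 3 * exp (4 * (norm z + 1))" .
  have "\<bar>tilt_remainder a z\<bar> \<le> r ^ 3 * exp (4 * (norm z + 1)) + r ^ 3 * exp (4 * (norm z + 1))"
    using 1 2 by linarith
  then show ?thesis by (simp add: r_def)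
qed

lemma integrable_tilt: "integrable std_mvnormal (\<lambda>z::real^'n. exp (a \<bullet> z - (norm a)\<^sup>2 / 2))"
proof (rule Bochner_Integration.integrable_bound[OF integrable_exp_norm[of "norm a"]])
  have "a \<bullet> z - (norm a)\<^sup>2 / 2 \<le> norm a * norm z" for z :: "real^'n"
    using norm_cauchy_schwarz[of a z] zero_le_power2[of "norm a"] by linarith
  then show "AE z in std_mvnormal. norm (exp (a \<bullet> z - (norm a)\<^sup>2 / 2)) \<le> norm (exp (norm a * norm z))"
    by auto
qed auto

lemma integrable_inner: "integrable std_mvnormal (\<lambda>z::real^'n. a \<bullet> z)"
  by (rule Bochner_Integration.integrable_bound[OF integrable_mult_right[OF integrable_norm_power[of 1], of "norm a"]])
     (auto simp: Cauchy_Schwarz_ineq2)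

lemma inner_square_le: "(a \<bullet> (z::real^'n))\<^sup>2 \<le> (norm a)\<^sup>2 * (norm z)\<^sup>2"
proof -
  have "\<bar>a \<bullet> z\<bar>\<^sup>2 \<le> (norm a * norm z)\<^sup>2" by (intro power_mono Cauchy_Schwarz_ineq2) simp
  then show ?thesis by (simp add: power_mult_distrib)
qed

lemma integrable_inner_square: "integrable std_mvnormal (\<lambda>z::real^'n. (a \<bullet> z)\<^sup>2)"
  by (rule Bochner_Integration.integrable_bound[OF integrable_mult_right[OF integrable_norm_power[of 2], of "(norm a)\<^sup>2"]])
     (auto simp: inner_square_le)

lemma integrable_tilt_remainder: "integrable std_mvnormal (tilt_remainder (a::real^'n))"
  unfolding tilt_remainder_def[abs_def]
  by (intro Bochner_Integration.integrable_diff integrable_mult_right integrable_tilt integrable_inner integrable_inner_square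
      std_mvnormal.integrable_const)

text \<open>For short shifts this is the Taylor bound. For long ones every term of the remainder separately
  has an integral of order at most \<open>|a|\<^sup>2 \<le> |a|\<^sup>3\<close>.\<close>

lemma integral_abs_tilt_remainder:
  obtains C where "0 \<le> C" "\<And>a::real^'n. (LINT z|std_mvnormal. \<bar>tilt_remainder a z\<bar>) \<le> C * norm a ^ 3"
proof -
  define C1 where "C1 = (LINT z|std_mvnormal. 2 * exp (4 * (norm (z::real^'n) + 1)))"
  define m1 where "m1 = (LINT z|std_mvnormal. norm (z::real^'n))"
  define m2 where "m2 = (LINT z|std_mvnormal. (norm (z::real^'n))\<^sup>2)"
  have i0: "integrable std_mvnormal (\<lambda>z::real^'n. 2 * exp (4 * (norm z + 1)))"
    using integrable_exp_norm[of 4, where 'n='n] by (simp add: distrib_left exp_add)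
  have i1: "integrable std_mvnormal (\<lambda>z::real^'n. norm z)" using integrable_norm_power[of 1] by simp
  have i2: "integrable std_mvnormal (\<lambda>z::real^'n. (norm z)\<^sup>2)" by (rule integrable_norm_power)
  have C1: "0 \<le> C1" unfolding C1_def by (intro integral_nonneg_AE) auto
  have m1: "0 \<le> m1" unfolding m1_def by (intro integral_nonneg_AE) auto
  have m2: "0 \<le> m2" unfolding m2_def by (intro integral_nonneg_AE) auto
  show ?thesis
  proof (rule that)
    show "0 \<le> C1 + (2 + m1 + (m2 + 1))" using C1 m1 m2 by simp
    fix a :: "real^'n"
    let ?r = "norm a"
    have r3: "0 \<le> ?r ^ 3" by simp
    show "(LINT z|std_mvnormal. \<bar>tilt_remainder a z\<bar>) \<le> (C1 + (2 + m1 + (m2 + 1))) * ?r ^ 3"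
    proof (cases "?r \<le> 1")
      case True
      have "(LINT z|std_mvnormal. \<bar>tilt_remainder a z\<bar>) \<le> (LINT z|std_mvnormal. ?r ^ 3 * (2 * exp (4 * (norm (z::real^'n) + 1))))"
        using i0 tilt_remainder_le[OF True] by (intro integral_mono) (auto intro: integrable_tilt_remainder)
      also have "\<dots> = C1 * ?r ^ 3" by (simp add: C1_def)
      also have "\<dots> \<le> (C1 + (2 + m1 + (m2 + 1))) * ?r ^ 3" using C1 m1 m2 by (intro mult_right_mono) auto
      finally show ?thesis .
    next
      case False
      then have r: "1 \<le> ?r" by simp
      have tilt1: "(LINT z|std_mvnormal. exp (a \<bullet> z - (norm a)\<^sup>2 / 2)) = 1"
        using std_mvnormal_shift[of "\<lambda>_. 1" a] by simp
      have "(LINT z|std_mvnormal. \<bar>tilt_remainder a z\<bar>)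
         \<le> (LINT z|std_mvnormal. exp (a \<bullet> z - (norm a)\<^sup>2 / 2) + 1 + ?r * norm z + (?r\<^sup>2 * (norm z)\<^sup>2 + ?r\<^sup>2))"
      proof (rule integral_mono)
        fix z :: "real^'n"
        have "\<bar>1/2 * ((a \<bullet> z)\<^sup>2 - (norm a)\<^sup>2)\<bar> \<le> ?r\<^sup>2 * (norm z)\<^sup>2 + ?r\<^sup>2"
        proof -
          have "\<bar>1/2 * (x - N)\<bar> \<le> Q + N" if "0 \<le> x" "x \<le> Q" "0 \<le> N" for x Q N :: real
            using that by (auto simp: abs_le_iff)
          from this[OF zero_le_power2 inner_square_le zero_le_power2] show ?thesis .
        qed
        moreover have "\<bar>a \<bullet> z\<bar> \<le> ?r * norm z" by (rule Cauchy_Schwarz_ineq2)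
        moreover have "0 < exp (a \<bullet> z - (norm a)\<^sup>2 / 2)" by simp
        ultimately show "\<bar>tilt_remainder a z\<bar> \<le> exp (a \<bullet> z - (norm a)\<^sup>2 / 2) + 1 + ?r * norm z + (?r\<^sup>2 * (norm z)\<^sup>2 + ?r\<^sup>2)"
          unfolding tilt_remainder_def by linarith
      qed (use i1 i2 in \<open>auto intro!: Bochner_Integration.integrable_add integrable_tilt_remainder integrable_tilt\<close>)
      also have "\<dots> = 2 + ?r * m1 + ?r\<^sup>2 * (m2 + 1)"
        using i1 i2 integrable_tilt[of a] tilt1 by (simp add: m1_def m2_def algebra_simps)
      also have "\<dots> \<le> 2 * ?r ^ 3 + ?r ^ 3 * m1 + ?r ^ 3 * (m2 + 1)"
      proof -
        have "1 \<le> ?r ^ 3" using r by simp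
        moreover have "?r \<le> ?r ^ 3" using r power_increasing[of 1 3 ?r] by simp
        moreover have "?r\<^sup>2 \<le> ?r ^ 3" using r by (intro power_increasing) auto
        ultimately show ?thesis using m1 m2 by (intro add_mono mult_right_mono) auto
      qed
      also have "\<dots> \<le> (C1 + (2 + m1 + (m2 + 1))) * ?r ^ 3" using C1 r3 by (simp add: algebra_simps)
      finally show ?thesis .
    qed
  qed
qed

text \<open>The constant bounds the second-order coefficients and the remainder uniformly in the point; the
  first-order coefficients are free, since they cancel against centred increments.\<close>

definition smoothing_expansion :: "real \<Rightarrow> real \<Rightarrow> (real^'n \<Rightarrow> real) \<Rightarrow> bool" where
  "smoothing_expansion \<sigma> C f \<longleftrightarrow> (\<forall>x. \<exists>g M. (\<forall>i j. \<bar>M i j\<bar> \<le> C) \<and> (\<forall>h::real^'n. \<bar>heat (\<lambda>z. \<sigma> *\<^sub>R z) f (x + h) - (heat (\<lambda>z. \<sigma> *\<^sub>R z) f x + g \<bullet> h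
       + 1/2 * (\<Sum>i\<in>UNIV. \<Sum>j\<in>UNIV. M i j * (h $ i * h $ j)))\<bar> \<le> C * norm h ^ 3))"

text \<open>By Cameron--Martin the shift \<open>h\<close> moves from the argument of \<open>f\<close> to the Gaussian density, where it
  can be expanded. The constant therefore depends on \<open>\<sigma>\<close> and the bound on \<open>f\<close> only.\<close>

lemma smoothing_taylor:
  assumes \<sigma>: "0 < \<sigma>"
  shows "\<exists>C\<ge>0. \<forall>f :: real^'n \<Rightarrow> real. f \<in> borel_measurable borel \<longrightarrow> (\<forall>y. \<bar>f y\<bar> \<le> 1) \<longrightarrow> smoothing_expansion \<sigma> C f"
proof -
  obtain C0 where C0: "0 \<le> C0" "\<And>a::real^'n. (LINT z|std_mvnormal. \<bar>tilt_remainder a z\<bar>) \<le> C0 * norm a ^ 3"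
    using integral_abs_tilt_remainder by blast
  define m2 where "m2 = (LINT z|std_mvnormal. (norm (z::real^'n))\<^sup>2)"
  have i2: "integrable std_mvnormal (\<lambda>z::real^'n. (norm z)\<^sup>2)" by (rule integrable_norm_power)
  have m2: "0 \<le> m2" unfolding m2_def by (intro integral_nonneg_AE) auto
  define C where "C = C0 / \<sigma> ^ 3 + (m2 + 1) / \<sigma>\<^sup>2"
  have C: "C0 / \<sigma> ^ 3 \<le> C" "(m2 + 1) / \<sigma>\<^sup>2 \<le> C" "0 \<le> C" using C0 m2 \<sigma> by (auto simp: C_def)
  show ?thesis
    unfolding smoothing_expansion_def
  proof (intro exI[of _ C] conjI allI impI C(3))
    fix f :: "real^'n \<Rightarrow> real" and x
    assume f[measurable]: "f \<in> borel_measurable borel" and "\<forall>y. \<bar>f y\<bar> \<le> 1"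
    then have f1: "\<bar>f y\<bar> \<le> 1" for y by blast
    define w where "w z = f (x + \<sigma> *\<^sub>R z)" for z
    have w[measurable]: "w \<in> borel_measurable borel" unfolding w_def by measurable
    have w1: "\<bar>w z\<bar> \<le> 1" for z by (simp add: w_def f1)
    have iw: "integrable std_mvnormal (\<lambda>z. w z * k z)" if "integrable std_mvnormal k" for k :: "real^'n \<Rightarrow> real"
    proof (rule Bochner_Integration.integrable_bound[OF that])
      show "(\<lambda>z. w z * k z) \<in> borel_measurable std_mvnormal" using borel_measurable_integrable[OF that] by measurable
      show "AE z in std_mvnormal. norm (w z * k z) \<le> norm (k z)"
        using w1 by (auto simp: abs_mult mult_left_le_one_le)
    qed
    define g where "g = (\<chi> i. LINT z|std_mvnormal. w z * (z $ i / \<sigma>))"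
    define M where "M i j = (LINT z|std_mvnormal. w z * ((z $ i * z $ j - (if i = j then 1 else 0)) / \<sigma>\<^sup>2))" for i j
    have i1: "integrable std_mvnormal (\<lambda>z::real^'n. z $ i / \<sigma>)" for i
      by (intro integrable_divide integrable_component)
    have iM: "integrable std_mvnormal (\<lambda>z::real^'n. (z $ i * z $ j - (if i = j then 1 else 0)) / \<sigma>\<^sup>2)" for i j
      by (intro integrable_divide Bochner_Integration.integrable_diff integrable_component_mult std_mvnormal.integrable_const)
    have M: "\<bar>M i j\<bar> \<le> C" for i j
    proof -
      have "\<bar>M i j\<bar> \<le> (LINT z|std_mvnormal. \<bar>w z * ((z $ i * z $ j - (if i = j then 1 else 0)) / \<sigma>\<^sup>2)\<bar>)"
        unfolding M_def by (rule integral_abs_bound)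
      also have "\<dots> \<le> (LINT z|std_mvnormal. ((norm (z::real^'n))\<^sup>2 + 1) / \<sigma>\<^sup>2)"
      proof (rule integral_mono)
        fix z :: "real^'n"
        have "\<bar>z $ i * z $ j - (if i = j then 1 else 0)\<bar> \<le> (norm z)\<^sup>2 + 1"
          using abs_component_mult_le[of z i j]
            abs_triangle_ineq4[of "z $ i * z $ j" "if i = j then 1 else 0"] by (auto split: if_splits)
        then have "\<bar>(z $ i * z $ j - (if i = j then 1 else 0)) / \<sigma>\<^sup>2\<bar> \<le> ((norm z)\<^sup>2 + 1) / \<sigma>\<^sup>2"
          by (simp add: abs_divide divide_right_mono)
        then show "\<bar>w z * ((z $ i * z $ j - (if i = j then 1 else 0)) / \<sigma>\<^sup>2)\<bar> \<le> ((norm z)\<^sup>2 + 1) / \<sigma>\<^sup>2"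
          unfolding abs_mult[of "w z"] using w1[of z] by (meson abs_ge_zero mult_left_le_one_le order_trans)
      qed (rule integrable_abs[OF iw[OF iM]], use i2 in auto)
      also have "\<dots> = (m2 + 1) / \<sigma>\<^sup>2" using i2 by (simp add: m2_def)
      finally show ?thesis using C by simp
    qed
    have "\<bar>heat (\<lambda>z. \<sigma> *\<^sub>R z) f (x + h) - (heat (\<lambda>z. \<sigma> *\<^sub>R z) f x + g \<bullet> h
       + 1/2 * (\<Sum>i\<in>UNIV. \<Sum>j\<in>UNIV. M i j * (h $ i * h $ j)))\<bar> \<le> C * norm h ^ 3" for h
    proof -
      define a where "a = h /\<^sub>R \<sigma>"
      have ha: "h = \<sigma> *\<^sub>R a" using \<sigma> by (simp add: a_def)
      have t1: "heat (\<lambda>z. \<sigma> *\<^sub>R z) f (x + h) = (LINT z|std_mvnormal. w z * exp (a \<bullet> z - (norm a)\<^sup>2 / 2))"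
      proof -
        have "heat (\<lambda>z. \<sigma> *\<^sub>R z) f (x + h) = (LINT z|std_mvnormal. w (z + a))"
          by (simp add: heat_def w_def ha scaleR_add_right add_ac)
        then show ?thesis by (simp add: std_mvnormal_shift mult.commute)
      qed
      have t2: "heat (\<lambda>z. \<sigma> *\<^sub>R z) f x = (LINT z|std_mvnormal. w z * 1)" by (simp add: heat_def w_def)
      have t3: "g \<bullet> h = (LINT z|std_mvnormal. w z * (a \<bullet> z))"
      proof -
        have "g \<bullet> h = (\<Sum>i\<in>UNIV. (LINT z|std_mvnormal. w z * (z $ i / \<sigma>) * h $ i))"
          by (simp add: g_def inner_vec_def)
        also have "\<dots> = (LINT z|std_mvnormal. (\<Sum>i\<in>UNIV. w z * (z $ i / \<sigma>) * h $ i))"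
          by (rule Bochner_Integration.integral_sum[symmetric]) (intro integrable_mult_left iw i1)
        also have "\<dots> = (LINT z|std_mvnormal. w z * (a \<bullet> z))"
          using \<sigma> by (intro Bochner_Integration.integral_cong refl)
            (auto simp: ha inner_vec_def sum_distrib_left mult_ac intro!: sum.cong)
        finally show ?thesis .
      qed
      have t4: "(\<Sum>i\<in>UNIV. \<Sum>j\<in>UNIV. M i j * (h $ i * h $ j)) = (LINT z|std_mvnormal. w z * ((a \<bullet> z)\<^sup>2 - (norm a)\<^sup>2))"
      proof -
        have "(\<Sum>i\<in>UNIV. \<Sum>j\<in>UNIV. M i j * (h $ i * h $ j))
           = (\<Sum>i\<in>UNIV. \<Sum>j\<in>UNIV. LINT z|std_mvnormal. w z * ((z $ i * z $ j - (if i = j then 1 else 0)) / \<sigma>\<^sup>2) * (h $ i * h $ j))"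
          by (simp add: M_def)
        also have "\<dots> = (LINT z|std_mvnormal. (\<Sum>i\<in>UNIV. \<Sum>j\<in>UNIV. w z * ((z $ i * z $ j - (if i = j then 1 else 0)) / \<sigma>\<^sup>2) * (h $ i * h $ j)))"
          by (subst Bochner_Integration.integral_sum, intro Bochner_Integration.integrable_sum integrable_mult_left iw iM)
             (intro sum.cong refl Bochner_Integration.integral_sum[symmetric] integrable_mult_left iw iM)
        also have "\<dots> = (LINT z|std_mvnormal. w z * ((a \<bullet> z)\<^sup>2 - (norm a)\<^sup>2))"
        proof (rule Bochner_Integration.integral_cong[OF refl])
          fix z :: "real^'n"
          have "(a \<bullet> z)\<^sup>2 = (\<Sum>i\<in>UNIV. \<Sum>j\<in>UNIV. a $ i * z $ i * (a $ j * z $ j))"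
            by (simp add: inner_vec_def power2_eq_square sum_product)
          moreover have "(norm a)\<^sup>2 = (\<Sum>i\<in>UNIV. \<Sum>j\<in>UNIV. if i = j then a $ i * a $ j else 0)"
            by (simp add: power2_norm_eq_inner inner_vec_def)
          ultimately have "(a \<bullet> z)\<^sup>2 - (norm a)\<^sup>2 = (\<Sum>i\<in>UNIV. \<Sum>j\<in>UNIV. (z $ i * z $ j - (if i = j then 1 else 0)) * (a $ i * a $ j))"
            by (simp only: sum_subtractf[symmetric]) (intro sum.cong refl; simp add: algebra_simps)
          then have "w z * ((a \<bullet> z)\<^sup>2 - (norm a)\<^sup>2) = (\<Sum>i\<in>UNIV. \<Sum>j\<in>UNIV. w z * ((z $ i * z $ j - (if i = j then 1 else 0)) * (a $ i * a $ j)))"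
            by (simp add: sum_distrib_left)
          then show "(\<Sum>i\<in>UNIV. \<Sum>j\<in>UNIV. w z * ((z $ i * z $ j - (if i = j then 1 else 0)) / \<sigma>\<^sup>2) * (h $ i * h $ j)) = w z * ((a \<bullet> z)\<^sup>2 - (norm a)\<^sup>2)"
            using \<sigma> by (simp only:) (intro sum.cong refl; simp add: ha power2_eq_square mult_ac)
        qed
        finally show ?thesis .
      qed
      have "heat (\<lambda>z. \<sigma> *\<^sub>R z) f (x + h) - (heat (\<lambda>z. \<sigma> *\<^sub>R z) f x + g \<bullet> h
       + 1/2 * (\<Sum>i\<in>UNIV. \<Sum>j\<in>UNIV. M i j * (h $ i * h $ j))) = (LINT z|std_mvnormal. w z * tilt_remainder a z)"
      proof -
        have I: "integrable std_mvnormal (\<lambda>z. w z * exp (a \<bullet> z - (norm a)\<^sup>2 / 2))" "integrable std_mvnormal (\<lambda>z. w z * 1)"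
          "integrable std_mvnormal (\<lambda>z. w z * (a \<bullet> z))" "integrable std_mvnormal (\<lambda>z. w z * ((a \<bullet> z)\<^sup>2 - (norm a)\<^sup>2))"
          by (intro iw integrable_tilt integrable_inner integrable_inner_square Bochner_Integration.integrable_diff std_mvnormal.integrable_const)+
        have "(LINT z|std_mvnormal. w z * tilt_remainder a z) = (LINT z|std_mvnormal. w z * exp (a \<bullet> z - (norm a)\<^sup>2 / 2) - w z * 1 - w z * (a \<bullet> z)
            - 1/2 * (w z * ((a \<bullet> z)\<^sup>2 - (norm a)\<^sup>2)))"
          by (intro Bochner_Integration.integral_cong refl) (simp add: tilt_remainder_def algebra_simps)
        also have "\<dots> = (LINT z|std_mvnormal. w z * exp (a \<bullet> z - (norm a)\<^sup>2 / 2)) - (LINT z|std_mvnormal. w z * 1) - (LINT z|std_mvnormal. w z * (a \<bullet> z))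
            - 1/2 * (LINT z|std_mvnormal. w z * ((a \<bullet> z)\<^sup>2 - (norm a)\<^sup>2))"
          using I by (simp only: Bochner_Integration.integral_diff Bochner_Integration.integrable_diff integrable_mult_right integral_mult_right_zero)
        finally show ?thesis unfolding t1 t2 t3 t4 by simp
      qed
      also have "\<bar>\<dots>\<bar> \<le> (LINT z|std_mvnormal. \<bar>w z * tilt_remainder a z\<bar>)" by (rule integral_abs_bound)
      also have "\<dots> \<le> (LINT z|std_mvnormal. \<bar>tilt_remainder a z\<bar>)"
      proof (rule integral_mono)
        show "\<bar>w z * tilt_remainder a z\<bar> \<le> \<bar>tilt_remainder a z\<bar>" for z
          using w1 by (auto simp: abs_mult intro!: mult_left_le_one_le)
      qed (intro integrable_abs iw integrable_tilt_remainder)+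
      also have "\<dots> \<le> C0 * norm a ^ 3" by (rule C0)
      also have "\<dots> = C0 / \<sigma> ^ 3 * norm h ^ 3" using \<sigma> by (simp add: ha power_mult_distrib)
      also have "\<dots> \<le> C * norm h ^ 3" using C(1) by (intro mult_right_mono) auto
      finally show ?thesis .
    qed
    with M show "\<exists>g M. (\<forall>i j. \<bar>M i j\<bar> \<le> C) \<and> (\<forall>h::real^'n. \<bar>heat (\<lambda>z. \<sigma> *\<^sub>R z) f (x + h) - (heat (\<lambda>z. \<sigma> *\<^sub>R z) f x + g \<bullet> h
       + 1/2 * (\<Sum>i\<in>UNIV. \<Sum>j\<in>UNIV. M i j * (h $ i * h $ j)))\<bar> \<le> C * norm h ^ 3)" by blast
  qed
qed

lemma matrix_vector_measurable[measurable]: "(\<lambda>z. A *v z) \<in> borel_measurable (borel :: (real^'n) measure)"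
  by (intro borel_measurable_continuous_onI matrix_vector_mult_linear_continuous_on)

lemma gaussian_image_moments:
  fixes A :: "real^'n^'n"
  shows "integrable std_mvnormal (\<lambda>z. (A *v z) $ i)" "(LINT z|std_mvnormal. (A *v z) $ i) = 0"
    "integrable std_mvnormal (\<lambda>z. (A *v z) $ i * (A *v z) $ j)"
    "(LINT z|std_mvnormal. (A *v z) $ i * (A *v z) $ j) = (A ** transpose A) $ i $ j"
    "integrable std_mvnormal (\<lambda>z. norm (A *v z) ^ 3)"
proof -
  have e: "(A *v z) $ i = (\<Sum>k\<in>UNIV. A $ i $ k * z $ k)" for z i by (simp add: matrix_vector_mult_def)
  show "integrable std_mvnormal (\<lambda>z. (A *v z) $ i)" "(LINT z|std_mvnormal. (A *v z) $ i) = 0"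
    unfolding e by (auto intro!: integrable_mult_right integrable_component simp: integrable_component std_mvnormal_mean)
  have e2: "(A *v z) $ i * (A *v z) $ j = (\<Sum>k\<in>UNIV. \<Sum>l\<in>UNIV. A $ i $ k * A $ j $ l * (z $ k * z $ l))" for z
    unfolding e by (simp add: sum_product mult_ac)
  show "integrable std_mvnormal (\<lambda>z. (A *v z) $ i * (A *v z) $ j)"
    unfolding e2 by (intro Bochner_Integration.integrable_sum integrable_mult_right integrable_component_mult)
  have "(LINT z|std_mvnormal. (A *v z) $ i * (A *v z) $ j) = (\<Sum>k\<in>UNIV. \<Sum>l\<in>UNIV. A $ i $ k * A $ j $ l * (if k = l then 1 else 0))"
    unfolding e2
    by (subst Bochner_Integration.integral_sum, intro Bochner_Integration.integrable_sum integrable_mult_right integrable_component_mult)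
       (intro sum.cong refl, subst Bochner_Integration.integral_sum,
         auto intro!: integrable_mult_right integrable_component_mult simp: std_mvnormal_cov)
  then show "(LINT z|std_mvnormal. (A *v z) $ i * (A *v z) $ j) = (A ** transpose A) $ i $ j"
    by (simp add: matrix_matrix_mult_def transpose_def if_distrib[of "\<lambda>x. _ * x"] cong: if_cong)
  show "integrable std_mvnormal (\<lambda>z. norm (A *v z) ^ 3)"
  proof (rule Bochner_Integration.integrable_bound[OF integrable_mult_right[OF integrable_norm_power[of 3], of "norm A ^ 3"]])
    have "norm (A *v z) ^ 3 \<le> (norm A * norm z) ^ 3" for z
      by (intro power_mono norm_matrix_vector_mult_le) auto
    then show "AE z in std_mvnormal. norm (norm (A *v z) ^ 3) \<le> norm (norm A ^ 3 * norm z ^ 3)"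
      by (auto simp: power_mult_distrib)
  qed measurable
qed

text \<open>Averaging a Taylor expansion over a centred random vector removes the linear term; up to third
  moments only the covariance is seen.\<close>

lemma integral_quadratic_bound:
  fixes M :: "'n::finite \<Rightarrow> 'n \<Rightarrow> real" and X :: "'b \<Rightarrow> real^'n"
  assumes "prob_space N" and [measurable]: "X \<in> borel_measurable N" and [measurable]: "\<phi> \<in> borel_measurable borel"
    and K: "\<And>y. \<bar>\<phi> y\<bar> \<le> 1"
    and taylor: "\<And>h. \<bar>\<phi> (x + h) - (\<phi> x + g \<bullet> h + 1/2 * (\<Sum>i\<in>UNIV. \<Sum>j\<in>UNIV. M i j * (h $ i * h $ j)))\<bar> \<le> C * norm h ^ 3"
    and i1: "\<And>i. integrable N (\<lambda>z. X z $ i)" and m1: "\<And>i. (LINT z|N. X z $ i) = 0"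
    and i2: "\<And>i j. integrable N (\<lambda>z. X z $ i * X z $ j)"
    and i3: "integrable N (\<lambda>z. norm (X z) ^ 3)"
  shows "\<bar>(LINT z|N. \<phi> (x + s *\<^sub>R X z)) - (\<phi> x + s\<^sup>2 / 2 * (\<Sum>i\<in>UNIV. \<Sum>j\<in>UNIV. M i j * (LINT z|N. X z $ i * X z $ j)))\<bar>
     \<le> C * \<bar>s\<bar> ^ 3 * (LINT z|N. norm (X z) ^ 3)"
proof -
  interpret prob_space N by fact
  define T where "T h = \<phi> x + g \<bullet> h + 1/2 * (\<Sum>i\<in>UNIV. \<Sum>j\<in>UNIV. M i j * (h $ i * h $ j))" for h
  have iphi: "integrable N (\<lambda>z. \<phi> (x + s *\<^sub>R X z))"
    by (rule integrable_const_bound[where B=1]) (auto simp: K)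
  have T: "T (s *\<^sub>R X z) = \<phi> x + (\<Sum>i\<in>UNIV. g $ i * s * X z $ i) + (\<Sum>i\<in>UNIV. \<Sum>j\<in>UNIV. s\<^sup>2 / 2 * M i j * (X z $ i * X z $ j))" for z
    by (simp add: T_def inner_vec_def sum_distrib_left power2_eq_square mult_ac)
  have iT: "integrable N (\<lambda>z. T (s *\<^sub>R X z))"
    unfolding T by (intro Bochner_Integration.integrable_add Bochner_Integration.integrable_sum integrable_mult_right i1 i2 integrable_const)
  have "(LINT z|N. T (s *\<^sub>R X z)) = \<phi> x + (\<Sum>i\<in>UNIV. g $ i * s * (LINT z|N. X z $ i))
      + (\<Sum>i\<in>UNIV. \<Sum>j\<in>UNIV. s\<^sup>2 / 2 * M i j * (LINT z|N. X z $ i * X z $ j))"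
    unfolding T
    by (simp add: Bochner_Integration.integral_add Bochner_Integration.integral_sum Bochner_Integration.integrable_sum
        Bochner_Integration.integrable_add integrable_mult_right i1 i2 prob_space del: integral_mult_right integral_mult_right_zero)
  then have IT: "(LINT z|N. T (s *\<^sub>R X z)) = \<phi> x + s\<^sup>2 / 2 * (\<Sum>i\<in>UNIV. \<Sum>j\<in>UNIV. M i j * (LINT z|N. X z $ i * X z $ j))"
    by (simp add: m1 sum_distrib_left mult_ac)
  have "\<bar>(LINT z|N. \<phi> (x + s *\<^sub>R X z)) - (LINT z|N. T (s *\<^sub>R X z))\<bar> = \<bar>LINT z|N. \<phi> (x + s *\<^sub>R X z) - T (s *\<^sub>R X z)\<bar>"
    using iphi iT by simp
  also have "\<dots> \<le> (LINT z|N. \<bar>\<phi> (x + s *\<^sub>R X z) - T (s *\<^sub>R X z)\<bar>)" by (rule integral_abs_bound)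
  also have "\<dots> \<le> (LINT z|N. C * \<bar>s\<bar> ^ 3 * norm (X z) ^ 3)"
  proof (rule integral_mono)
    fix z
    show "\<bar>\<phi> (x + s *\<^sub>R X z) - T (s *\<^sub>R X z)\<bar> \<le> C * \<bar>s\<bar> ^ 3 * norm (X z) ^ 3"
      using taylor[of "s *\<^sub>R X z"] by (simp add: T_def power_mult_distrib mult_ac)
  qed (use iphi iT i3 in auto)
  also have "\<dots> = C * \<bar>s\<bar> ^ 3 * (LINT z|N. norm (X z) ^ 3)" by simp
  finally show ?thesis unfolding IT .
qed

text \<open>The starting point is an argument, so that conditioning on the first step gives a recursion.\<close>

definition walk :: "'b pmf \<Rightarrow> ('b \<Rightarrow> real^'n) \<Rightarrow> real \<Rightarrow> nat \<Rightarrow> (real^'n \<Rightarrow> real) \<Rightarrow> real^'n \<Rightarrow> real" where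
  "walk p \<xi> s k \<phi> x = measure_pmf.expectation (replicate_pmf k p) (\<lambda>xs. \<phi> (x + s *\<^sub>R sum_list (map \<xi> xs)))"

lemma finite_set_replicate_pmf: "finite (set_pmf p) \<Longrightarrow> finite (set_pmf (replicate_pmf k p))"
proof -
  assume "finite (set_pmf p)"
  moreover have "set_pmf (replicate_pmf k p) = {xs. set xs \<subseteq> set_pmf p \<and> length xs = k}"
    by (auto simp: set_replicate_pmf)
  ultimately show ?thesis by (simp add: finite_lists_length_eq)
qed

lemma expectation_replicate_pmf_Suc:
  fixes \<phi> :: "'b list \<Rightarrow> real"
  assumes fin: "finite (set_pmf p)"
  shows "measure_pmf.expectation (replicate_pmf (Suc k) p) \<phi>
     = measure_pmf.expectation p (\<lambda>y. measure_pmf.expectation (replicate_pmf k p) (\<lambda>xs. \<phi> (y # xs)))"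
proof -
  have e: "replicate_pmf k p \<bind> (\<lambda>xs. return_pmf (y # xs)) = map_pmf ((#) y) (replicate_pmf k p)" for y
    by (simp add: map_pmf_def)
  have "measure_pmf.expectation (replicate_pmf (Suc k) p) \<phi>
    = (\<Sum>y\<in>set_pmf p. pmf p y *\<^sub>R measure_pmf.expectation (map_pmf ((#) y) (replicate_pmf k p)) \<phi>)"
    unfolding replicate_pmf.simps e
    by (rule pmf_expectation_bind) (use fin in \<open>auto simp: finite_set_replicate_pmf\<close>)
  also have "\<dots> = measure_pmf.expectation p (\<lambda>y. measure_pmf.expectation (replicate_pmf k p) (\<lambda>xs. \<phi> (y # xs)))"
    using fin by (subst integral_measure_pmf[of "set_pmf p"]) auto
  finally show ?thesis .
qed

lemma walk_Suc:
  "finite (set_pmf p) \<Longrightarrow> walk p \<xi> s (Suc k) \<phi> x = measure_pmf.expectation p (\<lambda>y. walk p \<xi> s k \<phi> (x + s *\<^sub>R \<xi> y))"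
  unfolding walk_def by (subst expectation_replicate_pmf_Suc) (auto simp: scaleR_add_right add_ac)

lemma walk_0: "walk p \<xi> s 0 \<phi> x = \<phi> x"
  by (simp add: walk_def)

text \<open>Lindeberg's replacement of one summand at a time. Smoothed bounded functions are stable under the
  Gaussian steps that have already been substituted, because Gaussian averages commute; hence the same
  Taylor constant serves in every replacement.\<close>

lemma lindeberg_comparison:
  fixes A :: "real^'n^'n" and f :: "real^'n \<Rightarrow> real"
  assumes C: "0 \<le> C" and taylor: "\<And>f :: real^'n \<Rightarrow> real. f \<in> borel_measurable borel \<Longrightarrow> (\<And>y. \<bar>f y\<bar> \<le> 1) \<Longrightarrow>
     smoothing_expansion \<sigma> C f"
    and f: "f \<in> borel_measurable borel" "\<And>y. \<bar>f y\<bar> \<le> 1"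
    and fin: "finite (set_pmf p)" and mean: "\<And>i. measure_pmf.expectation p (\<lambda>y. \<xi> y $ i) = 0"
    and bound: "\<And>y. y \<in> set_pmf p \<Longrightarrow> norm (\<xi> y) \<le> B"
    and cov: "\<And>i j. \<bar>measure_pmf.expectation p (\<lambda>y. \<xi> y $ i * \<xi> y $ j) - (A ** transpose A) $ i $ j\<bar> \<le> \<kappa>"
    and s: "0 \<le> s"
  shows "\<bar>walk p \<xi> s k (heat (\<lambda>z. \<sigma> *\<^sub>R z) f) x - heat (\<lambda>z. (sqrt k * s) *\<^sub>R (A *v z)) (heat (\<lambda>z. \<sigma> *\<^sub>R z) f) x\<bar>
     \<le> real k * (s\<^sup>2 / 2 * (real CARD('n))\<^sup>2 * C * \<kappa> + C * s ^ 3 * (B ^ 3 + (LINT z|std_mvnormal. norm (A *v z) ^ 3)))"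
proof (induction k arbitrary: x)
  case 0
  show ?case by (simp add: walk_0 heat_def)
next
  case (Suc k)
  let ?S = "heat (\<lambda>z. \<sigma> *\<^sub>R z)"
  let ?a = "(LINT z|std_mvnormal. norm (A *v z) ^ 3)"
  define \<Delta> where "\<Delta> = s\<^sup>2 / 2 * (real CARD('n))\<^sup>2 * C * \<kappa> + C * s ^ 3 * (B ^ 3 + ?a)"
  \<comment> \<open>The first step is treated after the other \<open>k\<close> have become Gaussian; \<open>f'\<close> is what those make of \<open>f\<close>.\<close>
  define f' where "f' = heat (\<lambda>z. (sqrt k * s) *\<^sub>R (A *v z)) f"
  have f': "f' \<in> borel_measurable borel" "\<And>y. \<bar>f' y\<bar> \<le> 1"
    using f unfolding f'_def by (auto intro: heat_bounded)
  have comm: "heat (\<lambda>z. (sqrt k * s) *\<^sub>R (A *v z)) (?S f) = ?S f'"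
    unfolding f'_def by (rule heat_commute[where K=1]) (use f in auto)
  have Sf: "?S f \<in> borel_measurable borel" "\<And>y. \<bar>?S f y\<bar> \<le> 1"
    using f by (auto intro: heat_bounded)
  have Sf': "?S f' \<in> borel_measurable borel" "\<And>y. \<bar>?S f' y\<bar> \<le> 1"
    using f' by (auto intro: heat_bounded)
  have int: "integrable (measure_pmf p) u" for u :: "_ \<Rightarrow> real" using fin by (rule integrable_measure_pmf_finite)
  have one: "\<bar>measure_pmf.expectation p (\<lambda>y. ?S f' (x + s *\<^sub>R \<xi> y)) - heat (\<lambda>z. s *\<^sub>R (A *v z)) (?S f') x\<bar> \<le> \<Delta>"
  proof -
    obtain g M where M: "\<And>i j. \<bar>M i j\<bar> \<le> C" and
      T: "\<And>h. \<bar>?S f' (x + h) - (?S f' x + g \<bullet> h + 1/2 * (\<Sum>i\<in>UNIV. \<Sum>j\<in>UNIV. M i j * (h $ i * h $ j)))\<bar> \<le> C * norm h ^ 3"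
      using taylor[OF f'] unfolding smoothing_expansion_def by blast
    define S1 where "S1 i j = measure_pmf.expectation p (\<lambda>y. \<xi> y $ i * \<xi> y $ j)" for i j
    define S2 where "S2 i j = (A ** transpose A) $ i $ j" for i j
    have 1: "\<bar>measure_pmf.expectation p (\<lambda>y. ?S f' (x + s *\<^sub>R \<xi> y)) - (?S f' x + s\<^sup>2 / 2 * (\<Sum>i\<in>UNIV. \<Sum>j\<in>UNIV. M i j * S1 i j))\<bar>
       \<le> C * \<bar>s\<bar> ^ 3 * measure_pmf.expectation p (\<lambda>y. norm (\<xi> y) ^ 3)"
      unfolding S1_def
      by (rule integral_quadratic_bound[OF _ _ Sf' T]) (use mean int in \<open>auto simp: measure_pmf.prob_space_axioms\<close>)
    have 2: "\<bar>heat (\<lambda>z. s *\<^sub>R (A *v z)) (?S f') x - (?S f' x + s\<^sup>2 / 2 * (\<Sum>i\<in>UNIV. \<Sum>j\<in>UNIV. M i j * S2 i j))\<bar>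
       \<le> C * \<bar>s\<bar> ^ 3 * ?a"
      unfolding S2_def heat_def[of "\<lambda>z. s *\<^sub>R (A *v z)"] gaussian_image_moments(4)[symmetric]
      by (rule integral_quadratic_bound[OF std_mvnormal.prob_space_axioms _ Sf' T])
         (use gaussian_image_moments in auto)
    have 3: "measure_pmf.expectation p (\<lambda>y. norm (\<xi> y) ^ 3) \<le> B ^ 3"
    proof -
      have "measure_pmf.expectation p (\<lambda>y. norm (\<xi> y) ^ 3) \<le> measure_pmf.expectation p (\<lambda>y. B ^ 3)"
        using bound by (intro integral_mono_AE int) (auto simp: AE_measure_pmf_iff intro!: power_mono)
      then show ?thesis by simp
    qed
    have 4: "\<bar>(\<Sum>i\<in>UNIV. \<Sum>j\<in>UNIV. M i j * S1 i j) - (\<Sum>i\<in>UNIV. \<Sum>j\<in>UNIV. M i j * S2 i j)\<bar> \<le> (real CARD('n))\<^sup>2 * C * \<kappa>"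
    proof -
      have "\<bar>(\<Sum>i\<in>UNIV. \<Sum>j\<in>UNIV. M i j * S1 i j) - (\<Sum>i\<in>UNIV. \<Sum>j\<in>UNIV. M i j * S2 i j)\<bar>
        = \<bar>\<Sum>i\<in>UNIV. \<Sum>j\<in>UNIV. M i j * (S1 i j - S2 i j)\<bar>"
        by (simp add: sum_subtractf algebra_simps)
      also have "\<dots> \<le> (\<Sum>i\<in>(UNIV::'n set). \<Sum>j\<in>(UNIV::'n set). C * \<kappa>)"
        using M cov by (intro order_trans[OF sum_abs] sum_mono) (auto simp: abs_mult S1_def S2_def intro!: mult_mono C)
      finally show ?thesis by (simp add: power2_eq_square mult_ac)
    qed
    have "\<bar>s\<^sup>2 / 2 * (\<Sum>i\<in>UNIV. \<Sum>j\<in>UNIV. M i j * S1 i j) - s\<^sup>2 / 2 * (\<Sum>i\<in>UNIV. \<Sum>j\<in>UNIV. M i j * S2 i j)\<bar>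
       \<le> s\<^sup>2 / 2 * ((real CARD('n))\<^sup>2 * C * \<kappa>)"
      using mult_left_mono[OF 4, of "s\<^sup>2 / 2"] unfolding right_diff_distrib[symmetric] abs_mult by simp
    moreover have "C * \<bar>s\<bar> ^ 3 * measure_pmf.expectation p (\<lambda>y. norm (\<xi> y) ^ 3) \<le> C * s ^ 3 * B ^ 3"
      using 3 C s by (auto intro!: mult_left_mono)
    moreover have "C * \<bar>s\<bar> ^ 3 * ?a = C * s ^ 3 * ?a" using s by simp
    moreover have "\<Delta> = s\<^sup>2 / 2 * ((real CARD('n))\<^sup>2 * C * \<kappa>) + (C * s ^ 3 * B ^ 3 + C * s ^ 3 * ?a)"
      by (simp add: \<Delta>_def distrib_left mult.assoc)
    ultimately show ?thesis using 1 2 by linarith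
  qed
  have "\<bar>walk p \<xi> s (Suc k) (?S f) x - measure_pmf.expectation p (\<lambda>y. ?S f' (x + s *\<^sub>R \<xi> y))\<bar>
     = \<bar>measure_pmf.expectation p (\<lambda>y. walk p \<xi> s k (?S f) (x + s *\<^sub>R \<xi> y) - ?S f' (x + s *\<^sub>R \<xi> y))\<bar>"
    using int by (simp add: walk_Suc[OF fin])
  also have "\<dots> \<le> real k * \<Delta>"
  proof (rule abs_integral_le_const[OF measure_pmf.prob_space_axioms])
    show "\<bar>walk p \<xi> s k (?S f) (x + s *\<^sub>R \<xi> y) - ?S f' (x + s *\<^sub>R \<xi> y)\<bar> \<le> real k * \<Delta>" for y
      using Suc.IH[of "x + s *\<^sub>R \<xi> y"] unfolding comm \<Delta>_def .
  qed auto
  finally have two: "\<bar>walk p \<xi> s (Suc k) (?S f) x - measure_pmf.expectation p (\<lambda>y. ?S f' (x + s *\<^sub>R \<xi> y))\<bar> \<le> real k * \<Delta>" .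
  have "heat (\<lambda>z. s *\<^sub>R (A *v z)) (?S f') = heat (\<lambda>z. sqrt ((sqrt k * s)\<^sup>2 + s\<^sup>2) *\<^sub>R (A *v z)) (?S f)"
    unfolding comm[symmetric] by (rule heat_semigroup[where K=1]) (use Sf s in auto)
  also have "sqrt ((sqrt k * s)\<^sup>2 + s\<^sup>2) = sqrt (real (Suc k)) * s"
  proof -
    have "(sqrt k * s)\<^sup>2 + s\<^sup>2 = real (Suc k) * s\<^sup>2" by (simp add: power_mult_distrib algebra_simps)
    then show ?thesis using s by (simp add: real_sqrt_mult)
  qed
  finally have "heat (\<lambda>z. s *\<^sub>R (A *v z)) (?S f') x = heat (\<lambda>z. (sqrt (real (Suc k)) * s) *\<^sub>R (A *v z)) (?S f) x"
    by (rule fun_cong)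
  then have "\<bar>walk p \<xi> s (Suc k) (?S f) x - heat (\<lambda>z. (sqrt (real (Suc k)) * s) *\<^sub>R (A *v z)) (?S f) x\<bar> \<le> real k * \<Delta> + \<Delta>"
    using one two by linarith
  also have "real k * \<Delta> + \<Delta> = real (Suc k) * \<Delta>" by (simp add: algebra_simps)
  finally have "\<bar>walk p \<xi> s (Suc k) (?S f) x - heat (\<lambda>z. (sqrt (real (Suc k)) * s) *\<^sub>R (A *v z)) (?S f) x\<bar> \<le> real (Suc k) * \<Delta>" .
  then show ?case unfolding \<Delta>_def .
qed

lemma BL1_measurable: "f \<in> BL1 \<Longrightarrow> (f :: real^'n \<Rightarrow> real) \<in> borel_measurable borel"
  unfolding BL1_def by (auto intro!: borel_measurable_continuous_onI lipschitz_on_continuous_on)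

lemma BL1_bounded: "f \<in> BL1 \<Longrightarrow> \<bar>f x\<bar> \<le> 1"
  unfolding BL1_def by auto

lemma BL1_lipschitz: "f \<in> BL1 \<Longrightarrow> \<bar>f x - f y\<bar> \<le> dist x y"
  unfolding BL1_def using lipschitz_onD[of 1 UNIV f x y] by (auto simp: dist_real_def)

text \<open>Smoothing changes a 1-Lipschitz function by at most \<open>\<sigma> E|Z|\<close>, so \<open>\<sigma>\<close> is chosen first. It fixes the
  Taylor constant, after which the tolerance \<open>\<kappa>\<close> for the covariance and the sample size \<open>T\<close> can be chosen
  independently of the law of the summands and of the test function.\<close>

lemma triangular_array_clt_BL1:
  fixes A :: "real^'n^'n" and e B :: real
  assumes e: "0 < e" and B: "0 \<le> B"
  obtains \<kappa> T where "0 < \<kappa>" "\<And>t (p :: 'b pmf) \<xi> f. T \<le> t \<Longrightarrow> finite (set_pmf p) \<Longrightarrow>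
     (\<And>i. measure_pmf.expectation p (\<lambda>y. \<xi> y $ i) = 0) \<Longrightarrow>
     (\<And>y. y \<in> set_pmf p \<Longrightarrow> norm (\<xi> y) \<le> B) \<Longrightarrow>
     (\<And>i j. \<bar>measure_pmf.expectation p (\<lambda>y. \<xi> y $ i * \<xi> y $ j) - (A ** transpose A) $ i $ j\<bar> \<le> \<kappa>) \<Longrightarrow>
     f \<in> BL1 \<Longrightarrow>
     \<bar>measure_pmf.expectation (replicate_pmf t p) (\<lambda>xs. f ((1 / sqrt t) *\<^sub>R sum_list (map \<xi> xs)))
        - (LINT z|std_mvnormal. f (A *v z))\<bar> \<le> e"
proof -
  define m1 where "m1 = (LINT z|std_mvnormal. norm (z::real^'n))"
  have i1: "integrable std_mvnormal (\<lambda>z::real^'n. norm z)" using integrable_norm_power[of 1] by simp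
  have m1: "0 \<le> m1" unfolding m1_def by (intro integral_nonneg_AE) auto
  define \<sigma> where "\<sigma> = e / (8 * (m1 + 1))"
  have \<sigma>: "0 < \<sigma>" "\<sigma> * m1 \<le> e / 8" using e m1 by (auto simp: \<sigma>_def field_simps)
  let ?S = "heat (\<lambda>z::real^'n. \<sigma> *\<^sub>R z)"
  obtain C where C: "0 \<le> C" and taylor: "\<And>f :: real^'n \<Rightarrow> real. f \<in> borel_measurable borel \<Longrightarrow> (\<And>y. \<bar>f y\<bar> \<le> 1) \<Longrightarrow>
     smoothing_expansion \<sigma> C f"
    using smoothing_taylor[OF \<sigma>(1)] by blast
  define a where "a = (LINT z|std_mvnormal. norm (A *v z) ^ 3)"
  have a: "0 \<le> a" unfolding a_def by (intro integral_nonneg_AE) auto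
  define N where "N = (real CARD('n))\<^sup>2 * C"
  have N: "0 \<le> N" using C by (simp add: N_def)
  define \<kappa> where "\<kappa> = e / (4 * (N + 1))"
  have \<kappa>: "0 < \<kappa>" "1/2 * N * \<kappa> \<le> e / 4" using e N by (auto simp: \<kappa>_def field_simps)
  define T where "T = Suc (nat \<lceil>(4 * (C * (B ^ 3 + a)) / e)\<^sup>2\<rceil>)"
  show ?thesis
  proof (rule that[OF \<kappa>(1), of T])
    fix t :: nat and p :: "'b pmf" and \<xi> :: "'b \<Rightarrow> real^'n" and f :: "real^'n \<Rightarrow> real"
    assume tT: "T \<le> t" and fin: "finite (set_pmf p)" and mean: "\<And>i. measure_pmf.expectation p (\<lambda>y. \<xi> y $ i) = 0"
      and bound: "\<And>y. y \<in> set_pmf p \<Longrightarrow> norm (\<xi> y) \<le> B"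
      and cov: "\<And>i j. \<bar>measure_pmf.expectation p (\<lambda>y. \<xi> y $ i * \<xi> y $ j) - (A ** transpose A) $ i $ j\<bar> \<le> \<kappa>"
      and f: "f \<in> BL1"
    note fm[measurable] = BL1_measurable[OF f] and fb = BL1_bounded[OF f]
    have t: "0 < t" using tT by (simp add: T_def)
    define s where "s = 1 / sqrt (real t)"
    have s: "0 \<le> s" "sqrt t * s = 1" "real t * s\<^sup>2 = 1" using t by (auto simp: s_def power_divide)
    have "(4 * (C * (B ^ 3 + a)) / e)\<^sup>2 \<le> real t"
      using tT unfolding T_def by linarith
    then have "4 * (C * (B ^ 3 + a)) / e \<le> sqrt (real t)" by (rule real_le_rsqrt)
    then have rt: "s * (C * (B ^ 3 + a)) \<le> e / 4" using e t by (simp add: s_def field_simps)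
    have near: "\<bar>f x - ?S f x\<bar> \<le> \<sigma> * m1" for x
    proof -
      have i: "integrable std_mvnormal (\<lambda>z. f (x + \<sigma> *\<^sub>R z))" by (rule heat_integrable[where K=1]) (auto simp: fb)
      have "f x - ?S f x = (LINT z|std_mvnormal. f x - f (x + \<sigma> *\<^sub>R z))" using i by (simp add: heat_def)
      also have "\<bar>\<dots>\<bar> \<le> (LINT z|std_mvnormal. \<bar>f x - f (x + \<sigma> *\<^sub>R z)\<bar>)" by (rule integral_abs_bound)
      also have "\<dots> \<le> (LINT z|std_mvnormal. \<sigma> * norm (z::real^'n))"
      proof (rule integral_mono)
        show "\<bar>f x - f (x + \<sigma> *\<^sub>R z)\<bar> \<le> \<sigma> * norm z" for z
          using BL1_lipschitz[OF f, of x "x + \<sigma> *\<^sub>R z"] \<sigma> by (simp add: dist_norm)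
      qed (use i i1 in auto)
      finally show ?thesis by (simp add: m1_def)
    qed
    have Sm[measurable]: "?S f \<in> borel_measurable borel" by measurable
    have Sb: "\<bar>?S f y\<bar> \<le> 1" for y using fb by (intro heat_bounded) auto
    have "\<bar>walk p \<xi> s t (?S f) 0 - heat (\<lambda>z. (sqrt t * s) *\<^sub>R (A *v z)) (?S f) 0\<bar>
      \<le> real t * (s\<^sup>2 / 2 * (real CARD('n))\<^sup>2 * C * \<kappa> + C * s ^ 3 * (B ^ 3 + (LINT z|std_mvnormal. norm (A *v z) ^ 3)))"
      by (rule lindeberg_comparison[where f=f]) (fact C taylor fm fb fin mean bound cov s(1))+
    also have "\<dots> = (real t * s\<^sup>2) * (1/2 * N * \<kappa>) + (real t * s\<^sup>2) * (s * (C * (B ^ 3 + a)))"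
      by (simp only: N_def a_def distrib_left distrib_right power2_eq_square power3_eq_cube mult.assoc mult.left_commute times_divide_eq_left mult_1_left) algebra
    also have "\<dots> \<le> e / 4 + e / 4" using \<kappa>(2) rt unfolding s(3) by simp
    finally have 1: "\<bar>walk p \<xi> s t (?S f) 0 - heat (\<lambda>z. A *v z) (?S f) 0\<bar> \<le> e / 2" unfolding s(2) by simp
    have 2: "\<bar>walk p \<xi> s t f 0 - walk p \<xi> s t (?S f) 0\<bar> \<le> \<sigma> * m1"
    proof -
      have i: "integrable (measure_pmf (replicate_pmf t p)) u" for u :: "_ \<Rightarrow> real"
        using finite_set_replicate_pmf[OF fin] by (rule integrable_measure_pmf_finite)
      have "walk p \<xi> s t f 0 - walk p \<xi> s t (?S f) 0 = measure_pmf.expectation (replicate_pmf t p)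
         (\<lambda>xs. f (0 + s *\<^sub>R sum_list (map \<xi> xs)) - ?S f (0 + s *\<^sub>R sum_list (map \<xi> xs)))"
        unfolding walk_def using i by simp
      also have "\<bar>\<dots>\<bar> \<le> \<sigma> * m1"
        by (rule abs_integral_le_const[OF measure_pmf.prob_space_axioms]) (auto intro: near)
      finally show ?thesis .
    qed
    have 3: "\<bar>heat (\<lambda>z. A *v z) f 0 - heat (\<lambda>z. A *v z) (?S f) 0\<bar> \<le> \<sigma> * m1"
    proof -
      have i: "integrable std_mvnormal (\<lambda>z. u (0 + A *v z))"
        if "u \<in> borel_measurable borel" "\<And>y. \<bar>u y\<bar> \<le> (1::real)" for u
        by (rule heat_integrable[where K=1]) (use that in auto)
      have "heat (\<lambda>z. A *v z) f 0 - heat (\<lambda>z. A *v z) (?S f) 0 = (LINT z|std_mvnormal. f (0 + A *v z) - ?S f (0 + A *v z))"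
        unfolding heat_def[of "\<lambda>z. A *v z"] using i[OF fm fb] i[OF Sm Sb] by simp
      also have "\<bar>\<dots>\<bar> \<le> \<sigma> * m1"
        by (rule abs_integral_le_const[OF std_mvnormal.prob_space_axioms]) (auto intro: near)
      finally show ?thesis .
    qed
    have "\<bar>walk p \<xi> s t f 0 - heat (\<lambda>z. A *v z) f 0\<bar> \<le> e"
      using 1 2 3 \<sigma>(2) e by linarith
    then show "\<bar>measure_pmf.expectation (replicate_pmf t p) (\<lambda>xs. f ((1 / sqrt t) *\<^sub>R sum_list (map \<xi> xs)))
        - (LINT z|std_mvnormal. f (A *v z))\<bar> \<le> e"
      by (simp add: walk_def heat_def s_def)
  qed
qed

section \<open>Multinomial resampling weights\<close>

definition resample_pmf :: "nat \<Rightarrow> nat list pmf" where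
  "resample_pmf t = multinomial_pmf t t (pmf_of_set {..<t})"

text \<open>The fluctuation \<open>\<surd>t (P\<^sub>t\<^bsup>boot\<^esup> - P\<^sub>t)\<close> of the resampled mean about the sample mean, with the values
  \<open>a \<tau>\<close> at the observations.\<close>

definition boot_fluct :: "nat \<Rightarrow> (nat \<Rightarrow> 'b::real_vector) \<Rightarrow> nat list \<Rightarrow> 'b" where
  "boot_fluct t a w = (1 / sqrt (real t)) *\<^sub>R (\<Sum>\<tau><t. (real (w ! \<tau>) - 1) *\<^sub>R a \<tau>)"

lemma sum_count_list:
  fixes a :: "nat \<Rightarrow> 'b::real_vector"
  assumes "set xs \<subseteq> {..<t}"
  shows "(\<Sum>\<tau><t. real (count_list xs \<tau>) *\<^sub>R a \<tau>) = sum_list (map a xs)"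
  using assms
proof (induction xs)
  case (Cons x xs)
  have "(\<Sum>\<tau><t. real (count_list (x # xs) \<tau>) *\<^sub>R a \<tau>)
    = (\<Sum>\<tau><t. (if \<tau> = x then a \<tau> else 0) + real (count_list xs \<tau>) *\<^sub>R a \<tau>)"
    by (intro sum.cong refl) (auto simp: scaleR_add_left)
  also have "\<dots> = a x + sum_list (map a xs)"
    using Cons by (simp add: sum.distrib)
  finally show ?case by simp
qed simp

lemma set_pmf_replicate_uniform:
  "0 < (t::nat) \<Longrightarrow> xs \<in> set_pmf (replicate_pmf k (pmf_of_set {..<t})) \<longleftrightarrow> set xs \<subseteq> {..<t} \<and> length xs = k"
proof -
  assume "0 < t"
  then have "set_pmf (pmf_of_set {..<t}) = {..<t}" by (simp add: set_pmf_of_set lessThan_empty_iff)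
  then show ?thesis by (auto simp: set_replicate_pmf)
qed

lemma finite_set_resample_pmf: "0 < t \<Longrightarrow> finite (set_pmf (resample_pmf t))"
  unfolding resample_pmf_def multinomial_pmf_def
  by (auto simp: finite_set_replicate_pmf set_pmf_of_set lessThan_empty_iff)

lemma integrable_resample_pmf: "0 < t \<Longrightarrow> integrable (resample_pmf t) (u :: _ \<Rightarrow> real)"
  by (intro integrable_measure_pmf_finite finite_set_resample_pmf)

lemma expectation_resample_pmf:
  fixes \<phi> :: "nat list \<Rightarrow> real"
  shows "measure_pmf.expectation (resample_pmf t) \<phi>
    = measure_pmf.expectation (replicate_pmf t (pmf_of_set {..<t})) (\<lambda>xs. \<phi> (map (count_list xs) [0..<t]))"
  unfolding resample_pmf_def multinomial_pmf_def by simp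

lemma expectation_uniform: "0 < t \<Longrightarrow> measure_pmf.expectation (pmf_of_set {..<t}) u = (\<Sum>\<tau><t. u \<tau>) / real t"
  for u :: "nat \<Rightarrow> real"
  by (subst integral_pmf_of_set) (auto simp: lessThan_empty_iff)

text \<open>In terms of the draws behind the counts, the fluctuation is a normalised sum of independent centred
  vectors.\<close>

lemma boot_fluct_counts:
  fixes a :: "nat \<Rightarrow> 'b::real_vector"
  assumes t: "0 < t" and xs: "set xs \<subseteq> {..<t}" "length xs = t"
  shows "boot_fluct t a (map (count_list xs) [0..<t])
    = (1 / sqrt (real t)) *\<^sub>R sum_list (map (\<lambda>\<tau>. a \<tau> - (1 / real t) *\<^sub>R (\<Sum>\<tau><t. a \<tau>)) xs)"
proof -
  let ?m = "(1 / real t) *\<^sub>R (\<Sum>\<tau><t. a \<tau>)"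
  have "(\<Sum>\<tau><t. (real (map (count_list xs) [0..<t] ! \<tau>) - 1) *\<^sub>R a \<tau>)
     = (\<Sum>\<tau><t. real (count_list xs \<tau>) *\<^sub>R a \<tau>) - (\<Sum>\<tau><t. a \<tau>)"
    by (simp add: scaleR_diff_left sum_subtractf)
  also have "(\<Sum>\<tau><t. a \<tau>) = real t *\<^sub>R ?m" using t by simp
  also have "(\<Sum>\<tau><t. real (count_list xs \<tau>) *\<^sub>R a \<tau>) - \<dots> = sum_list (map a xs) - real (length xs) *\<^sub>R ?m"
    using xs by (simp add: sum_count_list)
  also have "\<dots> = sum_list (map (\<lambda>\<tau>. a \<tau> - ?m) xs)"
    by (induction xs) (auto simp: algebra_simps)
  finally show ?thesis by (simp add: boot_fluct_def)
qed

lemma expectation_replicate_sum_square: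
  fixes \<xi> :: "'b \<Rightarrow> real"
  assumes fin: "finite (set_pmf p)" and mean: "measure_pmf.expectation p \<xi> = 0"
  shows "measure_pmf.expectation (replicate_pmf k p) (\<lambda>xs. (sum_list (map \<xi> xs))\<^sup>2)
     = real k * measure_pmf.expectation p (\<lambda>y. (\<xi> y)\<^sup>2)"
proof (induction k)
  case (Suc k)
  have i: "integrable (measure_pmf p) u" for u :: "_ \<Rightarrow> real" using fin by (rule integrable_measure_pmf_finite)
  have ik: "integrable (measure_pmf (replicate_pmf k p)) u" for u :: "_ \<Rightarrow> real"
    using finite_set_replicate_pmf[OF fin] by (rule integrable_measure_pmf_finite)
  let ?S = "measure_pmf.expectation (replicate_pmf k p) (\<lambda>xs. sum_list (map \<xi> xs))"
  let ?Q = "measure_pmf.expectation (replicate_pmf k p) (\<lambda>xs. (sum_list (map \<xi> xs))\<^sup>2)"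
  have "measure_pmf.expectation (replicate_pmf (Suc k) p) (\<lambda>xs. (sum_list (map \<xi> xs))\<^sup>2)
    = measure_pmf.expectation p (\<lambda>y. (\<xi> y)\<^sup>2 + \<xi> y * (2 * ?S) + ?Q)"
  proof (subst expectation_replicate_pmf_Suc[OF fin], rule arg_cong[where f="measure_pmf.expectation p"], rule ext)
    fix y
    have "measure_pmf.expectation (replicate_pmf k p) (\<lambda>xs. (sum_list (map \<xi> (y # xs)))\<^sup>2)
       = measure_pmf.expectation (replicate_pmf k p) (\<lambda>xs. (\<xi> y)\<^sup>2 + (2 * \<xi> y) * sum_list (map \<xi> xs) + (sum_list (map \<xi> xs))\<^sup>2)"
      by (simp add: power2_sum algebra_simps)
    also have "\<dots> = (\<xi> y)\<^sup>2 + (2 * \<xi> y) * ?S + ?Q"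
      using ik by (simp add: Bochner_Integration.integral_add)
    finally show "measure_pmf.expectation (replicate_pmf k p) (\<lambda>xs. (sum_list (map \<xi> (y # xs)))\<^sup>2) = (\<xi> y)\<^sup>2 + \<xi> y * (2 * ?S) + ?Q"
      by simp
  qed
  also have "\<dots> = measure_pmf.expectation p (\<lambda>y. (\<xi> y)\<^sup>2) + measure_pmf.expectation p \<xi> * (2 * ?S) + ?Q"
    using i by (simp add: Bochner_Integration.integral_add)
  finally show ?case using Suc.IH mean by (simp add: algebra_simps)
qed simp

lemma expectation_count_list:
  assumes t: "0 < t" and \<tau>: "\<tau> < t"
  shows "measure_pmf.expectation (replicate_pmf k (pmf_of_set {..<t})) (\<lambda>xs. real (count_list xs \<tau>)) = real k / real t"
proof (induction k)
  case (Suc k)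
  let ?p = "pmf_of_set {..<t}"
  have fin: "finite (set_pmf ?p)" using t by (simp add: set_pmf_of_set lessThan_empty_iff)
  have ik: "integrable (measure_pmf (replicate_pmf k ?p)) u" for u :: "_ \<Rightarrow> real"
    using finite_set_replicate_pmf[OF fin] by (rule integrable_measure_pmf_finite)
  have "measure_pmf.expectation (replicate_pmf (Suc k) ?p) (\<lambda>xs. real (count_list xs \<tau>))
    = measure_pmf.expectation ?p (\<lambda>y. (if y = \<tau> then 1 else 0) + real k / real t)"
  proof (subst expectation_replicate_pmf_Suc[OF fin], rule arg_cong[where f="measure_pmf.expectation ?p"], rule ext)
    fix y
    have "measure_pmf.expectation (replicate_pmf k ?p) (\<lambda>xs. real (count_list (y # xs) \<tau>))
      = measure_pmf.expectation (replicate_pmf k ?p) (\<lambda>xs. (if y = \<tau> then 1 else 0) + real (count_list xs \<tau>))"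
      by (intro Bochner_Integration.integral_cong refl) auto
    also have "\<dots> = (if y = \<tau> then 1 else 0) + real k / real t"
      using ik Suc.IH by (simp only: Bochner_Integration.integral_add ik) simp
    finally show "measure_pmf.expectation (replicate_pmf k ?p) (\<lambda>xs. real (count_list (y # xs) \<tau>)) = (if y = \<tau> then 1 else 0) + real k / real t" .
  qed
  also have "\<dots> = real (Suc k) / real t"
    using t \<tau> by (simp add: expectation_uniform sum.distrib add_divide_distrib)
  finally show ?case .
qed simp

text \<open>A weight is nonnegative with mean one.\<close>

lemma expectation_abs_weight_le:
  assumes t: "0 < t" and \<tau>: "\<tau> < t"
  shows "measure_pmf.expectation (resample_pmf t) (\<lambda>w. \<bar>real (w ! \<tau>) - 1\<bar>) \<le> 2"
proof -
  have "measure_pmf.expectation (resample_pmf t) (\<lambda>w. \<bar>real (w ! \<tau>) - 1\<bar>)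
     \<le> measure_pmf.expectation (resample_pmf t) (\<lambda>w. real (w ! \<tau>) + 1)"
    by (intro integral_mono integrable_resample_pmf t) auto
  also have "\<dots> = measure_pmf.expectation (resample_pmf t) (\<lambda>w. real (w ! \<tau>)) + 1"
    by (subst Bochner_Integration.integral_add) (auto intro: integrable_resample_pmf t)
  also have "measure_pmf.expectation (resample_pmf t) (\<lambda>w. real (w ! \<tau>)) = 1"
    unfolding expectation_resample_pmf using t \<tau> expectation_count_list[OF t \<tau>, of t] by simp
  finally show ?thesis by simp
qed

lemma boot_fluct_component: "boot_fluct t a w $ i = boot_fluct t (\<lambda>\<tau>. a \<tau> $ i) w"
  by (simp add: boot_fluct_def sum_component)

lemma expectation_boot_fluct_square_real:
  fixes a :: "nat \<Rightarrow> real"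
  assumes t: "0 < t"
  shows "measure_pmf.expectation (resample_pmf t) (\<lambda>w. (boot_fluct t a w)\<^sup>2) \<le> (\<Sum>\<tau><t. (a \<tau>)\<^sup>2) / real t"
proof -
  let ?p = "pmf_of_set {..<t}"
  let ?m = "(\<Sum>\<tau><t. a \<tau>) / real t"
  have fin: "finite (set_pmf ?p)" using t by (simp add: set_pmf_of_set lessThan_empty_iff)
  have mean: "measure_pmf.expectation ?p (\<lambda>\<tau>. a \<tau> - ?m) = 0"
    using t by (simp add: expectation_uniform sum_subtractf)
  have "measure_pmf.expectation (resample_pmf t) (\<lambda>w. (boot_fluct t a w)\<^sup>2)
     = measure_pmf.expectation (replicate_pmf t ?p) (\<lambda>xs. (1 / real t) * (sum_list (map (\<lambda>\<tau>. a \<tau> - ?m) xs))\<^sup>2)"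
    unfolding expectation_resample_pmf
    by (intro integral_cong_AE) (auto simp: AE_measure_pmf_iff set_pmf_replicate_uniform t boot_fluct_counts power_divide)
  also have "\<dots> = (1 / real t) * (real t * measure_pmf.expectation ?p (\<lambda>\<tau>. (a \<tau> - ?m)\<^sup>2))"
    by (simp only: integral_mult_right_zero expectation_replicate_sum_square[OF fin mean])
  also have "\<dots> = (\<Sum>\<tau><t. (a \<tau> - ?m)\<^sup>2) / real t" using t by (simp add: expectation_uniform)
  also have "\<dots> = (\<Sum>\<tau><t. (a \<tau>)\<^sup>2) / real t - ?m\<^sup>2"
  proof -
    have "(\<Sum>\<tau><t. (a \<tau> - ?m)\<^sup>2) = (\<Sum>\<tau><t. (a \<tau>)\<^sup>2 - 2 * ?m * a \<tau> + ?m\<^sup>2)"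
      by (intro sum.cong refl) (simp only: power2_diff mult.assoc mult.commute mult.left_commute algebra_simps)
    also have "\<dots> = (\<Sum>\<tau><t. (a \<tau>)\<^sup>2) - 2 * ?m * (\<Sum>\<tau><t. a \<tau>) + real t * ?m\<^sup>2"
      by (simp only: sum.distrib sum_subtractf sum_distrib_left[symmetric]) simp
    also have "(\<Sum>\<tau><t. a \<tau>) = real t * ?m" using t by simp
    finally show ?thesis using t by (simp add: field_simps power2_eq_square)
  qed
  finally show ?thesis by simp
qed

lemma norm_vec_power2: "(norm (x::real^'n))\<^sup>2 = (\<Sum>i\<in>UNIV. (x $ i)\<^sup>2)"
  by (simp add: norm_vec_def L2_set_def sum_nonneg)

lemma expectation_boot_fluct_square:
  fixes a :: "nat \<Rightarrow> real^'n"
  assumes t: "0 < t"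
  shows "measure_pmf.expectation (resample_pmf t) (\<lambda>w. (norm (boot_fluct t a w))\<^sup>2) \<le> (\<Sum>\<tau><t. (norm (a \<tau>))\<^sup>2) / real t"
proof -
  have "measure_pmf.expectation (resample_pmf t) (\<lambda>w. (norm (boot_fluct t a w))\<^sup>2)
    = (\<Sum>i\<in>UNIV. measure_pmf.expectation (resample_pmf t) (\<lambda>w. (boot_fluct t (\<lambda>\<tau>. a \<tau> $ i) w)\<^sup>2))"
    unfolding norm_vec_power2 boot_fluct_component
    by (rule Bochner_Integration.integral_sum) (rule integrable_resample_pmf[OF t])
  also have "\<dots> \<le> (\<Sum>i\<in>UNIV. (\<Sum>\<tau><t. (a \<tau> $ i)\<^sup>2) / real t)"
    by (intro sum_mono expectation_boot_fluct_square_real t)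
  also have "\<dots> = (\<Sum>\<tau><t. (norm (a \<tau>))\<^sup>2) / real t"
    unfolding norm_vec_power2 sum_divide_distrib[symmetric] by (subst sum.swap) simp
  finally show ?thesis .
qed

text \<open>The covariance of one uniform draw from the values \<open>a \<tau>\<close> is their empirical covariance.\<close>

lemma bootstrap_clt_BL1:
  fixes A :: "real^'n^'n" and e B :: real
  assumes e: "0 < e" and B: "0 \<le> B"
  obtains \<kappa> T where "0 < \<kappa>" "\<And>t (a :: nat \<Rightarrow> real^'n) f. T \<le> t \<Longrightarrow> (\<And>\<tau>. \<tau> < t \<Longrightarrow> norm (a \<tau>) \<le> B) \<Longrightarrow>
     (\<And>i j. \<bar>(\<Sum>\<tau><t. a \<tau> $ i * a \<tau> $ j) / t - ((\<Sum>\<tau><t. a \<tau> $ i) / t) * ((\<Sum>\<tau><t. a \<tau> $ j) / t)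
         - (A ** transpose A) $ i $ j\<bar> \<le> \<kappa>) \<Longrightarrow> f \<in> BL1 \<Longrightarrow>
     \<bar>measure_pmf.expectation (resample_pmf t) (\<lambda>w. f (boot_fluct t a w)) - (LINT z|std_mvnormal. f (A *v z))\<bar> \<le> e"
proof -
  have B2: "0 \<le> 2 * B" using B by simp
  obtain \<kappa> T where \<kappa>: "0 < \<kappa>" and clt: "\<And>t (p :: nat pmf) (\<xi> :: nat \<Rightarrow> real^'n) f. T \<le> t \<Longrightarrow> finite (set_pmf p) \<Longrightarrow>
     (\<And>i. measure_pmf.expectation p (\<lambda>y. \<xi> y $ i) = 0) \<Longrightarrow>
     (\<And>y. y \<in> set_pmf p \<Longrightarrow> norm (\<xi> y) \<le> 2 * B) \<Longrightarrow>
     (\<And>i j. \<bar>measure_pmf.expectation p (\<lambda>y. \<xi> y $ i * \<xi> y $ j) - (A ** transpose A) $ i $ j\<bar> \<le> \<kappa>) \<Longrightarrow>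
     f \<in> BL1 \<Longrightarrow>
     \<bar>measure_pmf.expectation (replicate_pmf t p) (\<lambda>xs. f ((1 / sqrt t) *\<^sub>R sum_list (map \<xi> xs)))
        - (LINT z|std_mvnormal. f (A *v z))\<bar> \<le> e"
    using triangular_array_clt_BL1[OF e B2, where 'b=nat and A=A] by blast
  show ?thesis
  proof (rule that[OF \<kappa>, of "max T 1"])
    fix t :: nat and a :: "nat \<Rightarrow> real^'n" and f :: "real^'n \<Rightarrow> real"
    assume T: "max T 1 \<le> t" and aB: "\<And>\<tau>. \<tau> < t \<Longrightarrow> norm (a \<tau>) \<le> B" and f: "f \<in> BL1"
     and cov: "\<And>i j. \<bar>(\<Sum>\<tau><t. a \<tau> $ i * a \<tau> $ j) / t - ((\<Sum>\<tau><t. a \<tau> $ i) / t) * ((\<Sum>\<tau><t. a \<tau> $ j) / t)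
         - (A ** transpose A) $ i $ j\<bar> \<le> \<kappa>"
    have t: "0 < t" using T by simp
    let ?p = "pmf_of_set {..<t}"
    define m where "m = (1 / real t) *\<^sub>R (\<Sum>\<tau><t. a \<tau>)"
    have mi: "m $ i = (\<Sum>\<tau><t. a \<tau> $ i) / t" for i by (simp add: m_def sum_component)
    have sp: "set_pmf ?p = {..<t}" using t by (simp add: set_pmf_of_set lessThan_empty_iff)
    have "norm m \<le> B"
    proof -
      have "norm m \<le> (1 / real t) * (\<Sum>\<tau><t. norm (a \<tau>))"
        unfolding m_def norm_scaleR using norm_sum[of a "{..<t}"] t by (simp add: divide_right_mono)
      also have "\<dots> \<le> (1 / real t) * (\<Sum>\<tau><t. B)" by (intro mult_left_mono sum_mono aB) auto
      finally show ?thesis using t by simp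
    qed
    have mean: "measure_pmf.expectation ?p (\<lambda>y. (a y - m) $ i) = 0" for i
      using t by (simp add: expectation_uniform sum_subtractf mi)
    have c: "measure_pmf.expectation ?p (\<lambda>y. (a y - m) $ i * (a y - m) $ j)
       = (\<Sum>\<tau><t. a \<tau> $ i * a \<tau> $ j) / t - ((\<Sum>\<tau><t. a \<tau> $ i) / t) * ((\<Sum>\<tau><t. a \<tau> $ j) / t)" for i j
    proof -
      have "(\<Sum>\<tau><t. (a \<tau> - m) $ i * (a \<tau> - m) $ j)
         = (\<Sum>\<tau><t. a \<tau> $ i * a \<tau> $ j) - m $ j * (\<Sum>\<tau><t. a \<tau> $ i) - m $ i * (\<Sum>\<tau><t. a \<tau> $ j) + real t * (m $ i * m $ j)"
        by (simp add: algebra_simps sum.distrib sum_subtractf sum_distrib_left)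
      moreover have "(\<Sum>\<tau><t. a \<tau> $ i) = real t * m $ i" for i using t by (simp add: mi)
      ultimately have "(\<Sum>\<tau><t. (a \<tau> - m) $ i * (a \<tau> - m) $ j) = (\<Sum>\<tau><t. a \<tau> $ i * a \<tau> $ j) - real t * (m $ i * m $ j)"
        by (simp add: algebra_simps)
      then show ?thesis using t by (simp add: expectation_uniform mi[symmetric] diff_divide_distrib)
    qed
    have "\<bar>measure_pmf.expectation (replicate_pmf t ?p) (\<lambda>xs. f ((1 / sqrt t) *\<^sub>R sum_list (map (\<lambda>\<tau>. a \<tau> - m) xs)))
        - (LINT z|std_mvnormal. f (A *v z))\<bar> \<le> e"
    proof (rule clt)
      show "norm (a y - m) \<le> 2 * B" if "y \<in> set_pmf ?p" for y
        using that aB[of y] \<open>norm m \<le> B\<close> norm_triangle_ineq4[of "a y" m] by (auto simp: sp)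
      show "\<bar>measure_pmf.expectation ?p (\<lambda>y. (a y - m) $ i * (a y - m) $ j) - (A ** transpose A) $ i $ j\<bar> \<le> \<kappa>" for i j
        unfolding c by (rule cov)
    qed (use T mean f sp in auto)
    also have "measure_pmf.expectation (replicate_pmf t ?p) (\<lambda>xs. f ((1 / sqrt t) *\<^sub>R sum_list (map (\<lambda>\<tau>. a \<tau> - m) xs)))
      = measure_pmf.expectation (resample_pmf t) (\<lambda>w. f (boot_fluct t a w))"
      unfolding expectation_resample_pmf
      by (intro integral_cong_AE) (auto simp: AE_measure_pmf_iff set_pmf_replicate_uniform t boot_fluct_counts m_def)
    finally show "\<bar>measure_pmf.expectation (resample_pmf t) (\<lambda>w. f (boot_fluct t a w)) - (LINT z|std_mvnormal. f (A *v z))\<bar> \<le> e" .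
  qed
qed

section \<open>Logarithmic pacing objectives\<close>

text \<open>Both H and its empirical version are a convex function plus the logarithmic barrier.\<close>

definition pacing_objective :: "real^'n \<Rightarrow> (real^'n \<Rightarrow> real) \<Rightarrow> real^'n \<Rightarrow> real" where
  "pacing_objective b G \<beta> = G \<beta> - (\<Sum>i\<in>UNIV. b $ i * ln (\<beta> $ i))"

text \<open>On the unit interval the second derivative of the logarithm is at most \<open>-1\<close>.\<close>

lemma ln_midpoint:
  fixes x y :: real
  assumes "0 < x" "x \<le> 1" "0 < y" "y \<le> 1"
  shows "(ln x + ln y) / 2 + (x - y)\<^sup>2 / 8 \<le> ln ((x + y) / 2)"
proof -
  define a where "a = ((x + y) / 2)\<^sup>2"
  have a: "0 < a" "a \<le> 1" using assms by (auto simp: a_def power_le_one)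
  have xy: "x * y = a - (x - y)\<^sup>2 / 4" by (simp add: a_def power2_eq_square field_simps)
  have "ln (x * y / a) \<le> x * y / a - 1" using assms a by (intro ln_le_minus_one) auto
  also have "\<dots> = - ((x - y)\<^sup>2 / 4) / a" using a by (simp add: xy field_simps)
  also have "\<dots> \<le> - ((x - y)\<^sup>2 / 4)"
    using mult_right_le_one_le[of "(x - y)\<^sup>2 / 4" a] a by (simp add: le_divide_eq)
  also have "ln (x * y / a) = ln x + ln y - 2 * ln ((x + y) / 2)"
    using assms a by (simp add: a_def ln_div ln_mult ln_realpow)
  finally have "ln x + ln y - 2 * ln ((x + y) / 2) \<le> - ((x - y)\<^sup>2 / 4)" .
  moreover have "A / 2 + S / 8 \<le> L" if "A - 2 * L \<le> - (S / 4)" for A S L :: real using that by linarith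
  ultimately show ?thesis by blast
qed

text \<open>The barrier is strongly convex on the box, with modulus the smallest budget; the midpoint of the
  minimiser and another point of the box cannot beat the minimiser.\<close>

lemma pacing_objective_growth:
  fixes b :: "real^'n"
  assumes b: "\<And>i. c \<le> b $ i" and c: "0 < c"
    and cvx: "\<And>x y. x \<in> pacing_box \<Longrightarrow> y \<in> pacing_box \<Longrightarrow> G ((1/2) *\<^sub>R (x + y)) \<le> (G x + G y) / 2"
    and m: "m \<in> pacing_box" "\<And>y. y \<in> pacing_box \<Longrightarrow> pacing_objective b G m \<le> pacing_objective b G y"
    and y: "y \<in> pacing_box"
  shows "pacing_objective b G m + c / 4 * (norm (y - m))\<^sup>2 \<le> pacing_objective b G y"
proof -
  let ?z = "(1/2) *\<^sub>R (m + y)"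
  have box: "0 < m $ i" "m $ i \<le> 1" "0 < y $ i" "y $ i \<le> 1" for i
    using m(1) y by (auto simp: pacing_box_def)
  have z: "?z \<in> pacing_box" unfolding pacing_box_def
  proof (safe)
    fix i show "0 < ?z $ i" "?z $ i \<le> 1" using box[of i] by auto
  qed
  have "pacing_objective b G m \<le> pacing_objective b G ?z" by (rule m(2)[OF z])
  also have "\<dots> \<le> (G m + G y) / 2 - (\<Sum>i\<in>UNIV. b $ i * ((ln (m $ i) + ln (y $ i)) / 2) + c * (y $ i - m $ i)\<^sup>2 / 8)"
  proof -
    have "b $ i * ((ln (m $ i) + ln (y $ i)) / 2) + c * (y $ i - m $ i)\<^sup>2 / 8 \<le> b $ i * ln (?z $ i)" for i
    proof -
      have "b $ i * ((ln (m $ i) + ln (y $ i)) / 2 + (m $ i - y $ i)\<^sup>2 / 8) \<le> b $ i * ln ((m $ i + y $ i) / 2)"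
        using b[of i] c box[of i] by (intro mult_left_mono ln_midpoint) auto
      moreover have "c * (y $ i - m $ i)\<^sup>2 / 8 \<le> b $ i * (m $ i - y $ i)\<^sup>2 / 8"
        using b[of i] by (auto simp: power2_commute intro!: mult_right_mono)
      moreover have "?z $ i = (m $ i + y $ i) / 2" by simp
      ultimately show ?thesis unfolding distrib_left by (simp only:)
    qed
    then have "(\<Sum>i\<in>UNIV. b $ i * ((ln (m $ i) + ln (y $ i)) / 2) + c * (y $ i - m $ i)\<^sup>2 / 8) \<le> (\<Sum>i\<in>UNIV. b $ i * ln (?z $ i))"
      by (rule sum_mono)
    then show ?thesis unfolding pacing_objective_def using cvx[OF m(1) y] by linarith
  qed
  also have "(\<Sum>i\<in>UNIV. b $ i * ((ln (m $ i) + ln (y $ i)) / 2) + c * (y $ i - m $ i)\<^sup>2 / 8)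
      = ((\<Sum>i\<in>UNIV. b $ i * ln (m $ i)) + (\<Sum>i\<in>UNIV. b $ i * ln (y $ i))) / 2 + c / 8 * (norm (y - m))\<^sup>2"
  proof -
    have "(\<Sum>i\<in>UNIV. b $ i * ((ln (m $ i) + ln (y $ i)) / 2) + c * (y $ i - m $ i)\<^sup>2 / 8)
      = (\<Sum>i\<in>UNIV. (b $ i * ln (m $ i) + b $ i * ln (y $ i)) / 2 + c / 8 * ((y - m) $ i)\<^sup>2)"
      by (intro sum.cong refl) (simp add: distrib_left)
    then show ?thesis
      unfolding norm_vec_power2 by (simp only: sum.distrib sum_divide_distrib[symmetric] sum_distrib_left[symmetric])
  qed
  finally show ?thesis unfolding pacing_objective_def by (simp add: field_simps)
qed

lemma pacing_objective_continuous_on: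
  assumes "continuous_on pacing_box G"
  shows "continuous_on pacing_box (pacing_objective b G)"
  unfolding pacing_objective_def[abs_def]
  by (intro continuous_intros assms) (auto simp: pacing_box_def, metis less_irrefl)

text \<open>The box is not closed at \<open>0\<close>, but the barrier makes points with a small coordinate worse than the
  point \<open>(1, \<dots>, 1)\<close>, so that the minimum over a compact sub-box is the minimum over the box.\<close>

lemma pacing_objective_arg_min:
  fixes b :: "real^'n"
  assumes b: "\<And>i. c \<le> b $ i" and c: "0 < c"
    and cont: "continuous_on pacing_box G" and nonneg: "\<And>x. x \<in> pacing_box \<Longrightarrow> 0 \<le> G x"
  defines "m \<equiv> arg_min_on (pacing_objective b G) pacing_box"
  shows "m \<in> pacing_box" "\<And>y. y \<in> pacing_box \<Longrightarrow> pacing_objective b G m \<le> pacing_objective b G y"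
proof -
  let ?g = "pacing_objective b G"
  let ?one = "\<chi> i. 1 :: real^'n"
  have one: "(\<chi> i. 1) \<in> (pacing_box :: (real^'n) set)" by (simp add: pacing_box_def)
  define c0 where "c0 = G (\<chi> i. 1)"
  have c0: "0 \<le> c0" unfolding c0_def by (rule nonneg[OF one])
  have g1: "?g (\<chi> i. 1) = c0" by (simp add: pacing_objective_def c0_def)
  define l where "l = exp (- ((c0 + 1) / c))"
  have l: "0 < l" "l \<le> 1" using c c0 by (auto simp: l_def)
  let ?K = "cbox (\<chi> i. l) (\<chi> i. 1) :: (real^'n) set"
  have K: "?K \<subseteq> pacing_box" using l by (auto simp: mem_box_cart pacing_box_def intro: less_le_trans)
  have oneK: "(\<chi> i. 1) \<in> ?K" using l by (simp add: mem_box_cart)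
  then have ne: "?K \<noteq> {}" by blast
  obtain k where k: "k \<in> ?K" "\<And>y. y \<in> ?K \<Longrightarrow> ?g k \<le> ?g y"
    using continuous_attains_inf[OF compact_cbox ne continuous_on_subset[OF pacing_objective_continuous_on[OF cont] K]] by blast
  have "?g k \<le> ?g y" if y: "y \<in> pacing_box" for y
  proof (cases "y \<in> ?K")
    case False
    then obtain i where i: "y $ i < l" using y by (auto simp: mem_box_cart pacing_box_def not_le) (metis not_le)
    have yi: "0 < y $ j" "y $ j \<le> 1" for j using y by (auto simp: pacing_box_def)
    have "c0 + 1 \<le> b $ i * (- ln (y $ i))"
    proof -
      have "ln (y $ i) \<le> ln l" using i yi[of i] l by simp
      then have "(c0 + 1) / c \<le> - ln (y $ i)" by (simp add: l_def)
      then have "c * ((c0 + 1) / c) \<le> b $ i * (- ln (y $ i))" using b[of i] c c0 by (intro mult_mono) auto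
      then show ?thesis using c by simp
    qed
    also have "\<dots> \<le> (\<Sum>j\<in>UNIV. b $ j * (- ln (y $ j)))"
    proof (rule member_le_sum)
      fix j show "0 \<le> b $ j * (- ln (y $ j))" using b[of j] c yi[of j] by (intro mult_nonneg_nonneg) auto
    qed auto
    also have "\<dots> \<le> ?g y" using nonneg[OF y] by (simp add: pacing_objective_def sum_negf)
    finally show ?thesis using k(2)[OF oneK] g1 by linarith
  qed (use k in blast)
  then have "is_arg_min ?g (\<lambda>x. x \<in> pacing_box) k" using k K by (auto simp: is_arg_min_linorder)
  then have "is_arg_min ?g (\<lambda>x. x \<in> pacing_box) m" unfolding m_def arg_min_on_def arg_min_def by (rule someI)
  then show "m \<in> pacing_box" "\<And>y. y \<in> pacing_box \<Longrightarrow> ?g m \<le> ?g y" by (auto simp: is_arg_min_linorder)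
qed

lemma pacing_box_dense_sequence:
  obtains q :: "nat \<Rightarrow> real^'n" where "\<And>k. q k \<in> pacing_box" "\<And>x e. x \<in> pacing_box \<Longrightarrow> 0 < e \<Longrightarrow> \<exists>k. dist (q k) x < e"
proof -
  obtain D :: "(real^'n) set" where D: "countable D" "\<And>X. open X \<Longrightarrow> X \<noteq> {} \<Longrightarrow> \<exists>d\<in>D. d \<in> X"
    using countable_dense_exists[where 'a="real^'n"] by blast
  then have "D \<noteq> {}" using D(2)[of UNIV] by auto
  \<comment> \<open>A continuous map of the whole space onto the box carries dense sequences to dense sequences.\<close>
  define \<phi> where "\<phi> x = (\<chi> i. exp (- \<bar>x $ i\<bar>))" for x :: "real^'n"
  have cont: "continuous_on UNIV \<phi>" unfolding \<phi>_def by (intro continuous_intros)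
  show ?thesis
  proof (rule that[of "\<lambda>k. \<phi> (from_nat_into D k)"])
    show "\<phi> (from_nat_into D k) \<in> pacing_box" for k by (simp add: \<phi>_def pacing_box_def)
    fix x :: "real^'n" and e :: real assume x: "x \<in> pacing_box" and e: "0 < e"
    have "\<phi> (\<chi> i. - ln (x $ i)) = x"
      using x by (simp add: \<phi>_def vec_eq_iff pacing_box_def)
    then have "(\<chi> i. - ln (x $ i)) \<in> \<phi> -` ball x e" using e by simp
    moreover have "open (\<phi> -` ball x e)" using cont by (simp add: open_vimage continuous_on_eq_continuous_at)
    ultimately obtain d where "d \<in> D" "\<phi> d \<in> ball x e" using D(2)[of "\<phi> -` ball x e"] by blast
    then show "\<exists>k. dist (\<phi> (from_nat_into D k)) x < e"
      using from_nat_into_surj[OF D(1)] by (metis dist_commute mem_ball)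
  qed
qed

primrec best_upto :: "('b \<Rightarrow> real) \<Rightarrow> (nat \<Rightarrow> 'b) \<Rightarrow> nat \<Rightarrow> 'b" where
  "best_upto h q 0 = q 0"
| "best_upto h q (Suc k) = (if h (q (Suc k)) < h (best_upto h q k) then q (Suc k) else best_upto h q k)"

lemma best_upto_le: "j \<le> k \<Longrightarrow> h (best_upto h q k) \<le> h (q j)"
  by (induction k) (auto simp: le_Suc_eq)

lemma best_upto_in: "(\<And>k. q k \<in> S) \<Longrightarrow> best_upto h q k \<in> S"
  by (induction k) auto

text \<open>A minimiser with quadratic growth is the limit of the best points of a dense sequence; hence
  it depends measurably on parameters.\<close>

lemma measurable_minimiser:
  fixes h :: "'d \<Rightarrow> real^'n \<Rightarrow> real"
  assumes h: "\<And>\<beta>. \<beta> \<in> borel_measurable N \<Longrightarrow> (\<lambda>d. h d (\<beta> d)) \<in> borel_measurable N"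
    and m: "\<And>d. d \<in> space N \<Longrightarrow> m d \<in> pacing_box" and c: "0 < c"
    and growth: "\<And>d y. d \<in> space N \<Longrightarrow> y \<in> pacing_box \<Longrightarrow> h d (m d) + c * (norm (y - m d))\<^sup>2 \<le> h d y"
    and cont: "\<And>d. d \<in> space N \<Longrightarrow> continuous_on pacing_box (h d)"
  shows "m \<in> borel_measurable N"
proof -
  obtain q :: "nat \<Rightarrow> real^'n" where q: "\<And>k. q k \<in> pacing_box"
    "\<And>x e. x \<in> pacing_box \<Longrightarrow> 0 < e \<Longrightarrow> \<exists>k. dist (q k) x < e"
    using pacing_box_dense_sequence by blast
  have hq[measurable]: "(\<lambda>d. h d (q k)) \<in> borel_measurable N" for k by (rule h) simp
  have meas: "(\<lambda>d. best_upto (h d) q k) \<in> borel_measurable N" for k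
  proof (induction k)
    case (Suc k)
    note [measurable] = Suc h[OF Suc]
    show ?case by simp
  qed simp
  show ?thesis
  proof (rule borel_measurable_LIMSEQ_metric[OF meas])
    fix d assume d: "d \<in> space N"
    show "(\<lambda>k. best_upto (h d) q k) \<longlonglongrightarrow> m d"
    proof (rule LIMSEQ_I)
      fix r :: real assume r: "0 < r"
      have "0 < c * r\<^sup>2" using c r by simp
      then obtain e where e: "0 < e" "\<And>y. y \<in> pacing_box \<Longrightarrow> dist y (m d) < e \<Longrightarrow> dist (h d y) (h d (m d)) < c * r\<^sup>2"
        using cont[OF d] m[OF d] unfolding continuous_on_iff by meson
      obtain k where k: "dist (q k) (m d) < e" using q(2)[OF m[OF d] e(1)] by blast
      have "norm (best_upto (h d) q j - m d) < r" if "k \<le> j" for j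
      proof -
        have "h d (m d) + c * (norm (best_upto (h d) q j - m d))\<^sup>2 \<le> h d (best_upto (h d) q j)"
          by (intro growth d best_upto_in q)
        also have "\<dots> \<le> h d (q k)" using that by (rule best_upto_le)
        also have "\<dots> < h d (m d) + c * r\<^sup>2" using e(2)[OF q(1) k] by (simp add: dist_real_def)
        finally have "(norm (best_upto (h d) q j - m d))\<^sup>2 < r\<^sup>2" using c by simp
        then show ?thesis using r by (simp add: power2_less_imp_less)
      qed
      then show "\<exists>no. \<forall>n\<ge>no. norm (best_upto (h d) q n - m d) < r" by blast
    qed
  qed
qed

section \<open>The highest bid\<close>

definition top_bid :: "('n::finite \<Rightarrow> 'a \<Rightarrow> real) \<Rightarrow> 'a \<Rightarrow> real^'n \<Rightarrow> real" where
  "top_bid v x \<beta> = (MAX i. \<beta> $ i * v i x)"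

lemma F_eq: "F b v x = pacing_objective b (top_bid v x)"
  by (simp add: fun_eq_iff F_def pacing_objective_def top_bid_def)

lemma top_bid_ge: "\<beta> $ i * v i x \<le> top_bid v x \<beta>"
  unfolding top_bid_def by (rule Max_ge) auto

lemma top_bid_le: "(\<And>i. \<beta> $ i * v i x \<le> c) \<Longrightarrow> top_bid v x \<beta> \<le> c"
  unfolding top_bid_def by (subst Max_le_iff) auto

lemma top_bid_attained: "\<exists>i. top_bid v x \<beta> = \<beta> $ i * v i x"
proof -
  have "top_bid v x \<beta> \<in> range (\<lambda>i. \<beta> $ i * v i x)"
    unfolding top_bid_def by (rule Max_in) auto
  then show ?thesis by auto
qed

lemma top_bid_increment_le:
  assumes "\<And>i. 0 \<le> v i x" "\<And>i. v i x \<le> V" 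
  shows "top_bid v x \<beta> \<le> top_bid v x \<beta>' + V * norm (\<beta> - \<beta>')"
proof (rule top_bid_le)
  fix i
  have "\<beta> $ i * v i x = \<beta>' $ i * v i x + (\<beta> - \<beta>') $ i * v i x" by (simp add: algebra_simps)
  also have "(\<beta> - \<beta>') $ i * v i x \<le> norm (\<beta> - \<beta>') * V"
    using component_le_norm_cart[of "\<beta> - \<beta>'" i] assms[of i]
    by (intro mult_mono) auto
  also have "\<beta>' $ i * v i x \<le> top_bid v x \<beta>'" by (rule top_bid_ge)
  finally show "\<beta> $ i * v i x \<le> top_bid v x \<beta>' + V * norm (\<beta> - \<beta>')" by (simp add: mult.commute)
qed

lemma top_bid_lipschitz:
  assumes "\<And>i. 0 \<le> v i x" "\<And>i. v i x \<le> V" 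
  shows "\<bar>top_bid v x \<beta> - top_bid v x \<beta>'\<bar> \<le> V * norm (\<beta> - \<beta>')"
  using top_bid_increment_le[of v x V \<beta> \<beta>', OF assms] top_bid_increment_le[of v x V \<beta>' \<beta>, OF assms]
  by (simp add: norm_minus_commute abs_le_iff)

lemma top_bid_convex:
  assumes "0 \<le> l" "l \<le> 1"
  shows "top_bid v x ((1 - l) *\<^sub>R \<beta> + l *\<^sub>R \<beta>') \<le> (1 - l) * top_bid v x \<beta> + l * top_bid v x \<beta>'"
proof (rule top_bid_le)
  fix i
  have "((1 - l) *\<^sub>R \<beta> + l *\<^sub>R \<beta>') $ i * v i x = (1 - l) * (\<beta> $ i * v i x) + l * (\<beta>' $ i * v i x)"
    by (simp add: algebra_simps)
  also have "\<dots> \<le> (1 - l) * top_bid v x \<beta> + l * top_bid v x \<beta>'"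
    using assms by (intro add_mono mult_left_mono top_bid_ge) auto
  finally show "((1 - l) *\<^sub>R \<beta> + l *\<^sub>R \<beta>') $ i * v i x \<le> (1 - l) * top_bid v x \<beta> + l * top_bid v x \<beta>'" .
qed

lemma top_bid_nonneg: "(\<And>i. 0 \<le> v i x) \<Longrightarrow> (\<And>i. 0 \<le> \<beta> $ i) \<Longrightarrow> 0 \<le> top_bid v x \<beta>"
  by (rule order_trans[OF _ top_bid_ge[of \<beta> undefined]]) simp

lemma vec_nth_measurable[measurable (raw)]:
  "f \<in> borel_measurable N \<Longrightarrow> (\<lambda>x. (f x :: real^'n) $ i) \<in> borel_measurable N"
  by (rule measurable_compose[where N=borel]) (auto intro!: borel_measurable_continuous_onI continuous_intros)

lemma top_bid_measurable:
  assumes v: "\<And>i. v i \<in> borel_measurable M" and f: "f \<in> measurable N M" and [measurable]: "\<beta> \<in> borel_measurable N"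
  shows "(\<lambda>d. top_bid v (f d) (\<beta> d)) \<in> borel_measurable N"
proof -
  have [measurable]: "(\<lambda>d. v i (f d)) \<in> borel_measurable N" for i by (rule measurable_compose[OF f v])
  show ?thesis unfolding top_bid_def by measurable
qed

section \<open>Ties for the highest bid\<close>

definition tie :: "('n::finite \<Rightarrow> 'a \<Rightarrow> real) \<Rightarrow> 'a \<Rightarrow> real^'n \<Rightarrow> bool" where
  "tie v x \<beta> \<longleftrightarrow> (\<exists>i j. i \<noteq> j \<and> \<beta> $ i * v i x = top_bid v x \<beta> \<and> \<beta> $ j * v j x = top_bid v x \<beta> \<and> 0 < top_bid v x \<beta>)"

text \<open>Where there is no tie this is the gradient of the highest bid; at a tie it is zero.\<close>

definition winner_value :: "('n::finite \<Rightarrow> 'a \<Rightarrow> real) \<Rightarrow> 'a \<Rightarrow> real^'n \<Rightarrow> real^'n" where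
  "winner_value v x \<beta> = (\<chi> i. if \<forall>k. k \<noteq> i \<longrightarrow> \<beta> $ k * v k x < \<beta> $ i * v i x then v i x else 0)"

text \<open>A quantitative form of the absence of ties. An item worth nothing to anybody has every margin,
  since its highest bid is identically zero.\<close>

definition winning_margin :: "('n::finite \<Rightarrow> 'a \<Rightarrow> real) \<Rightarrow> real \<Rightarrow> 'a \<Rightarrow> real^'n \<Rightarrow> bool" where
  "winning_margin v r x \<beta> \<longleftrightarrow> (\<forall>k. v k x = 0) \<or> (\<exists>i. \<forall>k. k \<noteq> i \<longrightarrow> \<beta> $ k * v k x + r \<le> \<beta> $ i * v i x)"

lemma top_bid_eqI: "(\<And>k. \<beta> $ k * v k x \<le> \<beta> $ i * v i x) \<Longrightarrow> top_bid v x \<beta> = \<beta> $ i * v i x"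
  by (intro antisym top_bid_le top_bid_ge)

lemma winner_value_tie: "tie v x \<beta> \<Longrightarrow> winner_value v x \<beta> = 0"
proof -
  assume "tie v x \<beta>"
  then obtain i j where ij: "i \<noteq> j" "\<beta> $ i * v i x = top_bid v x \<beta>" "\<beta> $ j * v j x = top_bid v x \<beta>"
    by (auto simp: tie_def)
  have "\<not> (\<forall>k. k \<noteq> l \<longrightarrow> \<beta> $ k * v k x < \<beta> $ l * v l x)" for l
  proof
    assume *: "\<forall>k. k \<noteq> l \<longrightarrow> \<beta> $ k * v k x < \<beta> $ l * v l x"
    have "\<exists>k. k \<noteq> l \<and> \<beta> $ k * v k x = top_bid v x \<beta>" using ij by metis
    then show False using * top_bid_ge[of \<beta> l v x] by force
  qed
  then show ?thesis by (auto simp: winner_value_def vec_eq_iff)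
qed

text \<open>A perturbation that is small compared with the margin cannot change the winner, so the highest bid
  is linear there.\<close>

lemma margin_stable:
  assumes v: "\<And>i. 0 \<le> v i x" "\<And>i. v i x \<le> V" and m: "winning_margin v r x \<beta>"
    and near: "2 * V * norm (\<beta>' - \<beta>) < r"
  shows "winner_value v x \<beta>' = winner_value v x \<beta>" "\<not> tie v x \<beta>'"
    "top_bid v x \<beta>' = winner_value v x \<beta> \<bullet> \<beta>'"
proof -
  have "winner_value v x \<beta>' = winner_value v x \<beta> \<and> \<not> tie v x \<beta>' \<and> top_bid v x \<beta>' = winner_value v x \<beta> \<bullet> \<beta>'"
  proof (cases "\<forall>k. v k x = 0")
    case True
    have t0: "top_bid v x \<beta>' = 0" using top_bid_attained[of v x \<beta>'] True by auto
    have "winner_value v x \<beta>'' = 0" for \<beta>'' using True by (simp add: winner_value_def vec_eq_iff)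
    then show ?thesis using t0 by (simp add: tie_def)
  next
    case False
    then obtain i where i: "\<And>k. k \<noteq> i \<Longrightarrow> \<beta> $ k * v k x + r \<le> \<beta> $ i * v i x"
      using m by (auto simp: winning_margin_def)
    have V: "0 \<le> V" using v[of i] by linarith
    then have r: "0 < r" using near by (smt (verit) mult_nonneg_nonneg norm_ge_zero)
    have dev: "\<bar>\<beta>' $ k * v k x - \<beta> $ k * v k x\<bar> \<le> V * norm (\<beta>' - \<beta>)" for k
    proof -
      have "\<bar>\<beta>' $ k * v k x - \<beta> $ k * v k x\<bar> = \<bar>v k x\<bar> * \<bar>(\<beta>' - \<beta>) $ k\<bar>" by (simp add: abs_mult[symmetric] algebra_simps)
      also have "\<dots> \<le> V * norm (\<beta>' - \<beta>)" using v[of k] component_le_norm_cart[of "\<beta>' - \<beta>" k] V by (intro mult_mono) auto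
      finally show ?thesis .
    qed
    have i': "\<beta>' $ k * v k x < \<beta>' $ i * v i x" if "k \<noteq> i" for k
      using i[OF that] dev[of k] dev[of i] near by linarith
    have i0: "\<beta> $ k * v k x < \<beta> $ i * v i x" if "k \<noteq> i" for k using i[OF that] r by linarith
    have w: "winner_value v x \<beta>'' = (\<chi> l. if l = i then v i x else 0)"
      if *: "\<And>k. k \<noteq> i \<Longrightarrow> \<beta>'' $ k * v k x < \<beta>'' $ i * v i x" for \<beta>''
    proof -
      have "(\<forall>k. k \<noteq> l \<longrightarrow> \<beta>'' $ k * v k x < \<beta>'' $ l * v l x) \<longleftrightarrow> l = i" for l
        using * by (metis less_asym)
      then show ?thesis by (auto simp: winner_value_def vec_eq_iff)
    qed
    have top: "top_bid v x \<beta>' = \<beta>' $ i * v i x"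
      by (rule top_bid_eqI) (metis i' less_imp_le order_refl)
    have "\<not> tie v x \<beta>'"
      unfolding tie_def top using i' by (metis less_irrefl)
    moreover have w0: "winner_value v x \<beta> = (\<chi> l. if l = i then v i x else 0)"
      by (rule w) (rule i0)
    moreover have "winner_value v x \<beta> \<bullet> \<beta>' = v i x * \<beta>' $ i"
      unfolding w0 by (simp add: inner_vec_def if_distrib[of "\<lambda>a. a * _"] cong: if_cong)
    moreover have "winner_value v x \<beta>' = (\<chi> l. if l = i then v i x else 0)"
      by (rule w) (rule i')
    ultimately show ?thesis using top by simp
  qed
  then show "winner_value v x \<beta>' = winner_value v x \<beta>" "\<not> tie v x \<beta>'" "top_bid v x \<beta>' = winner_value v x \<beta> \<bullet> \<beta>'"
    by auto
qed

lemma not_tie_margin: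
  assumes v: "\<And>i. 0 \<le> v i x" and \<beta>: "\<beta> \<in> pos_orthant" and nt: "\<not> tie v x \<beta>"
  shows "\<exists>r>0. winning_margin v r x \<beta>"
proof (cases "\<forall>k. v k x = 0")
  case True
  then show ?thesis by (auto simp: winning_margin_def intro: exI[of _ 1])
next
  case False
  then obtain k where "v k x \<noteq> 0" by blast
  then have "0 < \<beta> $ k * v k x" using v[of k] \<beta> by (auto simp: pos_orthant_def)
  then have top: "0 < top_bid v x \<beta>" using top_bid_ge[of \<beta> k v x] by linarith
  obtain i where i: "top_bid v x \<beta> = \<beta> $ i * v i x" using top_bid_attained[of v x \<beta>] by blast
  have lt: "\<beta> $ k * v k x < \<beta> $ i * v i x" if "k \<noteq> i" for k
    using nt that i top top_bid_ge[of \<beta> k v x] unfolding tie_def by (metis order_le_less)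
  define r where "r = Min (insert 1 ((\<lambda>k. \<beta> $ i * v i x - \<beta> $ k * v k x) ` (UNIV - {i})))"
  have "0 < r" using lt by (auto simp: r_def)
  moreover have "\<beta> $ k * v k x + r \<le> \<beta> $ i * v i x" if "k \<noteq> i" for k
  proof -
    have "r \<le> \<beta> $ i * v i x - \<beta> $ k * v k x" unfolding r_def by (rule Min_le) (use that in auto)
    then show ?thesis by simp
  qed
  ultimately show ?thesis by (auto simp: winning_margin_def)
qed

lemma winning_margin_antimono: "winning_margin v r x \<beta> \<Longrightarrow> r' \<le> r \<Longrightarrow> winning_margin v r' x \<beta>"
  unfolding winning_margin_def by (meson add_left_mono order_trans)

lemma winner_value_nonneg: "0 \<le> v i x \<Longrightarrow> 0 \<le> winner_value v x \<beta> $ i"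
  by (simp add: winner_value_def)

lemma winner_value_le: "0 \<le> v i x \<Longrightarrow> v i x \<le> V \<Longrightarrow> winner_value v x \<beta> $ i \<le> V"
  by (simp add: winner_value_def)

section \<open>Gradients and subgradients of the objective of one item\<close>

text \<open>Symmetric second differences are of smaller order than the step at a point of differentiability,
  while a kink makes them grow linearly.\<close>

lemma second_difference_differentiable:
  fixes f :: "'v::real_normed_vector \<Rightarrow> real"
  assumes "f differentiable (at x)" and r: "0 < r"
    and le: "\<And>h. 0 < h \<Longrightarrow> h < r \<Longrightarrow> h * a \<le> f (x + h *\<^sub>R u) + f (x - h *\<^sub>R u) - 2 * f x"
  shows "a \<le> 0"
proof (rule ccontr)
  assume "\<not> a \<le> 0"
  then have a: "0 < a" by simp
  obtain f' where f': "(f has_derivative f') (at x)" using assms(1) by (auto simp: differentiable_def)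
  interpret bounded_linear f' using f' by (rule has_derivative_bounded_linear)
  define e where "e = a / (4 * (norm u + 1))"
  have e: "0 < e" using a by (simp add: e_def add_nonneg_pos)
  obtain d where d: "0 < d" "\<And>y. norm (y - x) < d \<Longrightarrow> \<bar>f y - f x - f' (y - x)\<bar> \<le> e * norm (y - x)"
    using f' e unfolding has_derivative_at_alt by (auto simp: real_norm_def)
  define h where "h = min (r / 2) (d / (2 * (norm u + 1)))"
  have n1: "0 < norm u + 1" by (simp add: add_nonneg_pos)
  have h: "0 < h" "h < r" "h * norm u < d"
  proof -
    show "0 < h" "h < r" using r d n1 by (auto simp: h_def)
    have "h * norm u \<le> d / (2 * (norm u + 1)) * norm u" by (intro mult_right_mono) (auto simp: h_def)
    also have "\<dots> < d" using d(1) n1 by (simp add: field_simps) (smt (verit) mult_nonneg_nonneg norm_ge_zero)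
    finally show "h * norm u < d" .
  qed
  have p: "\<bar>f (x + h *\<^sub>R u) - f x - f' (h *\<^sub>R u)\<bar> \<le> e * (h * norm u)"
    using d(2)[of "x + h *\<^sub>R u"] h by simp
  have m: "\<bar>f (x - h *\<^sub>R u) - f x + f' (h *\<^sub>R u)\<bar> \<le> e * (h * norm u)"
    using d(2)[of "x - h *\<^sub>R u"] h neg[of "h *\<^sub>R u"] by simp
  have "h * a \<le> 2 * (e * (h * norm u))" using le[OF h(1,2)] p m by linarith
  then have "h * a \<le> h * (2 * e * norm u)" by (simp add: mult_ac)
  then have "a \<le> 2 * e * norm u" using h(1) by simp
  also have "\<dots> \<le> 2 * e * (norm u + 1)" using e by simp
  also have "\<dots> = a / 2"
  proof -
    have "2 * (a / (4 * N)) * N = a / 2" if "0 < N" for N :: real using that by simp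
    from this[OF n1] show ?thesis by (simp only: e_def)
  qed
  finally show False using a by simp
qed

lemma GDERIV_unique: "GDERIV f x :> D \<Longrightarrow> GDERIV f x :> D' \<Longrightarrow> D = D'"
proof -
  assume "GDERIV f x :> D" "GDERIV f x :> D'"
  then have "(\<lambda>h. h \<bullet> D) = (\<lambda>h. h \<bullet> D')" unfolding gderiv_def by (rule has_derivative_unique)
  then have "(D - D') \<bullet> (D - D') = 0" by (metis inner_diff_right right_minus_eq)
  then show ?thesis by simp
qed

lemma gradient_eqI: "GDERIV f x :> D \<Longrightarrow> gradient f x = D"
  unfolding gradient_def by (blast intro: GDERIV_unique)

lemma differentiable_GDERIV:
  fixes f :: "real^'n \<Rightarrow> real"
  assumes "f differentiable (at x)"
  shows "GDERIV f x :> gradient f x"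
proof -
  obtain f' where f': "(f has_derivative f') (at x)" using assms by (auto simp: differentiable_def)
  interpret bounded_linear f' using f' by (rule has_derivative_bounded_linear)
  define D where "D = (\<Sum>b\<in>Basis. f' b *\<^sub>R b)"
  have "f' h = h \<bullet> D" for h
  proof -
    have "f' h = f' (\<Sum>b\<in>Basis. (h \<bullet> b) *\<^sub>R b)" by (simp add: euclidean_representation)
    also have "\<dots> = (\<Sum>b\<in>Basis. (h \<bullet> b) * f' b)" by (simp add: sum scaleR)
    also have "\<dots> = h \<bullet> D" by (simp add: D_def inner_sum_right mult.commute)
    finally show ?thesis .
  qed
  then have "f' = (\<lambda>h. h \<bullet> D)" by (rule ext)
  then have "GDERIV f x :> D" using f' by (simp add: gderiv_def)
  then show ?thesis using gradient_eqI by metis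
qed

lemma subgradient_eq_gradient:
  fixes f :: "'v::real_inner \<Rightarrow> real"
  assumes g: "g \<in> subdifferential S f x" and S: "open S" "x \<in> S" and D: "GDERIV f x :> D"
  shows "g = D"
proof -
  have d: "((\<lambda>y. f y - g \<bullet> (y - x)) has_derivative (\<lambda>h. h \<bullet> D - g \<bullet> h)) (at x)"
    using D unfolding gderiv_def by (auto intro!: derivative_eq_intros)
  have "(\<lambda>h. h \<bullet> D - g \<bullet> h) = (\<lambda>h. 0)"
  proof (rule differential_zero_maxmin[OF S(2,1) d])
    have "\<forall>y\<in>S. f x - g \<bullet> (x - x) \<le> f y - g \<bullet> (y - x)"
      using g by (auto simp: subdifferential_def algebra_simps)
    then show "(\<forall>y\<in>S. f y - g \<bullet> (y - x) \<le> f x - g \<bullet> (x - x)) \<or> (\<forall>y\<in>S. f x - g \<bullet> (x - x) \<le> f y - g \<bullet> (y - x))" by blast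
  qed
  then have "(D - g) \<bullet> D - g \<bullet> (D - g) = 0" by meson
  then have "(D - g) \<bullet> (D - g) = 0" by (simp add: inner_diff_left inner_diff_right inner_commute algebra_simps)
  then show ?thesis by simp
qed

lemma open_pos_orthant: "open (pos_orthant :: (real^'n) set)"
proof -
  have eq: "pos_orthant = (\<Inter>i. {x :: real^'n. 0 < x $ i})" by (auto simp: pos_orthant_def)
  have "open {x :: real^'n. 0 < x $ i}" for i
    by (intro open_Collect_less continuous_intros)
  then show ?thesis unfolding eq by (intro open_INT) auto
qed

lemma pacing_box_pos: "pacing_box \<subseteq> pos_orthant"
  by (auto simp: pacing_box_def pos_orthant_def)

definition inv_budget :: "real^'n \<Rightarrow> real^'n \<Rightarrow> real^'n" where
  "inv_budget b \<beta> = (\<chi> i. b $ i / \<beta> $ i)"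

lemma barrier_GDERIV:
  assumes "\<beta> \<in> pos_orthant"
  shows "((\<lambda>\<beta>. \<Sum>i\<in>UNIV. b $ i * ln (\<beta> $ i)) has_derivative (\<lambda>h. h \<bullet> inv_budget b \<beta>)) (at \<beta>)"
proof -
  have "((\<lambda>\<beta>. b $ i * ln (\<beta> $ i)) has_derivative (\<lambda>h. b $ i * (inverse (\<beta> $ i) * h $ i))) (at \<beta>)" for i
  proof -
    have "((\<lambda>\<beta>. \<beta> $ i) has_derivative (\<lambda>h. h $ i)) (at \<beta>)"
      by (intro bounded_linear.has_derivative[OF bounded_linear_vec_nth] has_derivative_ident)
    then show ?thesis
      using assms by (auto intro!: derivative_eq_intros simp: pos_orthant_def less_imp_neq[THEN not_sym] fun_eq_iff divide_inverse mult_ac)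
  qed
  then have "((\<lambda>\<beta>. \<Sum>i\<in>UNIV. b $ i * ln (\<beta> $ i)) has_derivative (\<lambda>h. \<Sum>i\<in>UNIV. b $ i * (inverse (\<beta> $ i) * h $ i))) (at \<beta>)"
    by (intro has_derivative_sum)
  then show ?thesis by (simp add: inner_vec_def inv_budget_def divide_inverse mult_ac)
qed

lemma F_GDERIV:
  assumes v: "\<And>i. 0 \<le> v i x" "\<And>i. v i x \<le> V" and V: "0 < V" and \<beta>: "\<beta> \<in> pos_orthant" and nt: "\<not> tie v x \<beta>"
  shows "GDERIV (F b v x) \<beta> :> winner_value v x \<beta> - inv_budget b \<beta>"
proof -
  obtain r where r: "0 < r" "winning_margin v r x \<beta>" using not_tie_margin[OF v(1) \<beta> nt] by blast
  define w where "w = winner_value v x \<beta>"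
  have "((\<lambda>y. w \<bullet> y) has_derivative (\<lambda>h. h \<bullet> w)) (at \<beta>)" by (auto intro!: derivative_eq_intros simp: inner_commute)
  then have "((\<lambda>y. top_bid v x y) has_derivative (\<lambda>h. h \<bullet> w)) (at \<beta>)"
  proof (rule has_derivative_transform_within_open[where s="ball \<beta> (r / (2 * V))"])
    fix y assume "y \<in> ball \<beta> (r / (2 * V))"
    then have "2 * V * norm (y - \<beta>) < r" using V by (simp add: dist_norm norm_minus_commute field_simps)
    from margin_stable(3)[OF v r(2) this] show "w \<bullet> y = top_bid v x y" by (simp add: w_def)
  qed (use r V in auto)
  then have "((\<lambda>y. top_bid v x y - (\<Sum>i\<in>UNIV. b $ i * ln (y $ i))) has_derivative (\<lambda>h. h \<bullet> w - h \<bullet> inv_budget b \<beta>)) (at \<beta>)"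
    by (intro has_derivative_diff barrier_GDERIV \<beta>)
  then show ?thesis
    by (simp add: gderiv_def F_eq pacing_objective_def[abs_def] w_def inner_diff_right)
qed

text \<open>Raising the multiplier of one of the tied buyers raises the highest bid, and lowering it does not
  lower the highest bid, as the other tied buyer still bids it.\<close>

lemma tie_second_difference:
  assumes v: "\<And>i. 0 \<le> v i x" and tie: "i \<noteq> j" "\<beta> $ i * v i x = top_bid v x \<beta>" "\<beta> $ j * v j x = top_bid v x \<beta>" and h: "0 < h"
  shows "h * v i x \<le> top_bid v x (\<beta> + h *\<^sub>R axis i 1) + top_bid v x (\<beta> - h *\<^sub>R axis i 1) - 2 * top_bid v x \<beta>"
proof -
  have "top_bid v x \<beta> + h * v i x = (\<beta> + h *\<^sub>R axis i 1) $ i * v i x" using tie by (simp add: axis_def algebra_simps)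
  also have "\<dots> \<le> top_bid v x (\<beta> + h *\<^sub>R axis i 1)" by (rule top_bid_ge)
  finally have 1: "top_bid v x \<beta> + h * v i x \<le> top_bid v x (\<beta> + h *\<^sub>R axis i 1)" .
  have "top_bid v x \<beta> = (\<beta> - h *\<^sub>R axis i 1) $ j * v j x" using tie by (simp add: axis_def)
  also have "\<dots> \<le> top_bid v x (\<beta> - h *\<^sub>R axis i 1)" by (rule top_bid_ge)
  finally show ?thesis using 1 by linarith
qed

lemma top_bid_second_difference_nonneg:
  "0 \<le> top_bid v x (\<beta> + u) + top_bid v x (\<beta> - u) - 2 * top_bid v x \<beta>"
proof -
  have "\<beta> = (1 - 1/2) *\<^sub>R (\<beta> + u) + (1/2) *\<^sub>R (\<beta> - u)" by (simp add: algebra_simps flip: scaleR_add_left)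
  then have "top_bid v x \<beta> \<le> (1 - 1/2) * top_bid v x (\<beta> + u) + 1/2 * top_bid v x (\<beta> - u)"
    using top_bid_convex[of "1/2" v x "\<beta> + u" "\<beta> - u"] by simp
  then show ?thesis by simp
qed

lemma F_not_differentiable_tie:
  assumes v: "\<And>i. 0 \<le> v i x" and \<beta>: "\<beta> \<in> pos_orthant" and t: "tie v x \<beta>"
  shows "\<not> GDERIV (F b v x) \<beta> :> D"
proof
  assume "GDERIV (F b v x) \<beta> :> D"
  then have "((\<lambda>y. F b v x y + (\<Sum>i\<in>UNIV. b $ i * ln (y $ i))) has_derivative (\<lambda>h. h \<bullet> D + h \<bullet> inv_budget b \<beta>)) (at \<beta>)"
    unfolding gderiv_def by (intro has_derivative_add barrier_GDERIV \<beta>)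
  moreover have "(\<lambda>y. F b v x y + (\<Sum>i\<in>UNIV. b $ i * ln (y $ i))) = top_bid v x"
    by (simp add: F_eq pacing_objective_def fun_eq_iff)
  ultimately have d: "top_bid v x differentiable (at \<beta>)" by (auto simp: differentiable_def)
  obtain i j where ij: "i \<noteq> j" "\<beta> $ i * v i x = top_bid v x \<beta>" "\<beta> $ j * v j x = top_bid v x \<beta>" "0 < top_bid v x \<beta>"
    using t by (auto simp: tie_def)
  have "v i x \<le> 0"
    by (rule second_difference_differentiable[OF d zero_less_one, of _ "axis i 1"])
       (use tie_second_difference[OF v ij(1-3)] in auto)
  then have "v i x = 0" using v[of i] by simp
  then show False using ij by simp
qed

text \<open>The explicit default value at kinks makes the gradient measurable in the item.\<close>

lemma F_gradient:
  assumes v: "\<And>i. 0 \<le> v i x" "\<And>i. v i x \<le> V" and V: "0 < V" and \<beta>: "\<beta> \<in> pos_orthant"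
  shows "gradient (F b v x) \<beta> = (if tie v x \<beta> then (THE D. False) else winner_value v x \<beta> - inv_budget b \<beta>)"
  using F_not_differentiable_tie[of v x \<beta> b, OF v(1) \<beta>] gradient_eqI[OF F_GDERIV[of v x V \<beta> b, OF v V \<beta>]]
  by (auto simp: gradient_def)

text \<open>One-sided difference quotients in coordinate \<open>i\<close>: the highest bid is nondecreasing there with
  slope at most \<open>V\<close>, and the barrier is differentiable.\<close>

lemma subgradient_bounds:
  assumes v: "\<And>i. 0 \<le> v i x" "\<And>i. v i x \<le> V" and \<beta>: "\<beta> \<in> pos_orthant"
    and g: "g \<in> subdifferential pos_orthant (F b v x) \<beta>" and b: "0 < b $ i"
  shows "0 \<le> (g + inv_budget b \<beta>) $ i" "(g + inv_budget b \<beta>) $ i \<le> V"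
proof -
  have \<beta>i: "0 < \<beta> $ i" using \<beta> by (auto simp: pos_orthant_def)
  have V: "0 \<le> V" using v[of i] by linarith
  have sub: "h * g $ i \<le> (top_bid v x (\<beta> + h *\<^sub>R axis i 1) - top_bid v x \<beta>) - b $ i * (ln (\<beta> $ i + h) - ln (\<beta> $ i))"
    if "0 < \<beta> $ i + h" for h
  proof -
    let ?y = "\<beta> + h *\<^sub>R axis i 1"
    have "?y \<in> pos_orthant" using \<beta> that by (auto simp: pos_orthant_def axis_def)
    then have "F b v x \<beta> + g \<bullet> (h *\<^sub>R axis i 1) \<le> F b v x ?y" using g by (fastforce simp: subdifferential_def)
    moreover have "(\<Sum>k\<in>UNIV. b $ k * ln (?y $ k)) - (\<Sum>k\<in>UNIV. b $ k * ln (\<beta> $ k)) = b $ i * (ln (\<beta> $ i + h) - ln (\<beta> $ i))"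
    proof -
      have "(\<Sum>k\<in>UNIV. b $ k * ln (?y $ k)) - (\<Sum>k\<in>UNIV. b $ k * ln (\<beta> $ k))
        = (\<Sum>k\<in>UNIV. if k = i then b $ i * (ln (\<beta> $ i + h) - ln (\<beta> $ i)) else 0)"
        unfolding sum_subtractf[symmetric] by (intro sum.cong) (auto simp: axis_def algebra_simps)
      then show ?thesis by simp
    qed
    ultimately show ?thesis by (simp add: F_eq pacing_objective_def inner_axis)
  qed
  have "g $ i \<le> V - b $ i / (\<beta> $ i + h)" if h: "0 < h" for h
  proof -
    have "top_bid v x (\<beta> + h *\<^sub>R axis i 1) - top_bid v x \<beta> \<le> V * h"
      using top_bid_increment_le[of v x V "\<beta> + h *\<^sub>R axis i 1" \<beta>, OF v] h by simp
    moreover have "h / (\<beta> $ i + h) \<le> ln (\<beta> $ i + h) - ln (\<beta> $ i)"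
    proof -
      have "ln (\<beta> $ i / (\<beta> $ i + h)) \<le> \<beta> $ i / (\<beta> $ i + h) - 1" using \<beta>i h by (intro ln_le_minus_one) auto
      then show ?thesis using \<beta>i h by (simp add: ln_div field_simps)
    qed
    then have "b $ i * (h / (\<beta> $ i + h)) \<le> b $ i * (ln (\<beta> $ i + h) - ln (\<beta> $ i))" using b by (intro mult_left_mono) auto
    ultimately have "h * g $ i \<le> V * h - b $ i * (h / (\<beta> $ i + h))" using sub[of h] \<beta>i h by simp
    also have "\<dots> = h * (V - b $ i / (\<beta> $ i + h))" by (simp add: algebra_simps)
    finally show ?thesis using h by simp
  qed
  moreover have "((\<lambda>h. V - b $ i / (\<beta> $ i + h)) \<longlongrightarrow> V - b $ i / (\<beta> $ i + 0)) (at_right 0)"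
    using \<beta>i by (intro tendsto_intros) auto
  ultimately have "g $ i \<le> V - b $ i / \<beta> $ i"
    by (intro tendsto_lowerbound[where F="at_right 0"]) (auto simp: eventually_at_right_less intro: eventually_mono[OF eventually_at_right_less])
  then show "(g + inv_budget b \<beta>) $ i \<le> V" by (simp add: inv_budget_def)
  have "- (b $ i / (\<beta> $ i - h)) \<le> g $ i" if h: "0 < h" "h < \<beta> $ i" for h
  proof -
    have "top_bid v x (\<beta> + (- h) *\<^sub>R axis i 1) \<le> top_bid v x \<beta>"
    proof (rule top_bid_le)
      fix k
      have "(\<beta> + (- h) *\<^sub>R axis i 1) $ k * v k x \<le> \<beta> $ k * v k x"
        using v(1)[of k] h by (intro mult_right_mono) (auto simp: axis_def)
      also have "\<dots> \<le> top_bid v x \<beta>" by (rule top_bid_ge)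
      finally show "(\<beta> + (- h) *\<^sub>R axis i 1) $ k * v k x \<le> top_bid v x \<beta>" .
    qed
    moreover have "- (ln (\<beta> $ i - h) - ln (\<beta> $ i)) \<le> h / (\<beta> $ i - h)"
    proof -
      have "ln (\<beta> $ i / (\<beta> $ i - h)) \<le> \<beta> $ i / (\<beta> $ i - h) - 1" using \<beta>i h by (intro ln_le_minus_one) auto
      then show ?thesis using \<beta>i h by (simp add: ln_div field_simps)
    qed
    then have "b $ i * - (ln (\<beta> $ i - h) - ln (\<beta> $ i)) \<le> b $ i * (h / (\<beta> $ i - h))" using b by (intro mult_left_mono) auto
    ultimately have "- h * g $ i \<le> b $ i * (h / (\<beta> $ i - h))" using sub[of "- h"] h by (simp add: right_diff_distrib)
    moreover have "b $ i * (h / (\<beta> $ i - h)) = h * (b $ i / (\<beta> $ i - h))" by simp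
    ultimately have "h * (- (b $ i / (\<beta> $ i - h))) \<le> h * g $ i"
      unfolding mult_minus_left mult_minus_right by linarith
    then show ?thesis using h(1) by (simp only: mult_le_cancel_left_pos)
  qed
  moreover have "((\<lambda>h. - (b $ i / (\<beta> $ i - h))) \<longlongrightarrow> - (b $ i / (\<beta> $ i - 0))) (at_right 0)"
    using \<beta>i by (intro tendsto_intros) auto
  moreover have "\<forall>\<^sub>F h in at_right 0. h < \<beta> $ i" using \<beta>i by (intro eventually_at_rightI[of 0 "\<beta> $ i"]) auto
  ultimately have "- (b $ i / \<beta> $ i) \<le> g $ i"
    by (intro tendsto_upperbound[where F="at_right 0" and f="\<lambda>h. - (b $ i / (\<beta> $ i - h))"])
       (auto elim!: eventually_elim2[OF eventually_at_right_less])
  then show "0 \<le> (g + inv_budget b \<beta>) $ i" by (simp add: inv_budget_def)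
qed

section \<open>The limit market\<close>

locale fppe_market =
  fixes b :: "real^'n" and M :: "'a measure" and v :: "'n \<Rightarrow> 'a \<Rightarrow> real" and s :: "'a \<Rightarrow> real"
  assumes budgets: "\<And>i. 0 < b $ i"
    and v_nonneg: "\<And>i x. x \<in> space M \<Longrightarrow> 0 \<le> v i x"
    and v_measurable[measurable]: "\<And>i. v i \<in> borel_measurable M"
    and v_bounded: "\<And>i. bdd_above (v i ` space M)"
    and s_integrable: "integrable M s"
    and s_nonneg: "\<And>x. x \<in> space M \<Longrightarrow> 0 \<le> s x"
    and s_total: "(LINT x|M. s x) = 1"
begin

definition vmax :: real where
  "vmax = (SOME V. 0 < V \<and> (\<forall>i. \<forall>x\<in>space M. v i x \<le> V))"

lemma vmax: "0 < vmax" "x \<in> space M \<Longrightarrow> v i x \<le> vmax"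
proof -
  obtain K where K: "\<And>i x. x \<in> space M \<Longrightarrow> v i x \<le> K i"
    using v_bounded unfolding bdd_above_def by (metis imageI)
  have "v i x \<le> 1 + (\<Sum>i\<in>UNIV. \<bar>K i\<bar>)" if "x \<in> space M" for i x
  proof -
    have "\<bar>K i\<bar> \<le> (\<Sum>i\<in>UNIV. \<bar>K i\<bar>)" by (rule member_le_sum) auto
    then show ?thesis using K[OF that, of i] by linarith
  qed
  moreover have "0 < 1 + (\<Sum>i\<in>UNIV. \<bar>K i\<bar>)" by (simp add: add_pos_nonneg sum_nonneg)
  ultimately have "0 < vmax \<and> (\<forall>i. \<forall>x\<in>space M. v i x \<le> vmax)"
    unfolding vmax_def by (intro someI) auto
  then show "0 < vmax" "x \<in> space M \<Longrightarrow> v i x \<le> vmax" by auto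
qed

definition bmin :: real where "bmin = Min (range (\<lambda>i. b $ i))"

lemma bmin: "0 < bmin" "bmin \<le> b $ i"
  using budgets by (auto simp: bmin_def)

definition \<mu> :: "'a measure" where "\<mu> = density M (\<lambda>x. ennreal (s x))"

lemma s_measurable[measurable]: "s \<in> borel_measurable M"
  using s_integrable by (rule borel_measurable_integrable)

lemma sets_mu[simp, measurable_cong]: "sets \<mu> = sets M" and space_mu[simp]: "space \<mu> = space M"
  by (auto simp: \<mu>_def)

sublocale mu: prob_space \<mu>
proof
  have "emeasure \<mu> (space \<mu>) = (\<integral>\<^sup>+x. ennreal (s x) \<partial>M)"
    by (simp add: \<mu>_def emeasure_density cong: nn_integral_cong)
  also have "\<dots> = 1" using s_integrable s_nonneg s_total by (subst nn_integral_eq_integral) auto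
  finally show "emeasure \<mu> (space \<mu>) = 1" .
qed

lemma supply_mean_eq:
  assumes "g \<in> borel_measurable M"
  shows "supply_mean M s g = (LINT x|\<mu>. g x)"
  unfolding supply_mean_def \<mu>_def using assms s_nonneg
  by (subst integral_density) (auto simp: mult.commute)

lemma top_bid_meas[measurable (raw)]:
  "f \<in> measurable N M \<Longrightarrow> \<beta> \<in> borel_measurable N \<Longrightarrow> (\<lambda>d. top_bid v (f d) (\<beta> d)) \<in> borel_measurable N"
  by (rule top_bid_measurable[OF v_measurable])

lemma v_meas[measurable (raw)]: "f \<in> measurable N M \<Longrightarrow> (\<lambda>d. v i (f d)) \<in> borel_measurable N"
  by (rule measurable_compose[OF _ v_measurable])

lemma top_bid_lip: "x \<in> space M \<Longrightarrow> \<bar>top_bid v x \<beta> - top_bid v x \<beta>'\<bar> \<le> vmax * norm (\<beta> - \<beta>')"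
  by (rule top_bid_lipschitz) (auto intro: v_nonneg vmax)

lemma top_bid_abs_le: "x \<in> space M \<Longrightarrow> \<bar>top_bid v x \<beta>\<bar> \<le> vmax * norm \<beta>"
proof -
  have "top_bid v x 0 = 0" using top_bid_attained[of v x 0] by auto
  then show "x \<in> space M \<Longrightarrow> \<bar>top_bid v x \<beta>\<bar> \<le> vmax * norm \<beta>" using top_bid_lip[of x \<beta> 0] by simp
qed

definition bid_mean :: "real^'n \<Rightarrow> real" where "bid_mean \<beta> = (LINT x|\<mu>. top_bid v x \<beta>)"

lemma top_bid_integrable: "integrable \<mu> (\<lambda>x. top_bid v x \<beta>)"
  by (rule mu.integrable_const_bound[where B="vmax * norm \<beta>"]) (auto intro!: AE_I2 top_bid_abs_le)

lemma H_eq: "H b v M s = pacing_objective b bid_mean"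
proof
  fix \<beta>
  have "H b v M s \<beta> = (LINT x|\<mu>. top_bid v x \<beta> - (\<Sum>i\<in>UNIV. b $ i * ln (\<beta> $ i)))"
    unfolding H_def by (subst supply_mean_eq) (auto simp: F_eq pacing_objective_def)
  also have "\<dots> = bid_mean \<beta> - (\<Sum>i\<in>UNIV. b $ i * ln (\<beta> $ i))"
    by (simp add: bid_mean_def top_bid_integrable mu.prob_space[simplified])
  finally show "H b v M s \<beta> = pacing_objective b bid_mean \<beta>" by (simp add: pacing_objective_def)
qed

lemma bid_mean_lip: "\<bar>bid_mean \<beta> - bid_mean \<beta>'\<bar> \<le> vmax * norm (\<beta> - \<beta>')"
proof -
  have "bid_mean \<beta> - bid_mean \<beta>' = (LINT x|\<mu>. top_bid v x \<beta> - top_bid v x \<beta>')"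
    by (simp add: bid_mean_def top_bid_integrable)
  also have "\<bar>\<dots>\<bar> \<le> (LINT x|\<mu>. \<bar>top_bid v x \<beta> - top_bid v x \<beta>'\<bar>)" by (rule integral_abs_bound)
  also have "\<dots> \<le> (LINT x|\<mu>. vmax * norm (\<beta> - \<beta>'))"
    by (intro integral_mono_AE AE_I2) (auto intro!: top_bid_lip integrable_abs Bochner_Integration.integrable_diff top_bid_integrable)
  finally show ?thesis by (simp add: mu.prob_space[simplified])
qed

lemma bid_mean_convex:
  assumes "0 \<le> l" "l \<le> 1"
  shows "bid_mean ((1 - l) *\<^sub>R \<beta> + l *\<^sub>R \<beta>') \<le> (1 - l) * bid_mean \<beta> + l * bid_mean \<beta>'"
proof -
  have "bid_mean ((1 - l) *\<^sub>R \<beta> + l *\<^sub>R \<beta>') \<le> (LINT x|\<mu>. (1 - l) * top_bid v x \<beta> + l * top_bid v x \<beta>')"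
    unfolding bid_mean_def using assms
    by (intro integral_mono top_bid_convex) (auto intro!: Bochner_Integration.integrable_add integrable_mult_right top_bid_integrable)
  then show ?thesis by (simp add: bid_mean_def top_bid_integrable)
qed

lemma bid_mean_nonneg: "(\<And>i. 0 \<le> \<beta> $ i) \<Longrightarrow> 0 \<le> bid_mean \<beta>"
  unfolding bid_mean_def by (intro integral_nonneg_AE AE_I2 top_bid_nonneg) (auto intro: v_nonneg)

end

lemma lipschitz_imp_continuous_on:
  fixes G :: "'v::real_normed_vector \<Rightarrow> real"
  assumes "\<And>x y. \<bar>G x - G y\<bar> \<le> K * norm (x - y)" "0 \<le> K"
  shows "continuous_on S G"
  by (rule lipschitz_on_continuous_on[of K]) (use assms in \<open>auto simp: lipschitz_on_def dist_real_def dist_norm\<close>)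

lemma midpoint_convex:
  fixes G :: "'v::real_vector \<Rightarrow> real"
  assumes "\<And>l. 0 \<le> l \<Longrightarrow> l \<le> 1 \<Longrightarrow> G ((1 - l) *\<^sub>R x + l *\<^sub>R y) \<le> (1 - l) * G x + l * G y"
  shows "G ((1/2) *\<^sub>R (x + y)) \<le> (G x + G y) / 2"
  using assms[of "1/2"] by (simp add: scaleR_add_right)

context fppe_market
begin

abbreviation bstar :: "real^'n" where "bstar \<equiv> beta_star b v M s"

lemma bstar: "bstar \<in> pacing_box" "\<beta> \<in> pacing_box \<Longrightarrow> H b v M s bstar \<le> H b v M s \<beta>"
  unfolding beta_star_def H_eq
  using pacing_objective_arg_min[of bmin b bid_mean] bmin
    lipschitz_imp_continuous_on[OF bid_mean_lip] vmax bid_mean_nonneg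
  by (auto simp: pacing_box_def less_imp_le)

lemma bstar_growth:
  "\<beta> \<in> pacing_box \<Longrightarrow> H b v M s bstar + bmin / 4 * (norm (\<beta> - bstar))\<^sup>2 \<le> H b v M s \<beta>"
  using bstar unfolding H_eq
  by (intro pacing_objective_growth midpoint_convex) (auto intro: bmin bid_mean_convex)

abbreviation data_space :: "nat \<Rightarrow> (nat \<Rightarrow> 'a) measure" where "data_space t \<equiv> PiM {..<t} (\<lambda>_. M)"

lemma data_in_space: "d \<in> space (data_space t) \<Longrightarrow> \<tau> < t \<Longrightarrow> d \<tau> \<in> space M"
  by (auto simp: space_PiM)

definition emp_bid :: "nat \<Rightarrow> (nat \<Rightarrow> 'a) \<Rightarrow> real^'n \<Rightarrow> real" where
  "emp_bid t d \<beta> = (\<Sum>\<tau><t. top_bid v (d \<tau>) \<beta>) / real t"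

lemma H_emp_eq: "0 < t \<Longrightarrow> H_emp b v t d = pacing_objective b (emp_bid t d)"
  by (auto simp: H_emp_def emp_mean_def emp_bid_def F_eq pacing_objective_def fun_eq_iff sum_subtractf diff_divide_distrib)

lemma emp_bid_lip:
  assumes t: "0 < t" and d: "d \<in> space (data_space t)"
  shows "\<bar>emp_bid t d \<beta> - emp_bid t d \<beta>'\<bar> \<le> vmax * norm (\<beta> - \<beta>')"
proof -
  have "emp_bid t d \<beta> - emp_bid t d \<beta>' = (\<Sum>\<tau><t. top_bid v (d \<tau>) \<beta> - top_bid v (d \<tau>) \<beta>') / real t"
    by (simp add: emp_bid_def sum_subtractf diff_divide_distrib)
  also have "\<bar>\<dots>\<bar> = \<bar>\<Sum>\<tau><t. top_bid v (d \<tau>) \<beta> - top_bid v (d \<tau>) \<beta>'\<bar> / real t" by simp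
  also have "\<dots> \<le> (\<Sum>\<tau><t. vmax * norm (\<beta> - \<beta>')) / real t"
    by (intro divide_right_mono order_trans[OF sum_abs] sum_mono top_bid_lip data_in_space[OF d]) auto
  finally show ?thesis using t by simp
qed

lemma emp_bid_convex:
  assumes "0 \<le> l" "l \<le> 1"
  shows "emp_bid t d ((1 - l) *\<^sub>R \<beta> + l *\<^sub>R \<beta>') \<le> (1 - l) * emp_bid t d \<beta> + l * emp_bid t d \<beta>'"
proof -
  have "(\<Sum>\<tau><t. top_bid v (d \<tau>) ((1 - l) *\<^sub>R \<beta> + l *\<^sub>R \<beta>')) \<le> (\<Sum>\<tau><t. (1 - l) * top_bid v (d \<tau>) \<beta> + l * top_bid v (d \<tau>) \<beta>')"
    by (intro sum_mono top_bid_convex assms)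
  then have "emp_bid t d ((1 - l) *\<^sub>R \<beta> + l *\<^sub>R \<beta>') \<le> (\<Sum>\<tau><t. (1 - l) * top_bid v (d \<tau>) \<beta> + l * top_bid v (d \<tau>) \<beta>') / real t"
    unfolding emp_bid_def by (intro divide_right_mono) auto
  also have "\<dots> = (1 - l) * emp_bid t d \<beta> + l * emp_bid t d \<beta>'"
    by (simp add: emp_bid_def sum.distrib sum_distrib_left[symmetric] add_divide_distrib)
  finally show ?thesis .
qed

lemma emp_bid_nonneg: "d \<in> space (data_space t) \<Longrightarrow> (\<And>i. 0 \<le> \<beta> $ i) \<Longrightarrow> 0 \<le> emp_bid t d \<beta>"
  unfolding emp_bid_def
  by (intro divide_nonneg_nonneg sum_nonneg top_bid_nonneg) (auto intro: v_nonneg dest: data_in_space)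

lemma beta_obs:
  assumes "0 < t" "d \<in> space (data_space t)"
  shows "beta_obs b v t d \<in> pacing_box" "\<beta> \<in> pacing_box \<Longrightarrow> H_emp b v t d (beta_obs b v t d) \<le> H_emp b v t d \<beta>"
  unfolding beta_obs_def H_emp_eq[OF assms(1)]
  using pacing_objective_arg_min[of bmin b "emp_bid t d"] bmin
    lipschitz_imp_continuous_on[OF emp_bid_lip[OF assms]] vmax emp_bid_nonneg[OF assms(2)]
  by (auto simp: pacing_box_def less_imp_le)

lemma beta_obs_growth:
  assumes "0 < t" "d \<in> space (data_space t)" "\<beta> \<in> pacing_box"
  shows "H_emp b v t d (beta_obs b v t d) + bmin / 4 * (norm (\<beta> - beta_obs b v t d))\<^sup>2 \<le> H_emp b v t d \<beta>"
  using beta_obs[OF assms(1,2)] assms(3) unfolding H_emp_eq[OF assms(1)]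
  by (intro pacing_objective_growth midpoint_convex) (auto intro: bmin emp_bid_convex)

lemma beta_obs_measurable[measurable]:
  assumes t: "0 < t"
  shows "beta_obs b v t \<in> borel_measurable (data_space t)"
proof (rule measurable_minimiser[where h="\<lambda>d. H_emp b v t d" and c="bmin / 4"])
  fix \<beta> :: "(nat \<Rightarrow> 'a) \<Rightarrow> real^'n" assume [measurable]: "\<beta> \<in> borel_measurable (data_space t)"
  have [measurable]: "(\<lambda>d. top_bid v (d \<tau>) (\<beta> d)) \<in> borel_measurable (data_space t)" if "\<tau> \<in> {..<t}" for \<tau>
    using that by measurable
  show "(\<lambda>d. H_emp b v t d (\<beta> d)) \<in> borel_measurable (data_space t)"
    unfolding H_emp_eq[OF t] pacing_objective_def emp_bid_def by measurable
next
  fix d assume d: "d \<in> space (data_space t)"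
  show "continuous_on pacing_box (H_emp b v t d)"
    unfolding H_emp_eq[OF t]
    by (intro pacing_objective_continuous_on lipschitz_imp_continuous_on[OF emp_bid_lip[OF t d]]) (simp add: vmax less_imp_le)
qed (use t beta_obs beta_obs_growth bmin in auto)

text \<open>Comparing the two growth bounds leaves only the deviation of the empirical bids from their
  means, from which the logarithms have cancelled.\<close>

lemma beta_obs_deviation:
  assumes t: "0 < t" and d: "d \<in> space (data_space t)"
    and dev: "\<And>\<beta>. \<beta> \<in> pacing_box \<Longrightarrow> \<bar>emp_bid t d \<beta> - bid_mean \<beta>\<bar> \<le> e"
  shows "bmin / 4 * (norm (beta_obs b v t d - bstar))\<^sup>2 \<le> e"
proof -
  let ?g = "beta_obs b v t d"
  note g = beta_obs(1)[OF t d]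
  have 1: "H_emp b v t d ?g + bmin / 4 * (norm (?g - bstar))\<^sup>2 \<le> H_emp b v t d bstar"
    using beta_obs_growth[OF t d bstar(1)] by (simp add: norm_minus_commute)
  have 2: "H b v M s bstar + bmin / 4 * (norm (?g - bstar))\<^sup>2 \<le> H b v M s ?g"
    by (rule bstar_growth[OF g])
  show ?thesis using 1 2 dev[OF g] dev[OF bstar(1)]
    unfolding H_eq H_emp_eq[OF t] pacing_objective_def by linarith
qed

lemma tie_pred[measurable (raw)]:
  assumes [measurable]: "f \<in> measurable N M" "\<beta> \<in> borel_measurable N"
  shows "Measurable.pred N (\<lambda>d. tie v (f d) (\<beta> d))"
proof -
  have "(\<lambda>d. tie v (f d) (\<beta> d)) = (\<lambda>d. \<exists>i\<in>UNIV. \<exists>j\<in>UNIV. i \<noteq> j \<and> \<beta> d $ i * v i (f d) = top_bid v (f d) (\<beta> d)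
     \<and> \<beta> d $ j * v j (f d) = top_bid v (f d) (\<beta> d) \<and> 0 < top_bid v (f d) (\<beta> d))"
    by (simp add: tie_def fun_eq_iff)
  then show ?thesis by (simp only:) measurable
qed

lemma winner_value_measurable[measurable (raw)]:
  assumes [measurable]: "f \<in> measurable N M" "\<beta> \<in> borel_measurable N"
  shows "(\<lambda>d. winner_value v (f d) (\<beta> d)) \<in> borel_measurable N"
proof -
  have e: "winner_value v (f d) (\<beta> d) = (\<Sum>i\<in>UNIV. (if \<forall>k\<in>UNIV. k \<noteq> i \<longrightarrow> \<beta> d $ k * v k (f d) < \<beta> d $ i * v i (f d) then v i (f d) else 0) *\<^sub>R axis i 1)" for d
    by (auto simp: vec_eq_iff winner_value_def sum_component axis_def if_distrib[of "\<lambda>x. _ * x"] cong: if_cong)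
  have [measurable]: "Measurable.pred N (\<lambda>d. \<forall>k\<in>UNIV. k \<noteq> i \<longrightarrow> \<beta> d $ k * v k (f d) < \<beta> d $ i * v i (f d))" for i
    by measurable
  show ?thesis unfolding e by measurable
qed

lemma winning_margin_pred[measurable (raw)]:
  assumes [measurable]: "f \<in> measurable N M"
  shows "Measurable.pred N (\<lambda>d. winning_margin v r (f d) \<beta>)"
proof -
  have "(\<lambda>d. winning_margin v r (f d) \<beta>) = (\<lambda>d. (\<forall>k\<in>UNIV. v k (f d) = 0) \<or>
     (\<exists>i\<in>UNIV. \<forall>k\<in>UNIV. k \<noteq> i \<longrightarrow> \<beta> $ k * v k (f d) + r \<le> \<beta> $ i * v i (f d)))"
    by (simp add: winning_margin_def fun_eq_iff)
  then show ?thesis by (simp only:) measurable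
qed

lemma winner_value_norm: "x \<in> space M \<Longrightarrow> norm (winner_value v x \<beta>) \<le> real CARD('n) * vmax"
proof -
  assume x: "x \<in> space M"
  have "norm (winner_value v x \<beta>) \<le> (\<Sum>i\<in>UNIV. \<bar>winner_value v x \<beta> $ i\<bar>)" by (rule norm_le_l1_cart)
  also have "\<dots> \<le> (\<Sum>i\<in>(UNIV::'n set). vmax)"
    using winner_value_nonneg[of v] winner_value_le[of v] x v_nonneg vmax by (intro sum_mono) (auto simp: abs_le_iff order_trans[OF _ less_imp_le[OF vmax(1)]])
  finally show ?thesis by simp
qed

text \<open>A tie creates a kink of the objective, so ties must be null wherever H is differentiable.\<close>

lemma AE_not_tie:
  assumes \<beta>: "\<beta> \<in> pos_orthant" and diff: "H b v M s differentiable (at \<beta>)"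
  shows "AE x in \<mu>. \<not> tie v x \<beta>"
proof -
  have d: "bid_mean differentiable (at \<beta>)"
  proof -
    have "bid_mean = (\<lambda>y. H b v M s y + (\<Sum>i\<in>UNIV. b $ i * ln (y $ i)))"
      by (simp add: H_eq pacing_objective_def fun_eq_iff)
    moreover have "(\<lambda>y. \<Sum>i\<in>UNIV. b $ i * ln (y $ i)) differentiable (at \<beta>)"
      using barrier_GDERIV[OF \<beta>] by (auto simp: differentiable_def)
    ultimately show ?thesis using diff by simp
  qed
  define T where "T i j x \<longleftrightarrow> \<beta> $ i * v i x = top_bid v x \<beta> \<and> \<beta> $ j * v j x = top_bid v x \<beta> \<and> 0 < top_bid v x \<beta>" for i j x
  have Tm[measurable]: "Measurable.pred M (T i j)" for i j unfolding T_def[abs_def] by measurable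
  have "AE x in \<mu>. \<not> T i j x" if ij: "i \<noteq> j" for i j
  proof -
    let ?f = "\<lambda>x. v i x * indicator {x\<in>space M. T i j x} x"
    have int: "integrable \<mu> ?f"
      by (rule mu.integrable_const_bound[where B=vmax])
         (auto intro!: AE_I2 simp: indicator_def vmax v_nonneg less_imp_le)
    have nn: "AE x in \<mu>. 0 \<le> ?f x" by (auto intro!: AE_I2 simp: v_nonneg)
    have "(LINT x|\<mu>. ?f x) \<le> 0"
    proof (rule second_difference_differentiable[OF d zero_less_one, of _ "axis i 1"])
      fix h :: real assume h: "0 < h"
      have "h * (LINT x|\<mu>. ?f x) = (LINT x|\<mu>. h * ?f x)" by simp
      also have "\<dots> \<le> (LINT x|\<mu>. top_bid v x (\<beta> + h *\<^sub>R axis i 1) + top_bid v x (\<beta> - h *\<^sub>R axis i 1) - 2 * top_bid v x \<beta>)"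
      proof (rule integral_mono)
        fix x assume "x \<in> space \<mu>"
        then have x: "x \<in> space M" by simp
        show "h * ?f x \<le> top_bid v x (\<beta> + h *\<^sub>R axis i 1) + top_bid v x (\<beta> - h *\<^sub>R axis i 1) - 2 * top_bid v x \<beta>"
        proof (cases "T i j x")
          case True
          then show ?thesis using tie_second_difference[of v x i j \<beta> h] ij h v_nonneg[OF x] x by (auto simp: T_def)
        next
          case False
          then show ?thesis using top_bid_second_difference_nonneg[of v x \<beta> "h *\<^sub>R axis i 1"] by simp
        qed
      qed (use int top_bid_integrable in auto)
      also have "\<dots> = bid_mean (\<beta> + h *\<^sub>R axis i 1) + bid_mean (\<beta> - h *\<^sub>R axis i 1) - 2 * bid_mean \<beta>"
        by (simp add: bid_mean_def top_bid_integrable)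
      finally show "h * (LINT x|\<mu>. ?f x) \<le> bid_mean (\<beta> + h *\<^sub>R axis i 1) + bid_mean (\<beta> - h *\<^sub>R axis i 1) - 2 * bid_mean \<beta>" .
    qed
    moreover have "0 \<le> (LINT x|\<mu>. ?f x)" using nn by (rule integral_nonneg_AE)
    ultimately have "AE x in \<mu>. ?f x = 0" using integral_nonneg_eq_0_iff_AE[OF int nn] by simp
    then show ?thesis by (rule AE_mp) (auto intro!: AE_I2 simp: T_def)
  qed
  then have "AE x in \<mu>. \<forall>i\<in>UNIV. \<forall>j\<in>UNIV. i \<noteq> j \<longrightarrow> \<not> T i j x"
    by (intro AE_finite_allI) (auto intro!: AE_impI)
  then show ?thesis by (rule AE_mp) (auto intro!: AE_I2 simp: tie_def T_def)
qed

end

section \<open>The observed market\<close>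

locale fppe_sample = fppe_market b M v s
  for b :: "real^'n" and M :: "'a measure" and v :: "'n \<Rightarrow> 'a \<Rightarrow> real" and s :: "'a \<Rightarrow> real" +
  fixes P :: "'w measure" and \<theta> :: "nat \<Rightarrow> 'w \<Rightarrow> 'a"
  assumes prob: "prob_space P"
    and draws_indep: "prob_space.indep_vars P (\<lambda>_. M) \<theta> UNIV"
    and draws_density: "\<And>\<tau>. distributed P M (\<theta> \<tau>) (\<lambda>x. ennreal (s x))"
begin

sublocale P: prob_space P by (rule prob)

lemma draw_measurable[measurable]: "\<theta> \<tau> \<in> measurable P M"
  using draws_density by (rule distributed_measurable)

lemma draw_in_space: "\<omega> \<in> space P \<Longrightarrow> \<theta> \<tau> \<omega> \<in> space M"
  using draw_measurable by (rule measurable_space)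

lemma distr_draw: "distr P M (\<theta> \<tau>) = \<mu>"
  unfolding \<mu>_def using draws_density by (rule distributed_distr_eq_density)

lemma sample_measurable[measurable]: "sample \<theta> t \<in> measurable P (data_space t)"
  unfolding sample_def by (rule measurable_restrict) measurable

lemma sample_in_space: "\<omega> \<in> space P \<Longrightarrow> sample \<theta> t \<omega> \<in> space (data_space t)"
  using sample_measurable by (rule measurable_space)

lemma sample_nth: "\<tau> < t \<Longrightarrow> sample \<theta> t \<omega> \<tau> = \<theta> \<tau> \<omega>"
  by (simp add: sample_def)

text \<open>Hoeffding's inequality, weakened to the rate \<open>1 / t\<close> by \<open>exp (- x) \<le> 1 / x\<close>.\<close>

lemma law_of_large_numbers:
  assumes g[measurable]: "g \<in> borel_measurable M" and K: "\<And>x. x \<in> space M \<Longrightarrow> \<bar>g x\<bar> \<le> K" and e: "0 < e"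
  shows "vanishing P (\<lambda>t. {\<omega>\<in>space P. e \<le> \<bar>(\<Sum>\<tau><t. g (sample \<theta> t \<omega> \<tau>)) / real t - (LINT x|\<mu>. g x)\<bar>})"
proof (rule vanishing_le)
  define K' where "K' = max K 1"
  have K': "0 < K'" "\<And>x. x \<in> space M \<Longrightarrow> \<bar>g x\<bar> \<le> K'" using K by (auto simp: K'_def le_max_iff_disj)
  define c where "c = 2 * e\<^sup>2 / (2 * K')\<^sup>2"
  have c: "0 < c" using K'(1) e by (simp add: c_def)
  show "(\<lambda>t. (2 / c) / real t) \<longlonglongrightarrow> 0" by (rule lim_const_over_n)
  show "\<forall>\<^sub>F t in sequentially. outer_measure_of P {\<omega>\<in>space P. e \<le> \<bar>(\<Sum>\<tau><t. g (sample \<theta> t \<omega> \<tau>)) / real t - (LINT x|\<mu>. g x)\<bar>} \<le> ennreal ((2 / c) / real t)"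
  proof (rule eventually_sequentiallyI[of 1])
    fix t :: nat assume "1 \<le> t"
    then have t: "0 < t" by simp
    have mean: "P.expectation (\<lambda>\<omega>. g (\<theta> 0 \<omega>)) = (LINT x|\<mu>. g x)"
      unfolding distr_draw[symmetric, of 0] by (rule integral_distr[symmetric]) measurable
    have ind: "P.indep_vars (\<lambda>_. borel) (\<lambda>\<tau> \<omega>. g (\<theta> \<tau> \<omega>)) {..<t}"
      by (rule P.indep_vars_compose2[OF P.indep_vars_subset[OF draws_indep]]) auto
    have dist: "distr P borel (\<lambda>\<omega>. g (\<theta> \<tau> \<omega>)) = distr \<mu> borel g" for \<tau>
      unfolding distr_draw[symmetric, of \<tau>] by (subst distr_distr) (auto simp: comp_def)
    interpret hoeff: Hoeffding_ineq_iid P "{..<t}" "\<lambda>\<tau> \<omega>. g (\<theta> \<tau> \<omega>)" "\<lambda>\<omega>. g (\<theta> 0 \<omega>)" "- K'" K' "P.expectation (\<lambda>\<omega>. g (\<theta> 0 \<omega>))"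
    proof unfold_locales
      show "distr P borel (\<lambda>\<omega>. g (\<theta> \<tau> \<omega>)) = distr P borel (\<lambda>\<omega>. g (\<theta> 0 \<omega>))" for \<tau> unfolding dist ..
      show "AE \<omega> in P. g (\<theta> 0 \<omega>) \<in> {- K'..K'}" 
      proof (rule AE_I2)
        fix \<omega> assume "\<omega> \<in> space P"
        then show "g (\<theta> 0 \<omega>) \<in> {- K'..K'}" using K'(2)[OF draw_in_space, of \<omega> 0] by (auto simp: abs_le_iff)
      qed
    qed (use ind in auto)
    let ?A = "{\<omega>\<in>space P. e \<le> \<bar>(\<Sum>\<tau><t. g (sample \<theta> t \<omega> \<tau>)) / real t - (LINT x|\<mu>. g x)\<bar>}"
    have A: "?A = {\<omega>\<in>space P. e \<le> \<bar>(\<Sum>\<tau><t. g (\<theta> \<tau> \<omega>)) / real t - (LINT x|\<mu>. g x)\<bar>}"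
      by (simp add: sample_nth)
    have "P.prob ?A \<le> 2 * exp (- 2 * real t * e\<^sup>2 / (K' - - K')\<^sup>2)"
      unfolding A using hoeff.Hoeffding_ineq_abs_ge'[of e] e K'(1) t by (simp add: mean lessThan_empty_iff)
    also have "- 2 * real t * e\<^sup>2 / (K' - - K')\<^sup>2 = - (c * real t)" by (simp add: c_def)
    also have "2 * exp (- (c * real t)) \<le> 2 * (1 / (c * real t))"
    proof -
      have "c * real t \<le> exp (c * real t)" using exp_ge_add_one_self[of "c * real t"] by linarith
      moreover have "0 < c * real t" using c t by simp
      ultimately have "inverse (exp (c * real t)) \<le> inverse (c * real t)" by (rule le_imp_inverse_le)
      then show ?thesis by (simp add: exp_minus inverse_eq_divide)
    qed
    also have "\<dots> = (2 / c) / real t" by simp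
    finally have "P.prob ?A \<le> (2 / c) / real t" .
    moreover have "?A \<in> sets P" unfolding A by measurable
    ultimately show "outer_measure_of P ?A \<le> ennreal ((2 / c) / real t)"
      by (simp add: P.emeasure_eq_measure ennreal_leI)
  qed
qed

text \<open>A finite net suffices, because the empirical and the expected highest bid share a Lipschitz
  constant. The range of the multipliers is chosen larger than the box, so that test points
  slightly above the upper bound \<open>1\<close> are covered.\<close>

lemma uniform_law_of_large_numbers:
  assumes e: "0 < e"
  shows "vanishing P (\<lambda>t. {\<omega>\<in>space P. \<exists>\<beta>. (\<forall>i. \<bar>\<beta> $ i\<bar> \<le> 2) \<and> e < \<bar>emp_bid t (sample \<theta> t \<omega>) \<beta> - bid_mean \<beta>\<bar>})"
proof -
  let ?C = "cbox (\<chi> i. -2) (\<chi> i. 2) :: (real^'n) set"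
  define \<eta> where "\<eta> = e / (4 * vmax)"
  have \<eta>: "0 < \<eta>" using e vmax(1) by (simp add: \<eta>_def)
  obtain N where N: "finite N" "?C \<subseteq> (\<Union>x\<in>N. ball x \<eta>)"
  proof -
    have "seq_compact ?C" by (intro compact_imp_seq_compact compact_cbox)
    then obtain N where "finite N" "N \<subseteq> ?C" "?C \<subseteq> (\<Union>x\<in>N. ball x \<eta>)"
      using seq_compact_imp_totally_bounded \<eta> by metis
    then show thesis by (rule_tac that)
  qed
  let ?B = "\<lambda>c t. {\<omega>\<in>space P. e / 2 \<le> \<bar>emp_bid t (sample \<theta> t \<omega>) c - bid_mean c\<bar>}"
  have "vanishing P (\<lambda>t. \<Union>c\<in>N. ?B c t)"
  proof (rule vanishing_finite_UN[OF N(1)])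
    fix c
    show "vanishing P (?B c)" unfolding emp_bid_def bid_mean_def
      by (rule law_of_large_numbers[where K="vmax * norm c"]) (use e top_bid_abs_le in auto)
  qed
  then show ?thesis
  proof (rule vanishing_subset)
    show "\<forall>\<^sub>F t in sequentially. {\<omega>\<in>space P. \<exists>\<beta>. (\<forall>i. \<bar>\<beta> $ i\<bar> \<le> 2) \<and> e < \<bar>emp_bid t (sample \<theta> t \<omega>) \<beta> - bid_mean \<beta>\<bar>}
       \<subseteq> (\<Union>c\<in>N. ?B c t)"
    proof (rule eventually_sequentiallyI[of 1], safe)
      fix t :: nat and \<omega> \<beta> assume t: "1 \<le> t" and \<omega>: "\<omega> \<in> space P" and \<beta>: "\<forall>i. \<bar>\<beta> $ i\<bar> \<le> 2"
        and dev: "e < \<bar>emp_bid t (sample \<theta> t \<omega>) \<beta> - bid_mean \<beta>\<bar>"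
      have "\<beta> \<in> ?C" using \<beta> by (auto simp: mem_box_cart abs_le_iff minus_le_iff)
      then obtain c where c: "c \<in> N" "dist c \<beta> < \<eta>" using N by auto
      have "vmax * norm (\<beta> - c) \<le> vmax * \<eta>"
        using c(2) vmax(1) by (intro mult_left_mono) (auto simp: dist_norm norm_minus_commute)
      also have "\<dots> = e / 4" using vmax(1) by (simp add: \<eta>_def)
      finally have "vmax * norm (\<beta> - c) \<le> e / 4" .
      moreover have "\<bar>emp_bid t (sample \<theta> t \<omega>) \<beta> - emp_bid t (sample \<theta> t \<omega>) c\<bar> \<le> vmax * norm (\<beta> - c)"
        using t by (intro emp_bid_lip sample_in_space \<omega>) auto
      moreover have "\<bar>bid_mean \<beta> - bid_mean c\<bar> \<le> vmax * norm (\<beta> - c)" by (rule bid_mean_lip)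
      ultimately have "e / 2 \<le> \<bar>emp_bid t (sample \<theta> t \<omega>) c - bid_mean c\<bar>" using dev by linarith
      then show "\<omega> \<in> (\<Union>c\<in>N. ?B c t)" using c \<omega> by blast
    qed
  qed
qed

abbreviation bobs :: "nat \<Rightarrow> 'w \<Rightarrow> real^'n" where "bobs t \<omega> \<equiv> beta_obs b v t (sample \<theta> t \<omega>)"

lemma beta_obs_consistent:
  assumes r: "0 < r"
  shows "vanishing P (\<lambda>t. {\<omega>\<in>space P. r < norm (bobs t \<omega> - bstar)})"
proof (rule vanishing_subset[OF uniform_law_of_large_numbers])
  let ?e = "bmin / 4 * r\<^sup>2"
  show e: "0 < ?e" using r bmin(1) by simp
  show "\<forall>\<^sub>F t in sequentially. {\<omega>\<in>space P. r < norm (bobs t \<omega> - bstar)}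
     \<subseteq> {\<omega>\<in>space P. \<exists>\<beta>. (\<forall>i. \<bar>\<beta> $ i\<bar> \<le> 2) \<and> ?e < \<bar>emp_bid t (sample \<theta> t \<omega>) \<beta> - bid_mean \<beta>\<bar>}"
  proof (rule eventually_sequentiallyI[of 1], safe, rule ccontr)
    fix t :: nat and \<omega> assume t: "1 \<le> t" and \<omega>: "\<omega> \<in> space P" and far: "r < norm (bobs t \<omega> - bstar)"
      and no: "\<not> (\<exists>\<beta>. (\<forall>i. \<bar>\<beta> $ i\<bar> \<le> 2) \<and> ?e < \<bar>emp_bid t (sample \<theta> t \<omega>) \<beta> - bid_mean \<beta>\<bar>)"
    have "bmin / 4 * (norm (bobs t \<omega> - bstar))\<^sup>2 \<le> ?e"
    proof (rule beta_obs_deviation)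
      fix \<beta> :: "real^'n" assume "\<beta> \<in> pacing_box"
      then have "\<bar>\<beta> $ i\<bar> \<le> 2" for i unfolding pacing_box_def by (smt (verit) mem_Collect_eq)
      then show "\<bar>emp_bid t (sample \<theta> t \<omega>) \<beta> - bid_mean \<beta>\<bar> \<le> ?e" using no by (meson not_le)
    qed (use t \<omega> sample_in_space in auto)
    then have "(norm (bobs t \<omega> - bstar))\<^sup>2 \<le> r\<^sup>2" using bmin(1) by simp
    then have "norm (bobs t \<omega> - bstar) \<le> r" by (rule power2_le_imp_le) (use r in simp)
    then show False using far by simp
  qed
qed

end

context fppe_sample
begin

text \<open>A positive leftover budget makes the objective decrease when that multiplier is raised from any point
  near the equilibrium; by convexity the observed multiplier is therefore pushed to its upper bound.\<close>

lemma beta_obs_active: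
  assumes diff: "H b v M s differentiable (at bstar)" and i: "bstar $ i = 1" and lo: "0 < leftover b v M s $ i"
  shows "vanishing P (\<lambda>t. {\<omega>\<in>space P. bobs t \<omega> $ i < 1})"
proof -
  let ?H = "H b v M s"
  let ?e = "axis i 1 :: real^'n"
  define \<delta> where "\<delta> = leftover b v M s $ i"
  have \<delta>: "0 < \<delta>" using lo by (simp add: \<delta>_def)
  have D: "(?H has_derivative (\<lambda>h. h \<bullet> gradient ?H bstar)) (at bstar)"
    using differentiable_GDERIV[OF diff] by (simp add: gderiv_def)
  have "0 < \<delta> / 2" using \<delta> by simp
  from D[unfolded has_derivative_at_alt, THEN conjunct2, rule_format, OF this]
  obtain d where d: "0 < d" "\<And>y. norm (y - bstar) < d \<Longrightarrow>
     \<bar>?H y - ?H bstar - (y - bstar) \<bullet> gradient ?H bstar\<bar> \<le> \<delta> / 2 * norm (y - bstar)"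
    unfolding real_norm_def by blast
  define h where "h = min (d / 2) 1"
  have h: "0 < h" "h < d" "h \<le> 1" using d(1) by (auto simp: h_def)
  define \<kappa> where "\<kappa> = h * \<delta> / 2"
  have \<kappa>: "0 < \<kappa>" using h \<delta> by (simp add: \<kappa>_def)
  \<comment> \<open>A definite decrease of the limit objective in direction \<open>i\<close>, beyond the upper bound of the box.\<close>
  have drop: "?H (bstar + h *\<^sub>R ?e) - ?H bstar \<le> - \<kappa>"
  proof -
    have "(h *\<^sub>R ?e) \<bullet> gradient ?H bstar = - (h * \<delta>)" by (simp add: \<delta>_def leftover_def inner_axis')
    moreover have "\<bar>?H (bstar + h *\<^sub>R ?e) - ?H bstar - (h *\<^sub>R ?e) \<bullet> gradient ?H bstar\<bar> \<le> \<delta> / 2 * h"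
      using d(2)[of "bstar + h *\<^sub>R ?e"] h by simp
    moreover have "\<delta> / 2 * h = h * \<delta> / 2" by simp
    ultimately show ?thesis unfolding \<kappa>_def by linarith
  qed
  have k8: "0 < \<kappa> / 8" using \<kappa> by simp
  have isc: "isCont (\<lambda>y. b $ i * (ln (y + h) - ln y)) 1" using h by (intro continuous_intros) auto
  obtain r1 where r1: "0 < r1" "\<And>y. \<bar>y - 1\<bar> < r1 \<Longrightarrow>
      \<bar>b $ i * (ln (y + h) - ln y) - b $ i * (ln (1 + h) - ln 1)\<bar> < \<kappa> / 8"
  proof -
    have "\<exists>d>0. \<forall>y. \<bar>y - 1\<bar> < d \<longrightarrow> \<bar>b $ i * (ln (y + h) - ln y) - b $ i * (ln (1 + h) - ln 1)\<bar> < \<kappa> / 8"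
      using isc k8 unfolding continuous_at_real_range real_norm_def by (elim allE impE)
    then show thesis using that by meson
  qed
  define r where "r = min (r1 / 2) (\<kappa> / (8 * vmax))"
  have r: "0 < r" "r < r1" "vmax * r \<le> \<kappa> / 8"
  proof -
    show "0 < r" using r1(1) \<kappa> vmax(1) by (simp add: r_def)
    have "r \<le> r1 / 2" by (simp add: r_def)
    then show "r < r1" using r1(1) by linarith
    have "vmax * r \<le> vmax * (\<kappa> / (8 * vmax))" using vmax(1) by (intro mult_left_mono) (auto simp: r_def)
    also have "\<dots> = \<kappa> / 8" using vmax(1) by simp
    finally show "vmax * r \<le> \<kappa> / 8" .
  qed
  have "vanishing P (\<lambda>t. {\<omega>\<in>space P. \<exists>\<beta>. (\<forall>i. \<bar>\<beta> $ i\<bar> \<le> 2) \<and> \<kappa> / 8 < \<bar>emp_bid t (sample \<theta> t \<omega>) \<beta> - bid_mean \<beta>\<bar>}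
     \<union> {\<omega>\<in>space P. r < norm (bobs t \<omega> - bstar)})"
    using \<kappa> r by (intro vanishing_Un uniform_law_of_large_numbers beta_obs_consistent) auto
  then show ?thesis
  proof (rule vanishing_subset)
    show "\<forall>\<^sub>F t in sequentially. {\<omega>\<in>space P. bobs t \<omega> $ i < 1} \<subseteq>
      {\<omega>\<in>space P. \<exists>\<beta>. (\<forall>i. \<bar>\<beta> $ i\<bar> \<le> 2) \<and> \<kappa> / 8 < \<bar>emp_bid t (sample \<theta> t \<omega>) \<beta> - bid_mean \<beta>\<bar>}
     \<union> {\<omega>\<in>space P. r < norm (bobs t \<omega> - bstar)}"
    proof (rule eventually_sequentiallyI[of 1], rule subsetI, rule ccontr)
      fix t :: nat and \<omega> assume t1: "1 \<le> t" and "\<omega> \<in> {\<omega>\<in>space P. bobs t \<omega> $ i < 1}"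
        and no: "\<omega> \<notin> {\<omega>\<in>space P. \<exists>\<beta>. (\<forall>i. \<bar>\<beta> $ i\<bar> \<le> 2) \<and> \<kappa> / 8 < \<bar>emp_bid t (sample \<theta> t \<omega>) \<beta> - bid_mean \<beta>\<bar>}
     \<union> {\<omega>\<in>space P. r < norm (bobs t \<omega> - bstar)}"
      then have \<omega>: "\<omega> \<in> space P" and lt1: "bobs t \<omega> $ i < 1" by auto
      from t1 have t: "0 < t" by simp
      let ?d = "sample \<theta> t \<omega>"
      let ?g = "bobs t \<omega>"
      have dev: "\<bar>emp_bid t ?d \<beta> - bid_mean \<beta>\<bar> \<le> \<kappa> / 8" if "\<And>k. \<bar>\<beta> $ k\<bar> \<le> 2" for \<beta>
        using no \<omega> that by (auto simp: not_less)
      have near: "norm (?g - bstar) \<le> r" using no \<omega> by auto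
      have d: "?d \<in> space (data_space t)" by (rule sample_in_space[OF \<omega>])
      have box: "0 < ?g $ k" "?g $ k \<le> 1" for k using beta_obs(1)[OF t d] by (auto simp: pacing_box_def)
      let ?y = "?g + h *\<^sub>R ?e"
      have b2: "\<bar>?g $ k\<bar> \<le> 2" for k using box[of k] by linarith
      have y2: "\<bar>?y $ k\<bar> \<le> 2" for k using box[of k] h by (cases "k = i") (auto simp: axis_def)
      have gi: "\<bar>?g $ i - 1\<bar> < r1" using component_le_norm_cart[of "?g - bstar" i] near r(2) i by simp
      have barrier: "(\<Sum>k\<in>UNIV. b $ k * ln ((\<beta> + u *\<^sub>R ?e) $ k)) = (\<Sum>k\<in>UNIV. b $ k * ln (\<beta> $ k)) + b $ i * (ln (\<beta> $ i + u) - ln (\<beta> $ i))" for \<beta> u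
      proof -
        have "(\<Sum>k\<in>UNIV. b $ k * ln ((\<beta> + u *\<^sub>R ?e) $ k)) - (\<Sum>k\<in>UNIV. b $ k * ln (\<beta> $ k))
          = (\<Sum>k\<in>UNIV. if k = i then b $ i * (ln (\<beta> $ i + u) - ln (\<beta> $ i)) else 0)"
          unfolding sum_subtractf[symmetric] by (intro sum.cong) (auto simp: axis_def algebra_simps)
        then show ?thesis by simp
      qed
      have "bid_mean ?y - bid_mean ?g \<le> bid_mean (bstar + h *\<^sub>R ?e) - bid_mean bstar + 2 * (\<kappa> / 8)"
      proof -
        have "\<bar>bid_mean ?y - bid_mean (bstar + h *\<^sub>R ?e)\<bar> \<le> vmax * norm (?g - bstar)"
          using bid_mean_lip[of ?y "bstar + h *\<^sub>R ?e"] by simp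
        moreover have "\<bar>bid_mean ?g - bid_mean bstar\<bar> \<le> vmax * norm (?g - bstar)" by (rule bid_mean_lip)
        moreover have "vmax * norm (?g - bstar) \<le> vmax * r" using near vmax(1) by (intro mult_left_mono) auto
        ultimately show ?thesis using r(3) by linarith
      qed
      then have e1: "emp_bid t ?d ?y - emp_bid t ?d ?g \<le> bid_mean (bstar + h *\<^sub>R ?e) - bid_mean bstar + 4 * (\<kappa> / 8)"
        using dev[OF b2] dev[OF y2] by linarith
      have "bid_mean (bstar + h *\<^sub>R ?e) - bid_mean bstar \<le> - \<kappa> + b $ i * (ln (1 + h) - ln 1)"
        using drop barrier[of bstar h] i by (simp add: H_eq pacing_objective_def)
      then have neg: "(emp_bid t ?d ?y - emp_bid t ?d ?g) - b $ i * (ln (?g $ i + h) - ln (?g $ i)) < 0"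
        using e1 r1(2)[OF gi] \<kappa> by linarith
      \<comment> \<open>The point of comparison may lie outside the box; by convexity the decrease persists, scaled by
        \<open>l\<close>, at the point where the segment towards it leaves the box.\<close>
      define l where "l = min 1 ((1 - ?g $ i) / h)"
      have l: "0 < l" "l \<le> 1" "l * h \<le> 1 - ?g $ i" using lt1 h by (auto simp: l_def min_def field_simps)
      let ?z = "?g + (l * h) *\<^sub>R ?e"
      have z: "?z \<in> pacing_box"
        unfolding pacing_box_def
      proof safe
        fix k show "0 < ?z $ k" "?z $ k \<le> 1" using box[of k] l h by (cases "k = i"; simp add: axis_def add_pos_pos)+
      qed
      have "emp_bid t ?d ?z - emp_bid t ?d ?g \<le> l * (emp_bid t ?d ?y - emp_bid t ?d ?g)"
      proof -
        have "?z = (1 - l) *\<^sub>R ?g + l *\<^sub>R ?y" by (simp add: algebra_simps)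
        then have "emp_bid t ?d ?z \<le> (1 - l) * emp_bid t ?d ?g + l * emp_bid t ?d ?y"
          using emp_bid_convex[of l t ?d ?g ?y] l by simp
        then show ?thesis by (simp add: algebra_simps)
      qed
      moreover have "l * (b $ i * (ln (?g $ i + h) - ln (?g $ i))) \<le> b $ i * (ln (?g $ i + l * h) - ln (?g $ i))"
      proof -
        have "(1 - l) * ln (?g $ i) + l * ln (?g $ i + h) \<le> ln ((1 - l) *\<^sub>R (?g $ i) + l *\<^sub>R (?g $ i + h))"
          using ln_concave l box[of i] h by (intro concave_onD) auto
        also have "(1 - l) *\<^sub>R (?g $ i) + l *\<^sub>R (?g $ i + h) = ?g $ i + l * h" by (simp add: algebra_simps)
        finally have "l * (ln (?g $ i + h) - ln (?g $ i)) \<le> ln (?g $ i + l * h) - ln (?g $ i)" by (simp add: algebra_simps)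
        then have "b $ i * (l * (ln (?g $ i + h) - ln (?g $ i))) \<le> b $ i * (ln (?g $ i + l * h) - ln (?g $ i))"
          using budgets[of i] by (intro mult_left_mono) auto
        then show ?thesis by (simp add: mult_ac)
      qed
      ultimately have "(emp_bid t ?d ?z - emp_bid t ?d ?g) - b $ i * (ln (?g $ i + l * h) - ln (?g $ i))
        \<le> l * ((emp_bid t ?d ?y - emp_bid t ?d ?g) - b $ i * (ln (?g $ i + h) - ln (?g $ i)))"
        unfolding right_diff_distrib[of l] by linarith
      also have "\<dots> < 0" using neg l(1) by (simp add: mult_pos_neg)
      finally have "H_emp b v t ?d ?z < H_emp b v t ?d ?g"
        using barrier[of ?g "l * h"] by (simp add: H_emp_eq[OF t] pacing_objective_def)
      then show False using beta_obs(2)[OF t d z] by simp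
    qed
  qed
qed

end

section \<open>Ties in the sample\<close>

locale fppe_smooth = fppe_sample b M v s P \<theta>
  for b :: "real^'n" and M :: "'a measure" and v :: "'n \<Rightarrow> 'a \<Rightarrow> real" and s :: "'a \<Rightarrow> real"
    and P :: "'w measure" and \<theta> :: "nat \<Rightarrow> 'w \<Rightarrow> 'a" +
  assumes H_C2: "C2_near (H b v M s) bstar"
begin

lemma smooth_radius_exists:
  "\<exists>\<rho>>0. \<forall>\<beta>. (\<forall>i. \<bar>\<beta> $ i - bstar $ i\<bar> \<le> \<rho>) \<longrightarrow> \<beta> \<in> pos_orthant \<and> H b v M s differentiable (at \<beta>)"
proof -
  obtain U where U: "open U" "bstar \<in> U" "H b v M s differentiable_on U"
    using H_C2 by (auto simp: C2_near_def)
  have "open (U \<inter> pos_orthant)" "bstar \<in> U \<inter> pos_orthant"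
    using U open_pos_orthant bstar(1) pacing_box_pos by auto
  then obtain e where e: "0 < e" "ball bstar e \<subseteq> U \<inter> pos_orthant" by (meson open_contains_ball)
  define \<rho> where "\<rho> = e / (2 * real CARD('n))"
  have \<rho>: "0 < \<rho>" using e by (simp add: \<rho>_def)
  have "\<beta> \<in> pos_orthant \<and> H b v M s differentiable (at \<beta>)" if \<beta>: "\<forall>i. \<bar>\<beta> $ i - bstar $ i\<bar> \<le> \<rho>" for \<beta>
  proof -
    have "norm (\<beta> - bstar) \<le> (\<Sum>i\<in>UNIV. \<bar>(\<beta> - bstar) $ i\<bar>)" by (rule norm_le_l1_cart)
    also have "\<dots> \<le> (\<Sum>i\<in>(UNIV::'n set). \<rho>)" using \<beta> by (intro sum_mono) auto
    also have "\<dots> < e" using e by (simp add: \<rho>_def)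
    finally have "\<beta> \<in> ball bstar e" by (simp add: dist_norm norm_minus_commute)
    then have "\<beta> \<in> U" "\<beta> \<in> pos_orthant" using e by auto
    then show ?thesis using U by (metis differentiable_on_def at_within_open)
  qed
  then show ?thesis using \<rho> by blast
qed

definition rad :: real where
  "rad = (SOME \<rho>. 0 < \<rho> \<and> (\<forall>\<beta>. (\<forall>i. \<bar>\<beta> $ i - bstar $ i\<bar> \<le> \<rho>) \<longrightarrow> \<beta> \<in> pos_orthant \<and> H b v M s differentiable (at \<beta>)))"

text \<open>A box rather than a ball, so that coordinates can be moved independently.\<close>

definition near_star :: "real^'n \<Rightarrow> bool" where
  "near_star \<beta> \<longleftrightarrow> (\<forall>i\<in>UNIV. \<bar>\<beta> $ i - bstar $ i\<bar> \<le> rad)"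

lemma rad: "0 < rad" and near_star: "near_star \<beta> \<Longrightarrow> \<beta> \<in> pos_orthant" "near_star \<beta> \<Longrightarrow> H b v M s differentiable (at \<beta>)"
proof -
  have "0 < rad \<and> (\<forall>\<beta>. (\<forall>i. \<bar>\<beta> $ i - bstar $ i\<bar> \<le> rad) \<longrightarrow> \<beta> \<in> pos_orthant \<and> H b v M s differentiable (at \<beta>))"
    unfolding rad_def using smooth_radius_exists by (rule someI_ex)
  then show "0 < rad" "near_star \<beta> \<Longrightarrow> \<beta> \<in> pos_orthant" "near_star \<beta> \<Longrightarrow> H b v M s differentiable (at \<beta>)"
    by (auto simp: near_star_def)
qed

lemma near_star_bstar: "near_star bstar"
  using rad by (simp add: near_star_def)

text \<open>If \<open>x\<close> is tied between \<open>i\<close> and \<open>j\<close> at some point of the box, the ratio of these two multipliers is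
  determined by \<open>x\<close>. The witness raises the two as far as this ratio and the box allow and lowers the
  others as far as the box allows.\<close>

definition tie_witness :: "'n \<Rightarrow> 'n \<Rightarrow> 'a \<Rightarrow> real^'n" where
  "tie_witness i j x = (let y = min (bstar $ i + rad) ((bstar $ j + rad) * v j x / v i x) in
     (\<chi> k. if k = i then y else if k = j then y * v i x / v j x else bstar $ k - rad))"

lemma tie_witness_measurable[measurable (raw)]:
  assumes [measurable]: "f \<in> measurable N M"
  shows "(\<lambda>d. tie_witness i j (f d)) \<in> borel_measurable N"
proof -
  have e: "tie_witness i j (f d) = (\<Sum>k\<in>UNIV. (if k = i then min (bstar $ i + rad) ((bstar $ j + rad) * v j (f d) / v i (f d)) else if k = j
     then min (bstar $ i + rad) ((bstar $ j + rad) * v j (f d) / v i (f d)) * v i (f d) / v j (f d) else bstar $ k - rad) *\<^sub>R axis k 1)" for d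
    by (auto simp: vec_eq_iff tie_witness_def Let_def sum_component axis_def if_distrib[of "\<lambda>x. _ * x"] cong: if_cong)
  show ?thesis unfolding e by measurable
qed

text \<open>Both items force the same ratio of the multipliers \<open>i\<close> and \<open>j\<close>, so both bids move together
  when the two multipliers are raised, and lowering the others only helps: the tie of \<open>x'\<close> persists at a
  point that depends on \<open>x\<close> alone. This replaces the uncountably many candidates \<open>\<beta>\<close> by one.\<close>

lemma tie_witness:
  assumes \<beta>: "near_star \<beta>" and ij: "i \<noteq> j"
    and v: "\<And>k. 0 \<le> v k x" "\<And>k. 0 \<le> v k x'"
    and tx: "\<beta> $ i * v i x = top_bid v x \<beta>" "\<beta> $ j * v j x = top_bid v x \<beta>" "0 < top_bid v x \<beta>"
    and tx': "\<beta> $ i * v i x' = top_bid v x' \<beta>" "\<beta> $ j * v j x' = top_bid v x' \<beta>" "0 < top_bid v x' \<beta>"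
  shows "near_star (tie_witness i j x) \<and> tie v x' (tie_witness i j x)"
proof -
  have \<beta>pos: "0 < \<beta> $ k" for k using near_star(1)[OF \<beta>] by (auto simp: pos_orthant_def)
  have vpos: "0 < v i x" "0 < v j x" "0 < v i x'" "0 < v j x'"
    using tx tx' \<beta>pos[of i] \<beta>pos[of j] by (metis zero_less_mult_pos)+
  define q where "q = v i x / v j x"
  have q: "0 < q" using vpos by (simp add: q_def)
  have \<beta>j: "\<beta> $ j = q * \<beta> $ i" using tx vpos by (simp add: q_def field_simps)
  have q': "v i x' = q * v j x'"
  proof -
    have "\<beta> $ i * v i x' = \<beta> $ i * (q * v j x')" using tx' \<beta>j by (simp add: mult_ac)
    then show ?thesis using \<beta>pos[of i] by simp
  qed
  have nb: "bstar $ k - rad \<le> \<beta> $ k" "\<beta> $ k \<le> bstar $ k + rad" for k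
  proof -
    have "\<bar>\<beta> $ k - bstar $ k\<bar> \<le> rad" using \<beta> by (simp add: near_star_def)
    then show "bstar $ k - rad \<le> \<beta> $ k" "\<beta> $ k \<le> bstar $ k + rad" by linarith+
  qed
  define y where "y = min (bstar $ i + rad) ((bstar $ j + rad) / q)"
  have y1: "\<beta> $ i \<le> y" "y \<le> bstar $ i + rad" "q * y \<le> bstar $ j + rad"
    using nb[of i] nb[of j] q unfolding \<beta>j by (auto simp: y_def min_def field_simps)
  have y2: "q * \<beta> $ i \<le> q * y" using y1 q by (intro mult_left_mono) auto
  define w where "w = tie_witness i j x"
  have w: "w = (\<chi> k. if k = i then y else if k = j then q * y else bstar $ k - rad)"
    unfolding w_def tie_witness_def Let_def y_def q_def by (simp add: vec_eq_iff mult.commute)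
  have ns: "near_star w"
    unfolding near_star_def w using y1 y2 nb[of i] nb[of j] rad \<beta>j by (auto simp: abs_le_iff)
  have wi: "w $ i * v i x' = y * v i x'" "w $ j * v j x' = y * v i x'" using ij by (auto simp: w q')
  have up: "\<beta> $ i * v i x' \<le> y * v i x'" using y1 vpos by (intro mult_right_mono) auto
  have top: "top_bid v x' w = w $ i * v i x'"
  proof (rule top_bid_eqI)
    fix k show "w $ k * v k x' \<le> w $ i * v i x'"
    proof (cases "k = i \<or> k = j")
      case True
      then show ?thesis using wi by auto
    next
      case False
      then have "w $ k * v k x' \<le> \<beta> $ k * v k x'" using nb[of k] v(2)[of k] by (intro mult_right_mono) (auto simp: w)
      also have "\<dots> \<le> \<beta> $ i * v i x'" using tx' top_bid_ge[of \<beta> k v x'] by simp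
      finally show ?thesis using up wi by linarith
    qed
  qed
  have "tie v x' w" unfolding tie_def top using ij wi up \<beta>pos[of i] vpos
    by (intro exI[of _ i] exI[of _ j]) (auto intro: less_le_trans[OF mult_pos_pos])
  then show ?thesis using ns by (simp add: w_def)
qed

lemma near_star_pred[measurable (raw)]:
  assumes [measurable]: "\<beta> \<in> borel_measurable N"
  shows "Measurable.pred N (\<lambda>d. near_star (\<beta> d))"
  unfolding near_star_def by measurable

text \<open>The witness depends on one draw and is a point of differentiability, where the other, independent
  draw is almost surely not tied.\<close>

lemma AE_no_common_tie:
  assumes "\<tau> \<noteq> \<tau>'"
  shows "AE \<omega> in P. \<not> (near_star (tie_witness i j (\<theta> \<tau> \<omega>)) \<and> tie v (\<theta> \<tau>' \<omega>) (tie_witness i j (\<theta> \<tau> \<omega>)))"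
proof -
  have ind: "P.indep_var M (\<theta> \<tau>) M (\<theta> \<tau>')"
  proof -
    have "P.indep_var (PiM {\<tau>} (\<lambda>_. M)) (\<lambda>\<omega>. restrict (\<lambda>i. \<theta> i \<omega>) {\<tau>}) (PiM {\<tau>'} (\<lambda>_. M)) (\<lambda>\<omega>. restrict (\<lambda>i. \<theta> i \<omega>) {\<tau>'})"
      using assms by (intro P.indep_var_restrict[OF draws_indep]) auto
    then have "P.indep_var M ((\<lambda>d. d \<tau>) \<circ> (\<lambda>\<omega>. restrict (\<lambda>i. \<theta> i \<omega>) {\<tau>})) M ((\<lambda>d. d \<tau>') \<circ> (\<lambda>\<omega>. restrict (\<lambda>i. \<theta> i \<omega>) {\<tau>'}))"
      by (rule P.indep_var_compose) auto
    then show ?thesis by (simp add: comp_def)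
  qed
  then have joint: "distr P (M \<Otimes>\<^sub>M M) (\<lambda>\<omega>. (\<theta> \<tau> \<omega>, \<theta> \<tau>' \<omega>)) = \<mu> \<Otimes>\<^sub>M \<mu>"
    using P.indep_var_distribution_eq[of M "\<theta> \<tau>" M "\<theta> \<tau>'"] by (simp add: distr_draw)
  define Q where "Q p \<longleftrightarrow> near_star (tie_witness i j (fst p)) \<and> tie v (snd p) (tie_witness i j (fst p))" for p
  have Q[measurable]: "Measurable.pred (M \<Otimes>\<^sub>M M) Q" unfolding Q_def[abs_def] by measurable
  have "AE x in \<mu>. AE x' in \<mu>. \<not> Q (x, x')"
  proof (rule AE_I2)
    fix x
    show "AE x' in \<mu>. \<not> Q (x, x')"
    proof (cases "near_star (tie_witness i j x)")
      case True
      then show ?thesis using AE_not_tie[OF near_star(1,2), of "tie_witness i j x"] by (simp add: Q_def)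
    qed (simp add: Q_def)
  qed
  then have "AE p in \<mu> \<Otimes>\<^sub>M \<mu>. \<not> Q p"
  proof -
    interpret pp: pair_prob_space \<mu> \<mu> by unfold_locales
    assume *: "AE x in \<mu>. AE x' in \<mu>. \<not> Q (x, x')"
    have "{p \<in> space (\<mu> \<Otimes>\<^sub>M \<mu>). \<not> Q p} \<in> sets (\<mu> \<Otimes>\<^sub>M \<mu>)"
      using sets.sets_Collect_neg[OF predE[OF Q]] by (simp add: sets_pair_measure_cong[OF sets_mu sets_mu] space_pair_measure)
    then show ?thesis using * by (rule pp.AE_pair_measure)
  qed
  then have "AE p in distr P (M \<Otimes>\<^sub>M M) (\<lambda>\<omega>. (\<theta> \<tau> \<omega>, \<theta> \<tau>' \<omega>)). \<not> Q p" unfolding joint .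
  then have "AE \<omega> in P. \<not> Q (\<theta> \<tau> \<omega>, \<theta> \<tau>' \<omega>)" by (subst (asm) AE_distr_iff) auto
  then show ?thesis by (simp add: Q_def)
qed

text \<open>Almost surely no two observations are tied between the same two buyers at a common multiplier
  near the equilibrium, so a tied observation is determined by the pair of buyers it ties.\<close>

lemma AE_few_ties:
  "AE \<omega> in P. \<forall>t. \<forall>\<beta>. near_star \<beta> \<longrightarrow> card {\<tau>. \<tau> < t \<and> tie v (\<theta> \<tau> \<omega>) \<beta>} \<le> (CARD('n))\<^sup>2"
proof -
  have "AE \<omega> in P. \<forall>\<tau> \<tau>'. \<forall>i\<in>UNIV. \<forall>j\<in>UNIV. \<tau> \<noteq> \<tau>' \<longrightarrow>
    \<not> (near_star (tie_witness i j (\<theta> \<tau> \<omega>)) \<and> tie v (\<theta> \<tau>' \<omega>) (tie_witness i j (\<theta> \<tau> \<omega>)))"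
    unfolding AE_all_countable
    by (intro allI AE_finite_allI AE_impI AE_no_common_tie) auto
  then show ?thesis
  proof (rule AE_mp, intro AE_I2 impI allI)
    fix \<omega> t \<beta> assume \<omega>: "\<omega> \<in> space P" and no: "\<forall>\<tau> \<tau>'. \<forall>i\<in>UNIV. \<forall>j\<in>UNIV. \<tau> \<noteq> \<tau>' \<longrightarrow>
      \<not> (near_star (tie_witness i j (\<theta> \<tau> \<omega>)) \<and> tie v (\<theta> \<tau>' \<omega>) (tie_witness i j (\<theta> \<tau> \<omega>)))"
      and \<beta>: "near_star \<beta>"
    define R where "R \<tau> p \<longleftrightarrow> fst p \<noteq> snd p \<and> \<beta> $ fst p * v (fst p) (\<theta> \<tau> \<omega>) = top_bid v (\<theta> \<tau> \<omega>) \<beta> \<and>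
       \<beta> $ snd p * v (snd p) (\<theta> \<tau> \<omega>) = top_bid v (\<theta> \<tau> \<omega>) \<beta> \<and> 0 < top_bid v (\<theta> \<tau> \<omega>) \<beta>" for \<tau> p
    define \<phi> where "\<phi> \<tau> = (SOME p. R \<tau> p)" for \<tau>
    let ?T = "{\<tau>. \<tau> < t \<and> tie v (\<theta> \<tau> \<omega>) \<beta>}"
    have \<phi>: "R \<tau> (\<phi> \<tau>)" if "\<tau> \<in> ?T" for \<tau>
    proof -
      have "\<exists>p. R \<tau> p" using that by (auto simp: tie_def R_def)
      then show ?thesis unfolding \<phi>_def by (rule someI_ex)
    qed
    have "inj_on \<phi> ?T"
    proof (rule inj_onI, rule ccontr)
      fix \<tau> \<tau>' assume T: "\<tau> \<in> ?T" "\<tau>' \<in> ?T" and eq: "\<phi> \<tau> = \<phi> \<tau>'" and ne: "\<tau> \<noteq> \<tau>'"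
      have "near_star (tie_witness (fst (\<phi> \<tau>)) (snd (\<phi> \<tau>)) (\<theta> \<tau> \<omega>)) \<and> tie v (\<theta> \<tau>' \<omega>) (tie_witness (fst (\<phi> \<tau>)) (snd (\<phi> \<tau>)) (\<theta> \<tau> \<omega>))"
        using \<phi>[OF T(1)] \<phi>[OF T(2)] v_nonneg[OF draw_in_space[OF \<omega>]]
        by (intro tie_witness[OF \<beta>]) (auto simp: R_def eq)
      then show False using no ne by blast
    qed
    then have "card ?T \<le> card (UNIV :: ('n \<times> 'n) set)" by (rule card_inj_on_le) auto
    then show "card ?T \<le> (CARD('n))\<^sup>2" by (simp add: power2_eq_square)
  qed
qed

text \<open>As the margin shrinks, the items without it decrease to the tied ones, which are null.\<close>

lemma margin_measure:
  assumes e: "0 < e"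
  obtains r where "0 < r" "mu.prob {x\<in>space M. \<not> winning_margin v r x bstar} < e"
proof -
  define A where "A k = {x\<in>space M. \<not> winning_margin v (1 / real (Suc k)) x bstar}" for k
  have A[measurable]: "A k \<in> sets \<mu>" for k unfolding A_def by measurable
  have dec: "decseq A"
  proof (rule decseq_SucI, safe)
    fix k x assume "x \<in> A (Suc k)"
    then show "x \<in> A k"
      using winning_margin_antimono[of v "1 / real (Suc k)" x bstar "1 / real (Suc (Suc k))"] by (auto simp: A_def frac_le)
  qed
  have "(\<lambda>k. mu.prob (A k)) \<longlonglongrightarrow> mu.prob (\<Inter>k. A k)"
    using dec A by (intro mu.finite_Lim_measure_decseq) blast+
  also have "mu.prob (\<Inter>k. A k) = 0"
  proof -
    have bpos: "bstar \<in> pos_orthant" using near_star near_star_bstar by blast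
    have sub: "(\<Inter>k. A k) \<subseteq> {x\<in>space M. tie v x bstar}"
    proof safe
      fix x assume x: "x \<in> (\<Inter>k. A k)"
      then show xM: "x \<in> space M" by (auto simp: A_def)
      show "tie v x bstar"
      proof (rule ccontr)
        assume "\<not> tie v x bstar"
        then obtain r where r: "0 < r" "winning_margin v r x bstar"
          using not_tie_margin[of v x bstar] v_nonneg[OF xM] bpos by blast
        obtain k where "1 / real (Suc k) < r" using r(1) by (rule nat_approx_posE)
        then have "winning_margin v (1 / real (Suc k)) x bstar" by (intro winning_margin_antimono[OF r(2)] less_imp_le)
        then show False using x by (auto simp: A_def)
      qed
    qed
    have "AE x in \<mu>. \<not> tie v x bstar" by (rule AE_not_tie[OF near_star(1,2)]) (auto intro: near_star_bstar)
    then have "mu.prob {x\<in>space M. tie v x bstar} = 0"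
      by (subst mu.prob_eq_0) auto
    moreover have "mu.prob (\<Inter>k. A k) \<le> mu.prob {x\<in>space M. tie v x bstar}"
      using sub by (intro mu.finite_measure_mono) auto
    ultimately show ?thesis using measure_nonneg[of \<mu> "\<Inter>k. A k"] by linarith
  qed
  finally have "\<forall>\<^sub>F k in sequentially. mu.prob (A k) < e" using e by (rule order_tendstoD)
  then obtain k where "mu.prob (A k) < e" by (auto simp: eventually_sequentially)
  then show ?thesis by (intro that[of "1 / real (Suc k)"]) (auto simp: A_def)
qed

end

section \<open>The bootstrap world\<close>

lemma distr_pair_indep:
  assumes P: "prob_space P" and X[measurable]: "X \<in> measurable P S" and Y[measurable]: "Y \<in> measurable P T"
    and ind: "prob_space.indep_set P (sets (vimage_algebra (space P) X S)) (sets (vimage_algebra (space P) Y T))"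
  shows "distr P (S \<Otimes>\<^sub>M T) (\<lambda>\<omega>. (X \<omega>, Y \<omega>)) = distr P S X \<Otimes>\<^sub>M distr P T Y"
proof -
  interpret prob_space P by fact
  show ?thesis
  proof (rule pair_measure_eqI[symmetric])
    show "sigma_finite_measure (distr P S X)" "sigma_finite_measure (distr P T Y)"
      by (auto intro!: prob_space_imp_sigma_finite prob_space_distr)
    fix A B assume "A \<in> sets (distr P S X)" "B \<in> sets (distr P T Y)"
    then have A[measurable]: "A \<in> sets S" and B[measurable]: "B \<in> sets T" by auto
    have "prob ((X -` A \<inter> space P) \<inter> (Y -` B \<inter> space P)) = prob (X -` A \<inter> space P) * prob (Y -` B \<inter> space P)"
      by (rule indep_setD[OF ind]) (auto intro: in_vimage_algebra)
    moreover have "(\<lambda>\<omega>. (X \<omega>, Y \<omega>)) -` (A \<times> B) \<inter> space P = (X -` A \<inter> space P) \<inter> (Y -` B \<inter> space P)" by auto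
    ultimately show "emeasure (distr P S X) A * emeasure (distr P T Y) B
       = emeasure (distr P (S \<Otimes>\<^sub>M T) (\<lambda>\<omega>. (X \<omega>, Y \<omega>))) (A \<times> B)"
      by (subst (1 2 3) emeasure_distr) (auto simp: emeasure_eq_measure ennreal_mult)
  qed (simp cong: sets_pair_measure_cong)
qed

text \<open>Weights range over a countable set, so measurability in the data for each fixed weight is enough.\<close>

lemma measurable_countable_weights:
  fixes f :: "'d \<times> nat list \<Rightarrow> 'e"
  assumes "\<And>w. (\<lambda>d. f (d, w)) \<in> measurable N K"
  shows "f \<in> measurable (N \<Otimes>\<^sub>M count_space UNIV) K"
proof -
  have "(\<lambda>p. f (fst p, snd p)) \<in> measurable (N \<Otimes>\<^sub>M count_space UNIV) K"
    by (rule measurable_compose_countable'[where f="\<lambda>w p. f (fst p, w)" and g=snd and I=UNIV])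
       (auto intro: measurable_compose[OF _ assms])
  then show ?thesis by simp
qed

locale fppe_bootstrap = fppe_smooth b M v s P \<theta>
  for b :: "real^'n" and M :: "'a measure" and v :: "'n \<Rightarrow> 'a \<Rightarrow> real" and s :: "'a \<Rightarrow> real"
    and P :: "'w measure" and \<theta> :: "nat \<Rightarrow> 'w \<Rightarrow> 'a" +
  fixes W :: "nat \<Rightarrow> 'w \<Rightarrow> nat list"
    and D_F :: "'a \<Rightarrow> real^'n \<Rightarrow> real^'n"
    and \<delta> \<epsilon> \<eta> :: "nat \<Rightarrow> real"
    and beta_boot :: "nat \<Rightarrow> (nat \<Rightarrow> 'a) \<Rightarrow> nat list \<Rightarrow> real^'n"
  assumes W_measurable: "\<And>t. 0 < t \<Longrightarrow> W t \<in> measurable P (count_space UNIV)"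
    and W_multinomial: "\<And>t. 0 < t \<Longrightarrow> distr P (count_space UNIV) (W t) =
          measure_pmf (multinomial_pmf t t (pmf_of_set {..<t}))"
    and W_indep: "\<And>t. 0 < t \<Longrightarrow> prob_space.indep_set P
          (sets (sample_sigma P M \<theta> t))
          (sets (vimage_algebra (space P) (W t) (count_space UNIV)))"
    and D_F_selection: "\<And>x \<beta>. x \<in> space M \<Longrightarrow> \<beta> \<in> pos_orthant \<Longrightarrow>
          D_F x \<beta> \<in> subdifferential pos_orthant (F b v x) \<beta>"
    and hessian_pos_def: "\<And>x. x \<noteq> 0 \<Longrightarrow> 0 < x \<bullet> (limit_hessian b v M s *v x)"
    and no_degenerate: "\<And>i. bstar $ i = 1 \<Longrightarrow> 0 < leftover b v M s $ i"
    and delta_pos: "\<And>t. 0 < t \<Longrightarrow> 0 < \<delta> t" and epsilon_pos: "\<And>t. 0 < t \<Longrightarrow> 0 < \<epsilon> t"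
    and \<delta>_lim: "\<delta> \<longlonglongrightarrow> 0"
    and \<epsilon>_lim: "\<epsilon> \<longlonglongrightarrow> 0"
    and boot_measurable: "\<And>t. 0 < t \<Longrightarrow> (\<lambda>(d, w). beta_boot t d w) \<in>
          borel_measurable (PiM {..<t} (\<lambda>_. M) \<Otimes>\<^sub>M count_space UNIV)"
    and boot_argmin: "\<And>t \<omega>. 0 < t \<Longrightarrow> \<omega> \<in> space P \<Longrightarrow>
          is_arg_min (boot_objective b v D_F (\<epsilon> t) (\<eta> t) t (sample \<theta> t \<omega>) (W t \<omega>))
            (\<lambda>\<beta>. \<beta> \<in> B_hat b v (\<delta> t) t (sample \<theta> t \<omega>))
            (beta_boot t (sample \<theta> t \<omega>) (W t \<omega>))"
    and H_hat_consistent: "tendsto_in_prob P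
          (\<lambda>t \<omega>. H_hat b v (\<eta> t) t (sample \<theta> t \<omega>)) (limit_hessian b v M s)"
begin

abbreviation joint_space :: "nat \<Rightarrow> ((nat \<Rightarrow> 'a) \<times> nat list) measure" where
  "joint_space t \<equiv> data_space t \<Otimes>\<^sub>M count_space UNIV"

lemma joint_measurable: "0 < t \<Longrightarrow> (\<lambda>\<omega>. (sample \<theta> t \<omega>, W t \<omega>)) \<in> measurable P (joint_space t)"
  by (intro measurable_Pair sample_measurable W_measurable)

text \<open>Data and weights are independent, so the weights can be averaged out first.\<close>

lemma nn_integral_resample:
  assumes t: "0 < t" and h[measurable]: "h \<in> borel_measurable (joint_space t)"
  shows "(\<integral>\<^sup>+\<omega>. h (sample \<theta> t \<omega>, W t \<omega>) \<partial>P) = (\<integral>\<^sup>+\<omega>. \<integral>\<^sup>+w. h (sample \<theta> t \<omega>, w) \<partial>resample_pmf t \<partial>P)"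
proof -
  have J: "distr P (joint_space t) (\<lambda>\<omega>. (sample \<theta> t \<omega>, W t \<omega>)) = distr P (data_space t) (sample \<theta> t) \<Otimes>\<^sub>M measure_pmf (resample_pmf t)"
    using distr_pair_indep[OF prob sample_measurable W_measurable[OF t] W_indep[OF t, unfolded sample_sigma_def]]
    unfolding W_multinomial[OF t] resample_pmf_def by simp
  have hm: "h \<in> borel_measurable (distr P (data_space t) (sample \<theta> t) \<Otimes>\<^sub>M measure_pmf (resample_pmf t))"
    using h unfolding J[symmetric] by simp
  have "(\<integral>\<^sup>+\<omega>. h (sample \<theta> t \<omega>, W t \<omega>) \<partial>P) = (\<integral>\<^sup>+p. h p \<partial>distr P (joint_space t) (\<lambda>\<omega>. (sample \<theta> t \<omega>, W t \<omega>)))"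
    using joint_measurable[OF t] by (subst nn_integral_distr) auto
  also have "\<dots> = (\<integral>\<^sup>+d. \<integral>\<^sup>+w. h (d, w) \<partial>resample_pmf t \<partial>distr P (data_space t) (sample \<theta> t))"
    unfolding J by (rule measure_pmf.nn_integral_fst[symmetric]) (rule hm)
  also have "\<dots> = (\<integral>\<^sup>+\<omega>. \<integral>\<^sup>+w. h (sample \<theta> t \<omega>, w) \<partial>resample_pmf t \<partial>P)"
    by (rule nn_integral_distr[OF sample_measurable])
       (use measure_pmf.borel_measurable_nn_integral_fst[OF hm] in \<open>simp add: measurable_distr_eq1\<close>)
  finally show ?thesis .
qed

lemma AE_weights: "0 < t \<Longrightarrow> AE \<omega> in P. W t \<omega> \<in> set_pmf (resample_pmf t)"
proof -
  assume t: "0 < t"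
  have "AE w in distr P (count_space UNIV) (W t). w \<in> set_pmf (resample_pmf t)"
    unfolding W_multinomial[OF t] resample_pmf_def by (rule AE_pmfI)
  then show ?thesis using W_measurable[OF t] by (subst (asm) AE_distr_iff) auto
qed

lemma vanishing_null:
  assumes "\<And>t. 0 < t \<Longrightarrow> AE \<omega> in P. \<omega> \<notin> A t"
  shows "vanishing P (\<lambda>t. {\<omega>\<in>space P. \<omega> \<in> A t})"
proof (rule vanishing_le[where B="\<lambda>_. 0"])
  show "\<forall>\<^sub>F t in sequentially. outer_measure_of P {\<omega>\<in>space P. \<omega> \<in> A t} \<le> ennreal 0"
  proof (rule eventually_sequentiallyI[of 1])
    fix t :: nat assume "1 \<le> t"
    then have "AE \<omega> in P. \<omega> \<notin> A t" using assms by simp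
    then obtain N where N: "{\<omega>\<in>space P. \<not> \<omega> \<notin> A t} \<subseteq> N" "emeasure P N = 0" "N \<in> sets P" by (rule AE_E)
    then have "outer_measure_of P {\<omega>\<in>space P. \<omega> \<in> A t} \<le> outer_measure_of P N"
      by (intro outer_measure_of_mono) auto
    then show "outer_measure_of P {\<omega>\<in>space P. \<omega> \<in> A t} \<le> ennreal 0" using N by simp
  qed
qed simp

lemma resample_weights_sum: "0 < t \<Longrightarrow> w \<in> set_pmf (resample_pmf t) \<Longrightarrow> (\<Sum>\<tau><t. real (w ! \<tau>)) = real t"
proof -
  assume t: "0 < t" and "w \<in> set_pmf (resample_pmf t)"
  then obtain xs where xs: "set xs \<subseteq> {..<t}" "length xs = t" and w: "w = map (count_list xs) [0..<t]"
    by (auto simp: resample_pmf_def multinomial_pmf_def set_pmf_replicate_uniform)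
  have "(\<Sum>\<tau><t. real (w ! \<tau>)) = (\<Sum>\<tau><t. real (count_list xs \<tau>) *\<^sub>R (1::real))" by (simp add: w)
  also have "\<dots> = sum_list (map (\<lambda>_. 1::real) xs)" by (rule sum_count_list[OF xs(1)])
  also have "\<dots> = real t" using xs(2) by (simp add: sum_list_triv)
  finally show ?thesis .
qed

subsection \<open>The linear term of the bootstrap programme\<close>

text \<open>The change of the gradient of the highest bid for one item, off ties, when the point of linearisation moves from the
  equilibrium to its estimate.\<close>

definition gap :: "nat \<Rightarrow> (nat \<Rightarrow> 'a) \<Rightarrow> nat \<Rightarrow> real^'n" where
  "gap t d \<tau> = winner_value v (d \<tau>) (beta_obs b v t d) - winner_value v (d \<tau>) bstar"

text \<open>A bound for the contribution of the observations that are tied at the estimate.\<close>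

definition tie_mass :: "nat \<Rightarrow> (nat \<Rightarrow> 'a) \<Rightarrow> nat list \<Rightarrow> real" where
  "tie_mass t d w = (1 / sqrt (real t)) * (\<Sum>\<tau><t. \<bar>real (w ! \<tau>) - 1\<bar> * (if tie v (d \<tau>) (beta_obs b v t d) then real CARD('n) * vmax else 0))"

definition G_star :: "nat \<Rightarrow> (nat \<Rightarrow> 'a) \<Rightarrow> nat list \<Rightarrow> real^'n" where
  "G_star t d w = boot_fluct t (\<lambda>\<tau>. winner_value v (d \<tau>) bstar) w"

text \<open>Off ties the subgradient is unique. At a tie the selection is arbitrary within the bounds on
  subgradients.\<close>

lemma subgradient_gap:
  assumes x: "x \<in> space M" and \<beta>: "\<beta> \<in> pos_orthant"
  shows "norm (D_F x \<beta> + inv_budget b \<beta> - winner_value v x \<beta>) \<le> (if tie v x \<beta> then real CARD('n) * vmax else 0)"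
proof (cases "tie v x \<beta>")
  case True
  have "norm (D_F x \<beta> + inv_budget b \<beta>) \<le> (\<Sum>i\<in>UNIV. \<bar>(D_F x \<beta> + inv_budget b \<beta>) $ i\<bar>)" by (rule norm_le_l1_cart)
  also have "\<dots> \<le> (\<Sum>i\<in>(UNIV::'n set). vmax)"
  proof (rule sum_mono)
    fix i
    have "0 \<le> (D_F x \<beta> + inv_budget b \<beta>) $ i" "(D_F x \<beta> + inv_budget b \<beta>) $ i \<le> vmax"
      using subgradient_bounds[of v x vmax \<beta> "D_F x \<beta>" b i, OF v_nonneg[OF x] vmax(2)[OF x] \<beta> D_F_selection[OF x \<beta>] budgets]
      by auto
    then show "\<bar>(D_F x \<beta> + inv_budget b \<beta>) $ i\<bar> \<le> vmax" by linarith
  qed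
  finally show ?thesis using True by (simp add: winner_value_tie)
next
  case False
  have "D_F x \<beta> = winner_value v x \<beta> - inv_budget b \<beta>"
    using False by (intro subgradient_eq_gradient[OF D_F_selection[OF x \<beta>] open_pos_orthant \<beta>] F_GDERIV[of v x vmax])
      (auto intro: v_nonneg x vmax \<beta>)
  then show ?thesis using False by simp
qed

text \<open>The gradient of the barrier is the same for all items, so it cancels: the weights sum to \<open>t\<close>.\<close>

lemma G_boot_decomposition:
  assumes t: "0 < t" and d: "d \<in> space (data_space t)" and w: "w \<in> set_pmf (resample_pmf t)"
  shows "norm (G_boot b v D_F t d w - G_star t d w) \<le> norm (boot_fluct t (gap t d) w) + tie_mass t d w"
proof -
  let ?\<beta> = "beta_obs b v t d"
  have \<beta>: "?\<beta> \<in> pos_orthant" using beta_obs(1)[OF t d] pacing_box_pos by blast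
  define r where "r \<tau> = D_F (d \<tau>) ?\<beta> + inv_budget b ?\<beta> - winner_value v (d \<tau>) ?\<beta>" for \<tau>
  have st: "sqrt (real t) * (1 / real t) = 1 / sqrt (real t)" using t by (simp add: field_simps)
  have "G_boot b v D_F t d w = boot_fluct t (\<lambda>\<tau>. D_F (d \<tau>) ?\<beta>) w"
    unfolding G_boot_def boot_mean_def emp_mean_def boot_fluct_def
    by (simp add: scaleR_diff_right[symmetric] st scaleR_diff_left sum_subtractf)
       (simp add: st[simplified] scaleR_diff_right)
  also have "\<dots> = boot_fluct t (\<lambda>\<tau>. gap t d \<tau> + r \<tau> + winner_value v (d \<tau>) bstar - inv_budget b ?\<beta>) w"
    by (simp add: gap_def r_def)
  also have "\<dots> = boot_fluct t (gap t d) w + boot_fluct t r w + G_star t d w - boot_fluct t (\<lambda>_. inv_budget b ?\<beta>) w"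
    by (simp add: boot_fluct_def G_star_def scaleR_add_right scaleR_diff_right sum.distrib sum_subtractf)
  also have "boot_fluct t (\<lambda>_. inv_budget b ?\<beta>) w = 0"
    using resample_weights_sum[OF t w] by (simp add: boot_fluct_def scaleR_left.sum[symmetric] sum_subtractf)
  finally have "G_boot b v D_F t d w - G_star t d w = boot_fluct t (gap t d) w + boot_fluct t r w" by simp
  moreover have "norm (boot_fluct t r w) \<le> tie_mass t d w"
  proof -
    have "norm (\<Sum>\<tau><t. (real (w ! \<tau>) - 1) *\<^sub>R r \<tau>) \<le> (\<Sum>\<tau><t. \<bar>real (w ! \<tau>) - 1\<bar> * (if tie v (d \<tau>) ?\<beta> then real CARD('n) * vmax else 0))"
    proof (rule order_trans[OF norm_sum], rule sum_mono)
      fix \<tau> assume "\<tau> \<in> {..<t}"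
      then have "norm (r \<tau>) \<le> (if tie v (d \<tau>) ?\<beta> then real CARD('n) * vmax else 0)"
        unfolding r_def using data_in_space[OF d] by (intro subgradient_gap \<beta>) auto
      then show "norm ((real (w ! \<tau>) - 1) *\<^sub>R r \<tau>) \<le> \<bar>real (w ! \<tau>) - 1\<bar> * (if tie v (d \<tau>) ?\<beta> then real CARD('n) * vmax else 0)"
        unfolding norm_scaleR real_norm_def by (rule mult_left_mono) simp
    qed
    then have "(1 / sqrt (real t)) * norm (\<Sum>\<tau><t. (real (w ! \<tau>) - 1) *\<^sub>R r \<tau>)
      \<le> (1 / sqrt (real t)) * (\<Sum>\<tau><t. \<bar>real (w ! \<tau>) - 1\<bar> * (if tie v (d \<tau>) ?\<beta> then real CARD('n) * vmax else 0))"
      by (rule mult_left_mono) simp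
    then show ?thesis by (simp add: boot_fluct_def tie_mass_def)
  qed
  ultimately show ?thesis using norm_triangle_ineq[of "boot_fluct t (gap t d) w" "boot_fluct t r w"] by simp
qed

lemma component_data_measurable: "\<tau> < t \<Longrightarrow> (\<lambda>d. d \<tau>) \<in> measurable (data_space t) M"
  by (rule measurable_component_singleton) simp

lemma boot_fluct_measurable:
  fixes a :: "(nat \<Rightarrow> 'a) \<Rightarrow> nat \<Rightarrow> real^'n"
  assumes "\<And>\<tau>. \<tau> < t \<Longrightarrow> (\<lambda>d. a d \<tau>) \<in> borel_measurable (data_space t)"
  shows "(\<lambda>p. boot_fluct t (a (fst p)) (snd p)) \<in> borel_measurable (joint_space t)"
proof (rule measurable_countable_weights)
  fix w :: "nat list"
  show "(\<lambda>d. boot_fluct t (a (fst (d, w))) (snd (d, w))) \<in> borel_measurable (data_space t)"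
    unfolding boot_fluct_def fst_conv snd_conv using assms
    by (intro borel_measurable_scaleR borel_measurable_sum borel_measurable_const) auto
qed

lemma gap_measurable: "0 < t \<Longrightarrow> \<tau> < t \<Longrightarrow> (\<lambda>d. gap t d \<tau>) \<in> borel_measurable (data_space t)"
  unfolding gap_def
  by (intro borel_measurable_diff winner_value_measurable component_data_measurable beta_obs_measurable borel_measurable_const)

lemma nn_integral_resample_real:
  fixes u :: "nat list \<Rightarrow> real"
  assumes "0 < t" "\<And>w. 0 \<le> u w"
  shows "(\<integral>\<^sup>+w. ennreal (u w) \<partial>resample_pmf t) = ennreal (measure_pmf.expectation (resample_pmf t) u)"
  using assms by (intro nn_integral_eq_integral integrable_resample_pmf) auto

lemma expectation_draw_indicator:
  assumes [measurable]: "Measurable.pred M Q"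
  shows "(\<integral>\<^sup>+\<omega>. indicator {x\<in>space M. Q x} (\<theta> \<tau> \<omega>) \<partial>P) = ennreal (mu.prob {x\<in>space M. Q x})"
proof -
  have "(\<integral>\<^sup>+\<omega>. indicator {x\<in>space M. Q x} (\<theta> \<tau> \<omega>) \<partial>P) = (\<integral>\<^sup>+x. indicator {x\<in>space M. Q x} x \<partial>distr P M (\<theta> \<tau>))"
    by (rule nn_integral_distr[symmetric]) auto
  also have "\<dots> = emeasure \<mu> {x\<in>space M. Q x}" unfolding distr_draw by (rule nn_integral_indicator) auto
  finally show ?thesis by (simp add: mu.emeasure_eq_measure)
qed

text \<open>Conditionally on the data the weights have variance at most the empirical second moment, and
  the integrand vanishes unless the item is nearly tied at the equilibrium.\<close>

lemma gap_fluctuation_vanishes: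
  assumes \<zeta>: "0 < \<zeta>"
  shows "vanishing P (\<lambda>t. {\<omega>\<in>space P. \<zeta> \<le> norm (boot_fluct t (gap t (sample \<theta> t \<omega>)) (W t \<omega>))})"
proof (rule vanishing_approx)
  fix e :: real assume e: "0 < e"
  define K where "K = 2 * (real CARD('n) * vmax)"
  have K: "0 < K" using vmax(1) by (simp add: K_def)
  define e' where "e' = e * \<zeta>\<^sup>2 / K\<^sup>2"
  have e': "0 < e'" using e K \<zeta> by (simp add: e'_def)
  \<comment> \<open>The margin is chosen so that the items without it, which alone contribute, have small mass.\<close>
  obtain r where r: "0 < r" "mu.prob {x\<in>space M. \<not> winning_margin v r x bstar} < e'" using margin_measure[OF e'] by blast
  define near where "near t d \<longleftrightarrow> 2 * vmax * norm (beta_obs b v t d - bstar) < r" for t d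
  define h where "h t p = (norm (boot_fluct t (gap t (fst p)) (snd p)))\<^sup>2 * (if near t (fst p) then 1 else 0)" for t and p :: "(nat \<Rightarrow> 'a) \<times> nat list"
  let ?B = "\<lambda>t. {\<omega>\<in>space P. r / (4 * vmax) < norm (bobs t \<omega> - bstar)}"
  let ?C = "\<lambda>t. {\<omega>\<in>space P. \<zeta>\<^sup>2 \<le> h t (sample \<theta> t \<omega>, W t \<omega>)}"
  show "\<exists>B C. (\<forall>\<^sub>F t in sequentially. {\<omega>\<in>space P. \<zeta> \<le> norm (boot_fluct t (gap t (sample \<theta> t \<omega>)) (W t \<omega>))} \<subseteq> B t \<union> C t)
     \<and> vanishing P B \<and> (\<forall>\<^sub>F t in sequentially. outer_measure_of P (C t) \<le> ennreal e)"
  proof (rule exI[of _ ?B], rule exI[of _ ?C], intro conjI)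
    show "\<forall>\<^sub>F t in sequentially. {\<omega>\<in>space P. \<zeta> \<le> norm (boot_fluct t (gap t (sample \<theta> t \<omega>)) (W t \<omega>))} \<subseteq> ?B t \<union> ?C t"
    proof (intro always_eventually allI, safe)
      fix t \<omega> assume \<omega>: "\<omega> \<in> space P" and big: "\<zeta> \<le> norm (boot_fluct t (gap t (sample \<theta> t \<omega>)) (W t \<omega>))"
        and "\<not> \<zeta>\<^sup>2 \<le> h t (sample \<theta> t \<omega>, W t \<omega>)"
      moreover have "\<zeta>\<^sup>2 \<le> (norm (boot_fluct t (gap t (sample \<theta> t \<omega>)) (W t \<omega>)))\<^sup>2" using big \<zeta> by (intro power_mono) auto
      ultimately have "\<not> near t (sample \<theta> t \<omega>)" by (auto simp: h_def)
      then have "r \<le> 2 * vmax * norm (bobs t \<omega> - bstar)" by (simp add: near_def)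
      then have "r / (4 * vmax) \<le> norm (bobs t \<omega> - bstar) / 2" using vmax(1) by (simp add: field_simps)
      moreover have "0 < r / (4 * vmax)" using r vmax(1) by simp
      ultimately show "r / (4 * vmax) < norm (bobs t \<omega> - bstar)" by linarith
    qed
  next
    show "vanishing P ?B" using r vmax(1) by (intro beta_obs_consistent) simp
  next
    show "\<forall>\<^sub>F t in sequentially. outer_measure_of P (?C t) \<le> ennreal e"
    proof (rule eventually_sequentiallyI[of 1])
      fix t :: nat assume "1 \<le> t"
      then have t: "0 < t" by simp
      have near_pred: "Measurable.pred (data_space t) (near t)"
        unfolding near_def[abs_def] using beta_obs_measurable[OF t] by measurable
      have hm[measurable]: "h t \<in> borel_measurable (joint_space t)"
      proof -
        have [measurable]: "(\<lambda>p. boot_fluct t (gap t (fst p)) (snd p)) \<in> borel_measurable (joint_space t)"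
          by (intro boot_fluct_measurable gap_measurable t)
        have [measurable]: "Measurable.pred (joint_space t) (\<lambda>p. near t (fst p))"
          by (rule measurable_compose[OF measurable_fst near_pred])
        show ?thesis unfolding h_def by measurable
      qed
      have hm': "(\<lambda>\<omega>. h t (sample \<theta> t \<omega>, W t \<omega>)) \<in> borel_measurable P"
        by (rule measurable_compose[OF joint_measurable[OF t] hm])
      have cond: "(\<integral>\<^sup>+w. ennreal (h t (sample \<theta> t \<omega>, w)) \<partial>resample_pmf t)
        \<le> (\<Sum>\<tau><t. ennreal (K\<^sup>2 / real t) * indicator {x\<in>space M. \<not> winning_margin v r x bstar} (\<theta> \<tau> \<omega>))" if \<omega>: "\<omega> \<in> space P" for \<omega>
      proof (cases "near t (sample \<theta> t \<omega>)")
        case False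
        then show ?thesis by (simp add: h_def)
      next
        case True
        let ?d = "sample \<theta> t \<omega>"
        have "(\<integral>\<^sup>+w. ennreal (h t (?d, w)) \<partial>resample_pmf t) = ennreal (measure_pmf.expectation (resample_pmf t) (\<lambda>w. (norm (boot_fluct t (gap t ?d) w))\<^sup>2))"
          using True t by (simp add: h_def nn_integral_resample_real)
        also have "\<dots> \<le> ennreal ((\<Sum>\<tau><t. (norm (gap t ?d \<tau>))\<^sup>2) / real t)"
          by (intro ennreal_leI expectation_boot_fluct_square t)
        also have "\<dots> \<le> ennreal (\<Sum>\<tau><t. K\<^sup>2 / real t * indicator {x\<in>space M. \<not> winning_margin v r x bstar} (\<theta> \<tau> \<omega>))"
          unfolding sum_divide_distrib
        proof (intro ennreal_leI sum_mono)
          fix \<tau> assume "\<tau> \<in> {..<t}"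
          then have g: "gap t ?d \<tau> = winner_value v (\<theta> \<tau> \<omega>) (bobs t \<omega>) - winner_value v (\<theta> \<tau> \<omega>) bstar"
            by (simp add: gap_def sample_nth)
          have x: "\<theta> \<tau> \<omega> \<in> space M" by (rule draw_in_space[OF \<omega>])
          show "(norm (gap t ?d \<tau>))\<^sup>2 / real t \<le> K\<^sup>2 / real t * indicator {x\<in>space M. \<not> winning_margin v r x bstar} (\<theta> \<tau> \<omega>)"
          proof (cases "winning_margin v r (\<theta> \<tau> \<omega>) bstar")
            case True
            then have "gap t ?d \<tau> = 0" unfolding g
              using margin_stable(1)[of v "\<theta> \<tau> \<omega>" vmax r bstar "bobs t \<omega>"] v_nonneg[OF x] vmax(2)[OF x] \<open>near t ?d\<close>
              by (simp add: near_def)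
            then show ?thesis by simp
          next
            case False
            have "norm (gap t ?d \<tau>) \<le> K"
              unfolding g K_def using winner_value_norm[OF x, of "bobs t \<omega>"] winner_value_norm[OF x, of bstar]
                norm_triangle_ineq4[of "winner_value v (\<theta> \<tau> \<omega>) (bobs t \<omega>)" "winner_value v (\<theta> \<tau> \<omega>) bstar"] by linarith
            then have "(norm (gap t ?d \<tau>))\<^sup>2 \<le> K\<^sup>2" by (intro power_mono) auto
            then show ?thesis using False x by (simp add: divide_right_mono)
          qed
        qed
        also have "\<dots> = (\<Sum>\<tau><t. ennreal (K\<^sup>2 / real t) * indicator {x\<in>space M. \<not> winning_margin v r x bstar} (\<theta> \<tau> \<omega>))"
        proof -
          have "ennreal (\<Sum>\<tau><t. K\<^sup>2 / real t * indicator {x\<in>space M. \<not> winning_margin v r x bstar} (\<theta> \<tau> \<omega>))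
             = (\<Sum>\<tau><t. ennreal (K\<^sup>2 / real t * indicator {x\<in>space M. \<not> winning_margin v r x bstar} (\<theta> \<tau> \<omega>)))"
            by (rule sum_ennreal[symmetric]) auto
          also have "\<dots> = (\<Sum>\<tau><t. ennreal (K\<^sup>2 / real t) * indicator {x\<in>space M. \<not> winning_margin v r x bstar} (\<theta> \<tau> \<omega>))"
            by (intro sum.cong refl) (simp split: split_indicator)
          finally show ?thesis .
        qed
        finally show ?thesis .
      qed
      have "(\<integral>\<^sup>+\<omega>. ennreal (h t (sample \<theta> t \<omega>, W t \<omega>)) \<partial>P) = (\<integral>\<^sup>+\<omega>. \<integral>\<^sup>+w. ennreal (h t (sample \<theta> t \<omega>, w)) \<partial>resample_pmf t \<partial>P)"
        by (rule nn_integral_resample[OF t, where h="\<lambda>p. ennreal (h t p)"]) measurable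
      also have "\<dots> \<le> (\<integral>\<^sup>+\<omega>. (\<Sum>\<tau><t. ennreal (K\<^sup>2 / real t) * indicator {x\<in>space M. \<not> winning_margin v r x bstar} (\<theta> \<tau> \<omega>)) \<partial>P)"
        by (intro nn_integral_mono cond)
      also have "\<dots> = (\<Sum>\<tau><t. ennreal (K\<^sup>2 / real t) * ennreal (mu.prob {x\<in>space M. \<not> winning_margin v r x bstar}))"
      proof -
        have [measurable]: "(\<lambda>\<omega>. indicator {x\<in>space M. \<not> winning_margin v r x bstar} (\<theta> \<tau> \<omega>) :: ennreal) \<in> borel_measurable P" for \<tau>
          by (rule measurable_compose[OF draw_measurable]) measurable
        show ?thesis
          by (subst nn_integral_sum) (auto simp: nn_integral_cmult expectation_draw_indicator)
      qed
      also have "\<dots> = ennreal (K\<^sup>2 * mu.prob {x\<in>space M. \<not> winning_margin v r x bstar})"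
        using t by (simp add: ennreal_of_nat_eq_real_of_nat flip: ennreal_mult')
      also have "\<dots> \<le> ennreal (e * \<zeta>\<^sup>2)"
        using r(2) K by (intro ennreal_leI) (simp add: e'_def field_simps)
      finally have "outer_measure_of P (?C t) \<le> ennreal (e * \<zeta>\<^sup>2 / \<zeta>\<^sup>2)"
        using \<zeta> by (intro markov_bound hm') auto
      then show "outer_measure_of P (?C t) \<le> ennreal e" using \<zeta> by simp
    qed
  qed
qed

lemma tie_mass_measurable: "0 < t \<Longrightarrow> (\<lambda>p. tie_mass t (fst p) (snd p)) \<in> borel_measurable (joint_space t)"
proof (rule measurable_countable_weights)
  fix w :: "nat list" assume t: "0 < t"
  have [measurable]: "Measurable.pred (data_space t) (\<lambda>d. tie v (d \<tau>) (beta_obs b v t d))" if "\<tau> < t" for \<tau>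
    by (intro tie_pred component_data_measurable beta_obs_measurable t that)
  show "(\<lambda>d. tie_mass t (fst (d, w)) (snd (d, w))) \<in> borel_measurable (data_space t)"
    unfolding tie_mass_def fst_conv snd_conv
    by (intro borel_measurable_times borel_measurable_const borel_measurable_sum measurable_If) auto
qed

text \<open>At most boundedly many terms of the sum are present, each has bounded mean, and the normalisation is
  \<open>t\<^bsup>-1/2\<^esup>\<close>.\<close>

lemma tie_mass_vanishes:
  assumes \<zeta>: "0 < \<zeta>"
  shows "vanishing P (\<lambda>t. {\<omega>\<in>space P. \<zeta> \<le> tie_mass t (sample \<theta> t \<omega>) (W t \<omega>)})"
proof -
  define N where "N = real CARD('n) * vmax"
  have N: "0 < N" using vmax(1) by (simp add: N_def)
  define h where "h t p = tie_mass t (fst p) (snd p) * (if near_star (beta_obs b v t (fst p)) then 1 else 0)" for t and p :: "(nat \<Rightarrow> 'a) \<times> nat list"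
  have tm0: "0 \<le> tie_mass t d w" for t d w
    unfolding tie_mass_def using vmax(1) by (intro mult_nonneg_nonneg sum_nonneg) auto
  let ?B = "\<lambda>t. {\<omega>\<in>space P. rad < norm (bobs t \<omega> - bstar)} \<union> {\<omega>\<in>space P. \<zeta> \<le> h t (sample \<theta> t \<omega>, W t \<omega>)}"
  have hm: "h t \<in> borel_measurable (joint_space t)" if t: "0 < t" for t
  proof -
    note [measurable] = tie_mass_measurable[OF t]
    have [measurable]: "Measurable.pred (joint_space t) (\<lambda>p. near_star (beta_obs b v t (fst p)))"
      by (intro near_star_pred measurable_compose[OF measurable_fst beta_obs_measurable[OF t]])
    show ?thesis unfolding h_def by measurable
  qed
  have "vanishing P (\<lambda>t. {\<omega>\<in>space P. \<zeta> \<le> h t (sample \<theta> t \<omega>, W t \<omega>)})"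
  proof (rule vanishing_markov[OF _ _ _ \<zeta>])
    show "\<forall>\<^sub>F t in sequentially. (\<lambda>\<omega>. h t (sample \<theta> t \<omega>, W t \<omega>)) \<in> borel_measurable P"
      by (rule eventually_sequentiallyI[of 1]) (auto intro!: measurable_compose[OF joint_measurable hm])
    define c where "c = 2 * N * real ((CARD('n))\<^sup>2)"
    show "(\<lambda>t. c / sqrt (real t)) \<longlonglongrightarrow> 0"
      by (intro tendsto_divide_0[OF tendsto_const] filterlim_at_top_imp_at_infinity
          filterlim_compose[OF sqrt_at_top] filterlim_real_sequentially)
    show "\<forall>\<^sub>F t in sequentially. (\<integral>\<^sup>+\<omega>. ennreal (h t (sample \<theta> t \<omega>, W t \<omega>)) \<partial>P) \<le> ennreal (c / sqrt (real t))"
    proof (rule eventually_sequentiallyI[of 1])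
      fix t :: nat assume "1 \<le> t"
      then have t: "0 < t" by simp
      note [measurable] = hm[OF t]
      have "(\<integral>\<^sup>+\<omega>. ennreal (h t (sample \<theta> t \<omega>, W t \<omega>)) \<partial>P) = (\<integral>\<^sup>+\<omega>. \<integral>\<^sup>+w. ennreal (h t (sample \<theta> t \<omega>, w)) \<partial>resample_pmf t \<partial>P)"
        by (rule nn_integral_resample[OF t, where h="\<lambda>p. ennreal (h t p)"]) measurable
      also have "\<dots> \<le> (\<integral>\<^sup>+\<omega>. ennreal (c / sqrt (real t)) \<partial>P)"
      proof (rule nn_integral_mono_AE, rule AE_mp[OF AE_few_ties], intro AE_I2 impI)
        fix \<omega> assume few: "\<forall>t \<beta>. near_star \<beta> \<longrightarrow> card {\<tau>. \<tau> < t \<and> tie v (\<theta> \<tau> \<omega>) \<beta>} \<le> (CARD('n))\<^sup>2"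
        let ?d = "sample \<theta> t \<omega>"
        have h0: "0 \<le> h t (?d, w)" for w by (simp add: h_def tm0)
        have "measure_pmf.expectation (resample_pmf t) (\<lambda>w. h t (?d, w)) \<le> c / sqrt (real t)"
        proof (cases "near_star (bobs t \<omega>)")
          case False
          then show ?thesis using N by (simp add: h_def c_def)
        next
          case True
          let ?T = "{\<tau>. \<tau> < t \<and> tie v (\<theta> \<tau> \<omega>) (bobs t \<omega>)}"
          have "measure_pmf.expectation (resample_pmf t) (\<lambda>w. h t (?d, w))
             = measure_pmf.expectation (resample_pmf t) (\<lambda>w. (\<Sum>\<tau><t. (1 / sqrt (real t) * (if tie v (?d \<tau>) (bobs t \<omega>) then N else 0)) * \<bar>real (w ! \<tau>) - 1\<bar>))"
            unfolding h_def tie_mass_def fst_conv snd_conv sum_distrib_left N_def[symmetric]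
            using True by (simp add: mult_ac)
          also have "\<dots> = (\<Sum>\<tau><t. (1 / sqrt (real t) * (if tie v (?d \<tau>) (bobs t \<omega>) then N else 0)) * measure_pmf.expectation (resample_pmf t) (\<lambda>w. \<bar>real (w ! \<tau>) - 1\<bar>))"
            by (subst Bochner_Integration.integral_sum) (auto intro: integrable_resample_pmf t)
          also have "\<dots> \<le> (\<Sum>\<tau><t. (1 / sqrt (real t) * (if tie v (?d \<tau>) (bobs t \<omega>) then N else 0)) * 2)"
            using N by (intro sum_mono mult_left_mono expectation_abs_weight_le t) auto
          also have "\<dots> = (\<Sum>\<tau><t. if tie v (\<theta> \<tau> \<omega>) (bobs t \<omega>) then 2 * N / sqrt (real t) else 0)"
            by (intro sum.cong refl) (auto simp: sample_nth)
          also have "\<dots> = real (card ?T) * (2 * N / sqrt (real t))"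
          proof -
            have "{..<t} \<inter> {\<tau>. tie v (\<theta> \<tau> \<omega>) (bobs t \<omega>)} = ?T" by auto
            then show ?thesis by (simp add: sum.If_cases)
          qed
          also have "\<dots> \<le> real ((CARD('n))\<^sup>2) * (2 * N / sqrt (real t))"
            using few True N by (intro mult_right_mono of_nat_mono) auto
          also have "\<dots> = c / sqrt (real t)" by (simp add: c_def)
          finally show ?thesis .
        qed
        then show "(\<integral>\<^sup>+w. ennreal (h t (?d, w)) \<partial>resample_pmf t) \<le> ennreal (c / sqrt (real t))"
          using h0 by (simp add: nn_integral_resample_real[OF t] ennreal_leI)
      qed
      also have "\<dots> = ennreal (c / sqrt (real t))" by (simp add: P.emeasure_space_1)
      finally show "(\<integral>\<^sup>+\<omega>. ennreal (h t (sample \<theta> t \<omega>, W t \<omega>)) \<partial>P) \<le> ennreal (c / sqrt (real t))" .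
    qed
  qed
  then have "vanishing P ?B" using rad by (intro vanishing_Un beta_obs_consistent)
  then show ?thesis
  proof (rule vanishing_subset, intro always_eventually allI)
    fix t
    show "{\<omega>\<in>space P. \<zeta> \<le> tie_mass t (sample \<theta> t \<omega>) (W t \<omega>)} \<subseteq> ?B t"
    proof (rule subsetI, rule ccontr)
      fix \<omega> assume "\<omega> \<in> {\<omega>\<in>space P. \<zeta> \<le> tie_mass t (sample \<theta> t \<omega>) (W t \<omega>)}" and no: "\<omega> \<notin> ?B t"
      then have \<omega>: "\<omega> \<in> space P" "\<zeta> \<le> tie_mass t (sample \<theta> t \<omega>) (W t \<omega>)" by auto
      then have "norm (bobs t \<omega> - bstar) \<le> rad" using no by auto
      then have "near_star (bobs t \<omega>)"
        unfolding near_star_def using component_le_norm_cart[of "bobs t \<omega> - bstar"] by (auto intro: order_trans)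
      then show False using \<omega> no by (auto simp: h_def)
    qed
  qed
qed


subsection \<open>The bootstrap estimator is asymptotically linear\<close>

abbreviation hess :: "real^'n^'n" where "hess \<equiv> limit_hessian b v M s"

definition paced :: "'n set" where "paced = {i. bstar $ i < 1}"

definition Q :: "real^'n^'n" where
  "Q = moore_penrose (unpaced_proj b v M s ** hess ** unpaced_proj b v M s)"

lemma unpaced_proj_eq: "unpaced_proj b v M s = diag_proj paced"
  by (simp add: unpaced_proj_def diag_proj_def paced_def vec_eq_iff)

lemma num_hessian_symmetric: "transpose (num_hessian e g \<beta>) = num_hessian e g \<beta>"
  unfolding num_hessian_def transpose_def vec_eq_iff
  by (simp add: algebra_simps)

text \<open>Numerical Hessians are symmetric, and so is their limit in probability.\<close>

lemma hess_symmetric: "transpose hess = hess"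
proof -
  have "hess $ i $ j = hess $ j $ i" for i j
  proof (rule ccontr)
    assume ne: "hess $ i $ j \<noteq> hess $ j $ i"
    define e where "e = \<bar>hess $ i $ j - hess $ j $ i\<bar> / 3"
    have e: "0 < e" using ne by (simp add: e_def)
    have "(\<lambda>t. outer_measure_of P {\<omega>\<in>space P. e < dist (H_hat b v (\<eta> t) t (sample \<theta> t \<omega>)) hess}) \<longlonglongrightarrow> 0"
      using H_hat_consistent e by (auto simp: tendsto_in_prob_def)
    then have "\<forall>\<^sub>F t in sequentially. outer_measure_of P {\<omega>\<in>space P. e < dist (H_hat b v (\<eta> t) t (sample \<theta> t \<omega>)) hess} < 1"
      by (rule order_tendstoD) simp
    then obtain t where t: "outer_measure_of P {\<omega>\<in>space P. e < dist (H_hat b v (\<eta> t) t (sample \<theta> t \<omega>)) hess} < 1"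
      by (auto simp: eventually_sequentially)
    have "\<exists>\<omega>\<in>space P. dist (H_hat b v (\<eta> t) t (sample \<theta> t \<omega>)) hess \<le> e"
    proof (rule ccontr)
      assume "\<not> ?thesis"
      then have "{\<omega>\<in>space P. e < dist (H_hat b v (\<eta> t) t (sample \<theta> t \<omega>)) hess} = space P" by auto
      then show False using t by (simp add: P.emeasure_space_1)
    qed
    then obtain \<omega> where "dist (H_hat b v (\<eta> t) t (sample \<theta> t \<omega>)) hess \<le> e" by blast
    moreover define A where "A = H_hat b v (\<eta> t) t (sample \<theta> t \<omega>)"
    ultimately have "norm (A - hess) \<le> e" by (simp add: dist_norm)
    then have c: "\<bar>A $ k $ l - hess $ k $ l\<bar> \<le> e" for k l
    proof -
      have "norm ((A - hess) $ k) \<le> norm (A - hess)" by (rule Finite_Cartesian_Product.norm_nth_le)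
      then show ?thesis using component_le_norm_cart[of "(A - hess) $ k" l] \<open>norm (A - hess) \<le> e\<close> by simp
    qed
    have "transpose A = A" unfolding A_def H_hat_def by (rule num_hessian_symmetric)
    moreover have "A $ i $ j = transpose A $ j $ i" by (simp add: transpose_def)
    ultimately have "A $ i $ j = A $ j $ i" by simp
    then have "\<bar>hess $ i $ j - hess $ j $ i\<bar> \<le> 2 * e" using c[of i j] c[of j i] by linarith
    then show False using ne by (simp add: e_def)
  qed
  then show ?thesis by (simp add: transpose_def vec_eq_iff)
qed

lemma Q: "transpose Q = Q" "diag_proj paced ** Q = Q" "diag_proj paced ** hess ** Q = diag_proj paced"
  using moore_penrose_compression[OF hess_symmetric hessian_pos_def, of paced]
  unfolding Q_def unpaced_proj_eq by auto

lemma Q_component: "i \<notin> paced \<Longrightarrow> (Q *v x) $ i = 0"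
proof -
  assume "i \<notin> paced"
  moreover have "(Q *v x) $ i = (diag_proj paced *v (Q *v x)) $ i" by (simp add: matrix_vector_mul_assoc Q(2))
  ultimately show ?thesis by (simp add: diag_proj_mult_vec)
qed

text \<open>The point \<open>- Q g\<close> solves the quadratic programme restricted to directions that vanish off the paced
  buyers.\<close>

lemma Q_stationary:
  assumes e: "\<And>i. i \<notin> paced \<Longrightarrow> e $ i = 0"
  shows "(hess *v (- (Q *v g)) + g) \<bullet> e = 0"
proof -
  let ?P = "diag_proj paced"
  have Pe: "x \<bullet> e = (?P *v x) \<bullet> e" for x
    using e by (auto simp: inner_vec_def diag_proj_mult_vec intro!: sum.cong)
  have "hess *v (- (Q *v g)) = - (hess *v (Q *v g))"
    using matrix_vector_mult_scaleR[of hess "- 1" "Q *v g"] by simp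
  moreover have "?P *v (hess *v (Q *v g)) = ?P *v g"
    by (simp add: matrix_vector_mul_assoc matrix_mul_assoc Q(3))
  ultimately have "?P *v (hess *v (- (Q *v g)) + g) = 0"
    by (simp add: matrix_vector_mult_diff_distrib)
  then show ?thesis using Pe[of "hess *v (- (Q *v g)) + g"] by simp
qed

definition boot_error :: "nat \<Rightarrow> (nat \<Rightarrow> 'a) \<Rightarrow> nat list \<Rightarrow> real^'n" where
  "boot_error t d w = (1 / \<epsilon> t) *\<^sub>R (beta_boot t d w - beta_obs b v t d)"

definition linear_part :: "nat \<Rightarrow> (nat \<Rightarrow> 'a) \<Rightarrow> nat list \<Rightarrow> real^'n" where
  "linear_part t d w = boot_fluct t (\<lambda>\<tau>. - (Q *v winner_value v (d \<tau>) bstar)) w"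

lemma linear_part_eq: "linear_part t d w = - (Q *v G_star t d w)"
proof -
  have "Q *v (\<Sum>\<tau><t. (real (w ! \<tau>) - 1) *\<^sub>R winner_value v (d \<tau>) bstar) = (\<Sum>\<tau><t. (real (w ! \<tau>) - 1) *\<^sub>R (Q *v winner_value v (d \<tau>) bstar))"
    by (induction t) (auto simp: matrix_vector_right_distrib matrix_vector_mult_scaleR)
  then show ?thesis
    by (simp add: linear_part_def G_star_def boot_fluct_def matrix_vector_mult_scaleR sum_negf)
qed

text \<open>On the event that the active set has been identified and the interior box constraints are
  slack, the bootstrap programme is an equality-constrained quadratic programme in the rescaled
  variable; its limit problem is solved by \<open>- Q g\<close>.\<close>

lemma boot_error_near_solution:
  assumes t: "0 < t" and \<omega>: "\<omega> \<in> space P"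
    and \<kappa>: "0 < \<kappa>" "\<And>i. i \<in> paced \<Longrightarrow> \<kappa> \<le> bobs t \<omega> $ i \<and> bobs t \<omega> $ i \<le> 1 - \<kappa>"
    and act: "\<And>i. i \<notin> paced \<Longrightarrow> bobs t \<omega> $ i = 1" and \<delta>: "\<delta> t \<le> \<kappa>"
    and m: "0 < m" "\<And>x. m * norm x ^ 2 \<le> x \<bullet> (hess *v x)"
    and \<rho>: "norm (H_hat b v (\<eta> t) t (sample \<theta> t \<omega>) - hess) \<le> \<rho>" "\<rho> \<le> m / 2"
  defines "g \<equiv> G_boot b v D_F t (sample \<theta> t \<omega>) (W t \<omega>)"
  assumes small: "\<epsilon> t * norm (Q *v g) \<le> \<kappa>"
  shows "norm (boot_error t (sample \<theta> t \<omega>) (W t \<omega>) + Q *v g) \<le> 4 * \<rho> / m * norm (Q *v g)"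
proof -
  let ?d = "sample \<theta> t \<omega>"
  let ?w = "W t \<omega>"
  let ?\<gamma> = "bobs t \<omega>"
  define A where "A = H_hat b v (\<eta> t) t ?d"
  define q where "q = - (Q *v g)"
  define u where "u = boot_error t ?d ?w"
  have \<epsilon>: "0 < \<epsilon> t" by (rule epsilon_pos[OF t])
  have Ih: "I_hat b v (\<delta> t) t ?d = - paced"
  proof -
    have "1 - \<delta> t < ?\<gamma> $ i \<longleftrightarrow> i \<notin> paced" for i
      using \<kappa>(2)[of i] act[of i] \<delta> delta_pos[OF t] by (cases "i \<in> paced") auto
    then show ?thesis by (auto simp: I_hat_def)
  qed
  have qi: "q $ i = 0" if "i \<notin> paced" for i using Q_component[OF that] by (simp add: q_def)
  have qs: "\<bar>\<epsilon> t * q $ i\<bar> \<le> \<kappa>" for i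
  proof -
    have "\<bar>\<epsilon> t * q $ i\<bar> = \<epsilon> t * \<bar>q $ i\<bar>" using \<epsilon> by (simp add: abs_mult)
    also have "\<dots> \<le> \<epsilon> t * norm (Q *v g)"
      using \<epsilon> component_le_norm_cart[of q i] by (intro mult_left_mono) (auto simp: q_def)
    finally show ?thesis using small by linarith
  qed
  have feas: "?\<gamma> + \<epsilon> t *\<^sub>R q \<in> B_hat b v (\<delta> t) t ?d"
    unfolding B_hat_def Ih
  proof (intro CollectI conjI allI ballI)
    fix i
    show "0 \<le> (?\<gamma> + \<epsilon> t *\<^sub>R q) $ i" "(?\<gamma> + \<epsilon> t *\<^sub>R q) $ i \<le> 1"
      using \<kappa>(2)[of i] act[of i] qi[of i] qs[of i] by (cases "i \<in> paced"; auto simp: abs_le_iff)+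
  next
    fix i assume "i \<in> - paced"
    then show "(?\<gamma> + \<epsilon> t *\<^sub>R q) $ i = 1" using act[of i] qi[of i] by simp
  qed
  have bu: "beta_boot t ?d ?w = ?\<gamma> + \<epsilon> t *\<^sub>R u" using \<epsilon> by (simp add: u_def boot_error_def)
  have am: "beta_boot t ?d ?w \<in> B_hat b v (\<delta> t) t ?d"
     "boot_objective b v D_F (\<epsilon> t) (\<eta> t) t ?d ?w (beta_boot t ?d ?w) \<le> boot_objective b v D_F (\<epsilon> t) (\<eta> t) t ?d ?w (?\<gamma> + \<epsilon> t *\<^sub>R q)"
    using boot_argmin[OF t \<omega>] feas by (auto simp: is_arg_min_linorder)
  have obj: "boot_objective b v D_F (\<epsilon> t) (\<eta> t) t ?d ?w (?\<gamma> + \<epsilon> t *\<^sub>R x) = (\<epsilon> t)\<^sup>2 * (g \<bullet> x + 1/2 * (x \<bullet> (A *v x)))" for x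
  proof -
    have "?\<gamma> - (?\<gamma> + \<epsilon> t *\<^sub>R x) = (- \<epsilon> t) *\<^sub>R x" by simp
    then show ?thesis
      unfolding boot_objective_def g_def[symmetric] A_def[symmetric]
      by (simp only: matrix_vector_mult_scaleR) (simp add: power2_eq_square algebra_simps)
  qed
  have "g \<bullet> u + 1/2 * (u \<bullet> (A *v u)) \<le> g \<bullet> q + 1/2 * (q \<bullet> (A *v q))"
    using am(2) \<epsilon> unfolding bu obj by simp
  moreover have "(u - q) $ i = 0" if "i \<notin> paced" for i
  proof -
    have "beta_boot t ?d ?w $ i = 1" using am(1) that by (auto simp: B_hat_def Ih)
    then have "u $ i = 0" using act[OF that] bu \<epsilon> by simp
    then show ?thesis using qi[OF that] by simp
  qed
  then have "(hess *v q + g) \<bullet> (u - q) = 0" unfolding q_def by (intro Q_stationary) auto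
  moreover have "transpose A = A" unfolding A_def H_hat_def by (rule num_hessian_symmetric)
  ultimately have "norm (u - q) \<le> 4 * \<rho> / m * norm q"
    using m \<rho> unfolding A_def[symmetric] by (intro quadratic_minimiser_perturbation) auto
  then show ?thesis by (simp add: u_def q_def)
qed

text \<open>Given the data, the second moment is at most the square of the bound on the summands; Markov's
  inequality concludes.\<close>

lemma G_star_bounded_in_prob:
  assumes e: "0 < e"
  obtains K where "0 < K" "\<forall>\<^sub>F t in sequentially. outer_measure_of P {\<omega>\<in>space P. K \<le> norm (G_star t (sample \<theta> t \<omega>) (W t \<omega>))} \<le> ennreal e"
proof -
  define N where "N = real CARD('n) * vmax"
  have N: "0 < N" using vmax(1) by (simp add: N_def)
  define K where "K = N / sqrt e"
  have K: "0 < K" "N\<^sup>2 / K\<^sup>2 = e" using N e by (auto simp: K_def power_divide)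
  have bound: "outer_measure_of P {\<omega>\<in>space P. K \<le> norm (G_star t (sample \<theta> t \<omega>) (W t \<omega>))} \<le> ennreal e" if t: "0 < t" for t
  proof -
    have Gm[measurable]: "(\<lambda>p. G_star t (fst p) (snd p)) \<in> borel_measurable (joint_space t)"
      unfolding G_star_def
      by (intro boot_fluct_measurable winner_value_measurable component_data_measurable borel_measurable_const)
    have Gm': "(\<lambda>\<omega>. (norm (G_star t (sample \<theta> t \<omega>) (W t \<omega>)))\<^sup>2) \<in> borel_measurable P"
      using measurable_compose[OF joint_measurable[OF t] Gm] by simp
    have "(\<integral>\<^sup>+\<omega>. ennreal ((norm (G_star t (sample \<theta> t \<omega>) (W t \<omega>)))\<^sup>2) \<partial>P)
      = (\<integral>\<^sup>+\<omega>. \<integral>\<^sup>+w. ennreal ((norm (G_star t (sample \<theta> t \<omega>) w))\<^sup>2) \<partial>resample_pmf t \<partial>P)"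
      using nn_integral_resample[OF t, where h="\<lambda>p. ennreal ((norm (G_star t (fst p) (snd p)))\<^sup>2)"] by simp
    also have "\<dots> \<le> (\<integral>\<^sup>+\<omega>. ennreal (N\<^sup>2) \<partial>P)"
    proof (rule nn_integral_mono)
      fix \<omega> assume \<omega>: "\<omega> \<in> space P"
      have "measure_pmf.expectation (resample_pmf t) (\<lambda>w. (norm (G_star t (sample \<theta> t \<omega>) w))\<^sup>2)
         \<le> (\<Sum>\<tau><t. (norm (winner_value v (sample \<theta> t \<omega> \<tau>) bstar))\<^sup>2) / real t"
        unfolding G_star_def by (rule expectation_boot_fluct_square[OF t])
      also have "\<dots> \<le> (\<Sum>\<tau><t. N\<^sup>2) / real t"
        unfolding N_def using winner_value_norm draw_in_space[OF \<omega>]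
        by (intro divide_right_mono sum_mono power_mono) (auto simp: sample_nth)
      also have "\<dots> = N\<^sup>2" using t by simp
      finally show "(\<integral>\<^sup>+w. ennreal ((norm (G_star t (sample \<theta> t \<omega>) w))\<^sup>2) \<partial>resample_pmf t) \<le> ennreal (N\<^sup>2)"
        by (simp add: nn_integral_resample_real[OF t] ennreal_leI)
    qed
    also have "\<dots> = ennreal (N\<^sup>2)" by (simp add: P.emeasure_space_1)
    finally have "outer_measure_of P {\<omega>\<in>space P. K\<^sup>2 \<le> (norm (G_star t (sample \<theta> t \<omega>) (W t \<omega>)))\<^sup>2} \<le> ennreal (N\<^sup>2 / K\<^sup>2)"
      using K by (intro markov_bound Gm') auto
    moreover have "K\<^sup>2 \<le> (norm x)\<^sup>2 \<longleftrightarrow> K \<le> norm x" for x :: "real^'n"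
      using K(1) by (intro power2_le_iff_abs_le[THEN trans]) auto
    ultimately show ?thesis using K(2) by simp
  qed
  show ?thesis by (rule that[OF K(1)], rule eventually_sequentiallyI[of 1], rule bound) simp
qed

lemma paced_margin:
  obtains \<kappa> where "0 < \<kappa>" "\<And>\<beta> i. norm (\<beta> - bstar) \<le> \<kappa> \<Longrightarrow> i \<in> paced \<Longrightarrow> \<kappa> \<le> \<beta> $ i \<and> \<beta> $ i \<le> 1 - \<kappa>"
proof -
  define \<kappa> where "\<kappa> = Min (insert 1 ((\<lambda>i. min (bstar $ i) (1 - bstar $ i) / 2) ` paced))"
  have bpos: "0 < bstar $ i" for i using bstar(1) by (auto simp: pacing_box_def)
  have \<kappa>: "0 < \<kappa>" using bpos by (auto simp: \<kappa>_def paced_def)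
  have "\<kappa> \<le> \<beta> $ i \<and> \<beta> $ i \<le> 1 - \<kappa>" if "norm (\<beta> - bstar) \<le> \<kappa>" "i \<in> paced" for \<beta> i
  proof -
    have "\<kappa> \<le> min (bstar $ i) (1 - bstar $ i) / 2" unfolding \<kappa>_def using that(2) by (intro Min_le) auto
    moreover have "\<bar>\<beta> $ i - bstar $ i\<bar> \<le> \<kappa>" using component_le_norm_cart[of "\<beta> - bstar" i] that(1) by simp
    ultimately show ?thesis by (auto simp: abs_le_iff min_def split: if_splits)
  qed
  with \<kappa> show ?thesis by (rule that)
qed

lemma vanishing_finite_ex:
  assumes "\<And>i. i \<in> (I :: 'n set) \<Longrightarrow> vanishing P (\<lambda>t. {\<omega>\<in>space P. R i t \<omega>})"
  shows "vanishing P (\<lambda>t. {\<omega>\<in>space P. \<exists>i\<in>I. R i t \<omega>})"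
proof -
  have "vanishing P (\<lambda>t. \<Union>i\<in>I. {\<omega>\<in>space P. R i t \<omega>})"
    using assms by (intro vanishing_finite_UN) auto
  then show ?thesis by (rule vanishing_subset) (intro always_eventually allI, blast)
qed

text \<open>Off a vanishing event the active set is identified, the Hessian estimate is accurate and the point of
  linearisation may be frozen. The size of the linear term is controlled only up to an
  arbitrarily small probability.\<close>

lemma boot_error_asymptotically_linear:
  assumes \<zeta>: "0 < \<zeta>"
  shows "vanishing P (\<lambda>t. {\<omega>\<in>space P. \<zeta> < norm (boot_error t (sample \<theta> t \<omega>) (W t \<omega>) - linear_part t (sample \<theta> t \<omega>) (W t \<omega>))})"
proof (rule vanishing_approx)
  fix e :: real assume e: "0 < e"
  obtain K where K: "0 < K" "\<forall>\<^sub>F t in sequentially. outer_measure_of P {\<omega>\<in>space P. K \<le> norm (G_star t (sample \<theta> t \<omega>) (W t \<omega>))} \<le> ennreal e"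
    using G_star_bounded_in_prob[OF e] by blast
  obtain \<kappa> where \<kappa>: "0 < \<kappa>" "\<And>\<beta> i. norm (\<beta> - bstar) \<le> \<kappa> \<Longrightarrow> i \<in> paced \<Longrightarrow> \<kappa> \<le> \<beta> $ i \<and> \<beta> $ i \<le> 1 - \<kappa>"
    by (rule paced_margin) blast
  obtain m where m: "0 < m" "\<And>x. m * norm x ^ 2 \<le> x \<bullet> (hess *v x)"
    by (rule pd_lower_bound[OF hessian_pos_def]) blast+
  define L where "L = norm Q + 1"
  have L: "0 < L" "norm (Q *v x) \<le> L * norm x" for x
  proof -
    show "0 < L" by (simp add: L_def add_nonneg_pos)
    have "norm (Q *v x) \<le> norm Q * norm x" by (rule norm_matrix_vector_mult_le)
    also have "\<dots> \<le> L * norm x" by (intro mult_right_mono) (auto simp: L_def)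
    finally show "norm (Q *v x) \<le> L * norm x" .
  qed
  \<comment> \<open>The constants give half of \<open>\<zeta>\<close> in equal parts to freezing the point of linearisation and to the
    error of the Hessian.\<close>
  define r where "r = min 1 (\<zeta> / (4 * L))"
  have r: "0 < r" "r \<le> 1" "L * r \<le> \<zeta> / 4"
  proof -
    show "0 < r" "r \<le> 1" using \<zeta> L(1) by (auto simp: r_def)
    have "L * r \<le> L * (\<zeta> / (4 * L))" using L(1) by (intro mult_left_mono) (auto simp: r_def)
    also have "\<dots> = \<zeta> / 4" using L(1) by simp
    finally show "L * r \<le> \<zeta> / 4" .
  qed
  define \<rho> where "\<rho> = min (m / 2) (m * \<zeta> / (16 * (L * (K + 1))))"
  have LK: "0 < L * (K + 1)" using L(1) K(1) by simp
  have \<rho>: "0 < \<rho>" "\<rho> \<le> m / 2" "4 * \<rho> / m * (L * (K + 1)) \<le> \<zeta> / 4"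
  proof -
    show "0 < \<rho>" "\<rho> \<le> m / 2" using \<zeta> m(1) LK by (auto simp: \<rho>_def)
    have "4 * \<rho> / m * (L * (K + 1)) \<le> 4 * (m * \<zeta> / (16 * (L * (K + 1)))) / m * (L * (K + 1))"
      using m(1) LK by (intro mult_right_mono divide_right_mono mult_left_mono) (auto simp: \<rho>_def)
    also have "\<dots> = \<zeta> / 4"
    proof -
      have "4 * (m * \<zeta> / (16 * y)) / m * y = \<zeta> / 4" if "0 < y" for y using that m(1) by (simp add: field_simps)
      from this[OF LK] show ?thesis .
    qed
    finally show "4 * \<rho> / m * (L * (K + 1)) \<le> \<zeta> / 4" .
  qed
  let ?act = "\<lambda>t. {\<omega>\<in>space P. \<exists>i\<in>- paced. bobs t \<omega> $ i < 1}"
  let ?far = "\<lambda>t. {\<omega>\<in>space P. \<kappa> < norm (bobs t \<omega> - bstar)}"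
  let ?hes = "\<lambda>t. {\<omega>\<in>space P. \<rho> < dist (H_hat b v (\<eta> t) t (sample \<theta> t \<omega>)) hess}"
  let ?gap = "\<lambda>t. {\<omega>\<in>space P. r / 2 \<le> norm (boot_fluct t (gap t (sample \<theta> t \<omega>)) (W t \<omega>))}"
  let ?tie = "\<lambda>t. {\<omega>\<in>space P. r / 2 \<le> tie_mass t (sample \<theta> t \<omega>) (W t \<omega>)}"
  let ?wts = "\<lambda>t. {\<omega>\<in>space P. \<omega> \<in> {\<omega>. W t \<omega> \<notin> set_pmf (resample_pmf t)}}"
  let ?B = "\<lambda>t. ?act t \<union> (?far t \<union> (?hes t \<union> (?gap t \<union> (?tie t \<union> ?wts t))))"
  let ?C = "\<lambda>t. {\<omega>\<in>space P. K \<le> norm (G_star t (sample \<theta> t \<omega>) (W t \<omega>))}"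
  have star_diff: "H b v M s differentiable (at bstar)" by (rule near_star(2)[OF near_star_bstar])
  have one: "bstar $ i = 1" if "i \<in> - paced" for i
    using that bstar(1) by (auto simp: paced_def pacing_box_def) (metis less_le)
  have "vanishing P ?B"
  proof (intro vanishing_Un)
    show "vanishing P ?act"
      using one no_degenerate by (intro vanishing_finite_ex beta_obs_active[OF star_diff]) auto
    show "vanishing P ?far" using \<kappa>(1) by (rule beta_obs_consistent)
    show "vanishing P ?hes" using H_hat_consistent \<rho>(1) by (auto simp: tendsto_in_prob_def vanishing_def)
    show "vanishing P ?gap" by (rule gap_fluctuation_vanishes) (use r(1) in simp)
    show "vanishing P ?tie" by (rule tie_mass_vanishes) (use r(1) in simp)
    show "vanishing P ?wts" by (rule vanishing_null) (use AE_weights in simp)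
  qed
  moreover have "\<forall>\<^sub>F t in sequentially. {\<omega>\<in>space P. \<zeta> < norm (boot_error t (sample \<theta> t \<omega>) (W t \<omega>) - linear_part t (sample \<theta> t \<omega>) (W t \<omega>))} \<subseteq> ?B t \<union> ?C t"
  proof -
    have "\<forall>\<^sub>F t in sequentially. \<delta> t < \<kappa>" using \<delta>_lim \<kappa>(1) by (rule order_tendstoD)
    moreover have "(\<lambda>t. \<epsilon> t * (L * (K + 1))) \<longlonglongrightarrow> 0 * (L * (K + 1))" by (intro tendsto_intros \<epsilon>_lim)
    then have "\<forall>\<^sub>F t in sequentially. \<epsilon> t * (L * (K + 1)) < \<kappa>" using \<kappa>(1) by (intro order_tendstoD(2)) auto
    moreover have "\<forall>\<^sub>F t in sequentially. 0 < t" by (rule eventually_gt_at_top)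
    ultimately show ?thesis
    proof eventually_elim
      case (elim t)
      note t = elim(3)
      show ?case
      proof (rule subsetI, rule ccontr)
        fix \<omega> assume "\<omega> \<in> {\<omega>\<in>space P. \<zeta> < norm (boot_error t (sample \<theta> t \<omega>) (W t \<omega>) - linear_part t (sample \<theta> t \<omega>) (W t \<omega>))}"
          and no: "\<omega> \<notin> ?B t \<union> ?C t"
        then have \<omega>: "\<omega> \<in> space P" and big: "\<zeta> < norm (boot_error t (sample \<theta> t \<omega>) (W t \<omega>) - linear_part t (sample \<theta> t \<omega>) (W t \<omega>))" by auto
        let ?d = "sample \<theta> t \<omega>"
        let ?w = "W t \<omega>"
        have d: "?d \<in> space (data_space t)" by (rule sample_in_space[OF \<omega>])
        have far: "norm (bobs t \<omega> - bstar) \<le> \<kappa>" and hes: "norm (H_hat b v (\<eta> t) t ?d - hess) \<le> \<rho>"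
          and gp: "norm (boot_fluct t (gap t ?d) ?w) < r / 2" and ti: "tie_mass t ?d ?w < r / 2"
          and ws: "?w \<in> set_pmf (resample_pmf t)" and Gs: "norm (G_star t ?d ?w) < K"
          using no \<omega> by (auto simp: not_le not_less dist_norm)
        have act: "bobs t \<omega> $ i = 1" if "i \<notin> paced" for i
        proof -
          have "\<not> bobs t \<omega> $ i < 1" using no \<omega> that by auto
          moreover have "bobs t \<omega> $ i \<le> 1" using beta_obs(1)[OF t d] by (auto simp: pacing_box_def)
          ultimately show ?thesis by simp
        qed
        define g where "g = G_boot b v D_F t ?d ?w"
        have gG: "norm (g - G_star t ?d ?w) \<le> r" using G_boot_decomposition[OF t d ws] gp ti by (simp add: g_def)
        then have "norm g \<le> K + 1" using Gs r(2) norm_triangle_sub[of g "G_star t ?d ?w"] by linarith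
        then have "L * norm g \<le> L * (K + 1)" using L(1) by (intro mult_left_mono) auto
        then have Qg: "norm (Q *v g) \<le> L * (K + 1)" using L(2)[of g] by linarith
        have "\<epsilon> t * norm (Q *v g) \<le> \<epsilon> t * (L * (K + 1))"
          using Qg epsilon_pos[OF t] by (intro mult_left_mono) auto
        then have small: "\<epsilon> t * norm (Q *v g) \<le> \<kappa>" using elim(2) by linarith
        have "norm (boot_error t ?d ?w + Q *v g) \<le> 4 * \<rho> / m * norm (Q *v g)"
          unfolding g_def
          using \<kappa>(2)[OF far] elim(1)
          by (intro boot_error_near_solution[OF t \<omega> \<kappa>(1) _ act _ m hes \<rho>(2)] small[unfolded g_def]) auto
        also have "\<dots> \<le> 4 * \<rho> / m * (L * (K + 1))" using Qg \<rho>(1) m(1) by (intro mult_left_mono) auto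
        finally have 1: "norm (boot_error t ?d ?w + Q *v g) \<le> \<zeta> / 4" using \<rho>(3) by linarith
        have "norm (Q *v (g - G_star t ?d ?w)) \<le> L * norm (g - G_star t ?d ?w)" by (rule L(2))
        also have "\<dots> \<le> L * r" using gG L(1) by (intro mult_left_mono) auto
        finally have 2: "norm (Q *v (g - G_star t ?d ?w)) \<le> \<zeta> / 4" using r(3) by linarith
        have split: "boot_error t ?d ?w - linear_part t ?d ?w = (boot_error t ?d ?w + Q *v g) - Q *v (g - G_star t ?d ?w)"
          by (simp add: linear_part_eq matrix_vector_mult_diff_distrib)
        have "norm (boot_error t ?d ?w - linear_part t ?d ?w) \<le> \<zeta> / 4 + \<zeta> / 4"
          unfolding split using 1 2 norm_triangle_ineq4[of "boot_error t ?d ?w + Q *v g" "Q *v (g - G_star t ?d ?w)"] by linarith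
        then show False using big \<zeta> by simp
      qed
    qed
  qed
  ultimately show "\<exists>B C. (\<forall>\<^sub>F t in sequentially. {\<omega>\<in>space P. \<zeta> < norm (boot_error t (sample \<theta> t \<omega>) (W t \<omega>) - linear_part t (sample \<theta> t \<omega>) (W t \<omega>))} \<subseteq> B t \<union> C t)
     \<and> vanishing P B \<and> (\<forall>\<^sub>F t in sequentially. outer_measure_of P (C t) \<le> ennreal e)"
    using K(2) by (rule_tac exI[of _ ?B], rule_tac exI[of _ ?C]) (intro conjI)
qed


subsection \<open>The limit covariance\<close>

text \<open>The gradient of the highest bid for an item at the equilibrium, zero if the item is tied there.\<close>

definition won :: "'a \<Rightarrow> real^'n" where "won x = winner_value v x bstar"

definition grad_cov :: "real^'n^'n" where
  "grad_cov = supply_cov M s (\<lambda>x. gradient (F b v x) bstar)"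

lemma bstar_pos: "bstar \<in> pos_orthant"
  using near_star(1) near_star_bstar by blast

lemma won_measurable[measurable]: "won \<in> borel_measurable M"
  unfolding won_def by measurable

lemma won_norm: "x \<in> space M \<Longrightarrow> norm (won x) \<le> real CARD('n) * vmax"
  unfolding won_def by (rule winner_value_norm)

lemma won_component: "x \<in> space M \<Longrightarrow> \<bar>won x $ i\<bar> \<le> real CARD('n) * vmax"
  using won_norm component_le_norm_cart order_trans by blast

lemma won_integrable: "integrable \<mu> (\<lambda>x. won x $ i)" "integrable \<mu> (\<lambda>x. won x $ i * won x $ j)"
proof -
  show "integrable \<mu> (\<lambda>x. won x $ i)"
    by (rule mu.integrable_const_bound[where B="real CARD('n) * vmax"]) (auto intro!: AE_I2 won_component)
  have "\<bar>won x $ i * won x $ j\<bar> \<le> (real CARD('n) * vmax) * (real CARD('n) * vmax)" if "x \<in> space M" for x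
    unfolding abs_mult using that vmax(1) by (intro mult_mono won_component) auto
  then show "integrable \<mu> (\<lambda>x. won x $ i * won x $ j)"
    by (intro mu.integrable_const_bound[where B="(real CARD('n) * vmax) * (real CARD('n) * vmax)"]) (auto intro!: AE_I2)
qed

lemma gradient_measurable[measurable]: "(\<lambda>x. gradient (F b v x) bstar) \<in> borel_measurable M"
proof (rule measurable_cong[THEN iffD2])
  fix x assume x: "x \<in> space M"
  show "gradient (F b v x) bstar = (if tie v x bstar then (THE D. False) else won x - inv_budget b bstar)"
    unfolding won_def using v_nonneg[OF x] vmax(2)[OF x] by (intro F_gradient[where V=vmax]) (auto simp: vmax(1) bstar_pos)
qed measurable

lemma AE_gradient: "AE x in \<mu>. gradient (F b v x) bstar = won x - inv_budget b bstar"
proof -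
  have "AE x in \<mu>. \<not> tie v x bstar" by (rule AE_not_tie[OF near_star(1,2)]) (auto intro: near_star_bstar)
  then show ?thesis
  proof (rule AE_mp, intro AE_I2 impI)
    fix x assume "x \<in> space \<mu>" and nt: "\<not> tie v x bstar"
    then have x: "x \<in> space M" by simp
    show "gradient (F b v x) bstar = won x - inv_budget b bstar"
      unfolding won_def using nt v_nonneg[OF x] vmax(2)[OF x] by (intro gradient_eqI F_GDERIV[where V=vmax]) (auto simp: vmax(1) bstar_pos)
  qed
qed

text \<open>The gradient differs from \<open>won\<close> by a constant almost surely, and covariances ignore constants.\<close>

lemma grad_cov_eq:
  "grad_cov $ k $ l = (LINT x|\<mu>. (won x $ k - (LINT x|\<mu>. won x $ k)) * (won x $ l - (LINT x|\<mu>. won x $ l)))"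
proof -
  let ?g = "\<lambda>x. gradient (F b v x) bstar"
  have m: "supply_mean M s (\<lambda>x. ?g x $ i) = (LINT x|\<mu>. won x $ i) - inv_budget b bstar $ i" for i
  proof -
    have "supply_mean M s (\<lambda>x. ?g x $ i) = (LINT x|\<mu>. ?g x $ i)" by (rule supply_mean_eq) measurable
    also have "\<dots> = (LINT x|\<mu>. won x $ i - inv_budget b bstar $ i)"
      by (rule integral_cong_AE) (use AE_gradient in auto)
    finally show ?thesis using won_integrable by (simp add: mu.prob_space[simplified])
  qed
  have "grad_cov $ k $ l = (LINT x|\<mu>. (?g x $ k - supply_mean M s (\<lambda>x. ?g x $ k)) * (?g x $ l - supply_mean M s (\<lambda>x. ?g x $ l)))"
    unfolding grad_cov_def supply_cov_def by (simp, rule supply_mean_eq) measurable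
  also have "\<dots> = (LINT x|\<mu>. (won x $ k - (LINT x|\<mu>. won x $ k)) * (won x $ l - (LINT x|\<mu>. won x $ l)))"
    unfolding m by (rule integral_cong_AE) (use AE_gradient in auto)
  finally show ?thesis .
qed

definition limit_cov :: "real^'n^'n" where "limit_cov = Q ** grad_cov ** Q"

lemma limit_cov_factor: "\<exists>A :: real^'n^'n. A ** transpose A = limit_cov"
proof (rule psd_factor)
  have sym: "transpose grad_cov = grad_cov"
    by (simp add: vec_eq_iff transpose_def grad_cov_eq mult.commute)
  show "transpose limit_cov = limit_cov"
    by (simp add: limit_cov_def matrix_transpose_mul sym Q(1) matrix_mul_assoc)
  fix x
  define z where "z i = (LINT x|\<mu>. won x $ i)" for i
  have i: "integrable \<mu> (\<lambda>x. (won x $ k - z k) * (won x $ l - z l))" for k l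
    by (simp add: algebra_simps won_integrable)
  have psd: "0 \<le> y \<bullet> (grad_cov *v y)" for y
  proof -
    have "y \<bullet> (grad_cov *v y) = (\<Sum>k\<in>UNIV. \<Sum>l\<in>UNIV. y $ k * y $ l * (LINT x|\<mu>. (won x $ k - z k) * (won x $ l - z l)))"
      by (simp add: inner_vec_def matrix_vector_mult_def grad_cov_eq z_def sum_distrib_left mult_ac)
    also have "\<dots> = (LINT x|\<mu>. (\<Sum>k\<in>UNIV. \<Sum>l\<in>UNIV. y $ k * y $ l * ((won x $ k - z k) * (won x $ l - z l))))"
      by (subst Bochner_Integration.integral_sum, intro Bochner_Integration.integrable_sum integrable_mult_right i)
         (intro sum.cong refl, subst Bochner_Integration.integral_sum, auto intro!: integrable_mult_right i)
    also have "\<dots> = (LINT x|\<mu>. (\<Sum>k\<in>UNIV. y $ k * (won x $ k - z k))\<^sup>2)"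
      by (simp add: power2_eq_square sum_product mult_ac)
    also have "0 \<le> \<dots>" by (intro integral_nonneg_AE) auto
    finally show ?thesis .
  qed
  have "x \<bullet> (limit_cov *v x) = (Q *v x) \<bullet> (grad_cov *v (Q *v x))"
    using Q(1) by (simp add: limit_cov_def flip: matrix_vector_mul_assoc) (metis dot_lmul_matrix vector_transpose_matrix)
  then show "0 \<le> x \<bullet> (limit_cov *v x)" using psd by simp
qed

text \<open>The normal law is defined through a chosen factor of the covariance, which exists since the
  covariance is positive semidefinite.\<close>

lemma limit_law:
  obtains A :: "real^'n^'n" where "A ** transpose A = limit_cov" "J_FPPE b v M s = distr std_mvnormal borel (\<lambda>z. A *v z)"
proof -
  define A :: "real^'n^'n" where "A = (SOME A. A ** transpose A = limit_cov)"
  have "A ** transpose A = limit_cov" unfolding A_def using limit_cov_factor by (rule someI_ex)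
  moreover have "J_FPPE b v M s = distr std_mvnormal borel (\<lambda>z. A *v z)"
    unfolding J_FPPE_def Let_def Q_def[symmetric] grad_cov_def[symmetric] limit_cov_def[symmetric] mvnormal_def A_def[symmetric]
    by simp
  ultimately show ?thesis by (rule that)
qed

definition influence :: "'a \<Rightarrow> real^'n" where "influence x = - (Q *v won x)"

lemma influence_measurable[measurable]: "influence \<in> borel_measurable M"
  unfolding influence_def by measurable

lemma influence_component: "influence x $ i = - (\<Sum>k\<in>UNIV. Q $ i $ k * won x $ k)"
  by (simp add: influence_def matrix_vector_mult_def)

definition influence_bound :: real where "influence_bound = norm Q * (real CARD('n) * vmax)"

lemma influence_norm: "x \<in> space M \<Longrightarrow> norm (influence x) \<le> influence_bound"
proof -
  assume x: "x \<in> space M"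
  have "norm (influence x) \<le> norm Q * norm (won x)" by (simp add: influence_def norm_matrix_vector_mult_le)
  also have "\<dots> \<le> influence_bound" unfolding influence_bound_def using won_norm[OF x] by (intro mult_left_mono) auto
  finally show ?thesis .
qed

lemma influence_bound_nonneg: "0 \<le> influence_bound"
  using vmax(1) by (simp add: influence_bound_def)

lemma influence_abs: "x \<in> space M \<Longrightarrow> \<bar>influence x $ i\<bar> \<le> influence_bound"
  using influence_norm component_le_norm_cart order_trans by blast

lemma influence_mult_abs: "x \<in> space M \<Longrightarrow> \<bar>influence x $ i * influence x $ j\<bar> \<le> influence_bound * influence_bound"
  unfolding abs_mult by (intro mult_mono influence_abs) (auto simp: influence_bound_nonneg)

lemma influence_cov:
  "(LINT x|\<mu>. influence x $ i * influence x $ j) - (LINT x|\<mu>. influence x $ i) * (LINT x|\<mu>. influence x $ j) = limit_cov $ i $ j"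
proof -
  define z where "z i = (LINT x|\<mu>. won x $ i)" for i
  define S where "S k l = (LINT x|\<mu>. won x $ k * won x $ l)" for k l
  have g: "grad_cov $ k $ l = S k l - z k * z l" for k l
  proof -
    have "grad_cov $ k $ l = (LINT x|\<mu>. won x $ k * won x $ l - z l * won x $ k - z k * won x $ l + z k * z l)"
      unfolding grad_cov_eq z_def[symmetric] by (intro Bochner_Integration.integral_cong refl) (simp add: algebra_simps)
    also have "\<dots> = S k l - z l * z k - z k * z l + z k * z l"
      using won_integrable by (simp add: S_def z_def mu.prob_space[simplified])
    finally show ?thesis by (simp add: algebra_simps)
  qed
  have m: "(LINT x|\<mu>. influence x $ i) = - (\<Sum>k\<in>UNIV. Q $ i $ k * z k)" for i
    unfolding influence_component z_def using won_integrable by simp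
  have "(LINT x|\<mu>. influence x $ i * influence x $ j) = (LINT x|\<mu>. (\<Sum>k\<in>UNIV. \<Sum>l\<in>UNIV. Q $ i $ k * Q $ j $ l * (won x $ k * won x $ l)))"
    unfolding influence_component by (simp add: sum_product mult_ac)
  also have "\<dots> = (\<Sum>k\<in>UNIV. \<Sum>l\<in>UNIV. Q $ i $ k * Q $ j $ l * S k l)"
    unfolding S_def
    by (subst Bochner_Integration.integral_sum, intro Bochner_Integration.integrable_sum integrable_mult_right won_integrable)
       (intro sum.cong refl, subst Bochner_Integration.integral_sum, auto intro!: integrable_mult_right won_integrable)
  finally have "(LINT x|\<mu>. influence x $ i * influence x $ j) - (LINT x|\<mu>. influence x $ i) * (LINT x|\<mu>. influence x $ j)
     = (\<Sum>k\<in>UNIV. \<Sum>l\<in>UNIV. Q $ i $ k * Q $ j $ l * (S k l - z k * z l))"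
    unfolding m by (simp add: sum_product sum_subtractf algebra_simps)
  also have "\<dots> = (\<Sum>l\<in>UNIV. \<Sum>k\<in>UNIV. Q $ i $ k * grad_cov $ k $ l * Q $ l $ j)"
  proof -
    have "Q $ j $ l = Q $ l $ j" for l
    proof -
      have "Q $ j $ l = transpose Q $ l $ j" by (simp add: transpose_def)
      then show ?thesis by (simp only: Q(1))
    qed
    then show ?thesis by (subst sum.swap) (simp add: g mult_ac)
  qed
  also have "\<dots> = limit_cov $ i $ j"
    by (simp add: limit_cov_def matrix_matrix_mult_def sum_distrib_right)
  finally show ?thesis .
qed

text \<open>Given the data the linear part is a normalised sum of independent bounded vectors whose
  covariance is the empirical covariance of the influence function, so the central limit bound applies
  as soon as the law of large numbers has identified that covariance.\<close>

lemma linear_part_conditional_clt: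
  assumes e: "0 < e"
  shows "vanishing P (\<lambda>t. {\<omega>\<in>space P. \<exists>f\<in>BL1. e < \<bar>measure_pmf.expectation (resample_pmf t) (\<lambda>w. f (linear_part t (sample \<theta> t \<omega>) w))
      - (LINT x|J_FPPE b v M s. f x)\<bar>})"
proof -
  obtain A :: "real^'n^'n" where A: "A ** transpose A = limit_cov" "J_FPPE b v M s = distr std_mvnormal borel (\<lambda>z. A *v z)"
    by (rule limit_law)
  define B where "B = influence_bound"
  have B: "0 \<le> B" using influence_bound_nonneg by (simp add: B_def)
  obtain \<kappa> T where \<kappa>: "0 < \<kappa>" and clt: "\<And>t (a :: nat \<Rightarrow> real^'n) f. T \<le> t \<Longrightarrow> (\<And>\<tau>. \<tau> < t \<Longrightarrow> norm (a \<tau>) \<le> B) \<Longrightarrow>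
     (\<And>i j. \<bar>(\<Sum>\<tau><t. a \<tau> $ i * a \<tau> $ j) / t - ((\<Sum>\<tau><t. a \<tau> $ i) / t) * ((\<Sum>\<tau><t. a \<tau> $ j) / t)
         - (A ** transpose A) $ i $ j\<bar> \<le> \<kappa>) \<Longrightarrow> f \<in> BL1 \<Longrightarrow>
     \<bar>measure_pmf.expectation (resample_pmf t) (\<lambda>w. f (boot_fluct t a w)) - (LINT z|std_mvnormal. f (A *v z))\<bar> \<le> e"
    using bootstrap_clt_BL1[OF e B, of A] by blast
  define \<kappa>' where "\<kappa>' = \<kappa> / (1 + 2 * B)"
  have \<kappa>': "0 < \<kappa>'" "\<kappa>' * (1 + 2 * B) = \<kappa>" using \<kappa> B by (auto simp: \<kappa>'_def)
  define a where "a t \<omega> \<tau> = influence (sample \<theta> t \<omega> \<tau>)" for t \<omega> \<tau>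
  let ?M1 = "\<lambda>i t. {\<omega>\<in>space P. \<kappa>' \<le> \<bar>(\<Sum>\<tau><t. influence (sample \<theta> t \<omega> \<tau>) $ i) / real t - (LINT x|\<mu>. influence x $ i)\<bar>}"
  let ?M2 = "\<lambda>p t. {\<omega>\<in>space P. \<kappa>' \<le> \<bar>(\<Sum>\<tau><t. influence (sample \<theta> t \<omega> \<tau>) $ (fst p) * influence (sample \<theta> t \<omega> \<tau>) $ (snd p)) / real t
       - (LINT x|\<mu>. influence x $ (fst p) * influence x $ (snd p))\<bar>}"
  have "vanishing P (\<lambda>t. (\<Union>i\<in>UNIV. ?M1 i t) \<union> (\<Union>p\<in>UNIV. ?M2 p t))"
    by (intro vanishing_Un vanishing_finite_UN law_of_large_numbers[where g="\<lambda>x. influence x $ _" and K=influence_bound]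
         law_of_large_numbers[where g="\<lambda>x. influence x $ _ * influence x $ _" and K="influence_bound * influence_bound"] \<kappa>'(1)
         influence_abs influence_mult_abs) auto
  then show ?thesis
  proof (rule vanishing_subset)
    show "\<forall>\<^sub>F t in sequentially. {\<omega>\<in>space P. \<exists>f\<in>BL1. e < \<bar>measure_pmf.expectation (resample_pmf t) (\<lambda>w. f (linear_part t (sample \<theta> t \<omega>) w))
      - (LINT x|J_FPPE b v M s. f x)\<bar>} \<subseteq> (\<Union>i\<in>UNIV. ?M1 i t) \<union> (\<Union>p\<in>UNIV. ?M2 p t)"
    proof (rule eventually_sequentiallyI[of "max T 1"], rule subsetI, rule ccontr)
      fix t \<omega> assume tT: "max T 1 \<le> t" and no: "\<omega> \<notin> (\<Union>i\<in>UNIV. ?M1 i t) \<union> (\<Union>p\<in>UNIV. ?M2 p t)"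
        and "\<omega> \<in> {\<omega>\<in>space P. \<exists>f\<in>BL1. e < \<bar>measure_pmf.expectation (resample_pmf t) (\<lambda>w. f (linear_part t (sample \<theta> t \<omega>) w))
           - (LINT x|J_FPPE b v M s. f x)\<bar>}"
      then obtain f where \<omega>: "\<omega> \<in> space P" and f: "f \<in> BL1" and big: "e < \<bar>measure_pmf.expectation (resample_pmf t) (\<lambda>w. f (linear_part t (sample \<theta> t \<omega>) w))
           - (LINT x|J_FPPE b v M s. f x)\<bar>" by auto
      have t: "0 < t" using tT by simp
      define m where "m i = (\<Sum>\<tau><t. a t \<omega> \<tau> $ i) / real t" for i
      define z where "z i = (LINT x|\<mu>. influence x $ i)" for i
      define m2 where "m2 i j = (\<Sum>\<tau><t. a t \<omega> \<tau> $ i * a t \<omega> \<tau> $ j) / real t" for i j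
      define z2 where "z2 i j = (LINT x|\<mu>. influence x $ i * influence x $ j)" for i j
      have c1: "\<bar>m i - z i\<bar> \<le> \<kappa>'" for i
        using no \<omega> by (auto simp: not_le m_def z_def a_def intro: less_imp_le)
      have c2: "\<bar>m2 i j - z2 i j\<bar> \<le> \<kappa>'" for i j
      proof -
        have "\<omega> \<notin> ?M2 (i, j) t" using no by blast
        then show ?thesis using \<omega> by (simp add: not_le m2_def z2_def a_def)
      qed
      have aB: "norm (a t \<omega> \<tau>) \<le> B" if "\<tau> < t" for \<tau>
        unfolding a_def B_def sample_nth[OF that] by (rule influence_norm[OF draw_in_space[OF \<omega>]])
      have mB: "\<bar>m i\<bar> \<le> B" for i
      proof -
        have "\<bar>a t \<omega> \<tau> $ i\<bar> \<le> B" if "\<tau> < t" for \<tau>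
          by (rule order_trans[OF component_le_norm_cart aB[OF that]])
        then have "\<bar>\<Sum>\<tau><t. a t \<omega> \<tau> $ i\<bar> \<le> (\<Sum>\<tau><t. B)"
          by (intro order_trans[OF sum_abs] sum_mono) auto
        then show ?thesis using t by (simp add: m_def field_simps)
      qed
      have zB: "\<bar>z i\<bar> \<le> B" for i
      proof -
        have "\<bar>z i\<bar> \<le> (LINT x|\<mu>. \<bar>influence x $ i\<bar>)" unfolding z_def by (rule integral_abs_bound)
        also have "\<dots> \<le> (LINT x|\<mu>. B)"
        proof (rule integral_mono_AE)
          show "integrable \<mu> (\<lambda>x. \<bar>influence x $ i\<bar>)"
            by (rule mu.integrable_const_bound[where B=influence_bound]) (auto intro!: AE_I2 influence_abs)
        qed (auto intro!: AE_I2 influence_abs simp: B_def)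
        finally show ?thesis by (simp add: mu.prob_space[simplified])
      qed
      have cov: "\<bar>m2 i j - m i * m j - (A ** transpose A) $ i $ j\<bar> \<le> \<kappa>" for i j
      proof -
        have "\<bar>m i * m j - z i * z j\<bar> = \<bar>m i * (m j - z j) + (m i - z i) * z j\<bar>" by (simp add: algebra_simps)
        also have "\<dots> \<le> B * \<kappa>' + \<kappa>' * B"
          using c1 mB zB \<kappa>'(1) B by (intro order_trans[OF abs_triangle_ineq] add_mono) (auto simp: abs_mult intro!: mult_mono)
        finally have "\<bar>m2 i j - m i * m j - (z2 i j - z i * z j)\<bar> \<le> \<kappa>' + (B * \<kappa>' + \<kappa>' * B)"
          using c2[of i j] by linarith
        also have "\<dots> = \<kappa>" using \<kappa>'(2) by (simp add: algebra_simps)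
        finally show ?thesis using influence_cov[of i j] by (simp add: A(1) z_def z2_def)
      qed
      have "\<bar>measure_pmf.expectation (resample_pmf t) (\<lambda>w. f (boot_fluct t (a t \<omega>) w)) - (LINT z|std_mvnormal. f (A *v z))\<bar> \<le> e"
        using tT aB cov f unfolding m_def m2_def by (intro clt) auto
      moreover have "(LINT z|std_mvnormal. f (A *v z)) = (LINT x|J_FPPE b v M s. f x)"
        unfolding A(2) using BL1_measurable[OF f] by (subst integral_distr) auto
      moreover have "boot_fluct t (a t \<omega>) w = linear_part t (sample \<theta> t \<omega>) w" for w
        by (simp add: linear_part_def a_def[abs_def] influence_def won_def)
      ultimately show False using big by simp
    qed
  qed
qed

subsection \<open>Conditional laws\<close>

lemma boot_error_measurable: "0 < t \<Longrightarrow> (\<lambda>p. boot_error t (fst p) (snd p)) \<in> borel_measurable (joint_space t)"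
proof -
  assume t: "0 < t"
  have [measurable]: "(\<lambda>p. beta_boot t (fst p) (snd p)) \<in> borel_measurable (joint_space t)"
    using boot_measurable[OF t] by (simp add: case_prod_beta)
  have [measurable]: "(\<lambda>p. beta_obs b v t (fst p)) \<in> borel_measurable (joint_space t)"
    by (rule measurable_compose[OF measurable_fst beta_obs_measurable[OF t]])
  show ?thesis unfolding boot_error_def by measurable
qed

lemma linear_part_measurable: "(\<lambda>p. linear_part t (fst p) (snd p)) \<in> borel_measurable (joint_space t)"
  unfolding linear_part_def
  by (intro boot_fluct_measurable borel_measurable_uminus measurable_compose[OF _ matrix_vector_measurable]
      winner_value_measurable component_data_measurable borel_measurable_const)

text \<open>Truncated at \<open>2\<close>, the largest possible difference of two values of a function bounded by \<open>1\<close>.\<close>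

definition conditional_error :: "nat \<Rightarrow> (nat \<Rightarrow> 'a) \<Rightarrow> real" where
  "conditional_error t d = measure_pmf.expectation (resample_pmf t) (\<lambda>w. min 2 (norm (boot_error t d w - linear_part t d w)))"

text \<open>The mean over the data of the conditional error is the joint mean, which is small by asymptotic
  linearity; Markov's inequality concludes.\<close>

lemma conditional_error_vanishes:
  assumes c: "0 < c"
  shows "vanishing P (\<lambda>t. {\<omega>\<in>space P. c \<le> conditional_error t (sample \<theta> t \<omega>)})"
  unfolding vanishing_iff
proof (intro allI impI)
  fix e :: real assume e: "0 < e"
  define \<zeta> where "\<zeta> = e * c / 2"
  have \<zeta>: "0 < \<zeta>" using e c by (simp add: \<zeta>_def)
  define Z where "Z t p = min 2 (norm (boot_error t (fst p) (snd p) - linear_part t (fst p) (snd p)))" for t and p :: "(nat \<Rightarrow> 'a) \<times> nat list"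
  let ?E = "\<lambda>t. {\<omega>\<in>space P. \<zeta> < norm (boot_error t (sample \<theta> t \<omega>) (W t \<omega>) - linear_part t (sample \<theta> t \<omega>) (W t \<omega>))}"
  have "\<forall>\<^sub>F t in sequentially. outer_measure_of P (?E t) \<le> ennreal (e * c / 4)"
    using boot_error_asymptotically_linear[OF \<zeta>] e c by (auto simp: vanishing_iff)
  moreover have "\<forall>\<^sub>F t in sequentially. (0::nat) < t" by (rule eventually_gt_at_top)
  ultimately show "\<forall>\<^sub>F t in sequentially. outer_measure_of P {\<omega>\<in>space P. c \<le> conditional_error t (sample \<theta> t \<omega>)} \<le> ennreal e"
  proof eventually_elim
    case (elim t)
    note t = elim(2)
    note [measurable] = boot_error_measurable[OF t] linear_part_measurable
    have Zm[measurable]: "Z t \<in> borel_measurable (joint_space t)" unfolding Z_def by measurable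
    have Em[measurable]: "?E t \<in> sets P"
    proof -
      have "(\<lambda>p. norm (boot_error t (fst p) (snd p) - linear_part t (fst p) (snd p))) \<in> borel_measurable (joint_space t)" by measurable
      from measurable_compose[OF joint_measurable[OF t] this]
      have [measurable]: "(\<lambda>\<omega>. norm (boot_error t (sample \<theta> t \<omega>) (W t \<omega>) - linear_part t (sample \<theta> t \<omega>) (W t \<omega>))) \<in> borel_measurable P" by simp
      show ?thesis by measurable
    qed
    have nn: "ennreal (conditional_error t (sample \<theta> t \<omega>)) = (\<integral>\<^sup>+w. ennreal (Z t (sample \<theta> t \<omega>, w)) \<partial>resample_pmf t)" for \<omega>
      unfolding conditional_error_def Z_def fst_conv snd_conv by (rule nn_integral_resample_real[OF t, symmetric]) simp
    have cm: "(\<lambda>\<omega>. conditional_error t (sample \<theta> t \<omega>)) \<in> borel_measurable P"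
    proof -
      have Zw[measurable]: "(\<lambda>d. Z t (d, w)) \<in> borel_measurable (data_space t)" for w
        by (rule measurable_compose[OF measurable_Pair2'[of w "count_space UNIV"]]) auto
      have "conditional_error t d = (\<Sum>w\<in>set_pmf (resample_pmf t). pmf (resample_pmf t) w *\<^sub>R Z t (d, w))" for d
        unfolding conditional_error_def Z_def fst_conv snd_conv
        by (rule integral_measure_pmf[OF finite_set_resample_pmf[OF t]]) auto
      then have "conditional_error t = (\<lambda>d. \<Sum>w\<in>set_pmf (resample_pmf t). pmf (resample_pmf t) w *\<^sub>R Z t (d, w))"
        by (rule ext)
      then have "conditional_error t \<in> borel_measurable (data_space t)" by (simp only:) measurable
      from measurable_compose[OF sample_measurable this] show ?thesis .
    qed
    have "(\<integral>\<^sup>+\<omega>. ennreal (conditional_error t (sample \<theta> t \<omega>)) \<partial>P) = (\<integral>\<^sup>+\<omega>. ennreal (Z t (sample \<theta> t \<omega>, W t \<omega>)) \<partial>P)"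
      unfolding nn by (rule nn_integral_resample[OF t, where h="\<lambda>p. ennreal (Z t p)", symmetric]) measurable
    also have "\<dots> \<le> (\<integral>\<^sup>+\<omega>. ennreal \<zeta> + 2 * indicator (?E t) \<omega> \<partial>P)"
    proof (rule nn_integral_mono)
      fix \<omega> assume "\<omega> \<in> space P"
      show "ennreal (Z t (sample \<theta> t \<omega>, W t \<omega>)) \<le> ennreal \<zeta> + 2 * indicator (?E t) \<omega>"
      proof (cases "\<omega> \<in> ?E t")
        case True
        have "ennreal (Z t (sample \<theta> t \<omega>, W t \<omega>)) \<le> ennreal 2" unfolding Z_def by (intro ennreal_leI) simp
        also have "\<dots> \<le> ennreal \<zeta> + 2 * indicator (?E t) \<omega>" using True by (simp add: add_increasing)
        finally show ?thesis .
      next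
        case False
        then have "Z t (sample \<theta> t \<omega>, W t \<omega>) \<le> \<zeta>" using \<open>\<omega> \<in> space P\<close> by (auto simp: Z_def not_less min_le_iff_disj)
        then show ?thesis using False by (simp add: ennreal_leI)
      qed
    qed
    also have "\<dots> = ennreal \<zeta> + 2 * emeasure P (?E t)"
      by (subst nn_integral_add) (auto simp: nn_integral_cmult P.emeasure_space_1)
    also have "\<dots> \<le> ennreal \<zeta> + 2 * ennreal (e * c / 4)"
      using elim(1) by (intro add_mono mult_left_mono) auto
    also have "\<dots> = ennreal (e * c)"
    proof -
      have "2 * ennreal (e * c / 4) = ennreal (2 * (e * c / 4))" using e c by (subst ennreal_mult) auto
      then show ?thesis using e c by (simp add: \<zeta>_def flip: ennreal_plus)
    qed
    finally have "outer_measure_of P {\<omega>\<in>space P. c \<le> conditional_error t (sample \<theta> t \<omega>)} \<le> ennreal (e * c / c)"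
      using c by (intro markov_bound cm) auto
    then show ?case using c by simp
  qed
qed

definition boot_law :: "nat \<Rightarrow> 'w \<Rightarrow> (real^'n) measure" where
  "boot_law t \<omega> = distr (measure_pmf (resample_pmf t)) borel (boot_error t (sample \<theta> t \<omega>))"

text \<open>Given the data, the weights still have the multinomial law, so the conditional law of the bootstrap
  error is an image of it.\<close>

lemma boot_law_conditional:
  assumes t: "0 < t"
  shows "cond_distribution P (sample_sigma P M \<theta> t) (\<lambda>\<omega>. boot_error t (sample \<theta> t \<omega>) (W t \<omega>)) (boot_law t)"
  unfolding cond_distribution_def
proof (intro conjI ballI)
  let ?G = "sample_sigma P M \<theta> t"
  let ?X = "\<lambda>\<omega>. boot_error t (sample \<theta> t \<omega>) (W t \<omega>)"
  have sG: "sample \<theta> t \<in> measurable ?G (data_space t)"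
    unfolding sample_sigma_def by (rule measurable_vimage_algebra1) (use sample_in_space in auto)
  show X[measurable]: "?X \<in> borel_measurable P"
    using measurable_compose[OF joint_measurable[OF t] boot_error_measurable[OF t]] by simp
  have ker: "(\<lambda>d. distr (measure_pmf (resample_pmf t)) borel (boot_error t d)) \<in> measurable (data_space t) (prob_algebra borel)"
  proof (rule measurable_distr_prob_space2)
    show "(\<lambda>d. measure_pmf (resample_pmf t)) \<in> data_space t \<rightarrow>\<^sub>M prob_algebra (count_space UNIV)"
      by (intro measurable_const) (simp add: space_prob_algebra measure_pmf.prob_space_axioms)
    show "(\<lambda>(d, w). boot_error t d w) \<in> borel_measurable (joint_space t)"
      using boot_error_measurable[OF t] by (simp add: case_prod_beta)
  qed
  show Km: "boot_law t \<in> measurable ?G (prob_algebra borel)"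
    unfolding boot_law_def[abs_def] by (rule measurable_compose[OF sG ker])
  have "subalgebra P ?G"
    unfolding subalgebra_def sample_sigma_def
  proof
    show "sets (vimage_algebra (space P) (sample \<theta> t) (data_space t)) \<subseteq> sets P"
      using sample_measurable[of t] sample_in_space by (subst sets_vimage_algebra2) (auto intro: measurable_sets)
  qed simp
  then interpret G: finite_measure_subalgebra P ?G by unfold_locales
  fix B :: "(real^'n) set" assume B[measurable]: "B \<in> sets borel"
  have KB: "(\<lambda>\<omega>. measure (boot_law t \<omega>) B) \<in> borel_measurable ?G"
    using Km by (rule measurable_compose) (auto intro!: measurable_measure_prob_algebra)
  have KBP: "(\<lambda>\<omega>. measure (boot_law t \<omega>) B) \<in> borel_measurable P"
    by (rule measurable_from_subalg[OF G.subalg KB])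
  have prb: "prob_space (boot_law t \<omega>)" for \<omega>
    unfolding boot_law_def by (intro measure_pmf.prob_space_distr) auto
  have "AE \<omega> in P. real_cond_exp P ?G (\<lambda>\<omega>. indicator B (?X \<omega>)) \<omega> = measure (boot_law t \<omega>) B"
  proof (rule G.real_cond_exp_charact)
    fix A assume "A \<in> sets ?G"
    then obtain A' where A': "A' \<in> sets (data_space t)" and A: "A = sample \<theta> t -` A' \<inter> space P"
      unfolding sample_sigma_def using sample_in_space by (subst (asm) sets_vimage_algebra2) auto
    have AP[measurable]: "A \<in> sets P" unfolding A by (rule measurable_sets[OF sample_measurable A'])
    let ?h = "\<lambda>p. indicator A' (fst p) * indicator B (boot_error t (fst p) (snd p)) :: ennreal"
    have hm: "?h \<in> borel_measurable (joint_space t)"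
    proof -
      note [measurable] = boot_error_measurable[OF t] A'
      show ?thesis by measurable
    qed
    have "(LINT \<omega>:A|P. indicator B (?X \<omega>)) = enn2real (\<integral>\<^sup>+\<omega>. ennreal (indicator A \<omega> *\<^sub>R indicator B (?X \<omega>)) \<partial>P)"
      unfolding set_lebesgue_integral_def by (rule integral_eq_nn_integral) auto
    also have "(\<integral>\<^sup>+\<omega>. ennreal (indicator A \<omega> *\<^sub>R indicator B (?X \<omega>)) \<partial>P) = (\<integral>\<^sup>+\<omega>. ?h (sample \<theta> t \<omega>, W t \<omega>) \<partial>P)"
      by (intro nn_integral_cong) (auto simp: A indicator_def)
    also have "\<dots> = (\<integral>\<^sup>+\<omega>. \<integral>\<^sup>+w. ?h (sample \<theta> t \<omega>, w) \<partial>resample_pmf t \<partial>P)"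
      by (rule nn_integral_resample[OF t hm])
    also have "\<dots> = (\<integral>\<^sup>+\<omega>. ennreal (indicator A \<omega> *\<^sub>R measure (boot_law t \<omega>) B) \<partial>P)"
    proof (rule nn_integral_cong)
      fix \<omega> assume \<omega>: "\<omega> \<in> space P"
      have "(\<integral>\<^sup>+w. ?h (sample \<theta> t \<omega>, w) \<partial>resample_pmf t) = indicator A \<omega> * (\<integral>\<^sup>+w. indicator B (boot_error t (sample \<theta> t \<omega>) w) \<partial>resample_pmf t)"
        using \<omega> by (simp add: nn_integral_cmult A indicator_def)
      also have "(\<integral>\<^sup>+w. indicator B (boot_error t (sample \<theta> t \<omega>) w) \<partial>resample_pmf t) = (\<integral>\<^sup>+x. indicator B x \<partial>boot_law t \<omega>)"
        unfolding boot_law_def by (subst nn_integral_distr) auto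
      also have "\<dots> = emeasure (boot_law t \<omega>) B" by (rule nn_integral_indicator) (simp add: boot_law_def)
      also have "\<dots> = ennreal (measure (boot_law t \<omega>) B)"
        using prob_space.finite_measure[OF prb] by (rule finite_measure.emeasure_eq_measure)
      finally show "(\<integral>\<^sup>+w. ?h (sample \<theta> t \<omega>, w) \<partial>resample_pmf t) = ennreal (indicator A \<omega> *\<^sub>R measure (boot_law t \<omega>) B)"
        by (simp add: indicator_def)
    qed
    also have "enn2real \<dots> = (LINT \<omega>:A|P. measure (boot_law t \<omega>) B)"
      unfolding set_lebesgue_integral_def using KBP by (intro integral_eq_nn_integral[symmetric]) auto
    finally show "(LINT \<omega>:A|P. indicator B (?X \<omega>)) = (LINT \<omega>:A|P. measure (boot_law t \<omega>) B)" .
  next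
    show "integrable P (\<lambda>\<omega>. indicator B (?X \<omega>) :: real)"
      by (rule P.integrable_const_bound[where B=1]) auto
    show "integrable P (\<lambda>\<omega>. measure (boot_law t \<omega>) B)"
      by (rule P.integrable_const_bound[where B=1]) (use KBP prob_space.prob_le_1[OF prb] in auto)
  qed (rule KB)
  then show "AE \<omega> in P. measure (boot_law t \<omega>) B = real_cond_exp P ?G (\<lambda>\<omega>. indicator B (?X \<omega>)) \<omega>"
    by (rule AE_mp) auto
qed

lemma BL1_nonempty: "(BL1 :: (real^'n \<Rightarrow> real) set) \<noteq> {}"
proof -
  have "(\<lambda>_. 0) \<in> (BL1 :: (real^'n \<Rightarrow> real) set)" by (auto simp: BL1_def lipschitz_on_def)
  then show ?thesis by blast
qed

text \<open>For every test function, the conditional law differs from that of the linear part by at most the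
  conditional error, and the latter obeys the conditional central limit theorem uniformly.\<close>

theorem bootstrap_consistency:
  "consistently_estimates P (sample_sigma P M \<theta>) (\<lambda>t \<omega>. boot_error t (sample \<theta> t \<omega>) (W t \<omega>)) (J_FPPE b v M s)"
  unfolding consistently_estimates_def
proof (intro exI[of _ boot_law] conjI allI impI)
  fix t :: nat assume "0 < t"
  then show "cond_distribution P (sample_sigma P M \<theta> t) (\<lambda>\<omega>. boot_error t (sample \<theta> t \<omega>) (W t \<omega>)) (boot_law t)"
    by (rule boot_law_conditional)
next
  let ?L = "J_FPPE b v M s"
  let ?S = "\<lambda>t \<omega>. SUP f\<in>BL1. \<bar>(LINT x|boot_law t \<omega>. f x) - (LINT x|?L. f x)\<bar>"
  show "tendsto_in_prob P ?S 0"
    unfolding tendsto_in_prob_def vanishing_def[symmetric]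
  proof (intro allI impI)
    fix e :: real assume e: "0 < e"
    let ?B = "\<lambda>t. {\<omega>\<in>space P. e / 2 \<le> conditional_error t (sample \<theta> t \<omega>)} \<union>
      {\<omega>\<in>space P. \<exists>f\<in>BL1. e / 2 < \<bar>measure_pmf.expectation (resample_pmf t) (\<lambda>w. f (linear_part t (sample \<theta> t \<omega>) w)) - (LINT x|?L. f x)\<bar>}"
    have "vanishing P ?B"
      using e by (intro vanishing_Un conditional_error_vanishes linear_part_conditional_clt) auto
    then show "vanishing P (\<lambda>t. {\<omega>\<in>space P. e < dist (?S t \<omega>) 0})"
    proof (rule vanishing_subset)
      show "\<forall>\<^sub>F t in sequentially. {\<omega>\<in>space P. e < dist (?S t \<omega>) 0} \<subseteq> ?B t"
      proof (rule eventually_sequentiallyI[of 1], rule subsetI, rule ccontr)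
        fix t :: nat and \<omega> assume t1: "1 \<le> t" and "\<omega> \<in> {\<omega>\<in>space P. e < dist (?S t \<omega>) 0}" and no: "\<omega> \<notin> ?B t"
        then have \<omega>: "\<omega> \<in> space P" and big: "e < \<bar>?S t \<omega>\<bar>" by auto
        from t1 have t: "0 < t" by simp
        let ?d = "sample \<theta> t \<omega>"
        have ce: "conditional_error t ?d \<le> e / 2" using no \<omega> by auto
        have ub: "\<bar>(LINT x|boot_law t \<omega>. f x) - (LINT x|?L. f x)\<bar> \<le> e" if f: "f \<in> BL1" for f
        proof -
          have 1: "\<bar>measure_pmf.expectation (resample_pmf t) (\<lambda>w. f (linear_part t ?d w)) - (LINT x|?L. f x)\<bar> \<le> e / 2"
            using no \<omega> f by (auto simp: not_less)
          have "(LINT x|boot_law t \<omega>. f x) = measure_pmf.expectation (resample_pmf t) (\<lambda>w. f (boot_error t ?d w))"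
            unfolding boot_law_def using BL1_measurable[OF f] by (subst integral_distr) auto
          then have split: "(LINT x|boot_law t \<omega>. f x) - measure_pmf.expectation (resample_pmf t) (\<lambda>w. f (linear_part t ?d w))
             = measure_pmf.expectation (resample_pmf t) (\<lambda>w. f (boot_error t ?d w) - f (linear_part t ?d w))"
            using integrable_resample_pmf[OF t] by simp
          have 2: "\<bar>measure_pmf.expectation (resample_pmf t) (\<lambda>w. f (boot_error t ?d w) - f (linear_part t ?d w))\<bar>
             \<le> measure_pmf.expectation (resample_pmf t) (\<lambda>w. \<bar>f (boot_error t ?d w) - f (linear_part t ?d w)\<bar>)"
            by (rule integral_abs_bound)
          have 3: "measure_pmf.expectation (resample_pmf t) (\<lambda>w. \<bar>f (boot_error t ?d w) - f (linear_part t ?d w)\<bar>) \<le> conditional_error t ?d"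
            unfolding conditional_error_def
          proof (rule integral_mono)
            fix w
            have "\<bar>f (boot_error t ?d w) - f (linear_part t ?d w)\<bar> \<le> 2"
              using BL1_bounded[OF f, of "boot_error t ?d w"] BL1_bounded[OF f, of "linear_part t ?d w"] by linarith
            then show "\<bar>f (boot_error t ?d w) - f (linear_part t ?d w)\<bar> \<le> min 2 (norm (boot_error t ?d w - linear_part t ?d w))"
              using BL1_lipschitz[OF f, of "boot_error t ?d w" "linear_part t ?d w"] by (simp add: dist_norm)
          qed (rule integrable_resample_pmf[OF t])+
          show ?thesis using 1 2 3 ce split by linarith
        qed
        have "?S t \<omega> \<le> e" using BL1_nonempty ub by (rule cSUP_least)
        moreover have "0 \<le> ?S t \<omega>"
        proof -
          obtain f :: "real^'n \<Rightarrow> real" where f: "f \<in> BL1" using BL1_nonempty by blast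
          have "bdd_above ((\<lambda>f. \<bar>(LINT x|boot_law t \<omega>. f x) - (LINT x|?L. f x)\<bar>) ` BL1)" using ub by (intro bdd_aboveI2)
          from cSUP_upper[OF f this] show ?thesis by linarith
        qed
        ultimately show False using big by simp
      qed
    qed
  qed
qed

end

theorem theorem4:
  fixes b :: "real^'n"
    and M :: "'a measure"
    and v :: "'n \<Rightarrow> 'a \<Rightarrow> real"
    and s :: "'a \<Rightarrow> real"
    and P :: "'w measure"
    and \<theta> :: "nat \<Rightarrow> 'w \<Rightarrow> 'a"
    and W :: "nat \<Rightarrow> 'w \<Rightarrow> nat list"
    and D_F :: "'a \<Rightarrow> real^'n \<Rightarrow> real^'n"
    and \<delta> \<epsilon> \<eta> :: "nat \<Rightarrow> real"
    and c :: ereal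
    and beta_boot :: "nat \<Rightarrow> (nat \<Rightarrow> 'a) \<Rightarrow> nat list \<Rightarrow> real^'n"
  assumes budgets: "\<And>i. 0 < b $ i"
    and v_nonneg: "\<And>i x. x \<in> space M \<Longrightarrow> 0 \<le> v i x"
    and v_integrable: "\<And>i. integrable M (v i)"
    and v_bounded: "\<And>i. bdd_above (v i ` space M)"
    and s_integrable: "integrable M s"
    and s_nonneg: "\<And>x. x \<in> space M \<Longrightarrow> 0 \<le> s x"
    and s_bounded: "bdd_above (s ` space M)"
    and s_total: "(LINT x|M. s x) = 1"
    and prob: "prob_space P"
    and draws_indep: "prob_space.indep_vars P (\<lambda>_. M) \<theta> UNIV"
    and draws_density: "\<And>\<tau>. distributed P M (\<theta> \<tau>) (\<lambda>x. ennreal (s x))"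
    and W_measurable: "\<And>t. 0 < t \<Longrightarrow> W t \<in> measurable P (count_space UNIV)"
    and W_multinomial: "\<And>t. 0 < t \<Longrightarrow> distr P (count_space UNIV) (W t) =
          measure_pmf (multinomial_pmf t t (pmf_of_set {..<t}))"
    and W_indep: "\<And>t. 0 < t \<Longrightarrow> prob_space.indep_set P
          (sets (sample_sigma P M \<theta> t))
          (sets (vimage_algebra (space P) (W t) (count_space UNIV)))"
    and D_F_selection: "\<And>x \<beta>. x \<in> space M \<Longrightarrow> \<beta> \<in> pos_orthant \<Longrightarrow>
          D_F x \<beta> \<in> subdifferential pos_orthant (F b v x) \<beta>"
    and H_C2: "C2_near (H b v M s) (beta_star b v M s)"
    and hessian_pos_def: "\<And>x. x \<noteq> 0 \<Longrightarrow> 0 < x \<bullet> (limit_hessian b v M s *v x)"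
    and F_differentiable: "AE x in density M (\<lambda>x. ennreal (s x)).
          F b v x differentiable (at (beta_star b v M s))"
    and no_degenerate: "\<And>i. beta_star b v M s $ i = 1 \<Longrightarrow> 0 < leftover b v M s $ i"
    and seq_pos: "\<And>t. 0 < t \<Longrightarrow> 0 < \<delta> t" "\<And>t. 0 < t \<Longrightarrow> 0 < \<epsilon> t" "\<And>t. 0 < t \<Longrightarrow> 0 < \<eta> t"
    and \<delta>_lim: "\<delta> \<longlonglongrightarrow> 0"
    and \<epsilon>_lim: "\<epsilon> \<longlonglongrightarrow> 0"
    and \<epsilon>_rate: "filterlim (\<lambda>t. sqrt (real t) * \<epsilon> t) at_top sequentially"
    and c_pos: "0 < c"
    and \<delta>_rate: "(\<lambda>t. ereal (sqrt (real t) * \<delta> t)) \<longlonglongrightarrow> c"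
    and boot_measurable: "\<And>t. 0 < t \<Longrightarrow> (\<lambda>(d, w). beta_boot t d w) \<in>
          borel_measurable (PiM {..<t} (\<lambda>_. M) \<Otimes>\<^sub>M count_space UNIV)"
    and boot_argmin: "\<And>t \<omega>. 0 < t \<Longrightarrow> \<omega> \<in> space P \<Longrightarrow>
          is_arg_min (boot_objective b v D_F (\<epsilon> t) (\<eta> t) t (sample \<theta> t \<omega>) (W t \<omega>))
            (\<lambda>\<beta>. \<beta> \<in> B_hat b v (\<delta> t) t (sample \<theta> t \<omega>))
            (beta_boot t (sample \<theta> t \<omega>) (W t \<omega>))"
    and H_hat_consistent: "tendsto_in_prob P
          (\<lambda>t \<omega>. H_hat b v (\<eta> t) t (sample \<theta> t \<omega>)) (limit_hessian b v M s)"
  shows "consistently_estimates P (sample_sigma P M \<theta>)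
     (\<lambda>t \<omega>. (1 / \<epsilon> t) *\<^sub>R
        (beta_boot t (sample \<theta> t \<omega>) (W t \<omega>) - beta_obs b v t (sample \<theta> t \<omega>)))
     (J_FPPE b v M s)"
proof -
  interpret fppe_bootstrap b M v s P \<theta> W D_F \<delta> \<epsilon> \<eta> beta_boot
  proof (intro fppe_bootstrap.intro fppe_smooth.intro fppe_sample.intro fppe_market.intro
      fppe_sample_axioms.intro fppe_smooth_axioms.intro fppe_bootstrap_axioms.intro)
    show "v i \<in> borel_measurable M" for i using v_integrable by (rule borel_measurable_integrable)
  qed (fact assms)+
  show ?thesis using bootstrap_consistency unfolding boot_error_def .
qed

end
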